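(* Let $M$ be a Riemann surface and let $f:M\to S^n$ be an isothermic Willmore surface with $n\ge 3$. Then, locally, either $f$ is minimal in $3$-space, or $f$ is an isothermic Willmore surface in $4$-space described by an ODE: the equation describing elastica, or a Painlevé-type equation for the Hopf differential with radial symmetry.
   Context: Invariants. Let $\mathbb R^{n+1,1}$ carry the Lorentzian form $\langle v,v\rangle=-v_0^2+\sum_{k=1}^{n+1}v_k^2$ (extended complex bilinearly), with light cone $\mathcal L$ and forward light cone $\mathcal L_+$, and identify $S^n$ with the projectivized light cone via $x\leftrightarrow[1:x]$. Surfaces are conformal immersions $f:M\to S^n$. Given a local holomorphic coordinate $z$, there is a unique normalized lift $\psi$ with values in $\mathcal L_+$ such that $\psi(p)$ spans the null line $f(p)$ and $|d\psi|^2=|dz|^2$. Let $V=\mathrm{span}\{\psi,d\psi,\psi_{z\bar z}\}$, a rank $4$ bundle of signature $(3,1)$ independent of the coordinate. Its orthogonal complement $V^\perp$ is isometric to the normal bundle of $f$ and carries the connection $D$ obtained by projecting the derivative to $V^\perp$. The equation $\psi_{zz}+\frac c2\psi=\kappa$ defines the Schwarzian derivative $c$ (complex valued) and the Hopf differential $\kappa\in\Gamma(V^\perp\otimes\mathbb C)$ of $f$ in the coordinate $z$. Umbilic points are the zeros of $\kappa$. Isothermic and Willmore. The surface $f$ is isothermic if, away from umbilics, there are holomorphic coordinates in which $\kappa=\bar\kappa$ is real (the normal bundle is then flat). It is Willmore if it is critical for the Willmore energy $W(f)=\int|\kappa|^2$; equivalently $D_{\bar z}D_{\bar z}\kappa+\frac12\bar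 c\,\kappa=0$. Space forms. For nonzero $v_0\in\mathbb R^{n+1,1}$, the conic section $S_{v_0}=\{v\in\mathcal L:\langle v,v_0\rangle=-1\}$ inherits a metric of constant curvature $-\langle v_0,v_0\rangle$; this realizes all space forms conformally inside the sphere. "In $m$-space" means that $f$ takes values in a round $m$-sphere of $S^n$; "minimal in $3$-space" means that $f$ takes values in a round $3$-sphere and is minimal for the metric of some such $3$-dimensional space form in it. The ODEs named in the claim. They are equations for the Hopf differential of a surface in $4$-space, viewed as an $\mathbb R^2$-valued function by means of the flat normal bundle. The equation describing elastica is $$k''+\tfrac{2}{|h|^2}\big(\langle k,k\rangle+\gamma\big)k=0,\qquad \kappa=k(hz+\bar h\bar z),$$ with constants $h\in\mathbb C\setminus\{0\}$, $\gamma\in\mathbb R$. The Painlevé-type equation with radial symmetry is the equation for $\kappa=k(s)$, $s=2\ln|z|$, depending on the radius only, $$k''-k'+\rho k=0,\qquad \rho'=2\langle k,k\rangle'\,|z|^2,$$ with $\rho=\rho(s)$ real valued and primes denoting $d/ds$.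
   Formalization: "Locally" is taken near every point not on the boundary of the set of umbilics; at boundary umbilics the claim can fail, e.g. at the point at infinity of a compactified minimal surface with a planar end, where f leaves the space form and no coordinate with real Hopf differential exists. *)

theory Defs
  imports "HOL-Analysis.Analysis"
begin

definition complex_chart :: "'a topology \<Rightarrow> 'a set \<Rightarrow> ('a \<Rightarrow> complex) \<Rightarrow> bool" where
  "complex_chart X U \<phi> \<longleftrightarrow>
     openin X U \<and> open (\<phi> ` U) \<and>
     homeomorphic_map (subtopology X U) (top_of_set (\<phi> ` U)) \<phi>"

definition holo_compatible ::
  "'a set \<Rightarrow> ('a \<Rightarrow> complex) \<Rightarrow> 'a set \<Rightarrow> ('a \<Rightarrow> complex) \<Rightarrow> bool" where
  "holo_compatible U \<phi> V \<theta> \<longleftrightarrow>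
     (\<theta> \<circ> inv_into U \<phi>) holomorphic_on (\<phi> ` (U \<inter> V)) \<and>
     (\<phi> \<circ> inv_into V \<theta>) holomorphic_on (\<theta> ` (U \<inter> V))"

text \<open>Second countability is automatic by Rado's theorem.\<close>

definition riemann_surface :: "'a topology \<Rightarrow> ('a set \<times> ('a \<Rightarrow> complex)) set \<Rightarrow> bool" where
  "riemann_surface X \<A> \<longleftrightarrow>
     Hausdorff_space X \<and> connected_space X \<and>
     (\<forall>(U, \<phi>)\<in>\<A>. complex_chart X U \<phi>) \<and>
     (\<Union>(U, \<phi>)\<in>\<A>. U) = topspace X \<and>
     (\<forall>(U, \<phi>)\<in>\<A>. \<forall>(V, \<theta>)\<in>\<A>. holo_compatible U \<phi> V \<theta>)"

text \<open>A local holomorphic coordinate is any chart of the maximal atlas, not only a member of \<open>\<A>\<close>.\<close>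

definition holo_coord ::
  "'a topology \<Rightarrow> ('a set \<times> ('a \<Rightarrow> complex)) set \<Rightarrow> 'a set \<Rightarrow> ('a \<Rightarrow> complex) \<Rightarrow> bool" where
  "holo_coord X \<A> U \<phi> \<longleftrightarrow>
     complex_chart X U \<phi> \<and> (\<forall>(V, \<theta>)\<in>\<A>. holo_compatible U \<phi> V \<theta>)"

definition dder :: "(complex \<Rightarrow> 'b::real_normed_vector) \<Rightarrow> complex \<Rightarrow> complex \<Rightarrow> 'b" where
  "dder F v z = frechet_derivative F (at z) v"

primrec Ck_on :: "nat \<Rightarrow> complex set \<Rightarrow> (complex \<Rightarrow> 'b::real_normed_vector) \<Rightarrow> bool" where
  "Ck_on 0 \<Omega> F \<longleftrightarrow> continuous_on \<Omega> F"
| "Ck_on (Suc k) \<Omega> F \<longleftrightarrow> (\<forall>z\<in>\<Omega>. F differentiable (at z)) \<and> (\<forall>v. Ck_on k \<Omega> (dder F v))"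

definition smooth_on :: "complex set \<Rightarrow> (complex \<Rightarrow> 'b::real_normed_vector) \<Rightarrow> bool" where
  "smooth_on \<Omega> F \<longleftrightarrow> (\<forall>k. Ck_on k \<Omega> F)"

definition wirt :: "(complex \<Rightarrow> complex ^ 'm) \<Rightarrow> complex \<Rightarrow> complex ^ 'm" where
  "wirt F z = (1/2) *s (dder F 1 z - \<i> *s dder F \<i> z)"

definition wirtbar :: "(complex \<Rightarrow> complex ^ 'm) \<Rightarrow> complex \<Rightarrow> complex ^ 'm" where
  "wirtbar F z = (1/2) *s (dder F 1 z + \<i> *s dder F \<i> z)"

text \<open>
  With \<open>CARD('n) = n + 1\<close>, Lorentz space of signature \<open>(n + 1, 1)\<close> is \<open>real ^ 'n option\<close>: the
  index \<open>None\<close> is the time-like coordinate \<open>0\<close> and \<open>Some k\<close> are the coordinates \<open>1, \<dots>, n + 1\<close>.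
  Its complexification is \<open>complex ^ 'n option\<close>, and the same formula \<open>lorentz\<close>, which involves
  no conjugation, is the complex bilinear extension of the form.
\<close>

definition lorentz ::
  "('a::comm_ring_1) ^ 'n::finite option \<Rightarrow> 'a ^ 'n option \<Rightarrow> 'a" where
  "lorentz v w = - (v $ None * w $ None) + (\<Sum>k\<in>UNIV. v $ Some k * w $ Some k)"

definition cplx :: "real ^ 'm \<Rightarrow> complex ^ 'm" where
  "cplx v = (\<chi> i. complex_of_real (v $ i))"

definition vcnj :: "complex ^ 'm \<Rightarrow> complex ^ 'm" where
  "vcnj v = (\<chi> i. cnj (v $ i))"

definition light_cone :: "(real ^ 'n::finite option) set" where
  "light_cone = {v. v \<noteq> 0 \<and> lorentz v v = 0}"

definition forward_light_cone :: "(real ^ 'n::finite option) set" where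
  "forward_light_cone = {v \<in> light_cone. v $ None > 0}"

text \<open>The sphere \<open>S\<^sup>n\<close> is \<open>sphere (0 :: real ^ 'n) 1\<close>; \<open>null_vec x\<close> is the vector \<open>(1 : x)\<close>.\<close>

definition null_vec :: "real ^ 'n \<Rightarrow> real ^ 'n::finite option" where
  "null_vec x = (\<chi> i. case i of None \<Rightarrow> 1 | Some k \<Rightarrow> x $ k)"

definition round_sphere :: "nat \<Rightarrow> (real ^ 'n::finite) set \<Rightarrow> bool" where
  "round_sphere m S \<longleftrightarrow>
     S \<subseteq> sphere 0 1 \<and>
     (\<exists>A a r. affine A \<and> aff_dim A = int m + 1 \<and> a \<in> A \<and> r > 0 \<and> S = A \<inter> sphere a r)"

text \<open>
  The linear span of the null lines of a round \<open>m\<close>-sphere: an \<open>(m + 2)\<close>-dimensional subspace of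
  signature \<open>(m + 1, 1)\<close> whose projectivized light cone is the given sphere.
\<close>

definition lorentz_span :: "(real ^ 'n::finite) set \<Rightarrow> (real ^ 'n option) set" where
  "lorentz_span S = span (null_vec ` S)"

definition conformal_immersion_on ::
  "complex set \<Rightarrow> (complex \<Rightarrow> real ^ 'n::finite) \<Rightarrow> bool" where
  "conformal_immersion_on \<Omega> F \<longleftrightarrow>
     smooth_on \<Omega> F \<and> (\<forall>z\<in>\<Omega>. \<exists>r>0. \<forall>v. norm (dder F v z) = r * cmod v)"

definition normalized_lift ::
  "complex set \<Rightarrow> (complex \<Rightarrow> real ^ 'n::finite) \<Rightarrow> (complex \<Rightarrow> real ^ 'n option) \<Rightarrow> bool" where
  "normalized_lift \<Omega> F \<psi> \<longleftrightarrow>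
     smooth_on \<Omega> \<psi> \<and>
     (\<forall>z\<in>\<Omega>. \<psi> z \<in> forward_light_cone \<and> \<psi> z \<in> span {null_vec (F z)}) \<and>
     (\<forall>z\<in>\<Omega>. \<forall>v. lorentz (dder \<psi> v z) (dder \<psi> v z) = (cmod v)\<^sup>2)"

text \<open>
  For a conformal immersion into the sphere the normalized lift exists and is unique on \<open>\<Omega>\<close>; its
  values off \<open>\<Omega>\<close> are arbitrary and never matter, since \<open>\<Omega>\<close> is open. It is taken with values in the
  complexified Lorentz space, so that its derivatives \<open>\<psi>\<^sub>z\<close> etc. make sense.
\<close>

definition nlift ::
  "complex set \<Rightarrow> (complex \<Rightarrow> real ^ 'n::finite) \<Rightarrow> complex \<Rightarrow> complex ^ 'n option" where
  "nlift \<Omega> F = cplx \<circ> (SOME \<psi>. normalized_lift \<Omega> F \<psi>)"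

text \<open>
  The fibre at \<open>z\<close> of the complexification of \<open>V = span {\<psi>, d\<psi>, \<psi>\<^bsub>z zbar\<^esub>}\<close> (\<open>vec.span\<close> is the
  complex linear span, and \<open>d\<psi>\<close> has complexified span \<open>\<psi>\<^sub>z, \<psi>\<^bsub>zbar\<^esub>\<close>), and of that of its
  orthogonal complement.
\<close>

definition bundleV ::
  "(complex \<Rightarrow> complex ^ 'n::finite option) \<Rightarrow> complex \<Rightarrow> (complex ^ 'n option) set" where
  "bundleV \<psi> z = vec.span {\<psi> z, wirt \<psi> z, wirtbar \<psi> z, wirtbar (wirt \<psi>) z}"

definition bundleVperp ::
  "(complex \<Rightarrow> complex ^ 'n::finite option) \<Rightarrow> complex \<Rightarrow> (complex ^ 'n option) set" where
  "bundleVperp \<psi> z = {Y. \<forall>X\<in>bundleV \<psi> z. lorentz Y X = 0}"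

definition perp_proj ::
  "(complex \<Rightarrow> complex ^ 'n::finite option) \<Rightarrow> complex \<Rightarrow> complex ^ 'n option \<Rightarrow> complex ^ 'n option"
  where
  "perp_proj \<psi> z X = (THE Y. Y \<in> bundleVperp \<psi> z \<and> X - Y \<in> bundleV \<psi> z)"

definition Dzbar ::
  "(complex \<Rightarrow> complex ^ 'n::finite option) \<Rightarrow> (complex \<Rightarrow> complex ^ 'n option) \<Rightarrow>
   complex \<Rightarrow> complex ^ 'n option" where
  "Dzbar \<psi> \<xi> z = perp_proj \<psi> z (wirtbar \<xi> z)"

definition schwarzian :: "(complex \<Rightarrow> complex ^ 'n::finite option) \<Rightarrow> complex \<Rightarrow> complex" where
  "schwarzian \<psi> z = (THE c. wirt (wirt \<psi>) z + (c / 2) *s \<psi> z \<in> bundleVperp \<psi> z)"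

definition hopf ::
  "(complex \<Rightarrow> complex ^ 'n::finite option) \<Rightarrow> complex \<Rightarrow> complex ^ 'n option" where
  "hopf \<psi> z = wirt (wirt \<psi>) z + (schwarzian \<psi> z / 2) *s \<psi> z"

definition conformal_immersion ::
  "'a topology \<Rightarrow> ('a set \<times> ('a \<Rightarrow> complex)) set \<Rightarrow> ('a \<Rightarrow> real ^ 'n::finite) \<Rightarrow> bool" where
  "conformal_immersion X \<A> f \<longleftrightarrow>
     f ` topspace X \<subseteq> sphere 0 1 \<and>
     (\<forall>U \<phi>. holo_coord X \<A> U \<phi> \<longrightarrow> conformal_immersion_on (\<phi> ` U) (f \<circ> inv_into U \<phi>))"

text \<open>The normalized lift of \<open>f\<close> in the coordinate \<open>\<phi>\<close> on \<open>U\<close>, as a function on \<open>\<phi> ` U\<close>.\<close>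

definition surf_lift ::
  "('a \<Rightarrow> real ^ 'n::finite) \<Rightarrow> 'a set \<Rightarrow> ('a \<Rightarrow> complex) \<Rightarrow> complex \<Rightarrow> complex ^ 'n option" where
  "surf_lift f U \<phi> = nlift (\<phi> ` U) (f \<circ> inv_into U \<phi>)"

text \<open>
  Vanishing of the Hopf differential at a point does not depend on the coordinate, so the set of
  umbilics is closed and the complement of its boundary is open and dense. At boundary points no
  local description in an isothermic coordinate or in a single space form need exist: for instance
  an isothermic Willmore surface can consist of minimal surfaces in the two copies of hyperbolic
  space that meet in a curve of umbilics on the sphere at infinity.
\<close>

definition umbilic ::
  "'a topology \<Rightarrow> ('a set \<times> ('a \<Rightarrow> complex)) set \<Rightarrow> ('a \<Rightarrow> real ^ 'n::finite) \<Rightarrow> 'a \<Rightarrow> bool" where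
  "umbilic X \<A> f p \<longleftrightarrow>
     (\<exists>U \<phi>. holo_coord X \<A> U \<phi> \<and> p \<in> U \<and> hopf (surf_lift f U \<phi>) (\<phi> p) = 0)"

definition isothermic ::
  "'a topology \<Rightarrow> ('a set \<times> ('a \<Rightarrow> complex)) set \<Rightarrow> ('a \<Rightarrow> real ^ 'n::finite) \<Rightarrow> bool" where
  "isothermic X \<A> f \<longleftrightarrow>
     (\<forall>p\<in>topspace X. \<not> umbilic X \<A> f p \<longrightarrow>
        (\<exists>U \<phi>. holo_coord X \<A> U \<phi> \<and> p \<in> U \<and>
           (\<forall>z\<in>\<phi> ` U. hopf (surf_lift f U \<phi>) z = vcnj (hopf (surf_lift f U \<phi>) z))))"

text \<open>Criticality for the Willmore energy, in the form of its Euler-Lagrange equation.\<close>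

definition willmore ::
  "'a topology \<Rightarrow> ('a set \<times> ('a \<Rightarrow> complex)) set \<Rightarrow> ('a \<Rightarrow> real ^ 'n::finite) \<Rightarrow> bool" where
  "willmore X \<A> f \<longleftrightarrow>
     (\<forall>U \<phi>. holo_coord X \<A> U \<phi> \<longrightarrow>
        (let \<psi> = surf_lift f U \<phi>; \<kappa> = hopf \<psi>; c = schwarzian \<psi> in
           \<forall>z\<in>\<phi> ` U. Dzbar \<psi> (Dzbar \<psi> \<kappa>) z + (cnj (c z) / 2) *s \<kappa> z = 0))"

definition space_form :: "real ^ 'n::finite option \<Rightarrow> (real ^ 'n option) set" where
  "space_form v0 = {v \<in> light_cone. lorentz v v0 = -1}"

text \<open>
  \<open>G\<close> is a conformally parametrized surface in the 3-dimensional space form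
  \<open>space_form v0 \<inter> W\<close>. Tangent vectors of the space form at \<open>G z\<close> are the \<open>\<xi> \<in> W\<close> orthogonal to
  \<open>G z\<close> and \<open>v0\<close>, and its Levi-Civita connection is the tangential part of the flat one. Hence the
  mean curvature in the normal direction \<open>\<xi>\<close> is, up to the (positive) conformal factor,
  the product of \<open>\<xi>\<close> with \<open>G\<^bsub>xx\<^esub> + G\<^bsub>yy\<^esub>\<close>.
\<close>

definition zero_mean_curvature ::
  "(real ^ 'n::finite option) set \<Rightarrow> real ^ 'n option \<Rightarrow> complex set \<Rightarrow>
   (complex \<Rightarrow> real ^ 'n option) \<Rightarrow> bool" where
  "zero_mean_curvature W v0 \<Omega> G \<longleftrightarrow>
     (\<forall>z\<in>\<Omega>. \<forall>\<xi>\<in>W.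
        lorentz \<xi> (G z) = 0 \<and> lorentz \<xi> v0 = 0 \<and> (\<forall>v. lorentz \<xi> (dder G v z) = 0) \<longrightarrow>
        lorentz \<xi> (dder (dder G 1) 1 z + dder (dder G \<i>) \<i> z) = 0)"

definition minimal_in_3space ::
  "'a topology \<Rightarrow> ('a set \<times> ('a \<Rightarrow> complex)) set \<Rightarrow> ('a \<Rightarrow> real ^ 'n::finite) \<Rightarrow> 'a set \<Rightarrow> bool"
  where
  "minimal_in_3space X \<A> f U \<longleftrightarrow>
     (\<exists>S v0 g. round_sphere 3 S \<and> f ` U \<subseteq> S \<and>
        v0 \<in> lorentz_span S \<and> v0 \<noteq> 0 \<and>
        (\<forall>p\<in>U. g p \<in> space_form v0 \<and> g p \<in> span {null_vec (f p)}) \<and>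
        (\<forall>U' \<phi>. holo_coord X \<A> U' \<phi> \<and> U' \<subseteq> U \<longrightarrow>
           zero_mean_curvature (lorentz_span S) v0 (\<phi> ` U') (g \<circ> inv_into U' \<phi>)))"

text \<open>
  A parallel orthonormal frame of the normal bundle of a surface in the round 4-sphere with
  Lorentz span \<open>W\<close>, i.e. of the real rank 2 bundle of vectors of \<open>W\<close> orthogonal to \<open>V\<close>.
\<close>

definition parallel_normal_frame ::
  "(real ^ 'n::finite option) set \<Rightarrow> complex set \<Rightarrow> (complex \<Rightarrow> complex ^ 'n option) \<Rightarrow>
   (2 \<Rightarrow> complex \<Rightarrow> real ^ 'n option) \<Rightarrow> bool" where
  "parallel_normal_frame W \<Omega> \<psi> \<xi> \<longleftrightarrow>
     (\<forall>i. smooth_on \<Omega> (\<xi> i)) \<and>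
     (\<forall>z\<in>\<Omega>. \<forall>i. \<xi> i z \<in> W \<and> cplx (\<xi> i z) \<in> bundleVperp \<psi> z) \<and>
     (\<forall>z\<in>\<Omega>. \<forall>i j. lorentz (\<xi> i z) (\<xi> j z) = (if i = j then 1 else 0)) \<and>
     (\<forall>z\<in>\<Omega>. \<forall>i v. perp_proj \<psi> z (cplx (dder (\<xi> i) v z)) = 0)"

text \<open>
  \<open>K\<close> is the (real) Hopf differential read as a map into the Euclidean plane by means of the flat
  normal bundle.
\<close>

definition hopf_components ::
  "(real ^ 'n::finite option) set \<Rightarrow> complex set \<Rightarrow> (complex \<Rightarrow> complex ^ 'n option) \<Rightarrow>
   (complex \<Rightarrow> real ^ 2) \<Rightarrow> bool" where
  "hopf_components W \<Omega> \<psi> K \<longleftrightarrow>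
     (\<exists>\<xi>. parallel_normal_frame W \<Omega> \<psi> \<xi> \<and>
        (\<forall>z\<in>\<Omega>. hopf \<psi> z = cplx (\<Sum>j\<in>UNIV. (K z $ j) *\<^sub>R \<xi> j z)))"

definition elastica_hopf :: "complex set \<Rightarrow> (complex \<Rightarrow> real ^ 2) \<Rightarrow> bool" where
  "elastica_hopf \<Omega> K \<longleftrightarrow>
     (\<exists>(h::complex) (\<gamma>::real) k k' k''. h \<noteq> 0 \<and>
        (\<forall>z\<in>\<Omega>. let t = Re (h * z + cnj h * cnj z) in
           K z = k t \<and>
           (k has_vector_derivative k' t) (at t) \<and>
           (k' has_vector_derivative k'' t) (at t) \<and>
           k'' t + (2 / (cmod h)\<^sup>2 * (k t \<bullet> k t + \<gamma>)) *\<^sub>R k t = 0))"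

text \<open>
  The variable \<open>s = 2 ln \<bar>z\<bar>\<close> makes sense for \<open>z \<noteq> 0\<close> only. The centre \<open>z = 0\<close> itself may lie in
  the coordinate domain: there are solutions for which the surface extends smoothly across it.
\<close>

definition radial_painleve_hopf :: "complex set \<Rightarrow> (complex \<Rightarrow> real ^ 2) \<Rightarrow> bool" where
  "radial_painleve_hopf \<Omega> K \<longleftrightarrow>
     (\<exists>k k' k'' (\<rho>::real \<Rightarrow> real) \<rho>' E'.
        (\<forall>z\<in>\<Omega> - {0}. let s = 2 * ln (cmod z) in
           K z = k s \<and>
           (k has_vector_derivative k' s) (at s) \<and>
           (k' has_vector_derivative k'' s) (at s) \<and>
           k'' s - k' s + \<rho> s *\<^sub>R k s = 0 \<and>
           (\<rho> has_real_derivative \<rho>' s) (at s) \<and>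
           ((\<lambda>u. k u \<bullet> k u) has_real_derivative E' s) (at s) \<and>
           \<rho>' s = 2 * E' s * (cmod z)\<^sup>2))"

text \<open>
  Being isothermic and Willmore passes to open subsets and does not depend on the ambient sphere,
  so for an isothermic Willmore surface \<open>f\<close> it is not repeated here; the Hopf differential is real
  in the coordinate \<open>\<phi>\<close> by \<open>hopf_components\<close>.
\<close>

definition ode_in_4space ::
  "'a topology \<Rightarrow> ('a set \<times> ('a \<Rightarrow> complex)) set \<Rightarrow> ('a \<Rightarrow> real ^ 'n::finite) \<Rightarrow> 'a set \<Rightarrow> bool"
  where
  "ode_in_4space X \<A> f U \<longleftrightarrow>
     (\<exists>S \<phi> K. round_sphere 4 S \<and> f ` U \<subseteq> S \<and> holo_coord X \<A> U \<phi> \<and>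
        hopf_components (lorentz_span S) (\<phi> ` U) (surf_lift f U \<phi>) K \<and>
        (elastica_hopf (\<phi> ` U) K \<or> radial_painleve_hopf (\<phi> ` U) K))"

end

theory Submission
  imports Defs "HOL-Complex_Analysis.Complex_Analysis"
begin

text \<open>
  Let \<open>\<psi>\<close> be the normalized lift in a coordinate in which the Hopf differential \<open>\<kappa>\<close> is real and without
  zeros, and write \<open>u = \<langle>\<kappa>, \<kappa>\<rangle>\<close>. The integrability conditions of the structure equations
  (\<open>third_derivative\<close>, \<open>has_wirt_N\<close>) express \<open>c\<^bsub>zbar\<^esub>\<close> by \<open>u\<^sub>z\<close>, and the normal connection is flat
  because \<open>\<kappa>\<close> is real (\<open>hasD_flat\<close>). The Euler-Lagrange equation
  \<open>D\<^bsub>zbar\<^esub> D\<^bsub>zbar\<^esub> \<kappa> = -(cnj c / 2) \<kappa>\<close> therefore makes all derivatives of \<open>\<kappa>\<close> beyond \<open>D\<^sub>z \<kappa>\<close>, \<open>D\<^bsub>zbar\<^esub> \<kappa>\<close> and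
  \<open>X = D\<^bsub>zbar\<^esub> D\<^sub>z \<kappa>\<close> expressible by these, the Schwarzian and its derivatives. Two consequences carry the proof.

  First, flatness applied to the real field \<open>X\<close> says that \<open>u\<^sub>z D\<^bsub>zbar\<^esub> \<kappa>\<close> is real: wherever \<open>u\<close> is not locally
  constant, \<open>d\<kappa>\<close> is parallel to \<open>du\<close> (\<open>du_parallel_dkap\<close>). Second, the bivector
  \<open>\<kappa> \<and> D\<^bsub>zbar\<^esub> \<kappa>\<close> is annihilated by \<open>D\<^bsub>zbar\<^esub>\<close>, so that its square \<open>Q\<close> is a holomorphic function
  (\<open>Q_holomorphic\<close>). Let \<open>mu\<close> be the component of \<open>D\<^sub>z \<kappa>\<close> orthogonal to \<open>\<kappa>\<close>. The first fact implies
  \<open>|Q| = u \<langle>mu, cnj mu\<rangle>\<close> where \<open>u\<close> is not locally constant, and repeated differentiation of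
  \<open>u = const\<close> implies it elsewhere (\<open>cmod_Q\<close>). By the equality case of the Cauchy-Schwarz inequality, a
  square root \<open>h\<close> of \<open>Q\<close> makes \<open>h mu\<close> and \<open>h D\<^sub>z \<kappa>\<close> real (\<open>sqrt_Q_real\<close>). Differentiating this relation once more shows that \<open>h'\<close> is real, and hence
  \<open>Q = 0\<close> or \<open>Q = (\<alpha> z + \<eta>)\<^sup>2\<close> with \<open>\<alpha>\<close> real (\<open>Q_zero_or_affine_square\<close>).

  If \<open>Q = 0\<close>, then \<open>mu = 0\<close> and \<open>\<kappa>\<close> spans a parallel line bundle. The sum of \<open>V\<close> and this line is constant, so
  the surface lies in a round 3-sphere. The Euler-Lagrange equation then provides a constant vector \<open>v\<close>
  orthogonal to the normal, and the surface is minimal in the space form of \<open>v\<close>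
  (\<open>hypersurface_minimal_frame\<close>). This is Thomsen's theorem that isothermic Willmore surfaces in the 3-sphere are minimal
  in a space form.

  If \<open>Q = (\<alpha> z + \<eta>)\<^sup>2\<close> is not identically zero, then \<open>\<kappa>\<close> and \<open>mu / cnj (\<alpha> z + \<eta>)\<close>, which extends
  smoothly over the zero, span a plane bundle that is invariant under \<open>D\<close>. Rotation by an angle, a primitive of a closed
  form, yields a parallel orthonormal frame (\<open>parallel_frame_2\<close>), and the sum of \<open>V\<close> and the plane bundle is a
  constant subspace: the surface lies in a round 4-sphere (\<open>surface_in_round_sphere\<close>). As
  \<open>(\<alpha> z + \<eta>) \<kappa>\<^sub>z\<close> is real in the frame, \<open>\<kappa>\<close> depends only on \<open>Re (cnj \<eta> z)\<close> if \<open>\<alpha> = 0\<close>, and only on the distance from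
  the zero of \<open>\<alpha> z + \<eta>\<close> otherwise. The remaining equations for \<open>\<kappa>\<close> and \<open>c\<close> become the equation of
  elastica (\<open>elastica\<close>) in the first case and the radial equation (\<open>radial\<close>) in the second.

  In the interior of the set of umbilics \<open>V\<close> itself is constant, and the surface is a piece of a round 2-sphere, which
  is minimal in the space form of a time-like vector of \<open>V\<close> (\<open>umbilic_minimal_frame\<close>).
\<close>

section \<open>Wirtinger calculus\<close>

text \<open>The two Wirtinger derivatives at a point, as a relation in the style of \<open>has_derivative\<close>, for scalar
  and for vector functions: product and chain rules then need no side conditions on
  differentiability, and an identity between derivatives follows from uniqueness.\<close>

definition has_wirtc :: "(complex \<Rightarrow> complex) \<Rightarrow> complex \<Rightarrow> complex \<Rightarrow> complex \<Rightarrow> bool" where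
  "has_wirtc f a b z \<longleftrightarrow> (f has_derivative (\<lambda>v. v * a + cnj v * b)) (at z)"

definition has_wirt :: "(complex \<Rightarrow> complex ^ 'm) \<Rightarrow> complex ^ 'm \<Rightarrow> complex ^ 'm \<Rightarrow> complex \<Rightarrow> bool" where
  "has_wirt F a b z \<longleftrightarrow> (F has_derivative (\<lambda>v. v *s a + cnj v *s b)) (at z)"

lemma has_derivative_vec_iff:
  fixes F :: "complex \<Rightarrow> ('b::real_normed_vector) ^ 'm"
  shows "(F has_derivative D) (at z) \<longleftrightarrow> (\<forall>i. ((\<lambda>z. F z $ i) has_derivative (\<lambda>v. D v $ i)) (at z))"
proof
  assume "(F has_derivative D) (at z)"
  then show "\<forall>i. ((\<lambda>z. F z $ i) has_derivative (\<lambda>v. D v $ i)) (at z)"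
    using bounded_linear.has_derivative[OF bounded_linear_vec_nth] by blast
next
  assume A: "\<forall>i. ((\<lambda>z. F z $ i) has_derivative (\<lambda>v. D v $ i)) (at z)"
  have ax: "bounded_linear (axis i :: 'b \<Rightarrow> 'b ^ 'm)" for i
  proof (rule bounded_linear_intro[where K=1])
    fix x :: 'b
    have "norm (axis i x :: 'b^'m) \<le> (\<Sum>j\<in>UNIV. norm ((axis i x :: 'b^'m) $ j))"
      unfolding norm_vec_def by (rule L2_set_le_sum) simp
    also have "\<dots> = (\<Sum>j\<in>UNIV. if j = i then norm x else 0)"
      by (rule sum.cong) (auto simp: axis_def)
    finally show "norm (axis i x :: 'b^'m) \<le> norm x * 1" by simp
  qed (auto simp: vec_eq_iff axis_def)
  have eq: "v = (\<Sum>i\<in>UNIV. axis i (v $ i))" for v :: "'b^'m"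
  proof -
    have "(\<Sum>i\<in>UNIV. axis i (v $ i) $ j) = v $ j" for j
      by (simp add: axis_def if_distrib cong: if_cong)
    then show ?thesis by (simp add: vec_eq_iff)
  qed
  have "((\<lambda>z. \<Sum>i\<in>UNIV. axis i (F z $ i)) has_derivative (\<lambda>v. \<Sum>i\<in>UNIV. axis i (D v $ i))) (at z)"
    by (intro has_derivative_sum bounded_linear.has_derivative[OF ax]) (use A in auto)
  then show "(F has_derivative D) (at z)" by (simp only: eq[symmetric])
qed

lemma has_wirt_iff: "has_wirt F a b z \<longleftrightarrow> (\<forall>i. has_wirtc (\<lambda>z. F z $ i) (a $ i) (b $ i) z)"
  unfolding has_wirt_def has_wirtc_def has_derivative_vec_iff by simp

lemma has_wirtc_unique:
  assumes "has_wirtc f a b z" "has_wirtc f a' b' z"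
  shows "a = a'" "b = b'"
proof -
  have e: "(\<lambda>v. v * a + cnj v * b) = (\<lambda>v. v * a' + cnj v * b')"
    using assms has_derivative_unique unfolding has_wirtc_def by blast
  have 1: "a + b = a' + b'" using fun_cong[OF e, of 1] by simp
  have "\<i> * (a - b) = \<i> * (a' - b')" using fun_cong[OF e, of \<i>] by (simp add: algebra_simps)
  then have 2: "a - b = a' - b'" by simp
  have "(a + b) + (a - b) = (a' + b') + (a' - b')" using 1 2 by simp
  then show "a = a'" by simp
  then show "b = b'" using 1 by simp
qed

lemma has_wirt_unique:
  assumes "has_wirt F a b z" "has_wirt F a' b' z"
  shows "a = a'" "b = b'"
proof -
  have "a $ i = a' $ i \<and> b $ i = b' $ i" for i
    using assms has_wirtc_unique[of "\<lambda>z. F z $ i"] unfolding has_wirt_iff by blast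
  then show "a = a'" "b = b'" by (auto simp: vec_eq_iff)
qed

lemma has_wirtD:
  assumes "has_wirt F a b z"
  shows "wirt F z = a" "wirtbar F z = b" "dder F v z = v *s a + cnj v *s b" "F differentiable (at z)"
proof -
  have d: "dder F v z = v *s a + cnj v *s b" for v
    using assms frechet_derivative_at[of F] unfolding has_wirt_def dder_def by metis
  show "wirt F z = a" unfolding wirt_def d by (simp add: vec_eq_iff algebra_simps)
  show "wirtbar F z = b" unfolding wirtbar_def d by (simp add: vec_eq_iff algebra_simps)
  show "dder F v z = v *s a + cnj v *s b" by (rule d)
  show "F differentiable (at z)" using assms unfolding has_wirt_def differentiable_def by blast
qed

lemma has_wirt_cong_open:
  assumes "has_wirt F a b z" "open S" "z \<in> S" "\<And>w. w \<in> S \<Longrightarrow> F w = G w"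
  shows "has_wirt G a b z"
  using assms unfolding has_wirt_def by (rule has_derivative_transform_within_open)

lemma has_wirtc_cong_open:
  assumes "has_wirtc F a b z" "open S" "z \<in> S" "\<And>w. w \<in> S \<Longrightarrow> F w = G w"
  shows "has_wirtc G a b z"
  using assms unfolding has_wirtc_def by (rule has_derivative_transform_within_open)

lemma complex_linear_decomp:
  fixes D :: "complex \<Rightarrow> 'b::real_vector"
  assumes "linear D" shows "D v = Re v *\<^sub>R D 1 + Im v *\<^sub>R D \<i>"
proof -
  have "v = Re v *\<^sub>R 1 + Im v *\<^sub>R \<i>" by (simp add: complex_eq_iff)
  then have "D v = D (Re v *\<^sub>R 1 + Im v *\<^sub>R \<i>)" by simp
  then show ?thesis using assms by (simp add: linear_add linear_scale)
qed

lemma differentiable_imp_dder: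
  assumes "F differentiable (at z)"
  shows "(F has_derivative (\<lambda>v. dder F v z)) (at z)"
    "dder F v z = Re v *\<^sub>R dder F 1 z + Im v *\<^sub>R dder F \<i> z"
proof -
  show *: "(F has_derivative (\<lambda>v. dder F v z)) (at z)"
    using assms unfolding frechet_derivative_works dder_def by simp
  show "dder F v z = Re v *\<^sub>R dder F 1 z + Im v *\<^sub>R dder F \<i> z"
    by (rule complex_linear_decomp[of "\<lambda>v. dder F v z"]) (use has_derivative_linear[OF *] in simp)
qed

lemma has_wirt_wirt:
  assumes "F differentiable (at z)"
  shows "has_wirt F (wirt F z) (wirtbar F z) z"
proof -
  have "dder F v z = v *s wirt F z + cnj v *s wirtbar F z" for v
    unfolding wirt_def wirtbar_def
    by (subst differentiable_imp_dder(2)[OF assms])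
       (simp add: vec_eq_iff complex_eq_iff field_simps)
  then show ?thesis using differentiable_imp_dder(1)[OF assms] unfolding has_wirt_def by simp
qed

definition wirtc :: "(complex \<Rightarrow> complex) \<Rightarrow> complex \<Rightarrow> complex" where
  "wirtc f z = (1/2) * (dder f 1 z - \<i> * dder f \<i> z)"

definition wirtbarc :: "(complex \<Rightarrow> complex) \<Rightarrow> complex \<Rightarrow> complex" where
  "wirtbarc f z = (1/2) * (dder f 1 z + \<i> * dder f \<i> z)"

lemma has_wirtcD:
  assumes "has_wirtc F a b z"
  shows "wirtc F z = a" "wirtbarc F z = b" "dder F v z = v * a + cnj v * b" "F differentiable (at z)"
proof -
  have d: "dder F v z = v * a + cnj v * b" for v
    using assms frechet_derivative_at[of F] unfolding has_wirtc_def dder_def by metis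
  show "wirtc F z = a" unfolding wirtc_def d by (simp add: algebra_simps)
  show "wirtbarc F z = b" unfolding wirtbarc_def d by (simp add: algebra_simps)
  show "dder F v z = v * a + cnj v * b" by (rule d)
  show "F differentiable (at z)" using assms unfolding has_wirtc_def differentiable_def by blast
qed

lemma has_wirtc_wirtc:
  assumes "F differentiable (at z)"
  shows "has_wirtc F (wirtc F z) (wirtbarc F z) z"
proof -
  have "dder F v z = v * wirtc F z + cnj v * wirtbarc F z" for v
    unfolding wirtc_def wirtbarc_def
    by (subst differentiable_imp_dder(2)[OF assms]) (simp add: complex_eq_iff field_simps)
  then show ?thesis using differentiable_imp_dder(1)[OF assms] unfolding has_wirtc_def by simp
qed

named_theorems wirt_intros

lemma has_wirtc_const [wirt_intros]: "has_wirtc (\<lambda>z. c) 0 0 z"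
  unfolding has_wirtc_def by simp
lemma has_wirtc_add [wirt_intros]:
  "has_wirtc f a b z \<Longrightarrow> has_wirtc g a' b' z \<Longrightarrow> has_wirtc (\<lambda>z. f z + g z) (a + a') (b + b') z"
  unfolding has_wirtc_def by (auto intro!: derivative_eq_intros simp: algebra_simps)
lemma has_wirtc_minus [wirt_intros]:
  "has_wirtc f a b z \<Longrightarrow> has_wirtc (\<lambda>z. - f z) (- a) (- b) z"
  unfolding has_wirtc_def by (auto intro!: derivative_eq_intros simp: algebra_simps)
lemma has_wirtc_diff [wirt_intros]:
  "has_wirtc f a b z \<Longrightarrow> has_wirtc g a' b' z \<Longrightarrow> has_wirtc (\<lambda>z. f z - g z) (a - a') (b - b') z"
  unfolding has_wirtc_def by (auto intro!: derivative_eq_intros simp: algebra_simps)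
lemma has_wirtc_mult [wirt_intros]:
  "has_wirtc f a b z \<Longrightarrow> has_wirtc g a' b' z \<Longrightarrow>
   has_wirtc (\<lambda>z. f z * g z) (a * g z + f z * a') (b * g z + f z * b') z"
  unfolding has_wirtc_def by (auto intro!: derivative_eq_intros simp: algebra_simps)
lemma has_wirtc_cnj [wirt_intros]:
  "has_wirtc f a b z \<Longrightarrow> has_wirtc (\<lambda>z. cnj (f z)) (cnj b) (cnj a) z"
  unfolding has_wirtc_def
  by (drule bounded_linear.has_derivative[OF bounded_linear_cnj]) (simp add: algebra_simps)
lemma has_wirtc_sum [wirt_intros]:
  "(\<And>i. i \<in> A \<Longrightarrow> has_wirtc (f i) (a i) (b i) z) \<Longrightarrow>
   has_wirtc (\<lambda>z. \<Sum>i\<in>A. f i z) (\<Sum>i\<in>A. a i) (\<Sum>i\<in>A. b i) z"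
  unfolding has_wirtc_def
  by (drule has_derivative_sum) (simp add: sum_distrib_left sum.distrib)
lemma has_wirtc_inverse [wirt_intros]:
  "has_wirtc f a b z \<Longrightarrow> f z \<noteq> 0 \<Longrightarrow>
   has_wirtc (\<lambda>z. inverse (f z)) (- (a * inverse (f z) ^ 2)) (- (b * inverse (f z) ^ 2)) z"
proof -
  assume f: "has_wirtc f a b z" and nz: "f z \<noteq> 0"
  have "(\<lambda>h. - (inverse (f z) * (h * a + cnj h * b) * inverse (f z))) =
      (\<lambda>v. v * - (a * (inverse (f z))\<^sup>2) + cnj v * - (b * (inverse (f z))\<^sup>2))"
    by (auto simp: fun_eq_iff algebra_simps power2_eq_square)
  then show ?thesis using Deriv.has_derivative_inverse[of f z, OF nz f[unfolded has_wirtc_def]]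
    unfolding has_wirtc_def by simp
qed
lemma has_wirtc_chain:
  "(f has_field_derivative f') (at (g z)) \<Longrightarrow> has_wirtc g a b z \<Longrightarrow>
   has_wirtc (\<lambda>z. f (g z)) (f' * a) (f' * b) z"
  unfolding has_wirtc_def has_field_derivative_def
  by (drule (1) has_derivative_compose[rotated], erule has_derivative_eq_rhs) (auto simp: algebra_simps)
lemma has_wirtc_field_iff: "has_wirtc f a 0 z \<longleftrightarrow> (f has_field_derivative a) (at z)"
proof -
  have "(\<lambda>v. v * a) = (*) a" by (auto simp: mult.commute)
  then show ?thesis unfolding has_wirtc_def has_field_derivative_def by simp
qed
lemmas has_wirtc_field = has_wirtc_field_iff[THEN iffD2]

lemma has_wirt_const [wirt_intros]: "has_wirt (\<lambda>z. c) 0 0 z"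
  unfolding has_wirt_def by simp
lemma has_wirt_add [wirt_intros]:
  "has_wirt f a b z \<Longrightarrow> has_wirt g a' b' z \<Longrightarrow> has_wirt (\<lambda>z. f z + g z) (a + a') (b + b') z"
  unfolding has_wirt_iff by (auto intro!: wirt_intros)
lemma has_wirt_minus [wirt_intros]:
  "has_wirt f a b z \<Longrightarrow> has_wirt (\<lambda>z. - f z) (- a) (- b) z"
  unfolding has_wirt_iff by (auto intro!: wirt_intros)
lemma has_wirt_diff [wirt_intros]:
  "has_wirt f a b z \<Longrightarrow> has_wirt g a' b' z \<Longrightarrow> has_wirt (\<lambda>z. f z - g z) (a - a') (b - b') z"
  unfolding has_wirt_iff by (auto intro!: wirt_intros)
lemma has_wirt_scale [wirt_intros]:
  "has_wirtc f a b z \<Longrightarrow> has_wirt g a' b' z \<Longrightarrow>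
   has_wirt (\<lambda>z. f z *s g z) (a *s g z + f z *s a') (b *s g z + f z *s b') z"
  unfolding has_wirt_iff by (auto intro!: wirt_intros)
lemma has_wirt_vcnj [wirt_intros]:
  "has_wirt f a b z \<Longrightarrow> has_wirt (\<lambda>z. vcnj (f z)) (vcnj b) (vcnj a) z"
  unfolding has_wirt_iff vcnj_def by (auto intro!: wirt_intros)
lemma has_wirtc_lorentz [wirt_intros]:
  "has_wirt f a b z \<Longrightarrow> has_wirt g a' b' z \<Longrightarrow>
   has_wirtc (\<lambda>z. lorentz (f z) (g z)) (lorentz a (g z) + lorentz (f z) a')
     (lorentz b (g z) + lorentz (f z) b') z"
  unfolding has_wirt_iff
  using has_wirtc_add[OF has_wirtc_minus[OF has_wirtc_mult] has_wirtc_sum[OF has_wirtc_mult],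
      of "\<lambda>z. f z $ None" "a $ None" "b $ None" z "\<lambda>z. g z $ None" "a' $ None" "b' $ None" UNIV
        "\<lambda>k z. f z $ Some k" "\<lambda>k. a $ Some k" "\<lambda>k. b $ Some k"
        "\<lambda>k z. g z $ Some k" "\<lambda>k. a' $ Some k" "\<lambda>k. b' $ Some k"]
  by (simp add: lorentz_def sum.distrib algebra_simps)

text \<open>Composition with a holomorphic change of coordinate scales the two Wirtinger derivatives by
  \<open>T'\<close> and its conjugate, without mixing them.\<close>

lemma has_wirt_holo:
  assumes "(T has_field_derivative T') (at z)" "has_wirt F a b (T z)"
  shows "has_wirt (\<lambda>z. F (T z)) (T' *s a) (cnj T' *s b) z"
proof -
  have "((\<lambda>z. F (T z)) has_derivative (\<lambda>v. (T' * v) *s a + cnj (T' * v) *s b)) (at z)"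
    using has_derivative_compose[of T "(*) T'" z UNIV F] assms
    unfolding has_wirt_def has_field_derivative_def by blast
  then show ?thesis unfolding has_wirt_def by (simp add: mult_ac)
qed

section \<open>Smooth functions\<close>

lemma Ck_on_cong:
  assumes "open S" "\<And>z. z \<in> S \<Longrightarrow> F z = G z" "Ck_on k S F"
  shows "Ck_on k S G"
  using assms(2,3)
proof (induction k arbitrary: F G)
  case 0 then show ?case by (simp cong: continuous_on_cong_simp)
next
  case (Suc k)
  have d: "F differentiable (at z)" if "z \<in> S" for z using Suc.prems that by auto
  have "G differentiable (at z)" if "z \<in> S" for z
    using d[OF that] Suc.prems(1) assms(1) that has_derivative_transform_within_open
    unfolding differentiable_def by metis
  moreover have "dder F v z = dder G v z" if "z \<in> S" for v z
    unfolding dder_def using frechet_derivative_transform_within_open[OF d[OF that] assms(1) that Suc.prems(1)] by simp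
  then have "Ck_on k S (dder G v)" for v
    using Suc.IH[of "dder F v" "dder G v"] Suc.prems(2) by auto
  ultimately show ?case by simp
qed

lemma Ck_on_Suc_imp: "Ck_on (Suc k) S F \<Longrightarrow> Ck_on k S F"
proof (induction k arbitrary: F)
  case 0
  then show ?case
    by (auto intro!: continuous_at_imp_continuous_on differentiable_imp_continuous_within)
next
  case (Suc k)
  have "Ck_on k S (dder F v)" for v using Suc.IH[of "dder F v"] Suc.prems by simp
  then show ?case using Suc.prems by simp
qed

lemma smooth_on_cong:
  assumes "open S" "\<And>z. z \<in> S \<Longrightarrow> F z = G z" "smooth_on S F" shows "smooth_on S G"
  using assms Ck_on_cong unfolding smooth_on_def by blast

text \<open>The way in which smoothness is established below: the derivative must be as regular as
  the function is already known to be.\<close>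

lemma Ck_on_SucI:
  assumes "open S" "\<And>z. z \<in> S \<Longrightarrow> (F has_derivative (\<lambda>v. D v z)) (at z)" "\<And>v. Ck_on k S (D v)"
  shows "Ck_on (Suc k) S F"
proof -
  have "dder F v z = D v z" if "z \<in> S" for v z
    using frechet_derivative_at[OF assms(2)[OF that]] unfolding dder_def by metis
  then have "Ck_on k S (dder F v)" for v using Ck_on_cong[OF assms(1) _ assms(3)[of v]] by metis
  then show ?thesis using assms(2) unfolding Ck_on.simps differentiable_def by blast
qed

lemma smooth_onI:
  assumes "open S" "continuous_on S F" "\<And>z. z \<in> S \<Longrightarrow> (F has_derivative (\<lambda>v. D v z)) (at z)"
    "\<And>v k. Ck_on k S F \<Longrightarrow> Ck_on k S (D v)"
  shows "smooth_on S F"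
proof -
  have "Ck_on k S F" for k
  proof (induction k)
    case (Suc k) then show ?case using Ck_on_SucI[OF assms(1,3)] assms(4) by blast
  qed (use assms(2) in simp)
  then show ?thesis unfolding smooth_on_def by simp
qed

lemma smooth_on_has_derivative:
  assumes "smooth_on S F" "z \<in> S"
  shows "F differentiable (at z)" "(F has_derivative (\<lambda>v. dder F v z)) (at z)"
proof -
  have "Ck_on (Suc 0) S F" using assms(1) unfolding smooth_on_def by blast
  then show "F differentiable (at z)" using assms(2) by simp
  then show "(F has_derivative (\<lambda>v. dder F v z)) (at z)" by (rule differentiable_imp_dder(1))
qed

lemma smooth_on_dder: "smooth_on S F \<Longrightarrow> smooth_on S (dder F v)"
  unfolding smooth_on_def using Ck_on.simps(2) by blast

lemma smooth_on_imp_continuous_on: "smooth_on S F \<Longrightarrow> continuous_on S F"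
  unfolding smooth_on_def using Ck_on.simps(1) by blast

lemma Ck_on_const: "Ck_on k S (\<lambda>z. c)"
proof (induction k arbitrary: c)
  case (Suc k)
  have "dder (\<lambda>z. c) v = (\<lambda>z. 0)" for v by (rule ext) (simp add: dder_def frechet_derivative_const)
  then show ?case using Suc by simp
qed simp

lemma Ck_on_linear:
  assumes "open S" "bounded_linear L" "Ck_on k S F" shows "Ck_on k S (\<lambda>z. L (F z))"
  using assms(3)
proof (induction k arbitrary: F)
  case 0 then show ?case using bounded_linear.continuous_on[OF assms(2)] by simp
next
  case (Suc k)
  show ?case
  proof (rule Ck_on_SucI[OF assms(1)])
    fix z assume "z \<in> S"
    then have "(F has_derivative (\<lambda>v. dder F v z)) (at z)" using Suc.prems by (auto intro!: differentiable_imp_dder(1))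
    then show "((\<lambda>z. L (F z)) has_derivative (\<lambda>v. L (dder F v z))) (at z)"
      by (rule bounded_linear.has_derivative[OF assms(2)])
  qed (use Suc in auto)
qed

lemma Ck_on_add:
  assumes "open S" "Ck_on k S F" "Ck_on k S G" shows "Ck_on k S (\<lambda>z. F z + G z)"
  using assms(2,3)
proof (induction k arbitrary: F G)
  case 0 then show ?case by (simp add: continuous_on_add)
next
  case (Suc k)
  show ?case
  proof (rule Ck_on_SucI[OF assms(1)])
    fix z assume "z \<in> S"
    then have "(F has_derivative (\<lambda>v. dder F v z)) (at z)" "(G has_derivative (\<lambda>v. dder G v z)) (at z)"
      using Suc.prems by (auto intro!: differentiable_imp_dder(1))
    then show "((\<lambda>z. F z + G z) has_derivative (\<lambda>v. dder F v z + dder G v z)) (at z)"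
      by (rule has_derivative_add)
  qed (use Suc in auto)
qed

lemma Ck_on_bilinear:
  assumes "open S" "bounded_bilinear B" "Ck_on k S F" "Ck_on k S G"
  shows "Ck_on k S (\<lambda>z. B (F z) (G z))"
  using assms(3,4)
proof (induction k arbitrary: F G)
  case 0 then show ?case using bounded_bilinear.continuous_on[OF assms(2)] by simp
next
  case (Suc k)
  show ?case
  proof (rule Ck_on_SucI[OF assms(1)])
    fix z assume "z \<in> S"
    then have "(F has_derivative (\<lambda>v. dder F v z)) (at z)" "(G has_derivative (\<lambda>v. dder G v z)) (at z)"
      using Suc.prems by (auto intro!: differentiable_imp_dder(1))
    then show "((\<lambda>z. B (F z) (G z)) has_derivative (\<lambda>v. B (F z) (dder G v z) + B (dder F v z) (G z))) (at z)"
      by (rule bounded_bilinear.FDERIV[OF assms(2)])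
  next
    fix v
    have "Ck_on k S F" "Ck_on k S G" using Suc.prems Ck_on_Suc_imp by blast+
    then show "Ck_on k S (\<lambda>z. B (F z) (dder G v z) + B (dder F v z) (G z))"
      using Suc.prems by (intro Ck_on_add[OF assms(1)] Suc.IH) auto
  qed
qed

lemma bounded_linear_euclidean: "linear L \<Longrightarrow> bounded_linear L"
  for L :: "'a::euclidean_space \<Rightarrow> 'b::real_normed_vector"
  by (simp add: linear_conv_bounded_linear)

lemma bounded_bilinear_euclidean: "bilinear B \<Longrightarrow> bounded_bilinear B"
  for B :: "'a::euclidean_space \<Rightarrow> 'b::euclidean_space \<Rightarrow> 'c::real_normed_vector"
  by (simp add: bilinear_conv_bounded_bilinear)

lemma bounded_bilinear_vec_scale:
  "bounded_bilinear (\<lambda>c (v :: complex ^ 'm). c *s v)"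
proof (rule bounded_bilinear_euclidean, unfold bilinear_def, intro conjI allI linearI)
  fix r :: real and b :: "complex ^ 'm" and c :: complex
  show "(r *\<^sub>R c) *s b = r *\<^sub>R (c *s b)" "c *s (r *\<^sub>R b) = r *\<^sub>R (c *s b)"
    by (simp_all add: vec_eq_iff)
qed (simp_all add: vec_eq_iff algebra_simps)

lemma bounded_bilinear_lorentz_complex:
  "bounded_bilinear (lorentz :: complex ^ 'n::finite option \<Rightarrow> _)"
  by (rule bounded_bilinear_euclidean)
     (auto simp: bilinear_def lorentz_def algebra_simps sum.distrib sum_distrib_left scaleR_sum_right intro!: linearI)

definition re_vec :: "complex ^ 'm \<Rightarrow> real ^ 'm" where
  "re_vec v = (\<chi> i. Re (v $ i))"

lemma bounded_linear_cplx: "bounded_linear (cplx :: real ^ 'm \<Rightarrow> _)"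
  by (rule bounded_linear_euclidean)
     (auto simp: cplx_def vec_eq_iff scaleR_conv_of_real[where 'a = complex] intro!: linearI)

lemma bounded_linear_re_vec: "bounded_linear (re_vec :: complex ^ 'm \<Rightarrow> _)"
  by (rule bounded_linear_euclidean) (auto simp: re_vec_def vec_eq_iff intro!: linearI)

lemma bounded_linear_vcnj: "bounded_linear (vcnj :: complex ^ 'm \<Rightarrow> _)"
  by (rule bounded_linear_euclidean) (auto simp: vcnj_def vec_eq_iff intro!: linearI)

named_theorems smooth_intros

lemma smooth_on_linear:
  assumes "bounded_linear L" "open S" "smooth_on S F" shows "smooth_on S (\<lambda>z. L (F z))"
  using assms Ck_on_linear unfolding smooth_on_def by blast
lemma smooth_on_bilinear:
  assumes "bounded_bilinear B" "open S" "smooth_on S F" "smooth_on S G"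
  shows "smooth_on S (\<lambda>z. B (F z) (G z))"
  using assms Ck_on_bilinear unfolding smooth_on_def by blast
lemma smooth_on_const [smooth_intros]: "smooth_on S (\<lambda>z. c)"
  unfolding smooth_on_def by (simp add: Ck_on_const)
lemma smooth_on_add [smooth_intros]:
  "open S \<Longrightarrow> smooth_on S F \<Longrightarrow> smooth_on S G \<Longrightarrow> smooth_on S (\<lambda>z. F z + G z)"
  using Ck_on_add unfolding smooth_on_def by blast
lemma smooth_on_minus [smooth_intros]:
  "open S \<Longrightarrow> smooth_on S F \<Longrightarrow> smooth_on S (\<lambda>z. - F z)"
  by (rule smooth_on_linear[OF bounded_linear_minus[OF bounded_linear_ident]])
lemma smooth_on_diff [smooth_intros]:
  "open S \<Longrightarrow> smooth_on S F \<Longrightarrow> smooth_on S G \<Longrightarrow> smooth_on S (\<lambda>z. F z - G z)"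
  using smooth_on_add[of S F "\<lambda>z. - G z"] smooth_on_minus[of S G] by simp
lemmas smooth_on_mult [smooth_intros] = smooth_on_bilinear[OF bounded_bilinear_mult]
lemmas smooth_on_scaleR [smooth_intros] = smooth_on_bilinear[OF bounded_bilinear_scaleR]
lemmas smooth_on_vec_scale [smooth_intros] = smooth_on_bilinear[OF bounded_bilinear_vec_scale]
lemmas smooth_on_lorentz [smooth_intros] = smooth_on_bilinear[OF bounded_bilinear_lorentz_complex]
lemmas smooth_on_inner [smooth_intros] = smooth_on_bilinear[OF bounded_bilinear_inner]
lemmas smooth_on_cnj [smooth_intros] = smooth_on_linear[OF bounded_linear_cnj]
lemmas smooth_on_Re [smooth_intros] = smooth_on_linear[OF bounded_linear_Re]
lemmas smooth_on_of_real [smooth_intros] = smooth_on_linear[OF bounded_linear_of_real[where 'a=complex]]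
lemmas smooth_on_vcnj [smooth_intros] = smooth_on_linear[OF bounded_linear_vcnj]
lemmas smooth_on_cplx [smooth_intros] = smooth_on_linear[OF bounded_linear_cplx]
lemmas smooth_on_re_vec [smooth_intros] = smooth_on_linear[OF bounded_linear_re_vec]
lemmas smooth_on_vec_nth [smooth_intros] = smooth_on_linear[OF bounded_linear_vec_nth]

lemma smooth_on_wirt [smooth_intros]: "open S \<Longrightarrow> smooth_on S F \<Longrightarrow> smooth_on S (wirt F)"
  unfolding wirt_def[abs_def] by (intro smooth_intros smooth_on_dder)
lemma smooth_on_wirtbar [smooth_intros]: "open S \<Longrightarrow> smooth_on S F \<Longrightarrow> smooth_on S (wirtbar F)"
  unfolding wirtbar_def[abs_def] by (intro smooth_intros smooth_on_dder)
lemma smooth_on_wirtc [smooth_intros]: "open S \<Longrightarrow> smooth_on S F \<Longrightarrow> smooth_on S (wirtc F)"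
  unfolding wirtc_def[abs_def] by (intro smooth_intros smooth_on_dder)
lemma smooth_on_wirtbarc [smooth_intros]: "open S \<Longrightarrow> smooth_on S F \<Longrightarrow> smooth_on S (wirtbarc F)"
  unfolding wirtbarc_def[abs_def] by (intro smooth_intros smooth_on_dder)

lemma smooth_has_wirt: "smooth_on S F \<Longrightarrow> z \<in> S \<Longrightarrow> has_wirt F (wirt F z) (wirtbar F z) z"
  by (rule has_wirt_wirt, rule smooth_on_has_derivative)
lemma smooth_has_wirtc: "smooth_on S F \<Longrightarrow> z \<in> S \<Longrightarrow> has_wirtc F (wirtc F z) (wirtbarc F z) z"
  by (rule has_wirtc_wirtc, rule smooth_on_has_derivative)

lemma smooth_on_id [smooth_intros]: "open S \<Longrightarrow> smooth_on S (\<lambda>z. z)"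
  by (rule smooth_onI[where D = "\<lambda>v z. v"]) (auto intro!: Ck_on_const has_derivative_ident)

text \<open>A real function composed with a solution of a first order system of scalar equations is as
  smooth as its argument; reciprocals, square roots, cosine and sine are the cases in use.\<close>

lemma smooth_on_inverse [smooth_intros]:
  fixes F :: "complex \<Rightarrow> 'b::real_normed_field"
  assumes S: "open S" and F: "smooth_on S F" and nz: "\<And>z. z \<in> S \<Longrightarrow> F z \<noteq> 0"
  shows "smooth_on S (\<lambda>z. inverse (F z))"
proof (rule smooth_onI[OF S, where D = "\<lambda>v z. - (inverse (F z) * dder F v z * inverse (F z))"])
  show "continuous_on S (\<lambda>z. inverse (F z))"
    using smooth_on_imp_continuous_on[OF F] nz by (auto intro: continuous_intros)
  fix z assume z: "z \<in> S"
  show "((\<lambda>z. inverse (F z)) has_derivative (\<lambda>v. - (inverse (F z) * dder F v z * inverse (F z)))) (at z)"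
    by (rule Deriv.has_derivative_inverse[OF nz[OF z] smooth_on_has_derivative(2)[OF F z]])
next
  fix v k assume k: "Ck_on k S (\<lambda>z. inverse (F z))"
  have "Ck_on k S (dder F v)" using smooth_on_dder[OF F] unfolding smooth_on_def by blast
  then show "Ck_on k S (\<lambda>z. - (inverse (F z) * dder F v z * inverse (F z)))"
    by (intro Ck_on_linear[OF S bounded_linear_minus[OF bounded_linear_ident]]
          Ck_on_bilinear[OF S bounded_bilinear_mult] k)
qed

lemma smooth_on_sqrt [smooth_intros]:
  assumes S: "open S" and F: "smooth_on S F" and nz: "\<And>z. z \<in> S \<Longrightarrow> F z > 0"
  shows "smooth_on S (\<lambda>z. sqrt (F z))"
proof (rule smooth_onI[OF S, where D = "\<lambda>v z. sqrt (F z) * (dder F v z * (1/2) * inverse (F z))"])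
  show "continuous_on S (\<lambda>z. sqrt (F z))"
    using smooth_on_imp_continuous_on[OF F] by (auto intro: continuous_intros)
  fix z assume z: "z \<in> S"
  have "inverse (sqrt (F z)) = sqrt (F z) * inverse (F z)"
    using nz[OF z] by (simp add: field_simps)
  then show "((\<lambda>z. sqrt (F z)) has_derivative (\<lambda>v. sqrt (F z) * (dder F v z * (1/2) * inverse (F z)))) (at z)"
    using nz[OF z]
    by (auto intro!: derivative_eq_intros smooth_on_has_derivative(2)[OF F z] simp: fun_eq_iff field_simps)
next
  fix v k assume k: "Ck_on k S (\<lambda>z. sqrt (F z))"
  have "smooth_on S (\<lambda>z. dder F v z * (1/2) * inverse (F z))"
    using nz by (intro smooth_intros S smooth_on_dder F) force
  then have "Ck_on k S (\<lambda>z. dder F v z * (1/2) * inverse (F z))" unfolding smooth_on_def by blast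
  then show "Ck_on k S (\<lambda>z. sqrt (F z) * (dder F v z * (1/2) * inverse (F z)))"
    by (rule Ck_on_bilinear[OF S bounded_bilinear_mult k])
qed

lemma smooth_on_cos_sin [smooth_intros]:
  fixes F :: "complex \<Rightarrow> real"
  assumes S: "open S" and F: "smooth_on S F"
  shows "smooth_on S (\<lambda>z. cos (F z))" "smooth_on S (\<lambda>z. sin (F z))"
proof -
  have "Ck_on k S (\<lambda>z. cos (F z)) \<and> Ck_on k S (\<lambda>z. sin (F z))" for k
  proof (induction k)
    case 0 then show ?case
      using smooth_on_imp_continuous_on[OF F] by (auto intro: continuous_intros)
  next
    case (Suc k)
    have d: "Ck_on k S (dder F v)" for v using smooth_on_dder[OF F] unfolding smooth_on_def by blast
    have "Ck_on (Suc k) S (\<lambda>z. cos (F z))"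
    proof (rule Ck_on_SucI[OF S, where D = "\<lambda>v z. dder F v z * - sin (F z)"])
      fix z assume z: "z \<in> S"
      show "((\<lambda>z. cos (F z)) has_derivative (\<lambda>v. dder F v z * - sin (F z))) (at z)"
        by (auto intro!: derivative_eq_intros smooth_on_has_derivative(2)[OF F z])
    qed (use Suc d in \<open>auto intro!: Ck_on_bilinear[OF S bounded_bilinear_mult] Ck_on_linear[OF S bounded_linear_minus[OF bounded_linear_ident]]\<close>)
    moreover have "Ck_on (Suc k) S (\<lambda>z. sin (F z))"
    proof (rule Ck_on_SucI[OF S, where D = "\<lambda>v z. dder F v z * cos (F z)"])
      fix z assume z: "z \<in> S"
      show "((\<lambda>z. sin (F z)) has_derivative (\<lambda>v. dder F v z * cos (F z))) (at z)"
        by (auto intro!: derivative_eq_intros smooth_on_has_derivative(2)[OF F z])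
    qed (use Suc d in \<open>auto intro!: Ck_on_bilinear[OF S bounded_bilinear_mult]\<close>)
    ultimately show ?case by blast
  qed
  then show "smooth_on S (\<lambda>z. cos (F z))" "smooth_on S (\<lambda>z. sin (F z))"
    unfolding smooth_on_def by auto
qed

section \<open>Symmetry of second derivatives\<close>

text \<open>Two applications of the mean value theorem express the second difference of \<open>g\<close> over a small
  square as a value of either mixed derivative.\<close>

lemma mixed_derivatives_agree_nearby:
  fixes g :: "complex \<Rightarrow> real"
  assumes S: "open S" and g: "Ck_on 2 S g" and a: "a \<in> S" and e: "0 < e"
  obtains p q where "p \<in> S" "q \<in> S" "dist p a < e" "dist q a < e"
    "dder (dder g 1) \<i> p = dder (dder g \<i>) 1 q"
proof -
  obtain r where r: "0 < r" "ball a r \<subseteq> S" using S a open_contains_ball by blast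
  define h where "h = min e r / 4"
  have h: "0 < h" "4 * h \<le> e" "4 * h \<le> r" using r e by (auto simp: h_def)
  have near: "dist (a + of_real s + \<i> * of_real t) a < 4 * h" if "0 \<le> s" "s \<le> h" "0 \<le> t" "t \<le> h" for s t
  proof -
    have "norm (of_real s + \<i> * of_real t :: complex) \<le> norm (of_real s :: complex) + norm (\<i> * of_real t)"
      by (rule norm_triangle_ineq)
    also have "\<dots> \<le> h + h" using that by (simp add: norm_mult)
    finally show ?thesis using h by (simp add: dist_norm add.assoc)
  qed
  then have inS: "a + of_real s + \<i> * of_real t \<in> S" if "0 \<le> s" "s \<le> h" "0 \<le> t" "t \<le> h" for s t
    using r that h(3) by (force simp: dist_commute)
  have g2: "Ck_on (Suc (Suc 0)) S g" using g by (simp add: numeral_2_eq_2)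
  have d: "(g has_derivative (\<lambda>v. dder g v z)) (at z)"
    "(dder g w has_derivative (\<lambda>v. dder (dder g w) v z)) (at z)" if "z \<in> S" for z w
    using g2 that by (auto intro!: differentiable_imp_dder(1))
  have sc: "dder F (of_real c * v) z = c * dder F v z" if "F differentiable (at z)" for F :: "complex \<Rightarrow> real" and c v z
    using differentiable_imp_dder(2)[OF that, of "of_real c * v"] differentiable_imp_dder(2)[OF that, of v]
    by (simp add: algebra_simps)
  have line: "((\<lambda>s. F (b + of_real s * w)) has_real_derivative dder F w (b + of_real s * w)) (at s)"
    if "F differentiable (at (b + of_real s * w))" for F :: "complex \<Rightarrow> real" and b w s
  proof -
    have "((\<lambda>s. F (b + of_real s * w)) has_derivative (\<lambda>t. dder F (of_real t * w) (b + of_real s * w))) (at s)"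
      by (rule has_derivative_compose[where g = F and f = "\<lambda>s. b + of_real s * w", OF _ differentiable_imp_dder(1)[OF that]])
         (auto intro!: derivative_eq_intros)
    then show ?thesis unfolding has_field_derivative_def using sc[OF that] by (simp add: mult_commute_abs)
  qed
  have key: "\<exists>p\<in>S. dist p a < 4 * h \<and>
      g (a + of_real h * u + of_real h * w) - g (a + of_real h * u) - g (a + of_real h * w) + g a
      = h * h * dder (dder g u) w p" if uw: "(u = 1 \<and> w = \<i>) \<or> (u = \<i> \<and> w = 1)" for u w
  proof -
    have inS': "a + of_real s * u + of_real t * w \<in> S" "dist (a + of_real s * u + of_real t * w) a < 4 * h"
      if "0 \<le> s" "s \<le> h" "0 \<le> t" "t \<le> h" for s t
      using uw inS[of s t] inS[of t s] near[of s t] near[of t s] that by (auto simp: algebra_simps)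
    have df: "g differentiable (at z)" "dder g v differentiable (at z)" if "z \<in> S" for z v
      using d[OF that] unfolding differentiable_def by blast+
    define \<phi> where "\<phi> = (\<lambda>s. g (a + of_real h * w + of_real s * u) - g (a + of_real s * u))"
    have "\<exists>s. 0 < s \<and> s < h \<and> \<phi> h - \<phi> 0 = (h - 0) * (dder g u (a + of_real h * w + of_real s * u) - dder g u (a + of_real s * u))"
    proof (rule MVT2[OF h(1)])
      fix s assume s: "0 \<le> s" "s \<le> h"
      have "a + of_real h * w + of_real s * u \<in> S" "a + of_real s * u \<in> S"
        using inS'(1)[OF s, of h] inS'(1)[OF s, of 0] h(1) by (auto simp: algebra_simps)
      then show "DERIV \<phi> s :> dder g u (a + of_real h * w + of_real s * u) - dder g u (a + of_real s * u)"
        unfolding \<phi>_def by (intro DERIV_diff line df)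
    qed
    then obtain s where s: "0 < s" "s < h" and 1: "\<phi> h - \<phi> 0 = h * (dder g u (a + of_real s * u + of_real h * w) - dder g u (a + of_real s * u))"
      by (auto simp: algebra_simps)
    define \<theta> where "\<theta> = (\<lambda>t. dder g u (a + of_real s * u + of_real t * w))"
    have "\<exists>t. 0 < t \<and> t < h \<and> \<theta> h - \<theta> 0 = (h - 0) * dder (dder g u) w (a + of_real s * u + of_real t * w)"
    proof (rule MVT2[OF h(1)])
      fix t assume t: "0 \<le> t" "t \<le> h"
      show "DERIV \<theta> t :> dder (dder g u) w (a + of_real s * u + of_real t * w)"
        unfolding \<theta>_def by (intro line df inS'(1) t) (use s in auto)
    qed
    then obtain t where t: "0 < t" "t < h" "\<theta> h - \<theta> 0 = h * dder (dder g u) w (a + of_real s * u + of_real t * w)"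
      by auto
    have "\<phi> h - \<phi> 0 = h * h * dder (dder g u) w (a + of_real s * u + of_real t * w)"
      using 1 t(3) unfolding \<theta>_def by simp
    then show ?thesis using inS'[of s t] s t unfolding \<phi>_def
      by (intro bexI[of _ "a + of_real s * u + of_real t * w"]) (auto simp: algebra_simps)
  qed
  obtain p where p: "p \<in> S" "dist p a < 4 * h" "g (a + of_real h * 1 + of_real h * \<i>) - g (a + of_real h * 1) - g (a + of_real h * \<i>) + g a
      = h * h * dder (dder g 1) \<i> p" using key[of 1 \<i>] by blast
  obtain q where q: "q \<in> S" "dist q a < 4 * h" "g (a + of_real h * \<i> + of_real h * 1) - g (a + of_real h * \<i>) - g (a + of_real h * 1) + g a
      = h * h * dder (dder g \<i>) 1 q" using key[of \<i> 1] by blast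
  have "h * h * dder (dder g 1) \<i> p = h * h * dder (dder g \<i>) 1 q" using p(3) q(3) by (simp add: algebra_simps)
  then show ?thesis using that p q h by force
qed

lemma mixed_derivatives_real:
  fixes g :: "complex \<Rightarrow> real"
  assumes S: "open S" and g: "Ck_on 2 S g" and a: "a \<in> S"
  shows "dder (dder g 1) \<i> a = dder (dder g \<i>) 1 a"
proof (rule ccontr)
  assume ne: "\<not> ?thesis"
  define F G where "F = dder (dder g 1) \<i>" and "G = dder (dder g \<i>) 1"
  define e where "e = \<bar>F a - G a\<bar> / 2"
  have e: "e > 0" using ne by (simp add: e_def F_def G_def)
  have "Ck_on (Suc (Suc 0)) S g" using g by (simp add: numeral_2_eq_2)
  then have "continuous_on S F" "continuous_on S G" by (auto simp: F_def G_def)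
  then obtain d1 d2 where d: "d1 > 0" "\<And>p. p \<in> S \<Longrightarrow> dist p a < d1 \<Longrightarrow> dist (F p) (F a) < e"
     "d2 > 0" "\<And>p. p \<in> S \<Longrightarrow> dist p a < d2 \<Longrightarrow> dist (G p) (G a) < e"
    using a e unfolding continuous_on_iff by metis
  obtain p q where pq: "p \<in> S" "q \<in> S" "dist p a < min d1 d2" "dist q a < min d1 d2" "F p = G q"
    using mixed_derivatives_agree_nearby[OF S g a, of "min d1 d2"] d unfolding F_def G_def by (metis min_less_iff_conj)
  have "dist (F p) (F a) < e" "dist (G q) (G a) < e" using d(2)[OF pq(1)] d(4)[OF pq(2)] pq(3,4) by simp_all
  then have "dist (F a) (G a) < \<bar>F a - G a\<bar>" unfolding pq(5) e_def by (rule dist_triangle_half_r)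
  then show False by (simp add: dist_real_def)
qed

text \<open>Both compositions are a quarter of the Laplacian once the mixed partial derivatives agree.\<close>

lemma wirt_wirtbar_commute:
  fixes F :: "complex \<Rightarrow> complex ^ 'm"
  assumes S: "open S" and F: "smooth_on S F" and z: "z \<in> S"
  shows "wirt (wirtbar F) z = wirtbar (wirt F) z"
proof -
  have lin: "dder (\<lambda>z. L (G z)) v z = L (dder G v z)"
    if "bounded_linear L" "smooth_on S G" "z \<in> S" for L :: "complex ^ 'm \<Rightarrow> real" and G v z
    using frechet_derivative_at[OF bounded_linear.has_derivative[OF that(1) smooth_on_has_derivative(2)[OF that(2,3)]]]
    unfolding dder_def by metis
  have sym: "L (dder (dder F 1) \<i> z) = L (dder (dder F \<i>) 1 z)" if L: "bounded_linear L" for L :: "complex ^ 'm \<Rightarrow> real"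
  proof -
    have s: "smooth_on S (\<lambda>z. L (F z))" by (rule smooth_on_linear[OF L S F])
    have c: "dder (dder (\<lambda>z. L (F z)) v) w z = L (dder (dder F v) w z)" for v w
    proof -
      have "dder (dder (\<lambda>z. L (F z)) v) w z = dder (\<lambda>z. L (dder F v z)) w z"
        unfolding dder_def[of "dder (\<lambda>z. L (F z)) v"] dder_def[of "\<lambda>z. L (dder F v z)"]
        by (subst frechet_derivative_transform_within_open[OF _ S z, where g = "\<lambda>z. L (dder F v z)"])
           (use lin[OF L F] smooth_on_has_derivative(1)[OF smooth_on_dder[OF s] z] in auto)
      also have "\<dots> = L (dder (dder F v) w z)" by (rule lin[OF L smooth_on_dder[OF F] z])
      finally show ?thesis .
    qed
    show ?thesis using mixed_derivatives_real[OF S _ z, of "\<lambda>z. L (F z)"] s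
      unfolding c smooth_on_def by blast
  qed
  have *: "dder (dder F 1) \<i> z = dder (dder F \<i>) 1 z"
  proof -
    have "dder (dder F 1) \<i> z $ i = dder (dder F \<i>) 1 z $ i" for i
      using sym[OF bounded_linear_compose[OF bounded_linear_Re bounded_linear_vec_nth[of i]]]
        sym[OF bounded_linear_compose[OF bounded_linear_Im bounded_linear_vec_nth[of i]]]
      by (simp add: complex_eq_iff)
    then show ?thesis by (simp add: vec_eq_iff)
  qed
  have d: "has_wirt (dder F v) (wirt (dder F v) z) (wirtbar (dder F v) z) z" for v
    by (rule smooth_has_wirt[OF smooth_on_dder[OF F] z])
  have e: "wirtbar F = (\<lambda>z. (1/2) *s (dder F 1 z + \<i> *s dder F \<i> z))"
     "wirt F = (\<lambda>z. (1/2) *s (dder F 1 z - \<i> *s dder F \<i> z))"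
    by (auto simp: wirtbar_def wirt_def)
  have "wirt (wirtbar F) z = (1/2) *s (wirt (dder F 1) z + \<i> *s wirt (dder F \<i>) z)"
    unfolding e(1)
    using has_wirtD(1)[OF has_wirt_scale[OF has_wirtc_const[of "1/2"] has_wirt_add[OF d[of 1] has_wirt_scale[OF has_wirtc_const[of \<i>] d[of \<i>]]]]]
    by (simp add: vec_eq_iff)
  moreover have "wirtbar (wirt F) z = (1/2) *s (wirtbar (dder F 1) z - \<i> *s wirtbar (dder F \<i>) z)"
    unfolding e(2)
    using has_wirtD(2)[OF has_wirt_scale[OF has_wirtc_const[of "1/2"] has_wirt_diff[OF d[of 1] has_wirt_scale[OF has_wirtc_const[of \<i>] d[of \<i>]]]]]
    by (simp add: vec_eq_iff)
  ultimately show ?thesis using * unfolding wirt_def wirtbar_def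
    by (simp add: vec_eq_iff algebra_simps)
qed

section \<open>Lorentz algebra\<close>

lemma lorentz_commute: "lorentz v w = lorentz w v"
  unfolding lorentz_def by (simp add: mult.commute)

lemma lorentz_simps [simp]:
  "lorentz (a + b) c = lorentz a c + lorentz b c"
  "lorentz c (a + b) = lorentz c a + lorentz c b"
  "lorentz (a - b) c = lorentz a c - lorentz b c"
  "lorentz c (a - b) = lorentz c a - lorentz c b"
  "lorentz (- a) c = - lorentz a c"
  "lorentz c (- a) = - lorentz c a"
  "lorentz 0 c = 0" "lorentz c 0 = 0"
  "lorentz (k *s a) c = k * lorentz a c"
  "lorentz c (k *s a) = k * lorentz c a"
  unfolding lorentz_def
  by (simp_all add: algebra_simps sum.distrib sum_subtractf sum_distrib_left sum_negf)

lemma lorentz_scaleR [simp]: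
  fixes a c :: "real ^ 'n::finite option"
  shows "lorentz (k *\<^sub>R a) c = k * lorentz a c" "lorentz c (k *\<^sub>R a) = k * lorentz c a"
  unfolding lorentz_def by (simp_all add: algebra_simps sum_distrib_left)

lemma lorentz_sum:
  fixes c :: "'a::comm_ring_1 ^ 'n::finite option"
  shows "lorentz (\<Sum>i\<in>I. f i) c = (\<Sum>i\<in>I. lorentz (f i) c)"
  by (induction I rule: infinite_finite_induct) auto

lemma lorentz_cplx [simp]: "lorentz (cplx a) (cplx b) = of_real (lorentz a b)"
  unfolding lorentz_def cplx_def by simp

lemma lorentz_vcnj [simp]: "lorentz (vcnj a) (vcnj b) = cnj (lorentz a b)"
  unfolding lorentz_def vcnj_def by simp

lemma vcnj_simps [simp]:
  "vcnj (vcnj a) = a" "vcnj (a + b) = vcnj a + vcnj b" "vcnj (a - b) = vcnj a - vcnj b"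
  "vcnj (- a) = - vcnj a" "vcnj 0 = 0" "vcnj (k *s a) = cnj k *s vcnj a" "vcnj (cplx v) = cplx v"
  unfolding vcnj_def by (simp_all add: vec_eq_iff cplx_def)

lemma re_vec_cplx [simp]: "re_vec (cplx v) = v"
  unfolding re_vec_def cplx_def by (simp add: vec_eq_iff)

lemma cplx_re_vec: "vcnj v = v \<Longrightarrow> cplx (re_vec v) = v"
  unfolding re_vec_def cplx_def vcnj_def by (simp add: vec_eq_iff complex_eq_iff)

lemma cplx_simps [simp]:
  "cplx (a + b) = cplx a + cplx b" "cplx (a - b) = cplx a - cplx b" "cplx 0 = 0" "cplx (- a) = - cplx a"
  "cplx (k *\<^sub>R a) = of_real k *s cplx a" "cplx a = cplx b \<longleftrightarrow> a = b"
  unfolding cplx_def by (simp_all add: vec_eq_iff)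

text \<open>The orthogonal complement of a time-like vector is positive definite, by Cauchy-Schwarz for the
  space components.\<close>

lemma lorentz_pos_orthogonal_timelike:
  fixes \<eta> t :: "real ^ 'n::finite option"
  assumes tt: "lorentz t t < 0" and et: "lorentz \<eta> t = 0" and "\<eta> \<noteq> 0"
  shows "lorentz \<eta> \<eta> > 0"
proof -
  define m where "m = - lorentz t t"
  have m: "m > 0" using tt by (simp add: m_def)
  define A where "A = (\<Sum>k\<in>UNIV. (\<eta> $ Some k)\<^sup>2)"
  have T: "(\<Sum>k\<in>UNIV. (t $ Some k)\<^sup>2) = (t $ None)\<^sup>2 - m"
    by (simp add: m_def lorentz_def power2_eq_square)
  have "(\<eta> $ None * t $ None)\<^sup>2 = (\<Sum>k\<in>UNIV. \<eta> $ Some k * t $ Some k)\<^sup>2"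
    using et by (simp add: lorentz_def)
  also have "\<dots> \<le> A * ((t $ None)\<^sup>2 - m)"
    unfolding A_def T[symmetric] by (rule Cauchy_Schwarz_ineq_sum)
  finally have le: "(\<eta> $ None)\<^sup>2 * (t $ None)\<^sup>2 \<le> A * (t $ None)\<^sup>2 - m * A"
    by (simp add: power_mult_distrib algebra_simps)
  have "0 \<le> (\<Sum>k\<in>UNIV. (t $ Some k)\<^sup>2)" by (simp add: sum_nonneg)
  then have t0: "(t $ None)\<^sup>2 > 0" using T m by linarith
  have A0: "A \<ge> 0" unfolding A_def by (simp add: sum_nonneg)
  have "A \<noteq> 0"
  proof
    assume A: "A = 0"
    then have "(\<eta> $ None)\<^sup>2 * (t $ None)\<^sup>2 \<le> 0" using le by simp
    then have 0: "\<eta> $ None = 0" using t0 by (auto simp: mult_le_0_iff)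
    have "\<eta> $ Some k = 0" for k using A unfolding A_def by (simp add: sum_nonneg_eq_0_iff)
    then have "\<eta> $ i = 0" for i using 0 by (cases i) auto
    then show False using assms(3) by (simp add: vec_eq_iff)
  qed
  then have "m * A > 0" using A0 m by simp
  then have "(\<eta> $ None)\<^sup>2 * (t $ None)\<^sup>2 < A * (t $ None)\<^sup>2" using le by linarith
  then have "(\<eta> $ None)\<^sup>2 < A" using t0 by (simp add: mult_less_cancel_right)
  then show ?thesis unfolding lorentz_def A_def by (simp add: power2_eq_square)
qed

lemma lorentz_pos_orthogonal_null_pair:
  fixes \<eta> p q :: "real ^ 'n::finite option"
  assumes "lorentz p p = 0" "lorentz q q = 0" "lorentz p q = -1"
    and "lorentz \<eta> p = 0" "lorentz \<eta> q = 0" and "\<eta> \<noteq> 0"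
  shows "lorentz \<eta> \<eta> > 0"
  by (rule lorentz_pos_orthogonal_timelike[of "p + q"]) (use assms in \<open>simp_all add: lorentz_commute[of q p]\<close>)

section \<open>The normalized lift\<close>

definition space_vec :: "real ^ 'n \<Rightarrow> real ^ 'n::finite option" where
  "space_vec x = (\<chi> i. case i of None \<Rightarrow> 0 | Some k \<Rightarrow> x $ k)"

lemma bounded_linear_space_vec: "bounded_linear (space_vec :: real ^ 'n::finite \<Rightarrow> _)"
  by (rule bounded_linear_euclidean) (auto simp: space_vec_def vec_eq_iff split: option.split intro!: linearI)

lemma null_vec_eq: "null_vec x = axis None 1 + space_vec x"
  unfolding null_vec_def space_vec_def by (auto simp: vec_eq_iff axis_def split: option.split)

lemma null_vec_nth [simp]: "null_vec x $ None = 1" "null_vec x $ Some k = x $ k"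
  unfolding null_vec_def by auto

lemma space_vec_nth [simp]: "space_vec x $ None = 0" "space_vec x $ Some k = x $ k"
  unfolding space_vec_def by auto

lemma lorentz_null_vec:
  "lorentz (null_vec x) (null_vec y) = x \<bullet> y - 1"
  "lorentz (null_vec x) (space_vec y) = x \<bullet> y"
  "lorentz (space_vec x) (space_vec y) = x \<bullet> y"
  unfolding lorentz_def by (simp_all add: inner_vec_def)

lemma smooth_on_null_vec [smooth_intros]:
  fixes F :: "complex \<Rightarrow> real ^ 'n::finite"
  shows "open S \<Longrightarrow> smooth_on S F \<Longrightarrow> smooth_on S (\<lambda>z. null_vec (F z))"
  unfolding null_vec_eq by (intro smooth_intros smooth_on_linear[OF bounded_linear_space_vec])

text \<open>The derivative of \<open>a (1 : F)\<close> differs from \<open>a (0 : dF)\<close> by a multiple of the null vector \<open>(1 : F)\<close>,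
  which is orthogonal to both, so only the conformal factor of \<open>F\<close> and the scale \<open>a\<close> enter.\<close>

lemma lorentz_dder_multiple_null_vec:
  fixes F :: "complex \<Rightarrow> real ^ 'n::finite"
  assumes S: "open S" and F: "smooth_on S F" "F ` S \<subseteq> sphere 0 1" and a: "smooth_on S a" and z: "z \<in> S"
  shows "lorentz (dder (\<lambda>z. a z *\<^sub>R null_vec (F z)) v z) (dder (\<lambda>z. a z *\<^sub>R null_vec (F z)) v z)
    = (a z * norm (dder F v z))\<^sup>2"
proof -
  have dF: "(F has_derivative (\<lambda>v. dder F v z)) (at z)" by (rule smooth_on_has_derivative[OF F(1) z])
  have da: "(a has_derivative (\<lambda>v. dder a v z)) (at z)" by (rule smooth_on_has_derivative[OF a z])
  have 1: "((\<lambda>z. null_vec (F z)) has_derivative (\<lambda>v. space_vec (dder F v z))) (at z)"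
    unfolding null_vec_eq using bounded_linear.has_derivative[OF bounded_linear_space_vec dF]
    by (auto intro!: derivative_eq_intros)
  have "((\<lambda>z. a z *\<^sub>R null_vec (F z)) has_derivative (\<lambda>v. a z *\<^sub>R space_vec (dder F v z) + dder a v z *\<^sub>R null_vec (F z))) (at z)"
    by (rule has_derivative_scaleR[OF da 1])
  then have d: "dder (\<lambda>z. a z *\<^sub>R null_vec (F z)) v z = a z *\<^sub>R space_vec (dder F v z) + dder a v z *\<^sub>R null_vec (F z)" for v
    using frechet_derivative_at[of "\<lambda>z. a z *\<^sub>R null_vec (F z)", THEN fun_cong[where x=v]] unfolding dder_def by simp
  have FF: "F w \<bullet> F w = 1" if "w \<in> S" for w
    using F(2) that by (auto simp: power2_norm_eq_inner[symmetric])
  have "((\<lambda>w. F w \<bullet> F w) has_derivative (\<lambda>v. F z \<bullet> dder F v z + dder F v z \<bullet> F z)) (at z)"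
    by (rule has_derivative_inner[OF dF dF])
  moreover have "((\<lambda>w. F w \<bullet> F w) has_derivative (\<lambda>v. 0)) (at z)"
    by (rule has_derivative_transform_within_open[OF has_derivative_const[of 1] S z]) (simp add: FF)
  ultimately have "(\<lambda>v. F z \<bullet> dder F v z + dder F v z \<bullet> F z) = (\<lambda>v. 0)"
    by (rule has_derivative_unique)
  then have "F z \<bullet> dder F v z + dder F v z \<bullet> F z = 0" by (rule fun_cong)
  then have "F z \<bullet> dder F v z = 0" by (simp add: inner_commute)
  then show ?thesis unfolding d
    by (simp add: lorentz_null_vec lorentz_commute[of "space_vec (dder F v z)" "null_vec (F z)"] FF[OF z] power_mult_distrib power2_norm_eq_inner)
       (simp add: power2_eq_square)
qed

text \<open>The time component of a lift determines it, and conformality fixes this component to be the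
  reciprocal of the conformal factor.\<close>

lemma normalized_lift_eq:
  fixes F :: "complex \<Rightarrow> real ^ 'n::finite"
  assumes S: "open S" and F: "conformal_immersion_on S F" "F ` S \<subseteq> sphere 0 1"
    and \<psi>: "normalized_lift S F \<psi>" and z: "z \<in> S"
  shows "\<psi> z = inverse (norm (dder F 1 z)) *\<^sub>R null_vec (F z)"
proof -
  define a where "a z = \<psi> z $ None" for z
  have sm: "smooth_on S F" "smooth_on S a"
    using F \<psi> S unfolding conformal_immersion_on_def normalized_lift_def a_def[abs_def] by (auto intro: smooth_intros)
  have mult: "\<psi> w = a w *\<^sub>R null_vec (F w)" if "w \<in> S" for w
  proof -
    have "\<psi> w \<in> span {null_vec (F w)}" using \<psi> that unfolding normalized_lift_def by blast
    then obtain k where "\<psi> w = k *\<^sub>R null_vec (F w)" by (auto simp: span_singleton)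
    then show ?thesis unfolding a_def by simp
  qed
  have "dder \<psi> 1 z = dder (\<lambda>z. a z *\<^sub>R null_vec (F z)) 1 z"
    unfolding dder_def
    by (subst frechet_derivative_transform_within_open[OF smooth_on_has_derivative(1)[OF _ z] S z mult])
       (use \<psi> in \<open>auto simp: normalized_lift_def\<close>)
  moreover have "lorentz (dder \<psi> 1 z) (dder \<psi> 1 z) = 1" using \<psi> z by (simp add: normalized_lift_def)
  ultimately have "(a z * norm (dder F 1 z))\<^sup>2 = 1"
    unfolding lorentz_dder_multiple_null_vec[OF S sm(1) F(2) sm(2) z, of 1, symmetric]
    by simp
  moreover have "a z > 0" using \<psi> z unfolding normalized_lift_def forward_light_cone_def a_def by blast
  ultimately have "a z * norm (dder F 1 z) = 1"
    by (metis norm_ge_zero mult_nonneg_nonneg less_imp_le power2_eq_1_iff not_one_le_zero neg_0_le_iff_le)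
  then have "a z = inverse (norm (dder F 1 z))" using inverse_unique[of "norm (dder F 1 z)" "a z"] by (simp add: mult.commute)
  then show ?thesis using mult[OF z] by simp
qed

lemma normalized_lift_exists:
  fixes F :: "complex \<Rightarrow> real ^ 'n::finite"
  assumes S: "open S" and F: "conformal_immersion_on S F" "F ` S \<subseteq> sphere 0 1"
  shows "\<exists>\<psi>. normalized_lift S F \<psi>"
proof -
  define a where "a z = inverse (norm (dder F 1 z))" for z
  have smF: "smooth_on S F" and conf: "z \<in> S \<Longrightarrow> \<exists>r>0. \<forall>v. norm (dder F v z) = r * cmod v" for z
    using F unfolding conformal_immersion_on_def by auto
  have nz: "norm (dder F 1 z) > 0" if "z \<in> S" for z using conf[OF that] by force
  have "smooth_on S (\<lambda>z. sqrt (dder F 1 z \<bullet> dder F 1 z))"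
    using nz by (intro smooth_on_sqrt smooth_on_inner S smooth_on_dder smF) auto
  then have sma: "smooth_on S a"
    unfolding a_def[abs_def] norm_eq_sqrt_inner
    by (rule smooth_on_inverse[OF S]) (use nz in \<open>force simp: norm_eq_sqrt_inner[symmetric]\<close>)
  have "normalized_lift S F (\<lambda>z. a z *\<^sub>R null_vec (F z))"
    unfolding normalized_lift_def
  proof (intro conjI ballI allI)
    show "smooth_on S (\<lambda>z. a z *\<^sub>R null_vec (F z))" by (intro smooth_intros S sma smF)
  next
    fix z assume z: "z \<in> S"
    have "F z \<bullet> F z = 1" using F(2) z by (auto simp: power2_norm_eq_inner[symmetric])
    then have "lorentz (null_vec (F z)) (null_vec (F z)) = 0" by (simp add: lorentz_null_vec)
    moreover have "a z > 0" using nz[OF z] by (simp add: a_def)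
    moreover have "null_vec (F z) \<noteq> 0" using null_vec_nth(1)[of "F z"] by force
    ultimately show "a z *\<^sub>R null_vec (F z) \<in> forward_light_cone"
      unfolding forward_light_cone_def light_cone_def by simp
    show "a z *\<^sub>R null_vec (F z) \<in> span {null_vec (F z)}" by (simp add: span_scale span_base)
    fix v
    obtain r where r: "r > 0" "\<And>v. norm (dder F v z) = r * cmod v" using conf[OF z] by blast
    have "a z * norm (dder F v z) = cmod v" using r by (simp add: a_def)
    then show "lorentz (dder (\<lambda>z. a z *\<^sub>R null_vec (F z)) v z) (dder (\<lambda>z. a z *\<^sub>R null_vec (F z)) v z) = (cmod v)\<^sup>2"
      using lorentz_dder_multiple_null_vec[OF S smF F(2) sma z, of v] by simp
  qed
  then show ?thesis by blast
qed

lemma nlift_normalized: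
  fixes F :: "complex \<Rightarrow> real ^ 'n::finite"
  assumes S: "open S" and F: "conformal_immersion_on S F" "F ` S \<subseteq> sphere 0 1"
  obtains \<psi> where "nlift S F = cplx \<circ> \<psi>" "normalized_lift S F \<psi>"
  unfolding nlift_def using someI_ex[OF normalized_lift_exists[OF assms]] by blast

section \<open>Structure equations of a lift\<close>

lemma wirtc_of_constant:
  assumes "has_wirtc f a b z" "open S" "z \<in> S" "\<And>w. w \<in> S \<Longrightarrow> f w = k"
  shows "a = 0" "b = 0"
proof -
  have "has_wirtc (\<lambda>w. k) a b z" by (rule has_wirtc_cong_open[OF assms])
  then show "a = 0" "b = 0" using has_wirtc_unique has_wirtc_const by metis+
qed

lemma lorentz_nondegenerate:
  fixes v :: "'a::comm_ring_1 ^ 'n::finite option"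
  assumes "\<And>w. lorentz v w = 0" shows "v = 0"
proof -
  have "lorentz v (axis None 1) = - (v $ None)"
    "lorentz v (axis (Some k) 1) = v $ Some k" for k
    by (simp_all add: lorentz_def axis_def if_distrib cong: if_cong)
  then have "v $ i = 0" for i using assms by (cases i) (metis neg_equal_0_iff_equal, metis)
  then show ?thesis by (simp add: vec_eq_iff)
qed

text \<open>All that is used of a normalized lift. The frame of the complexified bundle \<open>V\<close> consists of the null
  vectors \<open>\<psi>\<close>, \<open>P = \<psi>\<^sub>z\<close>, \<open>Pb = \<psi>\<^bsub>zbar\<^esub>\<close> and \<open>N\<close>, where \<open>N\<close> is \<open>2 \<psi>\<^bsub>z zbar\<^esub>\<close> corrected by a multiple of
  \<open>\<psi>\<close> so as to be null; \<open>\<langle>\<psi>, N\<rangle> = -1\<close> and \<open>\<langle>P, Pb\<rangle> = 1/2\<close> are its only nonzero products. In terms of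
  it the orthogonal projection \<open>pr\<close> to the normal bundle, the Schwarzian \<open>cc\<close> and the Hopf
  differential \<open>kap\<close> are explicit, whereas their definitions are by unique existence. The function
  \<open>mm\<close> turns out to be \<open>\<langle>\<kappa>, cnj \<kappa>\<rangle>\<close>.\<close>

locale lightcone_lift =
  fixes \<Omega> :: "complex set" and \<psi> :: "complex \<Rightarrow> complex ^ 'n::finite option"
  assumes open_dom: "open \<Omega>" and smooth: "smooth_on \<Omega> \<psi>"
    and real: "z \<in> \<Omega> \<Longrightarrow> vcnj (\<psi> z) = \<psi> z"
    and null: "z \<in> \<Omega> \<Longrightarrow> lorentz (\<psi> z) (\<psi> z) = 0"
    and conf: "z \<in> \<Omega> \<Longrightarrow> lorentz (wirt \<psi> z) (wirt \<psi> z) = 0"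
      "z \<in> \<Omega> \<Longrightarrow> lorentz (wirt \<psi> z) (wirtbar \<psi> z) = 1/2"
begin

abbreviation "P \<equiv> wirt \<psi>"
abbreviation "Pb \<equiv> wirtbar \<psi>"
abbreviation "Y \<equiv> wirtbar (wirt \<psi>)"
abbreviation "Z \<equiv> wirt (wirt \<psi>)"

definition "mm z = lorentz (Y z) (Y z)"
definition "N z = 2 *s Y z + (2 * mm z) *s \<psi> z"
definition "cc z = 4 * lorentz (Z z) (Y z)"
definition "kap z = Z z + (cc z / 2) *s \<psi> z"

definition "pr z X = X + lorentz X (N z) *s \<psi> z + lorentz X (\<psi> z) *s N z
   - (2 * lorentz X (Pb z)) *s P z - (2 * lorentz X (P z)) *s Pb z"

definition "perp z X \<longleftrightarrow> lorentz X (\<psi> z) = 0 \<and> lorentz X (P z) = 0 \<and> lorentz X (Pb z) = 0 \<and> lorentz X (N z) = 0"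

lemmas sm = open_dom smooth smooth_on_wirt[OF open_dom] smooth_on_wirtbar[OF open_dom]

lemma smooth_fields: "smooth_on \<Omega> P" "smooth_on \<Omega> Pb" "smooth_on \<Omega> Y" "smooth_on \<Omega> Z"
  "smooth_on \<Omega> mm" "smooth_on \<Omega> N" "smooth_on \<Omega> cc" "smooth_on \<Omega> kap"
proof -
  show 1: "smooth_on \<Omega> P" "smooth_on \<Omega> Pb" "smooth_on \<Omega> Y" "smooth_on \<Omega> Z" by (intro sm)+
  show 2: "smooth_on \<Omega> mm" "smooth_on \<Omega> cc" unfolding mm_def[abs_def] cc_def[abs_def] by (intro smooth_intros sm)+
  show "smooth_on \<Omega> N" unfolding N_def[abs_def] by (intro smooth_intros sm 1 2)
  have "smooth_on \<Omega> (\<lambda>z. Z z + ((1/2) * cc z) *s \<psi> z)" by (intro smooth_intros sm 1 2)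
  then show "smooth_on \<Omega> kap" unfolding kap_def[abs_def] by simp
qed

lemma has_wirt_psi: "z \<in> \<Omega> \<Longrightarrow> has_wirt \<psi> (P z) (Pb z) z"
  and has_wirt_P: "z \<in> \<Omega> \<Longrightarrow> has_wirt P (Z z) (Y z) z"
  by (auto intro!: smooth_has_wirt sm)

lemma vcnj_P: "z \<in> \<Omega> \<Longrightarrow> vcnj (P z) = Pb z" and vcnj_Pb: "z \<in> \<Omega> \<Longrightarrow> vcnj (Pb z) = P z"
  using has_wirt_unique[OF has_wirt_cong_open[OF has_wirt_vcnj[OF has_wirt_psi] open_dom _ real] has_wirt_psi]
  by auto

lemma has_wirt_Pb: "z \<in> \<Omega> \<Longrightarrow> has_wirt Pb (Y z) (vcnj (Z z)) z"
proof -
  assume z: "z \<in> \<Omega>"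
  have 1: "has_wirt Pb (vcnj (Y z)) (vcnj (Z z)) z"
    by (rule has_wirt_cong_open[OF has_wirt_vcnj[OF has_wirt_P[OF z]] open_dom z vcnj_P])
  have "wirt Pb z = Y z" by (rule wirt_wirtbar_commute[OF open_dom smooth z])
  then show ?thesis using 1 has_wirtD(1)[OF 1] by simp
qed

lemma vcnj_Y: "z \<in> \<Omega> \<Longrightarrow> vcnj (Y z) = Y z"
  using has_wirt_unique(1)[OF has_wirt_cong_open[OF has_wirt_vcnj[OF has_wirt_P] open_dom _ vcnj_P] has_wirt_Pb]
  by auto

text \<open>Differentiating the relations of the normalization once and twice gives all products of the
  frame.\<close>

lemma ip1:
  assumes z: "z \<in> \<Omega>"
  shows "lorentz (\<psi> z) (\<psi> z) = 0" "lorentz (\<psi> z) (P z) = 0" "lorentz (P z) (\<psi> z) = 0"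
    "lorentz (\<psi> z) (Pb z) = 0" "lorentz (Pb z) (\<psi> z) = 0"
    "lorentz (P z) (P z) = 0" "lorentz (P z) (Pb z) = 1/2" "lorentz (Pb z) (P z) = 1/2" "lorentz (Pb z) (Pb z) = 0"
proof -
  show "lorentz (\<psi> z) (\<psi> z) = 0" "lorentz (P z) (P z) = 0" "lorentz (P z) (Pb z) = 1/2" "lorentz (Pb z) (P z) = 1/2"
    using null[OF z] conf[OF z] lorentz_commute[of "P z" "Pb z"] by simp_all
  show "lorentz (Pb z) (Pb z) = 0" using lorentz_vcnj[of "P z" "P z"] conf(1)[OF z] vcnj_P[OF z] by simp
  show "lorentz (\<psi> z) (P z) = 0" "lorentz (\<psi> z) (Pb z) = 0"
    using wirtc_of_constant[OF has_wirtc_lorentz[OF has_wirt_psi[OF z] has_wirt_psi[OF z]] open_dom z null]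
    by (simp_all add: lorentz_commute[of "P z"] lorentz_commute[of "Pb z"])
  then show "lorentz (P z) (\<psi> z) = 0" "lorentz (Pb z) (\<psi> z) = 0" by (simp_all add: lorentz_commute)
qed

lemma ip2:
  assumes z: "z \<in> \<Omega>"
  shows "lorentz (\<psi> z) (Y z) = - (1/2)" "lorentz (P z) (Y z) = 0" "lorentz (Pb z) (Y z) = 0"
    "lorentz (\<psi> z) (Z z) = 0" "lorentz (P z) (Z z) = 0" "lorentz (Pb z) (Z z) = 0"
    "lorentz (Y z) (\<psi> z) = - (1/2)" "lorentz (Y z) (P z) = 0" "lorentz (Y z) (Pb z) = 0"
    "lorentz (Z z) (\<psi> z) = 0" "lorentz (Z z) (P z) = 0" "lorentz (Z z) (Pb z) = 0"
proof -
  note w = has_wirt_psi[OF z] has_wirt_P[OF z] has_wirt_Pb[OF z]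
  show 1: "lorentz (\<psi> z) (Y z) = - (1/2)" "lorentz (\<psi> z) (Z z) = 0"
    using wirtc_of_constant[OF has_wirtc_lorentz[OF w(1,2)] open_dom z ip1(2)] ip1[OF z]
    by (auto simp: add_eq_0_iff)
  show 2: "lorentz (P z) (Y z) = 0" "lorentz (P z) (Z z) = 0"
    using wirtc_of_constant[OF has_wirtc_lorentz[OF w(2,2)] open_dom z ip1(6)]
    by (auto simp: lorentz_commute[of "Y z"] lorentz_commute[of "Z z"])
  have "lorentz (Pb z) (Y z) = cnj (lorentz (P z) (Y z))"
    using lorentz_vcnj[of "P z" "Y z"] by (simp add: vcnj_P z vcnj_Y)
  then show 3: "lorentz (Pb z) (Y z) = 0" using 2 by simp
  show 4: "lorentz (Pb z) (Z z) = 0"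
    using wirtc_of_constant(1)[OF has_wirtc_lorentz[OF w(2,3)] open_dom z ip1(7)] 2
    by (simp add: lorentz_commute)
  show "lorentz (Y z) (\<psi> z) = - (1/2)" "lorentz (Y z) (P z) = 0" "lorentz (Y z) (Pb z) = 0"
    "lorentz (Z z) (\<psi> z) = 0" "lorentz (Z z) (P z) = 0" "lorentz (Z z) (Pb z) = 0"
    using 1 2 3 4 by (simp_all add: lorentz_commute)
qed

lemma ipN:
  assumes z: "z \<in> \<Omega>"
  shows "lorentz (\<psi> z) (N z) = -1" "lorentz (N z) (\<psi> z) = -1" "lorentz (P z) (N z) = 0" "lorentz (N z) (P z) = 0"
    "lorentz (Pb z) (N z) = 0" "lorentz (N z) (Pb z) = 0" "lorentz (N z) (N z) = 0"
  using ip1[OF z] ip2[OF z] by (simp_all add: N_def mm_def algebra_simps)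

lemmas ip = ip1 ip2 ipN

lemma kap_perp: "z \<in> \<Omega> \<Longrightarrow> perp z (kap z)"
  unfolding perp_def kap_def by (simp add: ip cc_def N_def)

lemma perp_iff_Y: "z \<in> \<Omega> \<Longrightarrow> perp z X \<longleftrightarrow> lorentz X (\<psi> z) = 0 \<and> lorentz X (P z) = 0 \<and> lorentz X (Pb z) = 0 \<and> lorentz X (Y z) = 0"
  unfolding perp_def N_def by auto

lemma bundleVperp_iff: "z \<in> \<Omega> \<Longrightarrow> X \<in> bundleVperp \<psi> z \<longleftrightarrow> perp z X"
proof -
  assume z: "z \<in> \<Omega>"
  have "bundleV \<psi> z \<subseteq> {U. lorentz X U = 0}" if "perp z X"
    unfolding bundleV_def
  proof (rule vec.span_minimal)
    show "vec.subspace {U. lorentz X U = 0}" by (rule vec.subspaceI) auto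
  qed (use that perp_iff_Y[OF z] in auto)
  moreover have "{\<psi> z, P z, Pb z, Y z} \<subseteq> bundleV \<psi> z" unfolding bundleV_def by (rule vec.span_superset)
  ultimately show ?thesis unfolding bundleVperp_def perp_iff_Y[OF z] by auto
qed

lemma pr_perp: "z \<in> \<Omega> \<Longrightarrow> perp z (pr z X)"
  unfolding perp_def pr_def by (simp add: ip)

lemma pr_lin [simp]: "pr z (X + X') = pr z X + pr z X'" "pr z (X - X') = pr z X - pr z X'" "pr z (k *s X) = k *s pr z X"
  unfolding pr_def by (simp_all add: vec_eq_iff algebra_simps)

lemma pr_frame: assumes z: "z \<in> \<Omega>" shows "pr z (\<psi> z) = 0" "pr z (P z) = 0" "pr z (Pb z) = 0" "pr z (N z) = 0"
  unfolding pr_def by (simp_all add: ip z vec_eq_iff)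

lemma pr_of_perp: "perp z X \<Longrightarrow> pr z X = X"
  unfolding perp_def pr_def by simp

lemma perp_frame: "perp z X \<Longrightarrow> lorentz X (\<psi> z) = 0" "perp z X \<Longrightarrow> lorentz (\<psi> z) X = 0"
  "perp z X \<Longrightarrow> lorentz X (P z) = 0" "perp z X \<Longrightarrow> lorentz (P z) X = 0"
  "perp z X \<Longrightarrow> lorentz X (Pb z) = 0" "perp z X \<Longrightarrow> lorentz (Pb z) X = 0"
  "perp z X \<Longrightarrow> lorentz X (N z) = 0" "perp z X \<Longrightarrow> lorentz (N z) X = 0"
  unfolding perp_def by (auto simp: lorentz_commute)

lemma lorentz_pr: "perp z X \<Longrightarrow> lorentz X (pr z U) = lorentz X U"
  unfolding pr_def by (simp add: perp_frame)

text \<open>The explicit projection is the one by which the normal connection is defined, since the form is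
  nondegenerate on \<open>V\<close>.\<close>

lemma perp_proj_eq: assumes z: "z \<in> \<Omega>" shows "perp_proj \<psi> z X = pr z X"
  unfolding perp_proj_def
proof (rule the_equality)
  let ?B = "bundleV \<psi> z"
  have sub: "vec.subspace ?B" unfolding bundleV_def by (rule vec.subspace_span)
  have mem: "\<psi> z \<in> ?B" "P z \<in> ?B" "Pb z \<in> ?B" "Y z \<in> ?B" unfolding bundleV_def by (auto intro: vec.span_base)
  then have memN: "N z \<in> ?B" unfolding N_def using sub by (intro vec.subspace_add vec.subspace_scale)
  have "X - pr z X = (2 * lorentz X (Pb z)) *s P z + (2 * lorentz X (P z)) *s Pb z - lorentz X (N z) *s \<psi> z - lorentz X (\<psi> z) *s N z"
    unfolding pr_def by simp
  then have "X - pr z X \<in> ?B" for X using mem memN sub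
    unfolding pr_def by (simp add: vec.subspace_add vec.subspace_scale vec.subspace_diff)
  then have diff: "X - pr z X \<in> ?B" for X .
  show "pr z X \<in> bundleVperp \<psi> z \<and> X - pr z X \<in> ?B" using diff pr_perp[OF z] bundleVperp_iff[OF z] by blast
  fix U assume U: "U \<in> bundleVperp \<psi> z \<and> X - U \<in> ?B"
  define W where "W = U - pr z X"
  have W1: "perp z W" using U pr_perp[OF z, of X] unfolding bundleVperp_iff[OF z] W_def perp_def by simp
  have "W = (X - pr z X) - (X - U)" unfolding W_def by simp
  then have W2: "W \<in> ?B" using U diff vec.subspace_diff[OF sub] by blast
  have "lorentz W V = 0" for V
  proof -
    have "lorentz W V = lorentz W (pr z V)" by (rule lorentz_pr[OF W1, symmetric])
    also have "\<dots> = lorentz (pr z V) W" by (rule lorentz_commute)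
    also have "\<dots> = 0" using pr_perp[OF z, of V] W2 unfolding bundleVperp_iff[OF z, symmetric] bundleVperp_def by blast
    finally show ?thesis .
  qed
  then have "W = 0" by (rule lorentz_nondegenerate)
  then show "U = pr z X" unfolding W_def by simp
qed

lemma schwarzian_eq: assumes z: "z \<in> \<Omega>" shows "schwarzian \<psi> z = cc z"
  unfolding schwarzian_def
proof (rule the_equality)
  show "Z z + (cc z / 2) *s \<psi> z \<in> bundleVperp \<psi> z" using kap_perp[OF z] unfolding bundleVperp_iff[OF z] kap_def .
  fix c assume "Z z + (c / 2) *s \<psi> z \<in> bundleVperp \<psi> z"
  then have "lorentz (Z z + (c / 2) *s \<psi> z) (Y z) = 0" unfolding bundleVperp_iff[OF z] perp_iff_Y[OF z] by blast
  then show "c = cc z" unfolding cc_def by (simp add: ip z field_simps)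
qed

lemma hopf_eq: "z \<in> \<Omega> \<Longrightarrow> hopf \<psi> z = kap z"
  unfolding hopf_def kap_def by (simp add: schwarzian_eq)

lemma Z_eq: "Z z = kap z - (cc z / 2) *s \<psi> z" unfolding kap_def by simp

lemma Y_eq: "Y z = (1/2) *s N z - mm z *s \<psi> z" unfolding N_def by (simp add: vec_eq_iff)

lemma mm_real: "z \<in> \<Omega> \<Longrightarrow> cnj (mm z) = mm z"
  unfolding mm_def using lorentz_vcnj[of "Y z" "Y z"] by (simp add: vcnj_Y)

lemma vcnj_N: "z \<in> \<Omega> \<Longrightarrow> vcnj (N z) = N z"
  unfolding N_def by (simp add: vcnj_Y mm_real real)

lemma perp_vcnj: "z \<in> \<Omega> \<Longrightarrow> perp z X \<Longrightarrow> perp z (vcnj X)"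
  unfolding perp_def using lorentz_vcnj[of X "\<psi> z"] lorentz_vcnj[of X "P z"] lorentz_vcnj[of X "Pb z"] lorentz_vcnj[of X "N z"]
  by (simp add: real vcnj_P vcnj_Pb vcnj_N)

lemma pr_vcnj: "z \<in> \<Omega> \<Longrightarrow> pr z (vcnj X) = vcnj (pr z X)"
  unfolding pr_def using lorentz_vcnj[of X "\<psi> z"] lorentz_vcnj[of X "P z"] lorentz_vcnj[of X "Pb z"] lorentz_vcnj[of X "N z"]
  by (simp add: real vcnj_P vcnj_Pb vcnj_N)

text \<open>Real normal vectors are space-like, as \<open>\<psi>\<close> and \<open>N\<close> form a real null pair orthogonal to them.\<close>

lemma perp_real_pos:
  assumes z: "z \<in> \<Omega>" and X: "perp z X" "vcnj X = X"
  shows "\<exists>r\<ge>0. lorentz X X = of_real r" "lorentz X X = 0 \<Longrightarrow> X = 0"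
proof -
  define x p q where "x = re_vec X" and "p = re_vec (\<psi> z)" and "q = re_vec (N z)"
  have e: "cplx x = X" "cplx p = \<psi> z" "cplx q = N z"
    unfolding x_def p_def q_def by (rule cplx_re_vec, use X real[OF z] vcnj_N[OF z] in simp)+
  have *: "lorentz (cplx u) (cplx v) = of_real r \<Longrightarrow> lorentz u v = r" for u v :: "real ^ 'n option" and r
    unfolding lorentz_cplx by (rule of_real_eq_iff[THEN iffD1])
  have "lorentz p p = 0" "lorentz q q = 0" "lorentz p q = -1" "lorentz x p = 0" "lorentz x q = 0"
    using *[of p p 0] *[of q q 0] *[of p q "-1"] *[of x p 0] *[of x q 0]
    unfolding e by (simp_all only: ip(1,22,28)[OF z] perp_frame(1,7)[OF X(1)] of_real_0 of_real_1 of_real_minus)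
  then have pos: "x \<noteq> 0 \<Longrightarrow> lorentz x x > 0" using lorentz_pos_orthogonal_null_pair by blast
  have eq: "lorentz X X = of_real (lorentz x x)" unfolding e(1)[symmetric] by simp
  show "\<exists>r\<ge>0. lorentz X X = of_real r" using pos eq by (cases "x = 0") (auto intro: less_imp_le exI[of _ 0])
  show "X = 0" if "lorentz X X = 0"
    using that pos eq e(1) by (cases "x = 0") auto
qed

section \<open>The normal connection\<close>

text \<open>\<open>dk\<close> is \<open>D\<^bsub>zbar\<^esub> \<kappa>\<close>. A normal field \<open>\<xi>\<close> has \<open>D\<^sub>z \<xi> = a\<close> and \<open>D\<^bsub>zbar\<^esub> \<xi> = b\<close> if its derivatives are \<open>a\<close> and
  \<open>b\<close> up to the components in \<open>V\<close> displayed here; these are forced by orthogonality to the frame. In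
  this form the relation determines the full derivatives of \<open>\<xi>\<close>, and therefore can be differentiated.\<close>

definition "dk z = pr z (wirtbar kap z)"

definition "sect \<xi> \<longleftrightarrow> smooth_on \<Omega> \<xi> \<and> (\<forall>z\<in>\<Omega>. perp z (\<xi> z))"

definition "hasD \<xi> a b \<longleftrightarrow> sect \<xi> \<and> sect a \<and> sect b \<and>
   (\<forall>z\<in>\<Omega>. has_wirt \<xi> (a z + (2 * lorentz (\<xi> z) (dk z)) *s \<psi> z - (2 * lorentz (\<xi> z) (kap z)) *s Pb z)
      (b z + (2 * lorentz (\<xi> z) (vcnj (dk z))) *s \<psi> z - (2 * lorentz (\<xi> z) (vcnj (kap z))) *s P z) z)"

lemma smooth_pr: assumes X: "smooth_on \<Omega> X" shows "smooth_on \<Omega> (\<lambda>z. pr z (X z))"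
  unfolding pr_def by (intro X smooth smooth_fields smooth_intros open_dom)

lemma smooth_dk: "smooth_on \<Omega> dk"
  unfolding dk_def[abs_def] by (intro smooth_pr sm smooth_fields)

lemma sect_kap: "sect kap" unfolding sect_def using kap_perp smooth_fields by blast

lemma sect_vcnj: "sect \<xi> \<Longrightarrow> sect (\<lambda>z. vcnj (\<xi> z))"
  unfolding sect_def using perp_vcnj smooth_on_vcnj[OF open_dom] by blast

lemma has_wirt_kap: "z \<in> \<Omega> \<Longrightarrow> has_wirt kap (wirt kap z) (wirtbar kap z) z"
  by (rule smooth_has_wirt[OF smooth_fields(8)])

lemma has_wirtc_cc: "z \<in> \<Omega> \<Longrightarrow> has_wirtc cc (wirtc cc z) (wirtbarc cc z) z"
  by (rule smooth_has_wirtc[OF smooth_fields(7)])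

lemma has_wirtc_mm: "z \<in> \<Omega> \<Longrightarrow> has_wirtc mm (wirtc mm z) (wirtbarc mm z) z"
  by (rule smooth_has_wirtc[OF smooth_fields(5)])

text \<open>Equality of the third derivatives \<open>\<psi>\<^bsub>zz zbar\<^esub>\<close> and \<open>\<psi>\<^bsub>z zbar z\<^esub>\<close> identifies the normal part
  of \<open>N\<^sub>z\<close> and contains the equation for the derivative of the Schwarzian.\<close>

lemma third_derivative:
  assumes z: "z \<in> \<Omega>"
  shows "wirt Y z = wirtbar kap z - (wirtbarc cc z / 2) *s \<psi> z - (cc z / 2) *s Pb z"
proof -
  have "has_wirt (\<lambda>z. kap z - ((1/2) * cc z) *s \<psi> z) (wirt kap z - (((1/2) * wirtc cc z) *s \<psi> z + ((1/2) * cc z) *s P z))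
      (wirtbar kap z - (((1/2) * wirtbarc cc z) *s \<psi> z + ((1/2) * cc z) *s Pb z)) z"
    using has_wirt_diff[OF has_wirt_kap[OF z] has_wirt_scale[OF has_wirtc_mult[OF has_wirtc_const[of "1/2"] has_wirtc_cc[OF z]] has_wirt_psi[OF z]]]
    by simp
  then have "wirtbar Z z = wirtbar kap z - (((1/2) * wirtbarc cc z) *s \<psi> z + ((1/2) * cc z) *s Pb z)"
    using has_wirtD(2) Z_eq[abs_def] by force
  moreover have "wirt Y z = wirtbar Z z"
    by (rule wirt_wirtbar_commute[OF open_dom _ z]) (intro sm)
  ultimately show ?thesis by simp
qed

lemma has_wirt_Y: "z \<in> \<Omega> \<Longrightarrow> has_wirt Y (wirt Y z) (wirtbar Y z) z"
  by (rule smooth_has_wirt[OF smooth_fields(3)])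

text \<open>The Gauss equation, from the derivatives of \<open>\<langle>\<psi>\<^bsub>zbar\<^esub>, \<psi>\<^bsub>zz\<^esub>\<rangle> = 0\<close> and \<open>\<langle>\<psi>\<^bsub>zbar\<^esub>, \<psi>\<^bsub>z zbar\<^esub>\<rangle> = 0\<close>.\<close>

lemma mm_eq: assumes z: "z \<in> \<Omega>" shows "mm z = lorentz (kap z) (vcnj (kap z))"
proof -
  note w = has_wirt_psi[OF z] has_wirt_P[OF z] has_wirt_Pb[OF z]
  have Zw: "has_wirt Z (wirt Z z) (wirt Y z) z"
    using smooth_has_wirt[OF smooth_fields(4) z] wirt_wirtbar_commute[OF open_dom smooth_fields(1) z] by simp
  have 1: "lorentz (vcnj (Z z)) (Z z) + lorentz (Pb z) (wirt Y z) = 0"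
    using wirtc_of_constant(2)[OF has_wirtc_lorentz[OF w(3) Zw] open_dom z ip2(6)] .
  have 2: "lorentz (Y z) (Y z) + lorentz (Pb z) (wirt Y z) = 0"
    using wirtc_of_constant(1)[OF has_wirtc_lorentz[OF w(3) has_wirt_Y[OF z]] open_dom z ip2(3)] .
  have "mm z = lorentz (vcnj (Z z)) (Z z)" using 1 2 unfolding mm_def by (simp add: add_eq_0_iff)
  also have "\<dots> = lorentz (kap z) (vcnj (kap z))"
    unfolding Z_eq using perp_frame[OF kap_perp[OF z]] perp_frame[OF perp_vcnj[OF z kap_perp[OF z]]]
    by (simp add: real z ip lorentz_commute)
  finally show ?thesis .
qed

text \<open>The components of \<open>N\<^sub>z\<close> along the frame come from the derivatives of the products of \<open>N\<close> with the
  frame, its normal component from the equality of third derivatives; the one component of that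
  equality left over is the equation for \<open>c\<^bsub>zbar\<^esub>\<close>.\<close>

lemma has_wirt_N:
  assumes z: "z \<in> \<Omega>"
  shows "has_wirt N (2 *s dk z - (2 * mm z) *s P z - cc z *s Pb z)
     (2 *s vcnj (dk z) - (2 * mm z) *s Pb z - cnj (cc z) *s P z) z"
    and wirtbarc_cc: "wirtbarc cc z = 2 * wirtc mm z + 4 * lorentz (kap z) (vcnj (dk z))"
proof -
  have NN: "N = (\<lambda>z. 2 *s Y z + (2 * mm z) *s \<psi> z)" by (simp add: fun_eq_iff N_def)
  have "has_wirt N (2 *s wirt Y z + ((2 * wirtc mm z) *s \<psi> z + (2 * mm z) *s P z))
     (2 *s wirtbar Y z + ((2 * wirtbarc mm z) *s \<psi> z + (2 * mm z) *s Pb z)) z"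
    unfolding NN using has_wirt_add[OF has_wirt_scale[OF has_wirtc_const[of 2] has_wirt_Y[OF z]]
      has_wirt_scale[OF has_wirtc_mult[OF has_wirtc_const[of 2] has_wirtc_mm[OF z]] has_wirt_psi[OF z]]]
    by simp
  then obtain n nb where n: "has_wirt N n nb z" and ne: "n = 2 *s wirt Y z + ((2 * wirtc mm z) *s \<psi> z + (2 * mm z) *s P z)" by blast
  have nb: "nb = vcnj n"
    using has_wirt_unique(2)[OF n has_wirt_cong_open[OF has_wirt_vcnj[OF n] open_dom z vcnj_N]] .
  note w = has_wirt_psi[OF z] has_wirt_P[OF z] has_wirt_Pb[OF z]
  have "lorentz n (\<psi> z) = 0"
    using wirtc_of_constant(1)[OF has_wirtc_lorentz[OF n w(1)] open_dom z ipN(2)] by (simp add: ip z)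
  moreover have "lorentz n (N z) = 0"
    using wirtc_of_constant(1)[OF has_wirtc_lorentz[OF n n] open_dom z ipN(7)] by (simp add: lorentz_commute)
  moreover have "lorentz n (P z) = - (cc z / 2)"
    using wirtc_of_constant(1)[OF has_wirtc_lorentz[OF n w(2)] open_dom z ipN(4)] perp_frame[OF kap_perp[OF z]]
    by (simp add: ip z Z_eq add_eq_0_iff2)
  moreover have "lorentz n (Pb z) = - mm z"
    using wirtc_of_constant(1)[OF has_wirtc_lorentz[OF n w(3)] open_dom z ipN(6)]
    by (simp add: ip z Y_eq add_eq_0_iff2)
  moreover have "pr z n = 2 *s dk z"
    unfolding ne third_derivative[OF z] dk_def by (simp add: pr_frame[OF z] vec_eq_iff)
  ultimately have "n = 2 *s dk z - (2 * mm z) *s P z - cc z *s Pb z"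
    unfolding pr_def by (simp add: vec_eq_iff algebra_simps)
  then show 1: "has_wirt N (2 *s dk z - (2 * mm z) *s P z - cc z *s Pb z)
     (2 *s vcnj (dk z) - (2 * mm z) *s Pb z - cnj (cc z) *s P z) z"
    using n nb by (simp add: vcnj_P vcnj_Pb z mm_real)
  have "lorentz (wirtbar kap z) (N z) + lorentz (kap z) (2 *s vcnj (dk z) - (2 * mm z) *s Pb z - cnj (cc z) *s P z) = 0"
    by (rule wirtc_of_constant(2)[OF has_wirtc_lorentz[OF has_wirt_kap[OF z] 1] open_dom z])
       (rule perp_frame(7)[OF kap_perp])
  then have a: "lorentz (wirtbar kap z) (N z) = - 2 * lorentz (kap z) (vcnj (dk z))"
    by (simp add: perp_frame[OF kap_perp[OF z]] add_eq_0_iff2)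
  have "lorentz n (N z) = 0" by fact
  then have "2 * lorentz (wirtbar kap z) (N z) + wirtbarc cc z - 2 * wirtc mm z = 0"
    unfolding ne third_derivative[OF z] by (simp add: ip z)
  then show "wirtbarc cc z = 2 * wirtc mm z + 4 * lorentz (kap z) (vcnj (dk z))"
    unfolding a by (simp add: algebra_simps)
qed

end

context lightcone_lift
begin

text \<open>The components of \<open>d\<xi>\<close> in \<open>V\<close> are the derivatives of the vanishing products of \<open>\<xi>\<close> with the frame.\<close>

lemma hasDI:
  assumes "sect \<xi>" shows "hasD \<xi> (\<lambda>z. pr z (wirt \<xi> z)) (\<lambda>z. pr z (wirtbar \<xi> z))"
proof -
  have sx: "smooth_on \<Omega> \<xi>" and px: "z \<in> \<Omega> \<Longrightarrow> perp z (\<xi> z)" for z using assms unfolding sect_def by auto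
  have "sect (\<lambda>z. pr z (wirt \<xi> z))" "sect (\<lambda>z. pr z (wirtbar \<xi> z))"
    unfolding sect_def using pr_perp by (auto intro!: smooth_pr sm sx)
  moreover have "has_wirt \<xi> (pr z (wirt \<xi> z) + (2 * lorentz (\<xi> z) (dk z)) *s \<psi> z - (2 * lorentz (\<xi> z) (kap z)) *s Pb z)
      (pr z (wirtbar \<xi> z) + (2 * lorentz (\<xi> z) (vcnj (dk z))) *s \<psi> z - (2 * lorentz (\<xi> z) (vcnj (kap z))) *s P z) z"
    if z: "z \<in> \<Omega>" for z
  proof -
    note w = smooth_has_wirt[OF sx z] has_wirt_psi[OF z] has_wirt_P[OF z] has_wirt_Pb[OF z] has_wirt_N[OF z]
    note pf = perp_frame[OF px[OF z]]
    note zero = wirtc_of_constant[OF has_wirtc_lorentz[OF w(1,2)] open_dom z perp_frame(1)[OF px]]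
      wirtc_of_constant[OF has_wirtc_lorentz[OF w(1,3)] open_dom z perp_frame(3)[OF px]]
      wirtc_of_constant[OF has_wirtc_lorentz[OF w(1,4)] open_dom z perp_frame(5)[OF px]]
      wirtc_of_constant[OF has_wirtc_lorentz[OF w(1,5)] open_dom z perp_frame(7)[OF px]]
    have "lorentz (wirt \<xi> z) (\<psi> z) = 0" "lorentz (wirtbar \<xi> z) (\<psi> z) = 0"
      "lorentz (wirt \<xi> z) (P z) = - lorentz (\<xi> z) (kap z)" "lorentz (wirtbar \<xi> z) (P z) = 0"
      "lorentz (wirt \<xi> z) (Pb z) = 0" "lorentz (wirtbar \<xi> z) (Pb z) = - lorentz (\<xi> z) (vcnj (kap z))"
      "lorentz (wirt \<xi> z) (N z) = - (2 * lorentz (\<xi> z) (dk z))" "lorentz (wirtbar \<xi> z) (N z) = - (2 * lorentz (\<xi> z) (vcnj (dk z)))"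
      using zero by (simp_all add: pf Z_eq Y_eq z real add_eq_0_iff2)
    then have "wirt \<xi> z = pr z (wirt \<xi> z) + (2 * lorentz (\<xi> z) (dk z)) *s \<psi> z - (2 * lorentz (\<xi> z) (kap z)) *s Pb z"
      "wirtbar \<xi> z = pr z (wirtbar \<xi> z) + (2 * lorentz (\<xi> z) (vcnj (dk z))) *s \<psi> z - (2 * lorentz (\<xi> z) (vcnj (kap z))) *s P z"
      unfolding pr_def by (simp_all add: vec_eq_iff)
    then show ?thesis using w(1) by simp
  qed
  ultimately show ?thesis unfolding hasD_def using assms by blast
qed

lemma hasD_at:
  assumes "hasD \<xi> a b" "z \<in> \<Omega>"
  obtains A B where "has_wirt \<xi> A B z" "pr z A = a z" "pr z B = b z"
proof -
  have "perp z (a z)" "perp z (b z)" using assms unfolding hasD_def sect_def by auto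
  then show ?thesis
    by (intro that[OF assms(1)[unfolded hasD_def, THEN conjunct2, THEN conjunct2, THEN conjunct2, rule_format, OF assms(2)]])
       (simp_all add: pr_frame assms(2) pr_of_perp)
qed

lemma hasD_unique:
  assumes "hasD \<xi> a b" "hasD \<xi>' a' b'" "\<And>z. z \<in> \<Omega> \<Longrightarrow> \<xi> z = \<xi>' z" "z \<in> \<Omega>"
  shows "a z = a' z" "b z = b' z"
proof -
  obtain A B where 1: "has_wirt \<xi> A B z" "pr z A = a z" "pr z B = b z" using hasD_at[OF assms(1,4)] .
  obtain A' B' where 2: "has_wirt \<xi>' A' B' z" "pr z A' = a' z" "pr z B' = b' z" using hasD_at[OF assms(2,4)] .
  have "has_wirt \<xi>' A B z" by (rule has_wirt_cong_open[OF 1(1) open_dom assms(4,3)])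
  then show "a z = a' z" "b z = b' z" using has_wirt_unique[OF _ 2(1)] 1 2 by metis+
qed

lemma hasD_wirtc:
  assumes "hasD \<xi> a b" "hasD \<eta> a' b'" and z: "z \<in> \<Omega>"
  shows "has_wirtc (\<lambda>z. lorentz (\<xi> z) (\<eta> z)) (lorentz (a z) (\<eta> z) + lorentz (\<xi> z) (a' z))
    (lorentz (b z) (\<eta> z) + lorentz (\<xi> z) (b' z)) z"
proof -
  have p: "perp z (\<xi> z)" "perp z (\<eta> z)" using assms unfolding hasD_def sect_def by auto
  show ?thesis using has_wirtc_lorentz[OF assms(1)[unfolded hasD_def, THEN conjunct2, THEN conjunct2, THEN conjunct2, rule_format, OF z]
     assms(2)[unfolded hasD_def, THEN conjunct2, THEN conjunct2, THEN conjunct2, rule_format, OF z]]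
    by (simp add: perp_frame[OF p(1)] perp_frame[OF p(2)])
qed

lemma sect_add: "sect \<xi> \<Longrightarrow> sect \<eta> \<Longrightarrow> sect (\<lambda>z. \<xi> z + \<eta> z)"
  unfolding sect_def perp_def by (auto intro: smooth_intros open_dom)

lemma sect_scale: "smooth_on \<Omega> f \<Longrightarrow> sect \<xi> \<Longrightarrow> sect (\<lambda>z. f z *s \<xi> z)"
  unfolding sect_def perp_def by (auto intro: smooth_intros open_dom)

lemma hasD_add:
  assumes "hasD \<xi> a b" "hasD \<eta> a' b'"
  shows "hasD (\<lambda>z. \<xi> z + \<eta> z) (\<lambda>z. a z + a' z) (\<lambda>z. b z + b' z)"
  unfolding hasD_def
proof (intro conjI ballI)
  fix z assume "z \<in> \<Omega>"
  then show "has_wirt (\<lambda>z. \<xi> z + \<eta> z)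
    (a z + a' z + (2 * lorentz (\<xi> z + \<eta> z) (dk z)) *s \<psi> z - (2 * lorentz (\<xi> z + \<eta> z) (kap z)) *s Pb z)
    (b z + b' z + (2 * lorentz (\<xi> z + \<eta> z) (vcnj (dk z))) *s \<psi> z - (2 * lorentz (\<xi> z + \<eta> z) (vcnj (kap z))) *s P z) z"
    using has_wirt_add[OF assms(1)[unfolded hasD_def, THEN conjunct2, THEN conjunct2, THEN conjunct2, rule_format, of z]
       assms(2)[unfolded hasD_def, THEN conjunct2, THEN conjunct2, THEN conjunct2, rule_format, of z]]
    by (simp add: algebra_simps)
qed (use assms in \<open>auto simp: hasD_def intro: sect_add\<close>)

lemma hasD_scale:
  assumes f: "smooth_on \<Omega> f" "\<And>z. z \<in> \<Omega> \<Longrightarrow> has_wirtc f (fa z) (fb z) z" and x: "hasD \<xi> a b"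
  shows "hasD (\<lambda>z. f z *s \<xi> z) (\<lambda>z. fa z *s \<xi> z + f z *s a z) (\<lambda>z. fb z *s \<xi> z + f z *s b z)"
  unfolding hasD_def
proof (intro conjI ballI)
  have "smooth_on \<Omega> fa" "smooth_on \<Omega> fb"
    using smooth_on_cong[OF open_dom _ smooth_on_wirtc[OF open_dom f(1)], of fa]
      smooth_on_cong[OF open_dom _ smooth_on_wirtbarc[OF open_dom f(1)], of fb] has_wirtcD[OF f(2)] by metis+
  then show "sect (\<lambda>z. fa z *s \<xi> z + f z *s a z)" "sect (\<lambda>z. fb z *s \<xi> z + f z *s b z)"
    using x f(1) unfolding hasD_def by (auto intro!: sect_add sect_scale)
  fix z assume z: "z \<in> \<Omega>"
  show "has_wirt (\<lambda>z. f z *s \<xi> z)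
    (fa z *s \<xi> z + f z *s a z + (2 * lorentz (f z *s \<xi> z) (dk z)) *s \<psi> z - (2 * lorentz (f z *s \<xi> z) (kap z)) *s Pb z)
    (fb z *s \<xi> z + f z *s b z + (2 * lorentz (f z *s \<xi> z) (vcnj (dk z))) *s \<psi> z - (2 * lorentz (f z *s \<xi> z) (vcnj (kap z))) *s P z) z"
    using has_wirt_scale[OF f(2)[OF z] x[unfolded hasD_def, THEN conjunct2, THEN conjunct2, THEN conjunct2, rule_format, OF z]]
    by (simp add: algebra_simps)
qed (use assms in \<open>auto simp: hasD_def intro: sect_scale\<close>)

lemma hasD_vcnj:
  assumes "hasD \<xi> a b" shows "hasD (\<lambda>z. vcnj (\<xi> z)) (\<lambda>z. vcnj (b z)) (\<lambda>z. vcnj (a z))"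
  unfolding hasD_def
proof (intro conjI ballI)
  fix z assume z: "z \<in> \<Omega>"
  have l: "lorentz (vcnj x) y = cnj (lorentz x (vcnj y))" for x y using lorentz_vcnj[of x "vcnj y"] by simp
  show "has_wirt (\<lambda>z. vcnj (\<xi> z))
    (vcnj (b z) + (2 * lorentz (vcnj (\<xi> z)) (dk z)) *s \<psi> z - (2 * lorentz (vcnj (\<xi> z)) (kap z)) *s Pb z)
    (vcnj (a z) + (2 * lorentz (vcnj (\<xi> z)) (vcnj (dk z))) *s \<psi> z - (2 * lorentz (vcnj (\<xi> z)) (vcnj (kap z))) *s P z) z"
    using has_wirt_vcnj[OF assms[unfolded hasD_def, THEN conjunct2, THEN conjunct2, THEN conjunct2, rule_format, OF z]]
    by (simp add: vcnj_P vcnj_Pb z real l)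
qed (use assms in \<open>auto simp: hasD_def intro: sect_vcnj\<close>)

lemma hasD_kap: "hasD kap (\<lambda>z. pr z (wirt kap z)) dk"
  using hasDI[OF sect_kap] unfolding dk_def[abs_def] .

end

section \<open>Surfaces with real Hopf differential\<close>

locale real_hopf = lightcone_lift +
  assumes kap_real: "z \<in> \<Omega> \<Longrightarrow> vcnj (kap z) = kap z"
begin

text \<open>Flatness of the normal connection. The normal parts of \<open>\<xi>\<^bsub>z zbar\<^esub>\<close> and \<open>\<xi>\<^bsub>zbar z\<^esub>\<close> differ from the second
  covariant derivatives by \<open>-2 \<langle>\<xi>, \<kappa>\<rangle> cnj \<kappa>\<close> and \<open>-2 \<langle>\<xi>, cnj \<kappa>\<rangle> \<kappa>\<close>, which agree for real \<open>\<kappa>\<close>.\<close>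

lemma hasD_flat:
  assumes "hasD \<xi> a b" "hasD a a1 a2" "hasD b b1 b2" and z: "z \<in> \<Omega>"
  shows "a2 z = b1 z"
proof -
  have sx: "smooth_on \<Omega> \<xi>" using assms(1) unfolding hasD_def sect_def by blast
  note x = assms(1)[unfolded hasD_def, THEN conjunct2, THEN conjunct2, THEN conjunct2, rule_format]
  obtain A A2 where A: "has_wirt a A A2 z" "pr z A2 = a2 z" using hasD_at[OF assms(2) z] by metis
  obtain B B1 where B: "has_wirt b B1 B z" "pr z B1 = b1 z" using hasD_at[OF assms(3) z] by metis
  define s t s' t' where "s z = 2 * lorentz (\<xi> z) (dk z)" and "t z = 2 * lorentz (\<xi> z) (kap z)"
    and "s' z = 2 * lorentz (\<xi> z) (vcnj (dk z))" and "t' z = 2 * lorentz (\<xi> z) (vcnj (kap z))" for z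
  have "smooth_on \<Omega> s" "smooth_on \<Omega> t" "smooth_on \<Omega> s'" "smooth_on \<Omega> t'"
    unfolding s_def[abs_def] t_def[abs_def] s'_def[abs_def] t'_def[abs_def]
    by (intro smooth_intros open_dom sx smooth_dk smooth_fields)+
  note st = this[THEN smooth_has_wirtc, OF z]
  have pb: "pr z (vcnj (Z z)) = vcnj (kap z)" "pr z (Z z) = kap z"
    unfolding Z_eq using pr_of_perp[OF kap_perp[OF z]] pr_of_perp[OF perp_vcnj[OF z kap_perp[OF z]]]
    by (simp_all add: real z pr_frame)
  have e1: "wirt \<xi> w = a w + s w *s \<psi> w - t w *s Pb w" and e2: "wirtbar \<xi> w = b w + s' w *s \<psi> w - t' w *s P w" if "w \<in> \<Omega>" for w
    using has_wirtD(1,2)[OF x[OF that]] unfolding s_def t_def s'_def t'_def by auto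
  have 1: "has_wirt (wirt \<xi>) (A + (wirtc s z *s \<psi> z + s z *s P z) - (wirtc t z *s Pb z + t z *s Y z))
      (A2 + (wirtbarc s z *s \<psi> z + s z *s Pb z) - (wirtbarc t z *s Pb z + t z *s vcnj (Z z))) z"
    by (rule has_wirt_cong_open[OF _ open_dom z e1[symmetric]])
       (intro wirt_intros A st has_wirt_psi z has_wirt_Pb)
  have 2: "has_wirt (wirtbar \<xi>) (B1 + (wirtc s' z *s \<psi> z + s' z *s P z) - (wirtc t' z *s P z + t' z *s Z z))
      (B + (wirtbarc s' z *s \<psi> z + s' z *s Pb z) - (wirtbarc t' z *s P z + t' z *s Y z)) z"
    by (rule has_wirt_cong_open[OF _ open_dom z e2[symmetric]])
       (intro wirt_intros B st has_wirt_psi z has_wirt_P)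
  have "pr z (wirtbar (wirt \<xi>) z) = a2 z - t z *s kap z"
    unfolding has_wirtD(2)[OF 1] by (simp add: A pr_frame z pb kap_real)
  moreover have "pr z (wirt (wirtbar \<xi>) z) = b1 z - t' z *s kap z"
    unfolding has_wirtD(1)[OF 2] by (simp add: B pr_frame z pb)
  ultimately show ?thesis using wirt_wirtbar_commute[OF open_dom sx z] by (simp add: t_def t'_def kap_real z)
qed

end

section \<open>Isothermic Willmore surfaces away from umbilics\<close>

text \<open>For a real Hopf differential, the Euler-Lagrange equation says that \<open>D\<^bsub>zbar\<^esub> D\<^bsub>zbar\<^esub> \<kappa>\<close> is the
  multiple \<open>-(cnj c)/2\<close> of \<open>\<kappa>\<close>. Here \<open>L\<close> is \<open>D\<^sub>z \<kappa>\<close>, as \<open>\<kappa>\<close> is real, and \<open>uz\<close> is the derivative \<open>u\<^sub>z\<close>.\<close>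

locale isothermic_willmore = real_hopf +
  assumes el: "z \<in> \<Omega> \<Longrightarrow> pr z (wirtbar dk z) = - (cnj (cc z) / 2) *s kap z"
    and kap_nz: "z \<in> \<Omega> \<Longrightarrow> kap z \<noteq> 0"
begin

definition "L z = vcnj (dk z)"
definition "X z = pr z (wirtbar L z)"
definition "u z = lorentz (kap z) (kap z)"
definition "uz z = 2 * lorentz (kap z) (L z)"

lemma smooth_L: "smooth_on \<Omega> L" unfolding L_def[abs_def] by (intro smooth_intros open_dom smooth_dk)

lemma vcnj_L: "vcnj (L z) = dk z" unfolding L_def by simp

lemma sect_dk: "sect dk" using hasD_kap unfolding hasD_def by blast
lemma sect_L: "sect L" unfolding L_def[abs_def] by (rule sect_vcnj[OF sect_dk])

lemma hasD_kap_L: "hasD kap L dk"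
proof -
  have "pr z (wirt kap z) = L z" if z: "z \<in> \<Omega>" for z
    using hasD_unique(1)[OF hasD_kap hasD_vcnj[OF hasD_kap] _ z] kap_real unfolding L_def by simp
  moreover have "sect L" by (rule sect_L)
  ultimately show ?thesis using hasD_kap unfolding hasD_def by simp
qed

lemma hasD_congD: "hasD \<xi> a b \<Longrightarrow> (\<And>z. z \<in> \<Omega> \<Longrightarrow> a z = a' z) \<Longrightarrow> (\<And>z. z \<in> \<Omega> \<Longrightarrow> b z = b' z) \<Longrightarrow> hasD \<xi> a' b'"
  unfolding hasD_def sect_def using smooth_on_cong[OF open_dom, of a a'] smooth_on_cong[OF open_dom, of b b'] by auto

lemma hasD_L: "hasD L (\<lambda>z. (- cc z / 2) *s kap z) X"
proof (rule hasD_congD)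
  show "hasD L (\<lambda>z. vcnj (pr z (wirtbar dk z))) (\<lambda>z. vcnj (pr z (wirt dk z)))"
    unfolding L_def[abs_def] by (rule hasD_vcnj[OF hasDI[OF sect_dk]])
  show "vcnj (pr z (wirtbar dk z)) = (- cc z / 2) *s kap z" if "z \<in> \<Omega>" for z
    using that by (simp add: el kap_real)
  show "vcnj (pr z (wirt dk z)) = X z" if z: "z \<in> \<Omega>" for z
    unfolding X_def using hasD_unique(2)[OF hasD_vcnj[OF hasDI[OF sect_dk]] hasDI[OF sect_L] _ z] by (simp add: L_def)
qed

text \<open>Complex conjugation exchanges \<open>D\<^bsub>zbar\<^esub> D\<^sub>z \<kappa>\<close> with \<open>D\<^sub>z D\<^bsub>zbar\<^esub> \<kappa>\<close>, and these agree by flatness.\<close>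

lemma X_real: "z \<in> \<Omega> \<Longrightarrow> vcnj (X z) = X z"
  using hasD_flat[OF hasD_kap_L hasD_L, of "\<lambda>z. vcnj (X z)"] hasD_vcnj[OF hasD_L] by (simp add: vcnj_L)

lemma hasD_dk: "hasD dk X (\<lambda>z. (- cnj (cc z) / 2) *s kap z)"
  by (rule hasD_congD[OF hasD_vcnj[OF hasD_L, unfolded vcnj_L]]) (auto simp: X_real kap_real)

lemma sect_X: "sect X" using hasD_L unfolding hasD_def by blast

lemma perps: "z \<in> \<Omega> \<Longrightarrow> perp z (L z)" "z \<in> \<Omega> \<Longrightarrow> perp z (dk z)" "z \<in> \<Omega> \<Longrightarrow> perp z (X z)"
  using sect_L sect_dk sect_X unfolding sect_def by auto

lemma cnj_uz: "z \<in> \<Omega> \<Longrightarrow> cnj (uz z) = 2 * lorentz (kap z) (dk z)"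
  unfolding uz_def using lorentz_vcnj[of "kap z" "L z"] by (simp add: kap_real vcnj_L)

lemma has_wirtc_u: "z \<in> \<Omega> \<Longrightarrow> has_wirtc u (uz z) (cnj (uz z)) z"
  using hasD_wirtc[OF hasD_kap_L hasD_kap_L, of z] unfolding u_def[abs_def]
  by (simp add: cnj_uz) (simp add: uz_def lorentz_commute)

text \<open>The equation for \<open>c\<^bsub>zbar\<^esub>\<close> in the structure equations, with \<open>mm = u\<close>.\<close>

lemma wirtbarc_cc_uz: assumes z: "z \<in> \<Omega>" shows "wirtbarc cc z = 4 * uz z"
proof -
  have "mm w = u w" if "w \<in> \<Omega>" for w using mm_eq[OF that] by (simp add: u_def kap_real that)
  then have "has_wirtc mm (uz z) (cnj (uz z)) z"
    using has_wirtc_cong_open[OF has_wirtc_u[OF z] open_dom z, of mm] by simp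
  then have "wirtc mm z = uz z" by (rule has_wirtcD)
  then show ?thesis using wirtbarc_cc[OF z] by (simp add: uz_def L_def)
qed

lemma has_wirtc_c: "z \<in> \<Omega> \<Longrightarrow> has_wirtc cc (wirtc cc z) (4 * uz z) z"
  using has_wirtc_cc wirtbarc_cc_uz by metis

lemma has_wirtc_uz: "z \<in> \<Omega> \<Longrightarrow> has_wirtc uz (2 * lorentz (L z) (L z) - cc z * u z)
   (2 * lorentz (L z) (dk z) + 2 * lorentz (kap z) (X z)) z"
  using has_wirtc_mult[OF has_wirtc_const[of 2] hasD_wirtc[OF hasD_kap_L hasD_L, of z]]
  unfolding uz_def[abs_def] u_def by (simp add: algebra_simps lorentz_commute[of "dk z" "L z"])

text \<open>By flatness \<open>D\<^sub>z X = D\<^bsub>zbar\<^esub> D\<^sub>z L\<close>, and \<open>D\<^sub>z L\<close> is known from the Euler-Lagrange equation.\<close>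

lemma hasD_X: "hasD X (\<lambda>z. (- 2 * uz z) *s kap z + (- cc z / 2) *s dk z)
    (\<lambda>z. (- 2 * cnj (uz z)) *s kap z + (- cnj (cc z) / 2) *s L z)"
proof -
  let ?Y = "\<lambda>z. (- 2 * uz z) *s kap z + (- cc z / 2) *s dk z"
  have "smooth_on \<Omega> (\<lambda>z. (-1/2) * cc z)" by (intro smooth_intros open_dom smooth_fields)
  then have c: "smooth_on \<Omega> (\<lambda>z. - cc z / 2)" by simp
  have "hasD (\<lambda>z. (- cc z / 2) *s kap z) (\<lambda>z. (- wirtc cc z / 2) *s kap z + (- cc z / 2) *s L z)
     (\<lambda>z. (- 2 * uz z) *s kap z + (- cc z / 2) *s dk z)"
  proof (rule hasD_scale[OF c _ hasD_kap_L])
    show "has_wirtc (\<lambda>z. - cc z / 2) (- wirtc cc z / 2) (- 2 * uz z) z" if "z \<in> \<Omega>" for z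
      using has_wirtc_mult[OF has_wirtc_const[of "-1/2"] has_wirtc_c[OF that]] by simp
  qed
  from hasD_flat[OF hasD_L this hasDI[OF sect_X]] have Y: "z \<in> \<Omega> \<Longrightarrow> pr z (wirt X z) = ?Y z" for z by simp
  have "pr z (wirtbar X z) = vcnj (?Y z)" if z: "z \<in> \<Omega>" for z
    using hasD_unique(2)[OF hasDI[OF sect_X] hasD_vcnj[OF hasDI[OF sect_X]] _ z] X_real Y[OF z] by simp
  then show ?thesis
    by (intro hasD_congD[OF hasDI[OF sect_X]]) (auto simp: Y kap_real vcnj_L L_def)
qed

text \<open>The commutator of the two derivatives also vanishes on \<open>X\<close>, and \<open>X\<close> is real, so
  \<open>D\<^bsub>zbar\<^esub> D\<^sub>z X\<close> is real. It is a real multiple of \<open>\<kappa>\<close> plus \<open>-4 u\<^sub>z D\<^bsub>zbar\<^esub> \<kappa>\<close>. Hence \<open>u\<^sub>z D\<^bsub>zbar\<^esub> \<kappa>\<close> is real: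
  the differentials of \<open>\<kappa>\<close> and of its squared length are proportional. This is the integrability
  condition that makes the classification rigid.\<close>

lemma du_parallel_dkap: assumes z: "z \<in> \<Omega>" shows "cnj (uz z) *s L z = uz z *s dk z"
proof -
  have suz: "smooth_on \<Omega> uz" unfolding uz_def[abs_def] by (intro smooth_intros open_dom smooth_fields smooth_L)
  have "smooth_on \<Omega> (\<lambda>z. (-1/2) * cc z)" "smooth_on \<Omega> (\<lambda>z. (-2) * uz z)" by (intro smooth_intros open_dom smooth_fields suz)+
  then have c: "smooth_on \<Omega> (\<lambda>z. - cc z / 2)" and u2: "smooth_on \<Omega> (\<lambda>z. - 2 * uz z)" by simp_all
  let ?y1 = "\<lambda>z. 2 * lorentz (L z) (L z) - cc z * u z"
  let ?y2 = "\<lambda>z. 2 * lorentz (L z) (dk z) + 2 * lorentz (kap z) (X z)"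
  have h: "hasD (\<lambda>z. (- 2 * uz z) *s kap z + (- cc z / 2) *s dk z)
     (\<lambda>z. (- 2 * ?y1 z) *s kap z + (- 2 * uz z) *s L z + ((- wirtc cc z / 2) *s dk z + (- cc z / 2) *s X z))
     (\<lambda>z. (- 2 * ?y2 z) *s kap z + (- 2 * uz z) *s dk z + ((- 2 * uz z) *s dk z + (- cc z / 2) *s ((- cnj (cc z) / 2) *s kap z)))"
  proof (intro hasD_add hasD_scale[OF u2 _ hasD_kap_L] hasD_scale[OF c _ hasD_dk])
    fix z assume z: "z \<in> \<Omega>"
    show "has_wirtc (\<lambda>z. - 2 * uz z) (- 2 * ?y1 z) (- 2 * ?y2 z) z"
      using has_wirtc_mult[OF has_wirtc_const[of "-2"] has_wirtc_uz[OF z]] by simp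
    show "has_wirtc (\<lambda>z. - cc z / 2) (- wirtc cc z / 2) (- 2 * uz z) z"
      using has_wirtc_mult[OF has_wirtc_const[of "-1/2"] has_wirtc_c[OF z]] by simp
  qed
  have e: "vcnj ((- 2 * uz z) *s kap z + (- cc z / 2) *s dk z) = ((- 2 * cnj (uz z)) *s kap z + (- cnj (cc z) / 2) *s L z)"
     if "z \<in> \<Omega>" for z using that by (simp add: kap_real L_def)
  have "hasD X (\<lambda>z. (- 2 * uz z) *s kap z + (- cc z / 2) *s dk z) (\<lambda>z. vcnj ((- 2 * uz z) *s kap z + (- cc z / 2) *s dk z))"
    by (rule hasD_congD[OF hasD_X refl]) (rule e[symmetric])
  from hasD_flat[OF this h hasD_vcnj[OF h] z]
  have "(- 2 * ?y2 z) *s kap z + (- 2 * uz z) *s dk z + ((- 2 * uz z) *s dk z + (- cc z / 2) *s ((- cnj (cc z) / 2) *s kap z))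
    = vcnj ((- 2 * ?y2 z) *s kap z + (- 2 * uz z) *s dk z + ((- 2 * uz z) *s dk z + (- cc z / 2) *s ((- cnj (cc z) / 2) *s kap z)))" .
  moreover define r where "r = ?y2 z"
  ultimately have eq: "(- 2 * r) *s kap z + (- 2 * uz z) *s dk z + ((- 2 * uz z) *s dk z + (- cc z / 2) *s ((- cnj (cc z) / 2) *s kap z))
    = vcnj ((- 2 * r) *s kap z + (- 2 * uz z) *s dk z + ((- 2 * uz z) *s dk z + (- cc z / 2) *s ((- cnj (cc z) / 2) *s kap z)))"
    by simp
  have r: "cnj r = r"
    using lorentz_vcnj[of "L z" "dk z"] lorentz_vcnj[of "kap z" "X z"] unfolding r_def
    by (simp add: vcnj_L kap_real z X_real L_def lorentz_commute)
  have "vcnj ((- 2 * r) *s kap z + (- 2 * uz z) *s dk z + ((- 2 * uz z) *s dk z + (- cc z / 2) *s ((- cnj (cc z) / 2) *s kap z)))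
    = (- 2 * r) *s kap z + (- 2 * cnj (uz z)) *s L z + ((- 2 * cnj (uz z)) *s L z + (- cnj (cc z) / 2) *s ((- cc z / 2) *s kap z))"
    unfolding vcnj_simps by (simp add: r kap_real[OF z] L_def)
  with eq have "(- 4 * uz z) *s dk z = (- 4 * cnj (uz z)) *s L z"
    by (simp add: vec_eq_iff algebra_simps)
  then have "(- 4) * (uz z * dk z $ i) = (- 4) * (cnj (uz z) * L z $ i)" for i by (simp add: vec_eq_iff)
  then have "uz z * dk z $ i = cnj (uz z) * L z $ i" for i using mult_cancel_left[of "-4 :: complex"] by simp
  then show ?thesis by (simp add: vec_eq_iff)
qed

end

context lightcone_lift
begin

lemma hermitian_real: "z \<in> \<Omega> \<Longrightarrow> Im (lorentz v (vcnj v)) = 0"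
  using lorentz_vcnj[of v "vcnj v"] lorentz_commute[of v "vcnj v"] by (simp add: complex_eq_iff)

text \<open>For normal \<open>v\<close> and complex \<open>h\<close>, the imaginary part of \<open>h v\<close> is a real normal vector, so its
  square is nonnegative, and zero only if \<open>h v\<close> is real.\<close>

lemma phase:
  assumes z: "z \<in> \<Omega>" and v: "perp z v"
  shows "Re (h\<^sup>2 * lorentz v v) \<le> (cmod h)\<^sup>2 * Re (lorentz v (vcnj v))"
    "Re (h\<^sup>2 * lorentz v v) = (cmod h)\<^sup>2 * Re (lorentz v (vcnj v)) \<Longrightarrow> vcnj (h *s v) = h *s v"
proof -
  define w where "w = h *s v - vcnj (h *s v)"
  have pv: "perp z (vcnj v)" by (rule perp_vcnj[OF z v])
  have pw: "perp z (\<i> *s w)" using v pv unfolding w_def perp_def by simp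
  have rw: "vcnj (\<i> *s w) = \<i> *s w" unfolding w_def by (simp add: vec_eq_iff)
  have vv: "lorentz (vcnj v) (vcnj v) = cnj (lorentz v v)" "lorentz (vcnj v) v = lorentz v (vcnj v)"
    by (simp_all add: lorentz_commute)
  have "lorentz (\<i> *s w) (\<i> *s w) = - (h * h * lorentz v v + cnj (h * h * lorentz v v) - 2 * (h * cnj h) * lorentz v (vcnj v))"
    unfolding w_def by (simp add: vv algebra_simps)
  then have re: "Re (lorentz (\<i> *s w) (\<i> *s w)) = 2 * ((cmod h)\<^sup>2 * Re (lorentz v (vcnj v)) - Re (h\<^sup>2 * lorentz v v))"
    by (simp add: complex_norm_square[symmetric] power2_eq_square[symmetric] complex_cnj_power[symmetric]
        del: of_real_power complex_cnj_power)
  obtain r where r: "r \<ge> 0" "lorentz (\<i> *s w) (\<i> *s w) = of_real r" using perp_real_pos(1)[OF z pw rw] by blast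
  show "Re (h\<^sup>2 * lorentz v v) \<le> (cmod h)\<^sup>2 * Re (lorentz v (vcnj v))" using r re by simp
  assume "Re (h\<^sup>2 * lorentz v v) = (cmod h)\<^sup>2 * Re (lorentz v (vcnj v))"
  then have "lorentz (\<i> *s w) (\<i> *s w) = 0" using r re by simp
  then have "\<i> *s w = 0" by (rule perp_real_pos(2)[OF z pw rw])
  then have "w = 0" by (simp add: vec_eq_iff)
  then show "vcnj (h *s v) = h *s v" unfolding w_def by simp
qed

lemma phase_cmod:
  assumes z: "z \<in> \<Omega>" and v: "perp z v"
  shows "cmod (lorentz v v) \<le> Re (lorentz v (vcnj v))"
proof -
  define s where "s = lorentz v v"
  obtain h where h: "h\<^sup>2 * s = of_real (cmod s)" "cmod h = 1"
  proof (cases "s = 0")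
    case True then show ?thesis using that[of 1] by simp
  next
    case False
    have "(csqrt (cnj s / of_real (cmod s)))\<^sup>2 * s = of_real (cmod s)"
      using False complex_norm_square[of s] by (simp add: field_simps) (simp add: power2_eq_square)
    moreover have "(cmod (csqrt (cnj s / of_real (cmod s))))\<^sup>2 = 1"
      using False by (simp add: norm_power[symmetric] norm_divide)
    ultimately show ?thesis using that by (metis norm_ge_zero one_power2 power2_eq_iff_nonneg zero_le_one)
  qed
  then show ?thesis using phase(1)[OF z v, of h] unfolding s_def[symmetric] by simp
qed

lemma hermitian_zero:
  assumes z: "z \<in> \<Omega>" and v: "perp z v" and 0: "Re (lorentz v (vcnj v)) = 0"
  shows "v = 0"
proof -
  have vv: "lorentz v v = 0" using phase_cmod[OF z v] 0 by simp
  then have "vcnj v = v" using phase(2)[OF z v, of 1] 0 by simp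
  then show ?thesis using perp_real_pos(2)[OF z v _ vv] by blast
qed

end

section \<open>The holomorphic function Q\<close>

context isothermic_willmore
begin

lemma u_pos: assumes z: "z \<in> \<Omega>" shows "u z = of_real (Re (u z))" "Re (u z) > 0" "u z \<noteq> 0"
proof -
  obtain r where r: "r \<ge> 0" "u z = of_real r" using perp_real_pos(1)[OF z kap_perp[OF z] kap_real[OF z]] unfolding u_def by blast
  have "u z \<noteq> 0" using perp_real_pos(2)[OF z kap_perp[OF z] kap_real[OF z]] kap_nz[OF z] unfolding u_def by blast
  then show "u z = of_real (Re (u z))" "Re (u z) > 0" "u z \<noteq> 0" using r by auto
qed

lemma cnj_u: "z \<in> \<Omega> \<Longrightarrow> cnj (u z) = u z"
  using u_pos(1) by (metis complex_cnj_complex_of_real)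

text \<open>\<open>mu\<close> and \<open>Mb\<close> are the components of \<open>D\<^sub>z \<kappa>\<close> and \<open>D\<^bsub>zbar\<^esub> \<kappa>\<close> orthogonal to \<open>\<kappa>\<close>. Up to the factor \<open>u\<close>,
  \<open>Q\<close> is the square of \<open>Mb\<close>.\<close>

definition "mu z = L z - (uz z / (2 * u z)) *s kap z"
definition "Mb z = dk z - (cnj (uz z) / (2 * u z)) *s kap z"
definition "Q z = u z * lorentz (dk z) (dk z) - (cnj (uz z))\<^sup>2 / 4"

lemma vcnj_mu: "z \<in> \<Omega> \<Longrightarrow> vcnj (mu z) = Mb z" unfolding mu_def Mb_def by (simp add: vcnj_L kap_real cnj_u)
lemma vcnj_Mb: "z \<in> \<Omega> \<Longrightarrow> vcnj (Mb z) = mu z" using vcnj_mu vcnj_simps(1) by metis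

lemma perp_mu: "z \<in> \<Omega> \<Longrightarrow> perp z (mu z)" "z \<in> \<Omega> \<Longrightarrow> perp z (Mb z)"
  using perps kap_perp unfolding mu_def Mb_def perp_def by simp_all

lemma kap_mu: assumes z: "z \<in> \<Omega>"
  shows "lorentz (kap z) (mu z) = 0" "lorentz (mu z) (kap z) = 0" "lorentz (kap z) (Mb z) = 0" "lorentz (Mb z) (kap z) = 0"
proof -
  show 1: "lorentz (kap z) (mu z) = 0" using u_pos(3)[OF z] unfolding mu_def by (simp add: u_def uz_def)
  show 2: "lorentz (kap z) (Mb z) = 0" using u_pos(3)[OF z] unfolding Mb_def by (simp add: u_def cnj_uz z)
  show "lorentz (mu z) (kap z) = 0" "lorentz (Mb z) (kap z) = 0" using 1 2 by (simp_all add: lorentz_commute)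
qed

lemma Mb_Mb: assumes z: "z \<in> \<Omega>" shows "lorentz (Mb z) (Mb z) = Q z / u z" "lorentz (mu z) (mu z) = cnj (Q z) / u z"
proof -
  have "lorentz (dk z) (kap z) = cnj (uz z) / 2" "lorentz (kap z) (dk z) = cnj (uz z) / 2" using cnj_uz[OF z] by (simp_all add: lorentz_commute)
  then show 1: "lorentz (Mb z) (Mb z) = Q z / u z"
    using u_pos(3)[OF z] u_def[of z] unfolding Mb_def Q_def by (simp add: field_simps power2_eq_square)
  show "lorentz (mu z) (mu z) = cnj (Q z) / u z"
    using lorentz_vcnj[of "Mb z" "Mb z"] 1 by (simp add: vcnj_Mb z cnj_u)
qed

lemma smooth_scalars: "smooth_on \<Omega> u" "smooth_on \<Omega> uz" "smooth_on \<Omega> Q" "smooth_on \<Omega> mu" "smooth_on \<Omega> Mb" "smooth_on \<Omega> X"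
proof -
  show 1: "smooth_on \<Omega> u" unfolding u_def[abs_def] by (intro smooth_intros open_dom smooth_fields)
  show 2: "smooth_on \<Omega> uz" unfolding uz_def[abs_def] by (intro smooth_intros open_dom smooth_fields smooth_L)
  have "smooth_on \<Omega> (\<lambda>z. u z * lorentz (dk z) (dk z) - (1/4) * (cnj (uz z) * cnj (uz z)))"
    by (intro smooth_intros open_dom 1 2 smooth_dk)
  then show "smooth_on \<Omega> Q" unfolding Q_def[abs_def] by (simp add: power2_eq_square)
  have "smooth_on \<Omega> (\<lambda>z. L z - ((1/2) * uz z * inverse (u z)) *s kap z)"
    by (intro smooth_intros open_dom 1 2 smooth_L smooth_fields u_pos(3))
  then show 3: "smooth_on \<Omega> mu" unfolding mu_def[abs_def] by (simp add: field_simps)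
  show "smooth_on \<Omega> Mb" by (rule smooth_on_cong[OF open_dom vcnj_mu smooth_on_vcnj[OF open_dom 3]])
  show "smooth_on \<Omega> X" using sect_X unfolding sect_def by blast
qed

text \<open>\<open>Q\<close> is the square of the holomorphic bivector \<open>\<kappa> \<and> D\<^bsub>zbar\<^esub> \<kappa>\<close>, which is annihilated by
  \<open>D\<^bsub>zbar\<^esub>\<close> since \<open>D\<^bsub>zbar\<^esub> D\<^bsub>zbar\<^esub> \<kappa>\<close> is a multiple of \<open>\<kappa>\<close>.\<close>

lemma Q_has_wirtc: assumes z: "z \<in> \<Omega>" shows "has_wirtc Q (wirtc Q z) 0 z"
proof -
  have a: "has_wirtc (\<lambda>z. u z * lorentz (dk z) (dk z) - (1/4) * (cnj (uz z) * cnj (uz z)))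
    (uz z * lorentz (dk z) (dk z) + u z * (lorentz (X z) (dk z) + lorentz (dk z) (X z)) -
       (0 * (cnj (uz z) * cnj (uz z)) + (1/4) * (cnj (2 * lorentz (L z) (dk z) + 2 * lorentz (kap z) (X z)) * cnj (uz z) + cnj (uz z) * cnj (2 * lorentz (L z) (dk z) + 2 * lorentz (kap z) (X z)))))
    (cnj (uz z) * lorentz (dk z) (dk z) + u z * (lorentz ((- cnj (cc z) / 2) *s kap z) (dk z) + lorentz (dk z) ((- cnj (cc z) / 2) *s kap z)) -
       (0 * (cnj (uz z) * cnj (uz z)) + (1/4) * (cnj (2 * lorentz (L z) (L z) - cc z * u z) * cnj (uz z) + cnj (uz z) * cnj (2 * lorentz (L z) (L z) - cc z * u z)))) z"
    by (intro wirt_intros has_wirtc_u has_wirtc_uz hasD_wirtc[OF hasD_dk hasD_dk] z)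
  have e: "(\<lambda>z. u z * lorentz (dk z) (dk z) - (1/4) * (cnj (uz z) * cnj (uz z))) = Q"
    by (auto simp: Q_def power2_eq_square)
  have l: "cnj (lorentz (L z) (L z)) = lorentz (dk z) (dk z)" using lorentz_vcnj[of "L z" "L z"] by (simp add: vcnj_L)
  have "lorentz (dk z) (kap z) = cnj (uz z) / 2" "lorentz (kap z) (dk z) = cnj (uz z) / 2" using cnj_uz[OF z] by (simp_all add: lorentz_commute)
  then have "has_wirtc Q (wirtc Q z) (cnj (uz z) * lorentz (dk z) (dk z) + u z * (lorentz ((- cnj (cc z) / 2) *s kap z) (dk z) + lorentz (dk z) ((- cnj (cc z) / 2) *s kap z)) -
       (0 * (cnj (uz z) * cnj (uz z)) + (1/4) * (cnj (2 * lorentz (L z) (L z) - cc z * u z) * cnj (uz z) + cnj (uz z) * cnj (2 * lorentz (L z) (L z) - cc z * u z)))) z"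
    using a has_wirtcD(1)[OF a] unfolding e by simp
  then show ?thesis using \<open>lorentz (dk z) (kap z) = cnj (uz z) / 2\<close> \<open>lorentz (kap z) (dk z) = cnj (uz z) / 2\<close>
    by (simp add: l cnj_u z algebra_simps)
qed

lemma Q_holomorphic: "Q holomorphic_on \<Omega>"
  unfolding holomorphic_on_def
  using Q_has_wirtc[unfolded has_wirtc_field_iff] by (meson field_differentiable_at_within field_differentiable_def)

lemma mu_parallel: assumes z: "z \<in> \<Omega>" shows "cnj (uz z) *s mu z = uz z *s Mb z"
  using du_parallel_dkap[OF z] unfolding mu_def Mb_def by (simp add: vec_eq_iff algebra_simps)

text \<open>Where \<open>u\<^sub>z\<close> does not vanish, proportionality of \<open>d\<kappa>\<close> and \<open>du\<close> makes \<open>mu\<close> a unit multiple of its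
  conjugate.\<close>

lemma cmod_Q_if_du_nz:
  assumes z: "z \<in> \<Omega>" and nz: "uz z \<noteq> 0"
  shows "cmod (Q z) = Re (u z) * Re (lorentz (mu z) (Mb z))"
proof -
  have "cnj (uz z) * lorentz (mu z) (mu z) = uz z * lorentz (mu z) (Mb z)"
    using mu_parallel[OF z] by (metis lorentz_simps(10))
  then have "cmod (uz z) * cmod (lorentz (mu z) (mu z)) = cmod (uz z) * cmod (lorentz (mu z) (Mb z))"
    by (metis norm_mult complex_mod_cnj)
  then have 1: "cmod (lorentz (mu z) (mu z)) = cmod (lorentz (mu z) (Mb z))" using nz by simp
  have "Im (lorentz (mu z) (Mb z)) = 0" using hermitian_real[OF z, of "mu z"] by (simp add: vcnj_mu z)
  moreover have "Re (lorentz (mu z) (Mb z)) \<ge> 0"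
    using order_trans[OF norm_ge_zero phase_cmod[OF z perp_mu(1)[OF z]]] by (simp add: vcnj_mu z)
  ultimately have 2: "cmod (lorentz (mu z) (Mb z)) = Re (lorentz (mu z) (Mb z))" by (simp add: cmod_eq_Re)
  have "cmod (lorentz (mu z) (mu z)) = cmod (Q z) / Re (u z)"
    unfolding Mb_Mb(2)[OF z] using u_pos[OF z] by (simp add: norm_divide) (metis norm_of_real abs_of_pos)
  then show ?thesis using 1 2 u_pos(2)[OF z] by (simp add: field_simps)
qed

text \<open>Where the length of \<open>\<kappa>\<close> is locally constant, repeated differentiation of \<open>\<langle>\<kappa>, L\<rangle> = 0\<close> gives
  \<open>\<langle>L, L\<rangle> = c u / 2\<close>, \<open>\<langle>\<kappa>, X\<rangle> = -\<langle>L, cnj L\<rangle>\<close> and \<open>\<langle>X, X\<rangle> = |c|\<^sup>2 u / 4\<close>. The Cauchy-Schwarz inequality for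
  the real normal vectors \<open>\<kappa>\<close> and \<open>X\<close> then says \<open>\<langle>L, cnj L\<rangle> \<le> |\<langle>L, L\<rangle>|\<close>, and the opposite inequality
  holds for every normal vector.\<close>

lemma cmod_Q_if_du_zero:
  assumes O: "open O'" "O' \<subseteq> \<Omega>" "\<And>w. w \<in> O' \<Longrightarrow> uz w = 0" and z: "z \<in> O'"
  shows "cmod (Q z) = Re (u z) * Re (lorentz (mu z) (Mb z))"
proof -
  have zO: "z \<in> \<Omega>" using O z by blast
  have uz1: "lorentz (L w) (L w) = cc w * u w / 2" "lorentz (kap w) (X w) = - lorentz (L w) (dk w)" if w: "w \<in> O'" for w
  proof -
    have wO: "w \<in> \<Omega>" using O w by blast
    show "lorentz (L w) (L w) = cc w * u w / 2" "lorentz (kap w) (X w) = - lorentz (L w) (dk w)"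
      using wirtc_of_constant[OF has_wirtc_uz[OF wO] O(1) w O(3)] by (auto simp: add_eq_0_iff algebra_simps)
  qed
  have LX: "lorentz (L w) (X w) = 0" if w: "w \<in> O'" for w
  proof -
    have wO: "w \<in> \<Omega>" using O w by blast
    have 1: "has_wirtc (\<lambda>z. lorentz (L z) (L z)) (lorentz ((- cc w / 2) *s kap w) (L w) + lorentz (L w) ((- cc w / 2) *s kap w))
        (lorentz (X w) (L w) + lorentz (L w) (X w)) w"
      by (rule hasD_wirtc[OF hasD_L hasD_L wO])
    have 2: "has_wirtc (\<lambda>z. (1/2) * (cc z * u z)) (0 * (cc w * u w) + (1/2) * (wirtc cc w * u w + cc w * uz w))
        (0 * (cc w * u w) + (1/2) * (4 * uz w * u w + cc w * cnj (uz w))) w"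
      by (intro wirt_intros has_wirtc_c has_wirtc_u wO)
    have "has_wirtc (\<lambda>z. lorentz (L z) (L z)) (0 * (cc w * u w) + (1/2) * (wirtc cc w * u w + cc w * uz w))
        (0 * (cc w * u w) + (1/2) * (4 * uz w * u w + cc w * cnj (uz w))) w"
      by (rule has_wirtc_cong_open[OF 2 O(1) w]) (simp add: uz1)
    from has_wirtc_unique(2)[OF 1 this] show ?thesis using O(3)[OF w] by (simp add: lorentz_commute)
  qed
  have XX: "lorentz (X z) (X z) = cnj (cc z) * cc z * u z / 4"
  proof -
    have "lorentz (X z) (X z) + lorentz (L z) ((- 2 * cnj (uz z)) *s kap z + (- cnj (cc z) / 2) *s L z) = 0"
      by (rule wirtc_of_constant(2)[OF hasD_wirtc[OF hasD_L hasD_X zO] O(1) z LX])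
    then show ?thesis using O(3)[OF z] uz1(1)[OF z] by (simp add: field_simps)
  qed
  define g where "g = Re (lorentz (L z) (dk z))"
  have gz: "lorentz (L z) (dk z) = of_real g"
    using hermitian_real[OF zO, of "L z"] unfolding g_def by (simp add: vcnj_L complex_eq_iff)
  have kX: "lorentz (kap z) (X z) = - of_real g" "lorentz (X z) (kap z) = - of_real g"
    using uz1(2)[OF z] gz by (simp_all add: lorentz_commute)
  define r where "r = Re (u z)"
  have r: "u z = of_real r" "r > 0" using u_pos[OF zO] unfolding r_def by auto
  \<comment> \<open>A multiple of the component of \<open>X\<close> orthogonal to \<open>\<kappa>\<close>; that its square is nonnegative is the Cauchy-Schwarz inequality.\<close>
  define Y' where "Y' = u z *s X z + of_real g *s kap z"
  have "perp z Y'" "vcnj Y' = Y'"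
    using perps(3)[OF zO] kap_perp[OF zO] unfolding Y'_def perp_def by (simp_all add: kap_real zO X_real cnj_u)
  then obtain q where q: "q \<ge> 0" "lorentz Y' Y' = of_real q" using perp_real_pos(1)[OF zO] by blast
  have "lorentz Y' Y' = u z * (u z * (u z * (cc z * cnj (cc z)) / 4) - (of_real g)\<^sup>2)"
    unfolding Y'_def using kX XX u_def[of z] by (simp add: algebra_simps power2_eq_square)
  also have "\<dots> = of_real (r * (r * (r * (cmod (cc z))\<^sup>2 / 4) - g\<^sup>2))"
    unfolding complex_norm_square[symmetric] r(1) by simp
  finally have "r * (r * (r * (cmod (cc z))\<^sup>2 / 4) - g\<^sup>2) \<ge> 0" using q by (metis of_real_eq_iff)
  then have "g\<^sup>2 \<le> (r * cmod (cc z) / 2)\<^sup>2"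
    using r(2) by (simp add: zero_le_mult_iff power2_eq_square algebra_simps)
  then have g1: "g \<le> r * cmod (cc z) / 2" by (rule power2_le_imp_le) (use r(2) in simp)
  have LL: "cmod (lorentz (L z) (L z)) = r * cmod (cc z) / 2"
    unfolding uz1(1)[OF z] r(1) using r(2) by (simp add: norm_mult norm_divide)
  have "cmod (lorentz (L z) (L z)) \<le> g"
    using phase_cmod[OF zO perps(1)[OF zO]] gz by (simp add: vcnj_L)
  then have g2: "g = cmod (lorentz (L z) (L z))" using g1 LL by simp
  have "lorentz (dk z) (dk z) = cnj (lorentz (L z) (L z))" using lorentz_vcnj[of "L z" "L z"] by (simp add: vcnj_L)
  then have "cmod (Q z) = r * g" unfolding Q_def g2 using O(3)[OF z] r by (simp add: norm_mult)
  moreover have "lorentz (mu z) (Mb z) = of_real g" unfolding mu_def Mb_def using O(3)[OF z] gz by simp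
  ultimately show ?thesis by (simp add: r_def)
qed

text \<open>The set where equality fails is open, and \<open>u\<^sub>z\<close> vanishes on it.\<close>

lemma cmod_Q: assumes z: "z \<in> \<Omega>" shows "cmod (Q z) = Re (u z) * Re (lorentz (mu z) (Mb z))"
proof (rule ccontr)
  assume ne: "\<not> ?thesis"
  define F where "F z = cmod (Q z) - Re (u z) * Re (lorentz (mu z) (Mb z))" for z
  have cont: "continuous_on \<Omega> F"
    unfolding F_def[abs_def]
    by (intro continuous_intros smooth_on_imp_continuous_on[of _ Q] smooth_on_imp_continuous_on[of _ u]
          smooth_on_imp_continuous_on[of _ "\<lambda>z. lorentz (mu z) (Mb z)"] smooth_scalars smooth_intros open_dom)
  define O' where "O' = {w \<in> \<Omega>. F w \<noteq> 0}"
  have "O' = F -` (- {0}) \<inter> \<Omega>" unfolding O'_def by auto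
  then have "open O'" using continuous_open_preimage[OF cont open_dom, of "- {0}"] by (simp add: Int_commute open_Compl)
  moreover have "uz w = 0" if "w \<in> O'" for w
    using that cmod_Q_if_du_nz[of w] unfolding O'_def F_def by auto
  ultimately show False using cmod_Q_if_du_zero[of O' z] z ne unfolding O'_def F_def by auto
qed

text \<open>Consequently equality holds in \<open>phase\<close>, and a square root \<open>h\<close> of \<open>Q\<close>
  turns the \<open>\<kappa>\<close>-orthogonal part of \<open>D\<^bsub>z\<^esub> \<kappa>\<close>, and then
  \<open>D\<^bsub>z\<^esub> \<kappa>\<close> itself, into a real vector.\<close>

lemma sqrt_Q_real:
  assumes z: "z \<in> \<Omega>" and h: "h\<^sup>2 = Q z"
  shows "h *s mu z = cnj h *s Mb z" "h * uz z = cnj h * cnj (uz z)" "h *s L z = cnj h *s dk z"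
proof -
  define r where "r = Re (u z)"
  have r: "u z = of_real r" "r > 0" using u_pos[OF z] unfolding r_def by auto
  have cQ: "cmod (Q z) = (cmod h)\<^sup>2" unfolding h[symmetric] by (simp add: norm_power)
  have re: "Re (lorentz (mu z) (Mb z)) = (cmod h)\<^sup>2 / r" using cmod_Q[OF z] r(2) unfolding cQ r_def by (simp add: field_simps)
  have "h\<^sup>2 * lorentz (mu z) (mu z) = Q z * cnj (Q z) / u z" unfolding Mb_Mb(2)[OF z] h by simp
  also have "\<dots> = of_real ((cmod h)\<^sup>2 * ((cmod h)\<^sup>2 / r))" unfolding complex_norm_square[symmetric] cQ r(1)
    by (simp add: power2_eq_square)
  finally have "Re (h\<^sup>2 * lorentz (mu z) (mu z)) = (cmod h)\<^sup>2 * ((cmod h)\<^sup>2 / r)" by simp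
  then have hm: "vcnj (h *s mu z) = h *s mu z"
    using phase(2)[OF z perp_mu(1)[OF z], of h] re by (simp add: vcnj_mu z)
  then show 1: "h *s mu z = cnj h *s Mb z" by (simp add: vcnj_mu z)
  show 2: "h * uz z = cnj h * cnj (uz z)"
  proof (cases "h = 0")
    case False
    then have "Q z \<noteq> 0" using h by auto
    then have "lorentz (Mb z) (Mb z) \<noteq> 0" using Mb_Mb(1)[OF z] u_pos(3)[OF z] by simp
    moreover have "(h * uz z) *s Mb z = (cnj h * cnj (uz z)) *s Mb z"
      using mu_parallel[OF z] 1 by (metis (no_types, lifting) mult.commute vector_smult_assoc)
    ultimately show ?thesis by (metis lorentz_simps(9) mult_right_cancel)
  qed simp
  have "L z = mu z + (uz z / (2 * u z)) *s kap z" "dk z = Mb z + (cnj (uz z) / (2 * u z)) *s kap z"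
    unfolding mu_def Mb_def by simp_all
  then show "h *s L z = cnj h *s dk z" using 1 2 by (simp add: mult.assoc[symmetric] times_divide_eq_right)
qed

end

section \<open>The square root of Q is affine\<close>

context isothermic_willmore
begin

text \<open>\<open>f0\<close> is \<open>(ln |\<kappa>|)\<^sub>z\<close>, and \<open>Xp\<close> is the component of \<open>X\<close> orthogonal to \<open>\<kappa>\<close>.\<close>

definition "f0 z = uz z / (2 * u z)"
definition "Xp z = X z - (lorentz (X z) (kap z) / u z) *s kap z"

lemma smooth_f0: "smooth_on \<Omega> f0"
proof -
  have "smooth_on \<Omega> (\<lambda>z. (1/2) * uz z * inverse (u z))"
    by (intro smooth_intros open_dom smooth_scalars u_pos(3))
  then show ?thesis unfolding f0_def[abs_def] by (simp add: field_simps)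
qed

lemma mu_f0: "mu z = L z - f0 z *s kap z" and L_mu: "L z = mu z + f0 z *s kap z" unfolding mu_def f0_def by simp_all

lemma dk_Mb: "z \<in> \<Omega> \<Longrightarrow> dk z = Mb z + cnj (f0 z) *s kap z" unfolding Mb_def f0_def by (simp add: cnj_u)

lemma hasD_mu_raw: "hasD mu (\<lambda>z. (- cc z / 2) *s kap z - (wirtc f0 z *s kap z + f0 z *s L z))
   (\<lambda>z. X z - (wirtbarc f0 z *s kap z + f0 z *s dk z))"
proof -
  have "smooth_on \<Omega> (\<lambda>z. - f0 z)" by (intro smooth_intros open_dom smooth_f0)
  note h = hasD_add[OF hasD_L hasD_scale[OF this has_wirtc_minus[OF smooth_has_wirtc[OF smooth_f0]] hasD_kap_L]]
  have e: "mu = (\<lambda>z. L z + (- f0 z) *s kap z)" unfolding mu_f0[abs_def] by (simp add: vec_eq_iff)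
  show ?thesis unfolding e by (rule hasD_congD[OF h]) (simp_all add: vec_eq_iff algebra_simps)
qed

text \<open>\<open>D\<^sub>z mu\<close> is a combination of \<open>mu\<close> and \<open>\<kappa>\<close>; the coefficient of \<open>\<kappa>\<close> is found by differentiating
  \<open>\<langle>mu, \<kappa>\<rangle> = 0\<close> rather than from \<open>c\<close> and \<open>f0\<close>.\<close>

lemma hasD_mu: "hasD mu (\<lambda>z. - (f0 z *s mu z) - (cnj (Q z) / (u z)\<^sup>2) *s kap z) (\<lambda>z. X z - (wirtbarc f0 z *s kap z + f0 z *s dk z))"
proof (rule hasD_congD[OF hasD_mu_raw _ refl])
  fix z assume z: "z \<in> \<Omega>"
  let ?a = "(- cc z / 2) *s kap z - (wirtc f0 z *s kap z + f0 z *s L z)"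
  define s where "s = - cc z / 2 - wirtc f0 z - f0 z * f0 z"
  have a: "?a = s *s kap z - f0 z *s mu z" unfolding s_def by (simp add: mu_f0 vec_eq_iff algebra_simps)
  have "lorentz ?a (kap z) + lorentz (mu z) (L z) = 0"
    by (rule wirtc_of_constant(1)[OF hasD_wirtc[OF hasD_mu_raw hasD_kap_L z] open_dom z kap_mu(2)])
  moreover have "lorentz (mu z) (L z) = cnj (Q z) / u z" unfolding L_mu using Mb_Mb(2)[OF z] kap_mu[OF z] by simp
  ultimately have "s * u z + cnj (Q z) / u z = 0" unfolding a using kap_mu[OF z] by (simp add: u_def)
  then have "s = - (cnj (Q z) / (u z)\<^sup>2)" using u_pos(3)[OF z] by (simp add: field_simps power2_eq_square add_eq_0_iff)
  then show "?a = - (f0 z *s mu z) - (cnj (Q z) / (u z)\<^sup>2) *s kap z" unfolding a by simp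
qed

lemma Xp_props: assumes z: "z \<in> \<Omega>"
  shows "lorentz (Xp z) (kap z) = 0" "vcnj (Xp z) = Xp z" "perp z (Xp z)"
proof -
  have "cnj (lorentz (X z) (kap z)) = lorentz (X z) (kap z)" using lorentz_vcnj[of "X z" "kap z"] by (simp add: X_real z kap_real)
  then show "vcnj (Xp z) = Xp z" unfolding Xp_def by (simp add: X_real z kap_real cnj_u)
  show "lorentz (Xp z) (kap z) = 0" unfolding Xp_def using u_pos(3)[OF z] by (simp add: u_def[symmetric])
  show "perp z (Xp z)" using perps(3)[OF z] kap_perp[OF z] unfolding Xp_def perp_def by simp
qed

text \<open>For a holomorphic square root \<open>h\<close> of \<open>Q\<close> the normal field \<open>h mu\<close> is real, so that its two
  covariant derivatives are conjugate to each other. Modulo \<open>\<kappa>\<close> this says \<open>h Xp = cnj h' Mb\<close>, and both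
  sides are orthogonal to \<open>\<kappa>\<close>.\<close>

lemma sqrt_Q_derivative:
  assumes O: "open O'" "O' \<subseteq> \<Omega>" "z \<in> O'" and h: "\<And>w. w \<in> O' \<Longrightarrow> (h w)\<^sup>2 = Q w" "(h has_field_derivative h') (at z)"
  shows "h z *s Xp z = cnj h' *s Mb z"
proof -
  have z: "z \<in> \<Omega>" using O by blast
  obtain A B where AB: "has_wirt mu A B z" "pr z A = - (f0 z *s mu z) - (cnj (Q z) / (u z)\<^sup>2) *s kap z"
    "pr z B = X z - (wirtbarc f0 z *s kap z + f0 z *s dk z)" using hasD_at[OF hasD_mu z] by metis
  have 1: "has_wirt (\<lambda>z. h z *s mu z) (h' *s mu z + h z *s A) (0 *s mu z + h z *s B) z"
    by (intro wirt_intros AB has_wirtc_field h(2))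
  have re: "vcnj (h w *s mu w) = h w *s mu w" if "w \<in> O'" for w
    using sqrt_Q_real(1)[OF _ h(1)[OF that]] that O(2) vcnj_mu by auto
  have "has_wirt (\<lambda>z. h z *s mu z) (vcnj (0 *s mu z + h z *s B)) (vcnj (h' *s mu z + h z *s A)) z"
    by (rule has_wirt_cong_open[OF has_wirt_vcnj[OF 1] O(1,3) re])
  from has_wirt_unique(2)[OF 1 this] have "h z *s B = vcnj (h' *s mu z + h z *s A)" by simp
  then have "pr z (h z *s B) = vcnj (pr z (h' *s mu z + h z *s A))" using pr_vcnj[OF z] by metis
  then have eq: "h z *s (X z - (wirtbarc f0 z *s kap z + f0 z *s dk z)) = vcnj (h' *s mu z + h z *s (- (f0 z *s mu z) - (cnj (Q z) / (u z)\<^sup>2) *s kap z))"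
    using AB(2,3) pr_of_perp[OF perp_mu(1)[OF z]] by simp
  have hf: "h z * f0 z = cnj (h z) * cnj (f0 z)"
    using sqrt_Q_real(2)[OF z h(1)[OF O(3)]] unfolding f0_def by (simp add: cnj_u z)
  define t where "t = - h z * (lorentz (X z) (kap z) / u z) + h z * wirtbarc f0 z + h z * f0 z * cnj (f0 z) - cnj (h z) * (Q z / (u z)\<^sup>2)"
  have e: "h z *s Xp z - cnj h' *s Mb z = t *s kap z"
  proof -
    have "h z * X z $ i = h z * (wirtbarc f0 z * kap z $ i + f0 z * (Mb z $ i + cnj (f0 z) * kap z $ i)) +
        cnj h' * Mb z $ i - cnj (h z) * cnj (f0 z) * Mb z $ i - cnj (h z) * (Q z / (u z)\<^sup>2) * kap z $ i" for i
      using arg_cong[OF eq, of "\<lambda>v. v $ i"]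
      by (simp add: vcnj_mu kap_real z cnj_u dk_Mb) (simp add: algebra_simps)
    then have "h z * X z $ i - h z * (lorentz (X z) (kap z) / u z * kap z $ i) - cnj h' * Mb z $ i = t * kap z $ i" for i
      unfolding hf[symmetric] t_def by (simp add: algebra_simps)
    then show ?thesis unfolding Xp_def by (simp add: vec_eq_iff algebra_simps)
  qed
  have "lorentz (h z *s Xp z - cnj h' *s Mb z) (kap z) = 0" using Xp_props[OF z] kap_mu[OF z] by simp
  then have "t * u z = 0" unfolding e by (simp add: u_def)
  then have "t = 0" using u_pos(3)[OF z] by simp
  then show ?thesis using e by simp
qed

text \<open>Multiplied by \<open>cnj h\<close>, the preceding identity expresses the real vector \<open>|h|\<^sup>2 Xp\<close> as \<open>cnj h'\<close> times the
  real vector \<open>h mu\<close>.\<close>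

lemma sqrt_Q_derivative_real:
  assumes O: "open O'" "O' \<subseteq> \<Omega>" "z \<in> O'" and h: "\<And>w. w \<in> O' \<Longrightarrow> (h w)\<^sup>2 = Q w" "(h has_field_derivative h') (at z)"
    and nz: "Q z \<noteq> 0"
  shows "cnj h' = h'"
proof -
  have z: "z \<in> \<Omega>" using O by blast
  define n where "n = cnj (h z) *s Mb z"
  have n: "n = h z *s mu z" using sqrt_Q_real(1)[OF z h(1)[OF O(3)]] unfolding n_def by simp
  have nr: "vcnj n = n" unfolding n by (simp add: vcnj_mu z) (simp add: n_def[symmetric] n)
  have "h z \<noteq> 0" using h(1)[OF O(3)] nz by auto
  moreover have "lorentz (Mb z) (Mb z) \<noteq> 0" using Mb_Mb(1)[OF z] nz u_pos(3)[OF z] by simp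
  ultimately have nn: "lorentz n n \<noteq> 0" unfolding n_def by simp
  have e: "(cnj (h z) * h z) *s Xp z = cnj h' *s n"
    using sqrt_Q_derivative[OF O h] unfolding n_def by (metis mult.commute vector_smult_assoc)
  have "vcnj ((cnj (h z) * h z) *s Xp z) = (cnj (h z) * h z) *s Xp z" by (simp add: Xp_props z mult.commute)
  then have "h' *s n = cnj h' *s n" unfolding e by (simp add: nr)
  then have "h' * lorentz n n = cnj h' * lorentz n n" by (metis lorentz_simps(9))
  then show ?thesis using nn by simp
qed

text \<open>A holomorphic function with real derivative has constant derivative, so a local square root of \<open>Q\<close> is
  \<open>\<alpha> z + \<eta>\<close> with \<open>\<alpha>\<close> real, and the identity theorem extends this from a disc to the whole domain. If
  \<open>Q\<close> vanishes identically, so does \<open>mu\<close>, because \<open>|Q| = u \<langle>mu, cnj mu\<rangle>\<close>.\<close>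

theorem Q_zero_or_affine_square:
  assumes conn: "connected \<Omega>"
  obtains (zero) "\<And>z. z \<in> \<Omega> \<Longrightarrow> mu z = 0"
    | (affine) \<alpha> :: real and \<eta> where "\<alpha> \<noteq> 0 \<or> \<eta> \<noteq> 0" "\<And>z. z \<in> \<Omega> \<Longrightarrow> (of_real \<alpha> * z + \<eta>)\<^sup>2 = Q z"
proof (cases "\<forall>z\<in>\<Omega>. Q z = 0")
  case True
  have "mu z = 0" if z: "z \<in> \<Omega>" for z
  proof (rule hermitian_zero[OF z perp_mu(1)[OF z]])
    show "Re (lorentz (mu z) (vcnj (mu z))) = 0"
      using cmod_Q[OF z] True z u_pos(2)[OF z] by (simp add: vcnj_mu)
  qed
  then show ?thesis by (rule zero)
next
  case False
  then obtain q where q: "q \<in> \<Omega>" "Q q \<noteq> 0" by blast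
  have cont: "continuous_on \<Omega> Q" by (rule smooth_on_imp_continuous_on[OF smooth_scalars(3)])
  have "open (\<Omega> \<inter> Q -` (- {0}))" by (rule continuous_open_preimage[OF cont open_dom]) (simp add: open_Compl)
  then obtain r where r: "r > 0" "ball q r \<subseteq> \<Omega> \<inter> Q -` (- {0})" using q open_contains_ball by blast
  define B where "B = ball q r"
  have B: "open B" "convex B" "q \<in> B" "B \<subseteq> \<Omega>" "\<And>w. w \<in> B \<Longrightarrow> Q w \<noteq> 0" using r unfolding B_def by auto
  obtain g where g: "g holomorphic_on B" "\<And>x. x \<in> B \<Longrightarrow> exp (g x) = Q x"
    using holomorphic_logarithm_exists[OF B(2,1) holomorphic_on_subset[OF Q_holomorphic B(4)] B(5,3)] by blast
  define h where "h z = exp (g z / 2)" for z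
  have h: "h holomorphic_on B" unfolding h_def[abs_def] by (intro holomorphic_intros g) auto
  have hQ: "(h w)\<^sup>2 = Q w" if "w \<in> B" for w using g(2)[OF that] unfolding h_def by (simp add: exp_double[symmetric])
  have hd: "(h has_field_derivative deriv h w) (at w)" if "w \<in> B" for w
    by (rule holomorphic_derivI[OF h B(1) that])
  have dr: "cnj (deriv h w) = deriv h w" if "w \<in> B" for w
    by (rule sqrt_Q_derivative_real[OF B(1,4) that hQ hd[OF that] B(5)[OF that]])
  have ddz: "(deriv h has_field_derivative 0) (at w)" if w: "w \<in> B" for w
  proof -
    have dd: "(deriv h has_field_derivative deriv (deriv h) w) (at w)"
      by (rule holomorphic_derivI[OF holomorphic_deriv[OF h B(1)] B(1) w])
    note 1 = has_wirtc_field[OF dd]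
    have "has_wirtc (deriv h) (cnj 0) (cnj (deriv (deriv h) w)) w"
      by (rule has_wirtc_cong_open[OF has_wirtc_cnj[OF 1] B(1) w dr])
    from has_wirtc_unique(1)[OF 1 this] show ?thesis using dd by simp
  qed
  obtain a where a: "\<And>w. w \<in> B \<Longrightarrow> deriv h w = a"
    using has_field_derivative_zero_constant[OF B(2) has_field_derivative_at_within[OF ddz]] by blast
  have "((\<lambda>w. h w - a * w) has_field_derivative 0) (at w)" if "w \<in> B" for w
    using hd[OF that] a[OF that] by (auto intro!: derivative_eq_intros)
  then obtain \<eta> where \<eta>: "\<And>w. w \<in> B \<Longrightarrow> h w - a * w = \<eta>"
    using has_field_derivative_zero_constant[OF B(2) has_field_derivative_at_within, of "\<lambda>w. h w - a * w"] by blast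
  have ar: "a = of_real (Re a)" using dr[OF B(3)] a[OF B(3)] by (simp add: complex_eq_iff)
  have hB: "h w = of_real (Re a) * w + \<eta>" if "w \<in> B" for w using \<eta>[OF that] ar by (simp add: algebra_simps)
  have "(of_real (Re a) * z + \<eta>)\<^sup>2 = Q z" if "z \<in> \<Omega>" for z
  proof (rule analytic_continuation_open[OF B(1) open_dom _ conn B(4) _ Q_holomorphic _ that])
    show "B \<noteq> {}" using B by blast
    show "(\<lambda>z. (of_real (Re a) * z + \<eta>)\<^sup>2) holomorphic_on \<Omega>" by (intro holomorphic_intros)
    show "(of_real (Re a) * w + \<eta>)\<^sup>2 = Q w" if "w \<in> B" for w using hQ[OF that] hB[OF that] by simp
  qed
  moreover have "Re a \<noteq> 0 \<or> \<eta> \<noteq> 0" using hB[OF B(3)] hQ[OF B(3)] B(5)[OF B(3)] by auto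
  ultimately show ?thesis by (rule affine[rotated])
qed

end

section \<open>A potential for a closed form on a disc\<close>

text \<open>The Poincare lemma for the real form \<open>2 Re (g dz)\<close>, which is closed iff \<open>g\<^bsub>zbar\<^esub>\<close> is real: its integral along
  the segment from the centre, differentiated under the integral sign.\<close>

lemma closed_form_potential:
  fixes g :: "complex \<Rightarrow> complex"
  assumes g: "smooth_on (ball p r) g" and closed: "\<And>z. z \<in> ball p r \<Longrightarrow> cnj (wirtbarc g z) = wirtbarc g z"
  obtains \<theta> :: "complex \<Rightarrow> real" where "smooth_on (ball p r) \<theta>"
    "\<And>z. z \<in> ball p r \<Longrightarrow> has_wirtc (\<lambda>z. of_real (\<theta> z)) (g z) (cnj (g z)) z"
proof -
  define U where "U = ball p r"
  have U: "open U" "convex U" unfolding U_def by auto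
  define y where "y z t = p + of_real t * (z - p)" for z and t :: real
  have yU: "y z t \<in> U" if "z \<in> U" "t \<in> cbox 0 1" for z t
  proof -
    have "cmod (of_real t * (z - p)) \<le> 1 * cmod (z - p)" unfolding norm_mult using that by (intro mult_right_mono) auto
    then show ?thesis using that unfolding U_def y_def by (auto simp: dist_norm norm_minus_commute)
  qed
  have gw: "has_wirtc g (wirtc g z) (wirtbarc g z) z" if "z \<in> U" for z
    using smooth_has_wirtc[OF g] that unfolding U_def by blast
  have cg: "continuous_on U g" "continuous_on U (wirtc g)" "continuous_on U (wirtbarc g)"
    using smooth_on_imp_continuous_on[OF g] smooth_on_imp_continuous_on[OF smooth_on_wirtc[OF _ g]]
      smooth_on_imp_continuous_on[OF smooth_on_wirtbarc[OF _ g]] unfolding U_def by auto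
  define f where "f z t = 2 * Re ((z - p) * g (y z t))" for z t
  define A where "A z t = 2 * cnj (g (y z t) + of_real t * ((z - p) * wirtc g (y z t) + cnj (z - p) * wirtbarc g (y z t)))" for z t
  define \<theta> where "\<theta> z = integral (cbox 0 1) (f z)" for z
  have dy: "((\<lambda>z. y z t) has_derivative (\<lambda>v. of_real t * v)) (at z)" for z t
    unfolding y_def by (auto intro!: derivative_eq_intros)
  have df: "((\<lambda>z. f z t) has_derivative blinfun_apply (blinfun_inner_right (A z t))) (at z within U)"
    if z: "z \<in> U" and t: "t \<in> cbox 0 1" for z t
  proof -
    have "((\<lambda>z. g (y z t)) has_derivative (\<lambda>v. (of_real t * v) * wirtc g (y z t) + cnj (of_real t * v) * wirtbarc g (y z t))) (at z)"
      by (rule has_derivative_compose[OF dy gw[OF yU[OF z t], unfolded has_wirtc_def]])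
    then have "((\<lambda>z. f z t) has_derivative (\<lambda>v. 2 * Re ((z - p) * ((of_real t * v) * wirtc g (y z t) + cnj (of_real t * v) * wirtbarc g (y z t)) + v * g (y z t)))) (at z)"
      unfolding f_def by (auto intro!: derivative_eq_intros)
    moreover have "Im (wirtbarc g (y z t)) = 0" using closed[of "y z t"] yU[OF z t] unfolding U_def by (simp add: complex_eq_iff)
    then have "2 * Re ((z - p) * ((of_real t * v) * wirtc g (y z t) + cnj (of_real t * v) * wirtbarc g (y z t)) + v * g (y z t)) = A z t \<bullet> v" for v
      unfolding A_def inner_complex_def by (simp add: algebra_simps)
    ultimately show ?thesis by (simp add: has_derivative_at_withinI)
  qed
  have cy: "continuous_on S (\<lambda>x. y (a x) (b x))" if "continuous_on S a" "continuous_on S b" for S :: "'s::topological_space set" and a b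
    unfolding y_def using that by (intro continuous_intros)
  have cf: "continuous_on (cbox 0 1) (f z)" if z: "z \<in> U" for z
    unfolding f_def[abs_def] using yU[OF z]
    by (intro continuous_intros continuous_on_compose2[OF cg(1) cy]) auto
  have cA: "continuous_on (U \<times> cbox 0 1) (\<lambda>(z, t). A z t)"
    unfolding A_def case_prod_unfold using yU
    by (intro continuous_intros continuous_on_compose2[OF cg(1) cy] continuous_on_compose2[OF cg(2) cy] continuous_on_compose2[OF cg(3) cy]) auto
  have cA': "continuous_on (U \<times> cbox 0 1) (\<lambda>(z, t). blinfun_inner_right (A z t))"
    using bounded_linear.continuous_on[OF bounded_linear_blinfun_inner_right cA] by (simp add: case_prod_unfold)
  have iA: "(A z has_integral 2 * cnj (g z)) (cbox 0 1)" if z: "z \<in> U" for z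
  proof -
    have d: "((\<lambda>t. of_real t * (2 * cnj (g (y z t)))) has_vector_derivative A z t) (at t within {0..1})" if t: "t \<in> {0..1}" for t
    proof -
      have "((\<lambda>t. y z t) has_derivative (\<lambda>s. of_real s * (z - p))) (at t within {0..1})"
        unfolding y_def by (auto intro!: derivative_eq_intros)
      then have "((\<lambda>t. g (y z t)) has_derivative (\<lambda>s. (of_real s * (z - p)) * wirtc g (y z t) + cnj (of_real s * (z - p)) * wirtbarc g (y z t))) (at t within {0..1})"
        by (rule has_derivative_compose[where g = g and f = "\<lambda>t. y z t", OF _ gw[OF yU[OF z], unfolded has_wirtc_def]]) (use t in auto)
      then show ?thesis unfolding has_vector_derivative_def A_def
        by (auto intro!: derivative_eq_intros simp: algebra_simps scaleR_conv_of_real)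
    qed
    show ?thesis using fundamental_theorem_of_calculus[of 0 1 "\<lambda>t. of_real t * (2 * cnj (g (y z t)))" "A z"] d
      by (auto simp: y_def)
  qed
  have d\<theta>: "(\<theta> has_derivative (\<lambda>v. (2 * cnj (g z)) \<bullet> v)) (at z)" if z: "z \<in> U" for z
  proof -
    have "(\<theta> has_derivative integral (cbox 0 1) (\<lambda>t. blinfun_inner_right (A z t))) (at z within U)"
      unfolding \<theta>_def by (rule leibniz_rule[OF df integrable_continuous[OF cf] cA' z U(2)])
    moreover have "((\<lambda>t. blinfun_inner_right (A z t)) has_integral blinfun_inner_right (2 * cnj (g z))) (cbox 0 1)"
      using has_integral_linear[OF iA[OF z] bounded_linear_blinfun_inner_right] by (simp add: o_def)
    ultimately show ?thesis using at_within_open[OF z U(1)] by (simp add: integral_unique)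
  qed
  have "smooth_on U \<theta>"
  proof (rule smooth_onI[OF U(1), where D = "\<lambda>v z. (2 * cnj (g z)) \<bullet> v"])
    show "continuous_on U \<theta>" using d\<theta> by (meson continuous_at_imp_continuous_on has_derivative_continuous)
    show "Ck_on k U (\<lambda>z. (2 * cnj (g z)) \<bullet> v)" for v k
    proof -
      have "smooth_on U (\<lambda>z. (2 * cnj (g z)) \<bullet> v)" by (intro smooth_intros U) (use g in \<open>simp add: U_def\<close>)
      then show ?thesis unfolding smooth_on_def by blast
    qed
  qed (rule d\<theta>)
  moreover have "has_wirtc (\<lambda>z. of_real (\<theta> z)) (g z) (cnj (g z)) z" if z: "z \<in> U" for z
  proof -
    have "((\<lambda>z. complex_of_real (\<theta> z)) has_derivative (\<lambda>v. of_real ((2 * cnj (g z)) \<bullet> v))) (at z)"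
      by (rule has_derivative_of_real[OF d\<theta>[OF z]])
    moreover have "of_real ((2 * cnj (g z)) \<bullet> v) = v * g z + cnj v * cnj (g z)" for v
      unfolding inner_complex_def by (simp add: complex_eq_iff algebra_simps)
    ultimately show ?thesis unfolding has_wirtc_def by simp
  qed
  ultimately show ?thesis using that unfolding U_def by blast
qed

section \<open>Parallel normal frames\<close>

text \<open>The outcome of the analysis in all cases: the Hopf differential is a combination of finitely
  many orthonormal parallel normal fields.\<close>

context lightcone_lift
begin

definition parallel_hopf_frame :: "('j::finite \<Rightarrow> complex \<Rightarrow> complex ^ 'n option) \<Rightarrow> ('j \<Rightarrow> complex \<Rightarrow> real) \<Rightarrow> bool" where
  "parallel_hopf_frame \<xi> K \<longleftrightarrow>
     (\<forall>j. hasD (\<xi> j) (\<lambda>z. 0) (\<lambda>z. 0)) \<and> (\<forall>j. \<forall>z\<in>\<Omega>. vcnj (\<xi> j z) = \<xi> j z) \<and>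
     (\<forall>i j. \<forall>z\<in>\<Omega>. lorentz (\<xi> i z) (\<xi> j z) = (if i = j then 1 else 0)) \<and>
     (\<forall>j. smooth_on \<Omega> (K j)) \<and> (\<forall>z\<in>\<Omega>. kap z = (\<Sum>j\<in>UNIV. of_real (K j z) *s \<xi> j z))"

end

context isothermic_willmore
begin

definition "rt z = sqrt (Re (u z))"

lemma smooth_rt: "smooth_on \<Omega> rt"
  unfolding rt_def[abs_def] by (intro smooth_on_sqrt smooth_on_Re open_dom smooth_scalars u_pos(2))

lemma rt_pos: "z \<in> \<Omega> \<Longrightarrow> rt z > 0" unfolding rt_def using u_pos(2) by simp

lemma rt_sq: "z \<in> \<Omega> \<Longrightarrow> of_real (rt z) * of_real (rt z) = u z"
  unfolding rt_def of_real_mult[symmetric] using u_pos[of z] by simp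

lemma has_wirtc_rt: assumes z: "z \<in> \<Omega>"
  shows "has_wirtc (\<lambda>z. of_real (rt z)) (of_real (rt z) * f0 z) (of_real (rt z) * cnj (f0 z)) z"
proof -
  have "smooth_on \<Omega> (\<lambda>z. of_real (rt z) :: complex)" by (intro smooth_intros open_dom smooth_rt)
  then obtain a b where ab: "has_wirtc (\<lambda>z. of_real (rt z)) a b z" using smooth_has_wirtc z by blast
  have "has_wirtc (\<lambda>z. of_real (rt z) * of_real (rt z)) (a * of_real (rt z) + of_real (rt z) * a) (b * of_real (rt z) + of_real (rt z) * b) z"
    by (rule has_wirtc_mult[OF ab ab])
  then have "has_wirtc u (a * of_real (rt z) + of_real (rt z) * a) (b * of_real (rt z) + of_real (rt z) * b) z"
    by (rule has_wirtc_cong_open[OF _ open_dom z rt_sq])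
  from has_wirtc_unique[OF this has_wirtc_u[OF z]]
  have e: "2 * (a * of_real (rt z)) = uz z" "2 * (b * of_real (rt z)) = cnj (uz z)" by (simp_all add: algebra_simps)
  have "a = of_real (rt z) * f0 z"
    using e(1) rt_pos[OF z] rt_sq[OF z] u_pos(3)[OF z] unfolding f0_def by (simp add: field_simps) (metis mult.assoc)
  moreover have "b = of_real (rt z) * cnj (f0 z)"
    using e(2) rt_pos[OF z] rt_sq[OF z] u_pos(3)[OF z] unfolding f0_def by (simp add: cnj_u z field_simps) (metis mult.assoc)
  ultimately show ?thesis using ab by simp
qed

lemma hasD_unit_kap:
  "hasD (\<lambda>z. inverse (of_real (rt z)) *s kap z) (\<lambda>z. inverse (of_real (rt z)) *s mu z) (\<lambda>z. inverse (of_real (rt z)) *s Mb z)"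
proof -
  have s: "smooth_on \<Omega> (\<lambda>z. inverse (of_real (rt z) :: complex))"
    using rt_pos by (intro smooth_intros open_dom smooth_rt) force
  have w: "has_wirtc (\<lambda>z. inverse (of_real (rt z))) (- (f0 z * inverse (of_real (rt z)))) (- (cnj (f0 z) * inverse (of_real (rt z)))) z" if z: "z \<in> \<Omega>" for z
    using has_wirtc_inverse[OF has_wirtc_rt[OF z]] rt_pos[OF z] by (simp add: power2_eq_square field_simps)
  show ?thesis
    by (rule hasD_congD[OF hasD_scale[OF s w hasD_kap_L]]) (simp_all add: L_mu dk_Mb vec_eq_iff algebra_simps)
qed

lemma unit_kap: assumes z: "z \<in> \<Omega>"
  shows "lorentz (inverse (of_real (rt z)) *s kap z) (inverse (of_real (rt z)) *s kap z) = 1"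
    "vcnj (inverse (of_real (rt z)) *s kap z) = inverse (of_real (rt z)) *s kap z"
    "of_real (rt z) *s (inverse (of_real (rt z)) *s kap z) = kap z"
  using rt_pos[OF z] rt_sq[OF z] u_pos(3)[OF z] by (simp_all add: kap_real z u_def[symmetric] field_simps)

text \<open>If \<open>mu\<close> vanishes, the direction of \<open>\<kappa>\<close> is parallel.\<close>

lemma parallel_frame_1:
  assumes "\<And>z. z \<in> \<Omega> \<Longrightarrow> mu z = 0"
  shows "parallel_hopf_frame (\<lambda>j::1. \<lambda>z. inverse (of_real (rt z)) *s kap z) (\<lambda>j. rt)"
proof -
  have "Mb z = 0" if "z \<in> \<Omega>" for z using assms[OF that] vcnj_mu[OF that] by simp
  then have "hasD (\<lambda>z. inverse (of_real (rt z)) *s kap z) (\<lambda>z. 0) (\<lambda>z. 0)"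
    by (intro hasD_congD[OF hasD_unit_kap]) (simp_all add: assms)
  then show ?thesis unfolding parallel_hopf_frame_def using smooth_rt unit_kap by simp
qed

end

locale affine_sqrt = isothermic_willmore +
  fixes \<alpha> :: real and \<eta> :: complex
  assumes aff_nz: "\<alpha> \<noteq> 0 \<or> \<eta> \<noteq> 0" and aff_Q: "z \<in> \<Omega> \<Longrightarrow> (of_real \<alpha> * z + \<eta>)\<^sup>2 = Q z"
begin

definition "hh z = of_real \<alpha> * z + \<eta>"

lemma hh_Q: "z \<in> \<Omega> \<Longrightarrow> (hh z)\<^sup>2 = Q z" unfolding hh_def by (rule aff_Q)

lemma hh_field: "(hh has_field_derivative of_real \<alpha>) (at z)"
  unfolding hh_def[abs_def] by (auto intro!: derivative_eq_intros)

lemma has_wirtc_hh: "has_wirtc hh (of_real \<alpha>) 0 z" by (rule has_wirtc_field[OF hh_field])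

lemma smooth_hh: "smooth_on \<Omega> hh" unfolding hh_def[abs_def] by (intro smooth_intros open_dom)

text \<open>The zero set of \<open>hh\<close> is at most one point. Identities obtained by cancelling \<open>hh\<close> extend over it by
  continuity.\<close>

lemma eq_off_zero:
  fixes F G :: "complex \<Rightarrow> 'b::real_normed_vector"
  assumes c: "continuous_on \<Omega> F" "continuous_on \<Omega> G" and e: "\<And>w. w \<in> \<Omega> \<Longrightarrow> hh w \<noteq> 0 \<Longrightarrow> F w = G w" and z: "z \<in> \<Omega>"
  shows "F z = G z"
proof (rule ccontr)
  assume ne: "F z \<noteq> G z"
  have "open (\<Omega> \<inter> (\<lambda>w. F w - G w) -` (- {0}))"
    by (rule continuous_open_preimage[OF _ open_dom]) (auto intro!: continuous_intros c simp: open_Compl)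
  moreover have "z \<in> \<Omega> \<inter> (\<lambda>w. F w - G w) -` (- {0})" using ne z by simp
  ultimately obtain r where r: "r > 0" "ball z r \<subseteq> \<Omega> \<inter> (\<lambda>w. F w - G w) -` (- {0})" using open_contains_ball by blast
  have 0: "hh w = 0" if "w \<in> ball z r" for w
  proof -
    have "w \<in> \<Omega>" "F w \<noteq> G w" using r(2) that by auto
    then show ?thesis using e by blast
  qed
  have "hh z = 0" "hh (z + of_real (r / 2)) = 0" using r by (auto intro!: 0 simp: dist_norm)
  note h0 = this[unfolded hh_def]
  have 1: "of_real \<alpha> * z + \<eta> = 0" by (rule h0(1))
  have "of_real \<alpha> * (z + of_real (r / 2)) + \<eta> = (of_real \<alpha> * z + \<eta>) + of_real \<alpha> * of_real (r / 2)"
    by (simp only: distrib_left add_ac)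
  with h0(2) have 2: "(of_real \<alpha> * z + \<eta>) + of_real \<alpha> * of_real (r / 2) = 0" by simp
  from 2 have "of_real \<alpha> * of_real (r / 2) = (0 :: complex)" unfolding 1 by (simp only: add_0_left)
  then have "\<alpha> = 0" using r(1) by simp
  moreover from this have "\<eta> = 0" using 1 by simp
  ultimately have "\<alpha> = 0" "\<eta> = 0" .
  then show False using aff_nz by simp
qed

text \<open>The real vector field with \<open>Mb = hh w\<close>. At a zero of \<open>hh\<close> it cannot be defined by division; but then
  \<open>\<alpha> \<noteq> 0\<close>, and \<open>hh Xp = \<alpha> Mb\<close> provides a smooth formula.\<close>

definition "w z = (if \<alpha> \<noteq> 0 then of_real (1 / \<alpha>) *s Xp z else inverse \<eta> *s Mb z)"

lemma w_rel: assumes z: "z \<in> \<Omega>" shows "Mb z = hh z *s w z" "mu z = cnj (hh z) *s w z"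
proof -
  show 1: "Mb z = hh z *s w z"
  proof (cases "\<alpha> = 0")
    case True then show ?thesis unfolding w_def hh_def using aff_nz by simp
  next
    case False
    have "hh z *s Xp z = of_real \<alpha> *s Mb z"
      using sqrt_Q_derivative[OF open_dom order_refl z hh_Q hh_field] by simp
    then have "hh z * Xp z $ i = of_real \<alpha> * Mb z $ i" for i by (simp add: vec_eq_iff)
    then show ?thesis using False by (simp add: w_def vec_eq_iff field_simps)
  qed
  show "mu z = cnj (hh z) *s w z"
  proof (cases "\<alpha> = 0")
    case True
    then have n: "\<eta> \<noteq> 0" "hh z = \<eta>" using aff_nz unfolding hh_def by auto
    have "\<eta> *s mu z = cnj \<eta> *s Mb z" using sqrt_Q_real(1)[OF z hh_Q[OF z]] n by simp
    then have "\<eta> * mu z $ i = cnj \<eta> * Mb z $ i" for i by (simp add: vec_eq_iff)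
    moreover have "w z = inverse \<eta> *s Mb z" unfolding w_def using True by simp
    ultimately have "\<eta> * mu z $ i = \<eta> * (cnj \<eta> * w z $ i)" for i using n(1) by simp
    then show ?thesis unfolding n(2) using n(1) by (simp add: vec_eq_iff)
  next
    case False
    then have "vcnj (w z) = w z" by (simp add: w_def Xp_props z)
    then show ?thesis using arg_cong[OF 1, of vcnj] by (simp add: vcnj_Mb z)
  qed
qed

lemma w_real: assumes z: "z \<in> \<Omega>" shows "vcnj (w z) = w z"
proof (cases "\<alpha> = 0")
  case True
  then have n: "\<eta> \<noteq> 0" "hh z = \<eta>" using aff_nz unfolding hh_def by auto
  have "Mb z = hh z *s vcnj (w z)"
    using arg_cong[OF w_rel(2)[OF z], of vcnj] unfolding vcnj_mu[OF z] by simp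
  then have "hh z *s vcnj (w z) = hh z *s w z" using w_rel(1)[OF z] by (rule subst)
  moreover have "hh z \<noteq> 0" using n by simp
  ultimately show ?thesis by (metis vector_mul_lcancel)
qed (simp add: w_def Xp_props z)

lemma w_sect: "sect w"
proof (cases "\<alpha> = 0")
  case True
  have "sect (\<lambda>z. inverse \<eta> *s Mb z)" using perp_mu(2) smooth_scalars(5)
    by (intro sect_scale smooth_on_const) (auto simp: sect_def)
  then show ?thesis using True unfolding w_def[abs_def] by simp
next
  case False
  have "smooth_on \<Omega> (\<lambda>z. X z - (lorentz (X z) (kap z) * inverse (u z)) *s kap z)"
    by (intro smooth_intros open_dom smooth_scalars smooth_fields u_pos(3))
  then have "smooth_on \<Omega> Xp" unfolding Xp_def[abs_def] by (simp add: field_simps)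
  then have "sect (\<lambda>z. of_real (1/\<alpha>) *s Xp z)" using Xp_props(3)
    by (intro sect_scale smooth_on_const) (auto simp: sect_def)
  then show ?thesis using False unfolding w_def[abs_def] by simp
qed

lemma w_kap: "z \<in> \<Omega> \<Longrightarrow> lorentz (w z) (kap z) = 0" "z \<in> \<Omega> \<Longrightarrow> lorentz (kap z) (w z) = 0"
  using Xp_props(1) kap_mu by (auto simp: w_def lorentz_commute[of "kap z"])

lemma smooth_w: "smooth_on \<Omega> w" using w_sect unfolding sect_def by blast

lemma w_w: assumes z: "z \<in> \<Omega>" shows "u z * lorentz (w z) (w z) = 1"
proof (rule eq_off_zero[OF _ _ _ z])
  have "smooth_on \<Omega> (\<lambda>z. u z * lorentz (w z) (w z))" by (intro smooth_intros open_dom smooth_scalars smooth_w)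
  then show "continuous_on \<Omega> (\<lambda>z. u z * lorentz (w z) (w z))" by (rule smooth_on_imp_continuous_on)
  fix z assume z: "z \<in> \<Omega>" and nz: "hh z \<noteq> 0"
  have "(hh z)\<^sup>2 * lorentz (w z) (w z) = (hh z)\<^sup>2 / u z"
    using Mb_Mb(1)[OF z] unfolding w_rel(1)[OF z] hh_Q[OF z, symmetric] by (simp add: power2_eq_square mult.assoc)
  then show "u z * lorentz (w z) (w z) = 1" using nz u_pos(3)[OF z] by (simp add: field_simps)
qed simp

lemma hasD_w: "hasD w (\<lambda>z. - (f0 z *s w z) - (cnj (hh z) / (u z)\<^sup>2) *s kap z) (\<lambda>z. - (cnj (f0 z) *s w z) - (hh z / (u z)\<^sup>2) *s kap z)"
proof -
  have "smooth_on \<Omega> (\<lambda>z. - (f0 z *s w z) - (cnj (hh z) * inverse (u z) * inverse (u z)) *s kap z)"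
    by (intro smooth_intros open_dom smooth_f0 smooth_w smooth_hh smooth_scalars smooth_fields u_pos(3))
  then have sm: "smooth_on \<Omega> (\<lambda>z. - (f0 z *s w z) - (cnj (hh z) / (u z)\<^sup>2) *s kap z)" by (simp add: field_simps power2_eq_square)
  have hw: "hasD w (\<lambda>z. pr z (wirt w z)) (\<lambda>z. pr z (wirtbar w z))" by (rule hasDI[OF w_sect])
  have chs: "smooth_on \<Omega> (\<lambda>z. cnj (hh z))" by (intro smooth_intros open_dom smooth_hh)
  have ch: "has_wirtc (\<lambda>z. cnj (hh z)) 0 (of_real \<alpha>) z" for z using has_wirtc_cnj[OF has_wirtc_hh[of z]] by simp
  have a: "pr z (wirt w z) = - (f0 z *s w z) - (cnj (hh z) / (u z)\<^sup>2) *s kap z" if z: "z \<in> \<Omega>" for z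
  proof (rule eq_off_zero[OF _ _ _ z])
    show "continuous_on \<Omega> (\<lambda>z. pr z (wirt w z))"
      using hw unfolding hasD_def sect_def by (intro smooth_on_imp_continuous_on) blast
    show "continuous_on \<Omega> (\<lambda>z. - (f0 z *s w z) - (cnj (hh z) / (u z)\<^sup>2) *s kap z)" by (rule smooth_on_imp_continuous_on[OF sm])
    fix z assume z: "z \<in> \<Omega>" and nz: "hh z \<noteq> 0"
    have "0 *s w z + cnj (hh z) *s pr z (wirt w z) = - (f0 z *s mu z) - (cnj (Q z) / (u z)\<^sup>2) *s kap z"
      by (rule hasD_unique(1)[OF hasD_scale[OF chs ch hw] hasD_mu _ z]) (simp add: w_rel)
    then have "cnj (hh z) * pr z (wirt w z) $ i = cnj (hh z) * (- (f0 z * w z $ i) - (cnj (hh z) / (u z)\<^sup>2) * kap z $ i)" for i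
      unfolding w_rel(2)[OF z] hh_Q[OF z, symmetric]
      by (simp add: vec_eq_iff) (simp add: algebra_simps power2_eq_square)
    then show "pr z (wirt w z) = - (f0 z *s w z) - (cnj (hh z) / (u z)\<^sup>2) *s kap z"
      using nz by (simp add: vec_eq_iff)
  qed
  have b: "pr z (wirtbar w z) = - (cnj (f0 z) *s w z) - (hh z / (u z)\<^sup>2) *s kap z" if z: "z \<in> \<Omega>" for z
    using hasD_unique(2)[OF hw hasD_vcnj[OF hw] w_real[symmetric] z] a[OF z] by (simp add: w_real z kap_real cnj_u)
  show ?thesis by (rule hasD_congD[OF hw a b])
qed

lemma hasD_unit_w: "hasD (\<lambda>z. of_real (rt z) *s w z) (\<lambda>z. - (cnj (hh z) / u z) *s (inverse (of_real (rt z)) *s kap z))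
   (\<lambda>z. - (hh z / u z) *s (inverse (of_real (rt z)) *s kap z))"
proof -
  have s: "smooth_on \<Omega> (\<lambda>z. complex_of_real (rt z))" by (intro smooth_intros open_dom smooth_rt)
  have e: "of_real (rt z) * (k / (u z)\<^sup>2) = k / u z * inverse (of_real (rt z))" if "z \<in> \<Omega>" for z k
    using rt_sq[OF that] rt_pos[OF that] u_pos(3)[OF that]
    by (simp add: field_simps power2_eq_square)
  show ?thesis
    by (rule hasD_congD[OF hasD_scale[OF s has_wirtc_rt hasD_w]])
      (simp_all add: e vec_eq_iff algebra_simps mult.assoc[symmetric] del: times_divide_eq_right)
qed

text \<open>The unit fields \<open>\<kappa>/|\<kappa>|\<close> and \<open>|\<kappa>| w\<close> rotate with velocity \<open>d\<theta>\<close>; turning them back by the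
  angle \<open>\<theta>\<close> makes them parallel.\<close>

theorem parallel_frame_2:
  assumes ball: "\<Omega> = ball p r"
  obtains \<xi> :: "2 \<Rightarrow> complex \<Rightarrow> complex ^ 'a option" and K where "parallel_hopf_frame \<xi> K"
proof -
  define g where "g z = cnj (hh z) * inverse (u z)" for z
  have sg: "smooth_on \<Omega> g" unfolding g_def[abs_def] by (intro smooth_intros open_dom smooth_hh smooth_scalars u_pos(3))
  have closed: "cnj (wirtbarc g z) = wirtbarc g z" if z: "z \<in> \<Omega>" for z
  proof -
    have "has_wirtc g (cnj 0 * inverse (u z) + cnj (hh z) * - (uz z * inverse (u z) ^ 2))
       (cnj (of_real \<alpha>) * inverse (u z) + cnj (hh z) * - (cnj (uz z) * inverse (u z) ^ 2)) z"
      unfolding g_def[abs_def] by (intro wirt_intros has_wirtc_hh has_wirtc_u u_pos(3) z)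
    then have "wirtbarc g z = of_real \<alpha> * inverse (u z) - (cnj (hh z) * cnj (uz z)) * inverse (u z) ^ 2"
      using has_wirtcD(2) by force
    moreover have "hh z * uz z = cnj (hh z) * cnj (uz z)" by (rule sqrt_Q_real(2)[OF z hh_Q[OF z]])
    ultimately show ?thesis by (simp add: cnj_u z)
  qed
  obtain \<theta> where \<theta>: "smooth_on \<Omega> \<theta>" "\<And>z. z \<in> \<Omega> \<Longrightarrow> has_wirtc (\<lambda>z. of_real (\<theta> z)) (g z) (cnj (g z)) z"
    using closed_form_potential[of p r g] sg closed unfolding ball by metis
  define C S where "C z = complex_of_real (cos (\<theta> z))" and "S z = complex_of_real (sin (\<theta> z))" for z
  have sCS: "smooth_on \<Omega> C" "smooth_on \<Omega> S" unfolding C_def[abs_def] S_def[abs_def] by (intro smooth_intros open_dom \<theta>)+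
  have CS: "has_wirtc C (- S z * g z) (- S z * cnj (g z)) z" "has_wirtc S (C z * g z) (C z * cnj (g z)) z" if z: "z \<in> \<Omega>" for z
  proof -
    have C': "C = (\<lambda>z. cos (of_real (\<theta> z)))" and S': "S = (\<lambda>z. sin (of_real (\<theta> z)))" unfolding C_def S_def by (simp_all add: fun_eq_iff cos_of_real sin_of_real)
    show "has_wirtc C (- S z * g z) (- S z * cnj (g z)) z"
      unfolding C' S' by (rule has_wirtc_chain[OF DERIV_cos \<theta>(2)[OF z]])
    show "has_wirtc S (C z * g z) (C z * cnj (g z)) z"
      unfolding C' S' by (rule has_wirtc_chain[OF DERIV_sin \<theta>(2)[OF z]])
  qed
  have CS1: "C z * C z + S z * S z = 1" for z
    unfolding C_def S_def of_real_mult[symmetric] of_real_add[symmetric] by (simp add: power2_eq_square[symmetric])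
  define f1 f2 where "f1 z = inverse (of_real (rt z)) *s kap z" and "f2 z = of_real (rt z) *s w z" for z
  have D1: "hasD f1 (\<lambda>z. g z *s f2 z) (\<lambda>z. cnj (g z) *s f2 z)"
  proof (rule hasD_congD[OF hasD_unit_kap[folded f1_def[abs_def]]])
    fix z assume z: "z \<in> \<Omega>"
    have "inverse (of_real (rt z)) = inverse (u z) * of_real (rt z)"
      using rt_sq[OF z] rt_pos[OF z] u_pos(3)[OF z] by (simp add: field_simps)
    then show "inverse (of_real (rt z)) *s mu z = g z *s f2 z" "inverse (of_real (rt z)) *s Mb z = cnj (g z) *s f2 z"
      unfolding w_rel[OF z] g_def f2_def by (simp_all add: cnj_u z vec_eq_iff)
  qed
  have D2: "hasD f2 (\<lambda>z. - g z *s f1 z) (\<lambda>z. - cnj (g z) *s f1 z)"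
    unfolding f2_def[abs_def] f1_def[abs_def]
    by (rule hasD_congD[OF hasD_unit_w]) (simp_all add: g_def cnj_u divide_inverse)
  have smS: "smooth_on \<Omega> (\<lambda>z. - S z)" by (intro smooth_intros open_dom sCS)
  have mS: "has_wirtc (\<lambda>z. - S z) (- (C z * g z)) (- (C z * cnj (g z))) z" if "z \<in> \<Omega>" for z
    by (rule has_wirtc_minus[OF CS(2)[OF that]])
  define x1 x2 where "x1 z = C z *s f1 z + - S z *s f2 z" and "x2 z = S z *s f1 z + C z *s f2 z" for z
  have P1: "hasD x1 (\<lambda>z. 0) (\<lambda>z. 0)" unfolding x1_def[abs_def]
    by (rule hasD_congD[OF hasD_add[OF hasD_scale[OF sCS(1) CS(1) D1] hasD_scale[OF smS mS D2]]])
       (simp_all add: vec_eq_iff algebra_simps)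
  have P2: "hasD x2 (\<lambda>z. 0) (\<lambda>z. 0)" unfolding x2_def[abs_def]
    by (rule hasD_congD[OF hasD_add[OF hasD_scale[OF sCS(2) CS(2) D1] hasD_scale[OF sCS(1) CS(1) D2]]])
       (simp_all add: vec_eq_iff algebra_simps)
  have ff: "lorentz (f1 z) (f1 z) = 1" "lorentz (f1 z) (f2 z) = 0" "lorentz (f2 z) (f1 z) = 0" "lorentz (f2 z) (f2 z) = 1" if z: "z \<in> \<Omega>" for z
  proof -
    show "lorentz (f1 z) (f1 z) = 1" unfolding f1_def by (rule unit_kap(1)[OF z])
    show "lorentz (f1 z) (f2 z) = 0" "lorentz (f2 z) (f1 z) = 0" unfolding f1_def f2_def by (simp_all add: w_kap z)
    show "lorentz (f2 z) (f2 z) = 1" unfolding f2_def using w_w[OF z] rt_sq[OF z] by (simp add: mult.assoc[symmetric])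
  qed
  have re: "vcnj (x1 z) = x1 z" "vcnj (x2 z) = x2 z" if z: "z \<in> \<Omega>" for z
    unfolding x1_def x2_def f1_def f2_def C_def S_def by (simp_all add: kap_real z w_real)
  have on: "lorentz (x1 z) (x1 z) = 1" "lorentz (x1 z) (x2 z) = 0" "lorentz (x2 z) (x1 z) = 0" "lorentz (x2 z) (x2 z) = 1" if z: "z \<in> \<Omega>" for z
    unfolding x1_def x2_def using CS1[of z] by (simp_all add: ff[OF z] algebra_simps)
  have kk: "kap z = of_real (rt z * cos (\<theta> z)) *s x1 z + of_real (rt z * sin (\<theta> z)) *s x2 z" if z: "z \<in> \<Omega>" for z
  proof -
    have "C z *s x1 z + S z *s x2 z = (C z * C z + S z * S z) *s f1 z"
      unfolding x1_def x2_def by (simp add: vec_eq_iff algebra_simps)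
    then have "of_real (rt z) *s (C z *s x1 z + S z *s x2 z) = kap z"
      unfolding CS1 f1_def using unit_kap(3)[OF z] by simp
    then show ?thesis unfolding C_def S_def by (simp add: vec_eq_iff algebra_simps)
  qed
  define \<xi> where "\<xi> j = (if j = (1::2) then x1 else x2)" for j
  define K where "K j z = rt z * (if j = (1::2) then cos (\<theta> z) else sin (\<theta> z))" for j z
  have two: "j = 1 \<or> j = 2" for j :: 2 using exhaust_2 by blast
  have "parallel_hopf_frame \<xi> K"
    unfolding parallel_hopf_frame_def
  proof (intro conjI allI ballI)
    show "hasD (\<xi> j) (\<lambda>z. 0) (\<lambda>z. 0)" for j unfolding \<xi>_def using P1 P2 by simp
    show "vcnj (\<xi> j z) = \<xi> j z" if "z \<in> \<Omega>" for j z unfolding \<xi>_def using re[OF that] by simp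
    show "lorentz (\<xi> i z) (\<xi> j z) = (if i = j then 1 else 0)" if "z \<in> \<Omega>" for i j z
      using on[OF that] two[of i] two[of j] unfolding \<xi>_def by auto
    show "smooth_on \<Omega> (K j)" for j
      using two[of j] unfolding K_def[abs_def] by (auto intro!: smooth_intros open_dom smooth_rt \<theta>)
    show "kap z = (\<Sum>j\<in>UNIV. of_real (K j z) *s \<xi> j z)" if "z \<in> \<Omega>" for z
      unfolding sum_2 K_def \<xi>_def using kk[OF that] by simp
  qed
  then show ?thesis by (rule that)
qed

end

section \<open>Round spheres and Lorentz subspaces\<close>

lemma lorentz_orthogonal_independent:
  fixes e :: "'k::finite \<Rightarrow> real ^ 'n::finite option"
  assumes orth: "\<And>i j. i \<noteq> j \<Longrightarrow> lorentz (e i) (e j) = 0" and nz: "\<And>i. lorentz (e i) (e i) \<noteq> 0"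
  shows "dim (span (range e)) = CARD('k)"
proof -
  have inj: "inj e" using orth nz by (metis injI)
  have "independent (range e)"
  proof
    assume "dependent (range e)"
    then obtain c where c: "\<exists>v\<in>range e. c v \<noteq> 0" "(\<Sum>v\<in>range e. c v *\<^sub>R v) = 0"
      by (subst (asm) dependent_finite) auto
    then obtain i where i: "c (e i) \<noteq> 0" by auto
    have "(\<Sum>j\<in>UNIV. c (e j) *\<^sub>R e j) = 0" using c(2) inj by (simp add: sum.reindex)
    then have "lorentz (\<Sum>j\<in>UNIV. c (e j) *\<^sub>R e j) (e i) = 0" by simp
    then have "(\<Sum>j\<in>UNIV. c (e j) * lorentz (e j) (e i)) = 0" by (simp add: lorentz_sum)
    moreover have "(\<Sum>j\<in>UNIV. c (e j) * lorentz (e j) (e i)) = (\<Sum>j\<in>UNIV. if j = i then c (e i) * lorentz (e i) (e i) else 0)"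
      using orth by (intro sum.cong) auto
    ultimately show False using i nz by simp
  qed
  then show ?thesis using inj by (simp add: dim_eq_card_independent card_image)
qed

lemma null_vec_diff: "null_vec x - null_vec y = space_vec (x - y)"
  unfolding null_vec_eq by (simp add: linear_diff[OF bounded_linear.linear[OF bounded_linear_space_vec]])

lemma space_vec_linear: "space_vec (x + y) = space_vec x + space_vec y" "space_vec (c *\<^sub>R x) = c *\<^sub>R space_vec x" "space_vec 0 = 0"
  by (simp_all add: linear_add[OF bounded_linear.linear[OF bounded_linear_space_vec]]
      linear_scale[OF bounded_linear.linear[OF bounded_linear_space_vec]] linear_0[OF bounded_linear.linear[OF bounded_linear_space_vec]])

text \<open>A subspace containing a time-like vector cuts the sphere in the intersection with an affine
  subspace that meets the open ball; the centre of the resulting sphere is the point of the affine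
  subspace closest to the origin.\<close>

lemma round_sphere_of_subspace:
  fixes W :: "(real ^ 'n::finite option) set"
  assumes W: "subspace W" "dim W = m + 2" and t: "t \<in> W" "lorentz t t < 0"
  defines "S \<equiv> {x \<in> sphere 0 1. null_vec x \<in> W}"
  shows "round_sphere m S" "lorentz_span S = W"
proof -
  have nn: "null_vec (x + w) = null_vec x + space_vec w" for x w :: "real ^ 'n"
    unfolding null_vec_eq by (simp add: space_vec_linear)
  define W0 where "W0 = {x. space_vec x \<in> W}"
  have W0: "subspace W0" unfolding W0_def subspace_def using W(1)
    by (auto simp: space_vec_linear subspace_add subspace_scale subspace_0)
  have dec: "v = v $ None *\<^sub>R null_vec x + space_vec ((\<chi> k. v $ Some k) - v $ None *\<^sub>R x)" for v :: "real ^ 'n option" and x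
  proof -
    have "v $ i = (v $ None *\<^sub>R null_vec x + space_vec ((\<chi> k. v $ Some k) - v $ None *\<^sub>R x)) $ i" for i
      by (cases i) auto
    then show ?thesis by (intro vec_eq_iff[THEN iffD2] allI)
  qed
  have t0: "t $ None \<noteq> 0"
  proof
    assume "t $ None = 0"
    then have "lorentz t t = (\<Sum>k\<in>UNIV. t $ Some k * t $ Some k)" by (simp add: lorentz_def)
    then show False using t(2) sum_nonneg[of UNIV "\<lambda>k. t $ Some k * t $ Some k"] by simp
  qed
  define a0 where "a0 = (1 / t $ None) *\<^sub>R (\<chi> k. t $ Some k)"
  have "(\<chi> k. t $ Some k) - t $ None *\<^sub>R a0 = 0" using t0 unfolding a0_def by simp
  then have ta: "t = t $ None *\<^sub>R null_vec a0" using dec[of t a0] by (simp only: space_vec_linear add_0_right)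
  have "(1 / t $ None) *\<^sub>R t = (1 / t $ None) *\<^sub>R (t $ None *\<^sub>R null_vec a0)" by (rule arg_cong[OF ta])
  then have "null_vec a0 = (1 / t $ None) *\<^sub>R t" using t0 by simp
  then have a0W: "null_vec a0 \<in> W" using t(1) W(1) by (simp add: subspace_scale)
  have "lorentz t t = (t $ None)\<^sup>2 * (a0 \<bullet> a0 - 1)"
    by (subst (1 2) ta) (simp add: lorentz_null_vec power2_eq_square)
  then have a01: "a0 \<bullet> a0 < 1" using t(2) t0 by (simp add: mult_less_0_iff)
  \<comment> \<open>The point of the affine subspace through \<open>a0\<close> with direction \<open>W0\<close> that is closest to the origin.\<close>
  obtain b a where ba: "b \<in> span W0" "\<And>w. w \<in> span W0 \<Longrightarrow> orthogonal a w" "a0 = b + a"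
    using orthogonal_subspace_decomp_exists[of W0 a0] by metis
  have sW0: "span W0 = W0" using W0 by (rule span_eq_iff[THEN iffD2])
  have bW: "b \<in> W0" and aw: "a \<bullet> w = 0" if "w \<in> W0" for w using ba that unfolding sW0 orthogonal_def by auto
  have bW: "b \<in> W0" using ba(1) sW0 by simp
  have "null_vec a = null_vec a0 - space_vec b" using nn[of a b] ba(3) by (simp add: add.commute)
  then have aW: "null_vec a \<in> W" using a0W bW W(1) unfolding W0_def by (simp add: subspace_diff)
  have "a0 \<bullet> a0 = b \<bullet> b + a \<bullet> a" unfolding ba(3) using aw[OF bW] by (simp add: inner_add inner_commute)
  then have a1: "a \<bullet> a < 1" using a01 inner_ge_zero[of b] by linarith
  define A where "A = {x. null_vec x \<in> W}"
  have A: "A = (+) a ` W0"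
  proof -
    have "x \<in> A \<longleftrightarrow> x - a \<in> W0" for x
    proof -
      have d: "space_vec (x - a) = null_vec x - null_vec a" by (rule null_vec_diff[symmetric])
      have "null_vec x = null_vec a + space_vec (x - a)" unfolding d by simp
      then show ?thesis unfolding A_def W0_def mem_Collect_eq
        using subspace_add[OF W(1) aW, of "space_vec (x - a)"] subspace_diff[OF W(1) _ aW, of "null_vec x"] d by metis
    qed
    moreover have "x \<in> (+) a ` W0 \<longleftrightarrow> x - a \<in> W0" for x
    proof
      assume "x - a \<in> W0"
      then have "a + (x - a) \<in> (+) a ` W0" by (rule imageI)
      then show "x \<in> (+) a ` W0" by simp
    qed auto
    ultimately show ?thesis by blast
  qed
  have gen: "span (insert (null_vec a) (space_vec ` W0)) = W"
  proof
    show "span (insert (null_vec a) (space_vec ` W0)) \<subseteq> W"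
      by (rule span_minimal[OF _ W(1)]) (auto simp: aW W0_def)
    show "W \<subseteq> span (insert (null_vec a) (space_vec ` W0))"
    proof
      fix v assume v: "v \<in> W"
      let ?x = "(\<chi> k. v $ Some k) - v $ None *\<^sub>R a"
      have "space_vec ?x = v - v $ None *\<^sub>R null_vec a" using dec[of v a] by (simp add: algebra_simps)
      then have "?x \<in> W0" using v aW W(1) unfolding W0_def by (simp add: subspace_diff subspace_scale)
      then show "v \<in> span (insert (null_vec a) (space_vec ` W0))"
        by (subst dec[of v a]) (intro span_add span_scale span_base, auto)
    qed
  qed
  have "inj (space_vec :: real ^ 'n \<Rightarrow> _)"
    by (rule injI) (metis (no_types, lifting) space_vec_nth(2) vec_eq_iff)
  then have d0: "dim (space_vec ` W0) = dim W0"
    by (intro dim_image_eq bounded_linear.linear[OF bounded_linear_space_vec]) (auto intro: inj_on_subset)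
  have "null_vec a \<notin> span (space_vec ` W0)"
  proof
    have "span (space_vec ` W0) \<subseteq> {v. v $ None = 0}"
      by (rule span_minimal) (auto simp: subspace_def)
    moreover assume "null_vec a \<in> span (space_vec ` W0)"
    ultimately show False by force
  qed
  then have "dim W = dim W0 + 1" using dim_insert[of "null_vec a" "space_vec ` W0"] d0 gen by (metis dim_span)
  then have dW0: "dim W0 = m + 1" using W(2) by simp
  have "aff_dim A = int (dim W0)" unfolding A using aff_dim_translation_eq[of a W0] aff_dim_subspace[OF W0] by simp
  then have aff: "aff_dim A = int m + 1" using dW0 by simp
  have "affine A" unfolding A using affine_translation[of W0 a] subspace_imp_affine[OF W0] by simp
  moreover have aA: "a \<in> A" unfolding A_def using aW by simp
  moreover define \<rho> where "\<rho> = sqrt (1 - a \<bullet> a)"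
  have \<rho>: "\<rho> > 0" "\<rho>\<^sup>2 = 1 - a \<bullet> a" unfolding \<rho>_def using a1 by auto
  have sph: "a + w \<in> sphere 0 1 \<longleftrightarrow> a + w \<in> sphere a \<rho>" if w: "w \<in> W0" for w
  proof -
    have "(norm (a + w))\<^sup>2 = a \<bullet> a + (norm w)\<^sup>2" unfolding power2_norm_eq_inner using aw[OF w] by (simp add: inner_add inner_commute)
    moreover have "norm (a + w) = 1 \<longleftrightarrow> (norm (a + w))\<^sup>2 = 1" by (simp add: power2_eq_1_iff) (smt (verit) norm_ge_zero)
    moreover have "norm w = \<rho> \<longleftrightarrow> (norm w)\<^sup>2 = \<rho>\<^sup>2" using \<rho>(1) by (simp add: power2_eq_iff_nonneg)
    moreover have "norm (a - (a + w)) = norm w" by simp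
    ultimately show ?thesis using \<rho>(2) unfolding mem_sphere_0 unfolding mem_sphere dist_norm by auto
  qed
  have S: "S = A \<inter> sphere a \<rho>"
  proof -
    have "x \<in> S \<longleftrightarrow> x \<in> A \<and> x \<in> sphere 0 1" for x unfolding S_def A_def by blast
    moreover have "x \<in> sphere 0 1 \<longleftrightarrow> x \<in> sphere a \<rho>" if "x \<in> A" for x using that sph unfolding A by blast
    ultimately show ?thesis by blast
  qed
  show "round_sphere m S"
    unfolding round_sphere_def
  proof (intro conjI exI)
    show "S \<subseteq> sphere 0 1" unfolding S_def by auto
    show "affine A" by fact
    show "aff_dim A = int m + 1" by (rule aff)
    show "a \<in> A" by (rule aA)
    show "\<rho> > 0" by (rule \<rho>(1))
    show "S = A \<inter> sphere a \<rho>" by (rule S)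
  qed
  have pts: "a + (\<rho> / norm w) *\<^sub>R w \<in> S" if w: "w \<in> W0" "w \<noteq> 0" for w
  proof -
    have "(\<rho> / norm w) *\<^sub>R w \<in> W0" using W0 w by (simp add: subspace_scale)
    then show ?thesis unfolding S A using w \<rho> by (auto simp: dist_norm)
  qed
  \<comment> \<open>Half the sum and difference of the null vectors of two antipodal points.\<close>
  have two: "space_vec w \<in> lorentz_span S" "null_vec a \<in> lorentz_span S" if w: "w \<in> W0" "w \<noteq> 0" for w
  proof -
    let ?c = "\<rho> / norm w"
    have c: "?c \<noteq> 0" using w \<rho> by simp
    have m: "- w \<in> W0" "- w \<noteq> 0" using w W0 by (auto simp: subspace_neg)
    have 1: "null_vec a + ?c *\<^sub>R space_vec w \<in> lorentz_span S"
      using span_base[OF imageI[OF pts[OF w], of null_vec]] unfolding lorentz_span_def nn by (simp add: space_vec_linear)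
    have 2: "null_vec a + - (?c *\<^sub>R space_vec w) \<in> lorentz_span S"
      using span_base[OF imageI[OF pts[OF m], of null_vec]] unfolding lorentz_span_def nn
      using space_vec_linear(2)[of "- ?c" w] by (simp add: space_vec_linear)
    have sub: "subspace (lorentz_span S)" unfolding lorentz_span_def by (rule subspace_span)
    have "(1/2) *\<^sub>R ((null_vec a + ?c *\<^sub>R space_vec w) + (null_vec a + - (?c *\<^sub>R space_vec w))) \<in> lorentz_span S"
      by (rule subspace_scale[OF sub subspace_add[OF sub 1 2]])
    then show "null_vec a \<in> lorentz_span S" by (simp add: scaleR_2[symmetric])
    have "(1/(2*?c)) *\<^sub>R ((null_vec a + ?c *\<^sub>R space_vec w) - (null_vec a + - (?c *\<^sub>R space_vec w))) \<in> lorentz_span S"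
      by (rule subspace_scale[OF sub subspace_diff[OF sub 1 2]])
    then show "space_vec w \<in> lorentz_span S" using c by (simp add: scaleR_2[symmetric])
  qed
  show "lorentz_span S = W"
  proof
    show "lorentz_span S \<subseteq> W" unfolding lorentz_span_def by (rule span_minimal[OF _ W(1)]) (auto simp: S_def)
    have "W0 \<noteq> {0}" using dW0 by auto
    then obtain w where "w \<in> W0" "w \<noteq> 0" using subspace_0[OF W0] by blast
    then have "null_vec a \<in> lorentz_span S" using two(2) by blast
    moreover have "space_vec w \<in> lorentz_span S" if "w \<in> W0" for w
      using two(1)[of w] that by (cases "w = 0") (auto simp: space_vec_linear lorentz_span_def span_zero)
    ultimately have "span (insert (null_vec a) (space_vec ` W0)) \<subseteq> lorentz_span S"
      unfolding lorentz_span_def by (intro span_minimal subspace_span) auto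
    then show "W \<subseteq> lorentz_span S" using gen by simp
  qed
qed

section \<open>Surfaces in a round subsphere\<close>

context lightcone_lift
begin

text \<open>The projection onto the span of the frame of \<open>V\<close> and orthonormal normal vectors \<open>\<xi> j z\<close>, \<open>j \<in> J\<close>.\<close>

definition PiW :: "'j set \<Rightarrow> ('j \<Rightarrow> complex \<Rightarrow> complex ^ 'n option) \<Rightarrow> complex \<Rightarrow> complex ^ 'n option \<Rightarrow> complex ^ 'n option" where
  "PiW J \<xi> z X = - (lorentz X (N z) *s \<psi> z) - lorentz X (\<psi> z) *s N z + (2 * lorentz X (Pb z)) *s P z
     + (2 * lorentz X (P z)) *s Pb z + (\<Sum>j\<in>J. lorentz X (\<xi> j z) *s \<xi> j z)"

lemma has_wirt_sum: "(\<And>i. i \<in> I \<Longrightarrow> has_wirt (f i) (a i) (b i) z) \<Longrightarrow>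
   has_wirt (\<lambda>z. \<Sum>i\<in>I. f i z) (\<Sum>i\<in>I. a i) (\<Sum>i\<in>I. b i) z"
  by (induction I rule: infinite_finite_induct) (auto intro: wirt_intros)

text \<open>The orthogonal projection onto the span of the frame and of parallel normal fields spanning
  the Hopf differential does not depend on the point: all terms cancel in the structure equations.\<close>

lemma wirt_PiW_zero:
  assumes D: "\<And>j. j \<in> J \<Longrightarrow> hasD (\<xi> j) (\<lambda>z. 0) (\<lambda>z. 0)" and z: "z \<in> \<Omega>"
    and k: "(\<Sum>j\<in>J. lorentz (\<xi> j z) (kap z) *s \<xi> j z) = kap z" "(\<Sum>j\<in>J. lorentz (\<xi> j z) (dk z) *s \<xi> j z) = dk z"
  obtains b where "has_wirt (\<lambda>z. PiW J \<xi> z X) 0 b z"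
proof -
  have x: "has_wirt (\<xi> j) ((2 * lorentz (\<xi> j z) (dk z)) *s \<psi> z - (2 * lorentz (\<xi> j z) (kap z)) *s Pb z)
      ((2 * lorentz (\<xi> j z) (vcnj (dk z))) *s \<psi> z - (2 * lorentz (\<xi> j z) (vcnj (kap z))) *s P z) z" if "j \<in> J" for j
    using D[OF that] z unfolding hasD_def by simp
  have cw: "has_wirtc (\<lambda>z. lorentz X (F z)) (lorentz X a) (lorentz X b) z" if "has_wirt F a b z" for F a b
    using has_wirtc_lorentz[OF has_wirt_const[of X] that] by simp
  note w = has_wirt_psi[OF z] has_wirt_P[OF z] has_wirt_Pb[OF z] has_wirt_N[OF z]
  have two: "has_wirtc (\<lambda>z. 2 * f z) (2 * a) (2 * b) z" if "has_wirtc f a b z" for f a b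
    using has_wirtc_mult[OF has_wirtc_const[of 2] that] by simp
  let ?x = "\<lambda>j. (2 * lorentz (\<xi> j z) (dk z)) *s \<psi> z - (2 * lorentz (\<xi> j z) (kap z)) *s Pb z"
  define a where "a = - (lorentz X (2 *s dk z - (2 * mm z) *s P z - cc z *s Pb z) *s \<psi> z + lorentz X (N z) *s P z)
      - (lorentz X (P z) *s N z + lorentz X (\<psi> z) *s (2 *s dk z - (2 * mm z) *s P z - cc z *s Pb z))
      + ((2 * lorentz X (Y z)) *s P z + (2 * lorentz X (Pb z)) *s Z z) + ((2 * lorentz X (Z z)) *s Pb z + (2 * lorentz X (P z)) *s Y z)
      + (\<Sum>j\<in>J. lorentz X (?x j) *s \<xi> j z + lorentz X (\<xi> j z) *s ?x j)"
  have "\<exists>b. has_wirt (\<lambda>z. PiW J \<xi> z X) a b z"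
    unfolding PiW_def a_def
    by (rule exI, rule has_wirt_add[OF has_wirt_add[OF has_wirt_add[OF has_wirt_diff[OF has_wirt_minus[OF has_wirt_scale[OF cw[OF w(4)] w(1)]] has_wirt_scale[OF cw[OF w(1)] w(4)]]
        has_wirt_scale[OF two[OF cw[OF w(3)]] w(2)]] has_wirt_scale[OF two[OF cw[OF w(2)]] w(3)]] has_wirt_sum[OF has_wirt_scale[OF cw[OF x] x]]]; assumption)
  then obtain b where ab: "has_wirt (\<lambda>z. PiW J \<xi> z X) a b z" by blast
  have kX: "(\<Sum>j\<in>J. lorentz (\<xi> j z) v * lorentz X (\<xi> j z)) = lorentz X v" if "(\<Sum>j\<in>J. lorentz (\<xi> j z) v *s \<xi> j z) = v" for v
    using arg_cong[OF that, of "lorentz X"] by (simp add: lorentz_commute[of X] lorentz_sum)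
  have "(\<Sum>j\<in>J. lorentz X (?x j) *s \<xi> j z + lorentz X (\<xi> j z) *s ?x j) =
     (2 * lorentz X (\<psi> z)) *s (\<Sum>j\<in>J. lorentz (\<xi> j z) (dk z) *s \<xi> j z) - (2 * lorentz X (Pb z)) *s (\<Sum>j\<in>J. lorentz (\<xi> j z) (kap z) *s \<xi> j z)
     + (2 * (\<Sum>j\<in>J. lorentz (\<xi> j z) (dk z) * lorentz X (\<xi> j z))) *s \<psi> z - (2 * (\<Sum>j\<in>J. lorentz (\<xi> j z) (kap z) * lorentz X (\<xi> j z))) *s Pb z"
    by (simp add: vec_eq_iff sum_distrib_left sum_distrib_right sum.distrib sum_subtractf algebra_simps)
  also have "\<dots> = (2 * lorentz X (\<psi> z)) *s dk z - (2 * lorentz X (Pb z)) *s kap z + (2 * lorentz X (dk z)) *s \<psi> z - (2 * lorentz X (kap z)) *s Pb z"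
    unfolding k kX[OF k(1)] kX[OF k(2)] ..
  finally have "a = 0" unfolding a_def Z_eq Y_eq by (simp add: vec_eq_iff algebra_simps)
  then show ?thesis using ab that by blast
qed

lemma PiW_vcnj:
  assumes z: "z \<in> \<Omega>" and r: "\<And>j. j \<in> J \<Longrightarrow> vcnj (\<xi> j z) = \<xi> j z"
  shows "PiW J \<xi> z (vcnj X) = vcnj (PiW J \<xi> z X)"
proof -
  have l: "lorentz (vcnj X) V = cnj (lorentz X (vcnj V))" for V using lorentz_vcnj[of X "vcnj V"] by simp
  have s: "vcnj (\<Sum>j\<in>J. f j) = (\<Sum>j\<in>J. vcnj (f j))" for f by (induction J rule: infinite_finite_induct) auto
  show ?thesis unfolding PiW_def by (simp add: l s real vcnj_P vcnj_Pb vcnj_N z r)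
qed

lemma PiW_const:
  assumes D: "\<And>j. j \<in> J \<Longrightarrow> hasD (\<xi> j) (\<lambda>z. 0) (\<lambda>z. 0)" and r: "\<And>j z. j \<in> J \<Longrightarrow> z \<in> \<Omega> \<Longrightarrow> vcnj (\<xi> j z) = \<xi> j z"
    and k: "\<And>z. z \<in> \<Omega> \<Longrightarrow> (\<Sum>j\<in>J. lorentz (\<xi> j z) (kap z) *s \<xi> j z) = kap z" "\<And>z. z \<in> \<Omega> \<Longrightarrow> (\<Sum>j\<in>J. lorentz (\<xi> j z) (dk z) *s \<xi> j z) = dk z"
    and conv: "convex \<Omega>" and zz: "z \<in> \<Omega>" "z' \<in> \<Omega>"
  shows "PiW J \<xi> z X = PiW J \<xi> z' X"
proof -
  have "has_wirt (\<lambda>z. PiW J \<xi> z X) 0 0 z" if z: "z \<in> \<Omega>" for z X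
  proof -
    obtain b where b: "has_wirt (\<lambda>z. PiW J \<xi> z X) 0 b z" using wirt_PiW_zero[of J \<xi> z X, OF D z k(1)[OF z] k(2)[OF z]] .
    \<comment> \<open>The conjugate of a real projection supplies the vanishing of the other derivative.\<close>
    obtain b' where b': "has_wirt (\<lambda>z. PiW J \<xi> z (vcnj X)) 0 b' z" using wirt_PiW_zero[of J \<xi> z "vcnj X", OF D z k(1)[OF z] k(2)[OF z]] .
    have "has_wirt (\<lambda>z. PiW J \<xi> z X) (vcnj b') (vcnj 0) z"
      by (rule has_wirt_cong_open[OF has_wirt_vcnj[OF b'] open_dom z]) (use PiW_vcnj[of _ J \<xi> X] r in auto)
    from has_wirt_unique(2)[OF b this] show ?thesis using b by simp
  qed
  then have "((\<lambda>z. PiW J \<xi> z X) has_derivative (\<lambda>v. 0)) (at w within \<Omega>)" if "w \<in> \<Omega>" for w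
    using that unfolding has_wirt_def by (auto intro: has_derivative_at_withinI)
  then obtain c where "\<And>w. w \<in> \<Omega> \<Longrightarrow> PiW J \<xi> w X = c"
    using has_derivative_zero_constant[OF conv, of "\<lambda>z. PiW J \<xi> z X"] by blast
  then show ?thesis using zz by simp
qed

lemma PiW_frame:
  assumes z: "z \<in> \<Omega>" and J: "finite J" and p: "\<And>j. j \<in> J \<Longrightarrow> perp z (\<xi> j z)"
    and o: "\<And>i j. i \<in> J \<Longrightarrow> j \<in> J \<Longrightarrow> lorentz (\<xi> i z) (\<xi> j z) = (if i = j then 1 else 0)"
  shows "PiW J \<xi> z (\<psi> z) = \<psi> z" "PiW J \<xi> z (P z) = P z" "PiW J \<xi> z (Pb z) = Pb z" "PiW J \<xi> z (N z) = N z" "i \<in> J \<Longrightarrow> PiW J \<xi> z (\<xi> i z) = \<xi> i z"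
proof -
  show "PiW J \<xi> z (\<psi> z) = \<psi> z" "PiW J \<xi> z (P z) = P z" "PiW J \<xi> z (Pb z) = Pb z" "PiW J \<xi> z (N z) = N z"
    unfolding PiW_def using perp_frame[OF p] by (simp_all add: ip z)
  assume i: "i \<in> J"
  have "(\<Sum>j\<in>J. lorentz (\<xi> i z) (\<xi> j z) *s \<xi> j z) = (\<Sum>j\<in>J. if j = i then \<xi> i z else 0)"
    by (rule sum.cong) (use o i in auto)
  then show "PiW J \<xi> z (\<xi> i z) = \<xi> i z" unfolding PiW_def using perp_frame[OF p[OF i]] i J by simp
qed

lemma PiW_lin: "PiW J \<xi> z (X + X') = PiW J \<xi> z X + PiW J \<xi> z X'" "PiW J \<xi> z (c *s X) = c *s PiW J \<xi> z X" "PiW J \<xi> z 0 = 0"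
  unfolding PiW_def by (simp_all add: vec_eq_iff sum.distrib sum_distrib_left algebra_simps)

end

context lightcone_lift
begin

lemma hasD_sum:
  assumes "finite I" "\<And>i. i \<in> I \<Longrightarrow> hasD (x i) (a i) (b i)"
  shows "hasD (\<lambda>z. \<Sum>i\<in>I. x i z) (\<lambda>z. \<Sum>i\<in>I. a i z) (\<lambda>z. \<Sum>i\<in>I. b i z)"
  using assms
proof (induction I rule: finite_induct)
  case empty
  have "sect (\<lambda>z. 0)" unfolding sect_def perp_def by (simp add: smooth_on_const)
  then show ?case unfolding hasD_def by (simp add: has_wirt_const)
next
  case (insert i I)
  then show ?case using hasD_add[of "x i" "a i" "b i"] by simp
qed

end

locale framed_lift = lightcone_lift +
  fixes \<xi> :: "'j::finite \<Rightarrow> complex \<Rightarrow> complex ^ 'a option" and K :: "'j \<Rightarrow> complex \<Rightarrow> real"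
  assumes frame: "parallel_hopf_frame \<xi> K" and conv: "convex \<Omega>"
begin

lemma xi_D: "hasD (\<xi> j) (\<lambda>z. 0) (\<lambda>z. 0)" and xi_real: "z \<in> \<Omega> \<Longrightarrow> vcnj (\<xi> j z) = \<xi> j z"
  and xi_ip: "z \<in> \<Omega> \<Longrightarrow> lorentz (\<xi> i z) (\<xi> j z) = (if i = j then 1 else 0)"
  and K_smooth: "smooth_on \<Omega> (K j)" and kap_K: "z \<in> \<Omega> \<Longrightarrow> kap z = (\<Sum>j\<in>UNIV. of_real (K j z) *s \<xi> j z)"
  using frame unfolding parallel_hopf_frame_def by blast+

lemma xi_sect: "sect (\<xi> j)" using xi_D unfolding hasD_def by blast

lemma xi_perp: "z \<in> \<Omega> \<Longrightarrow> perp z (\<xi> j z)" using xi_sect unfolding sect_def by blast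

lemma xi_smooth: "smooth_on \<Omega> (\<xi> j)" using xi_sect unfolding sect_def by blast

definition "Kc j z = complex_of_real (K j z)"
definition "Kz j z = wirtc (Kc j) z"

lemma Kc_smooth: "smooth_on \<Omega> (Kc j)" unfolding Kc_def[abs_def] by (intro smooth_intros open_dom K_smooth)

lemma has_wirtc_Kc: "z \<in> \<Omega> \<Longrightarrow> has_wirtc (Kc j) (Kz j z) (cnj (Kz j z)) z"
proof -
  assume z: "z \<in> \<Omega>"
  have 1: "has_wirtc (Kc j) (Kz j z) (wirtbarc (Kc j) z) z" unfolding Kz_def by (rule smooth_has_wirtc[OF Kc_smooth z])
  have "has_wirtc (Kc j) (cnj (wirtbarc (Kc j) z)) (cnj (Kz j z)) z"
    by (rule has_wirtc_cong_open[OF has_wirtc_cnj[OF 1] open_dom z]) (simp add: Kc_def)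
  from has_wirtc_unique(2)[OF 1 this] show ?thesis using 1 by simp
qed

lemma coeff: "z \<in> \<Omega> \<Longrightarrow> lorentz (\<Sum>j\<in>UNIV. c j *s \<xi> j z) (\<xi> i z) = c i"
  by (simp add: lorentz_sum xi_ip if_distrib cong: if_cong)

lemma expand: "z \<in> \<Omega> \<Longrightarrow> v = (\<Sum>j\<in>UNIV. c j *s \<xi> j z) \<Longrightarrow> (\<Sum>j\<in>UNIV. lorentz (\<xi> j z) v *s \<xi> j z) = v"
  using coeff by (simp add: lorentz_commute[of "\<xi> _ z"])

lemma hasD_combination:
  assumes "\<And>j. smooth_on \<Omega> (c j)" "\<And>j z. z \<in> \<Omega> \<Longrightarrow> has_wirtc (c j) (ca j z) (cb j z) z"
  shows "hasD (\<lambda>z. \<Sum>j\<in>UNIV. c j z *s \<xi> j z) (\<lambda>z. \<Sum>j\<in>UNIV. ca j z *s \<xi> j z) (\<lambda>z. \<Sum>j\<in>UNIV. cb j z *s \<xi> j z)"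
proof -
  have "hasD (\<lambda>z. c j z *s \<xi> j z) (\<lambda>z. ca j z *s \<xi> j z) (\<lambda>z. cb j z *s \<xi> j z)" for j
    using hasD_scale[OF assms(1) assms(2) xi_D, of j] by simp
  then show ?thesis by (intro hasD_sum) auto
qed

lemma dk_K: assumes z: "z \<in> \<Omega>" shows "dk z = (\<Sum>j\<in>UNIV. cnj (Kz j z) *s \<xi> j z)"
  by (rule hasD_unique(2)[OF hasD_kap hasD_combination[OF Kc_smooth has_wirtc_Kc] _ z]) (simp_all add: kap_K Kc_def)

abbreviation "PrW \<equiv> PiW UNIV \<xi>"

lemma Pi_const: "z \<in> \<Omega> \<Longrightarrow> z' \<in> \<Omega> \<Longrightarrow> PrW z X = PrW z' X"
  by (rule PiW_const[OF xi_D xi_real _ _ conv]) (auto intro: expand kap_K dk_K)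

lemma Pi_frame:
  assumes z: "z \<in> \<Omega>"
  shows "PrW z (\<psi> z) = \<psi> z" "PrW z (P z) = P z" "PrW z (Pb z) = Pb z" "PrW z (N z) = N z" "PrW z (\<xi> i z) = \<xi> i z"
  using PiW_frame[OF z, of UNIV \<xi>] xi_perp[OF z] xi_ip[OF z] by auto

text \<open>The real subspace onto which \<open>PrW z\<close> projects.\<close>

definition "W z = {x. PrW z (cplx x) = cplx x}"

lemma W_const: "z \<in> \<Omega> \<Longrightarrow> z' \<in> \<Omega> \<Longrightarrow> W z = W z'" unfolding W_def using Pi_const by metis

lemma W_subspace: "subspace (W z)"
  unfolding W_def subspace_def by (auto simp: PiW_lin)

lemma re_in_W: "vcnj X = X \<Longrightarrow> PrW z X = X \<Longrightarrow> re_vec X \<in> W z" unfolding W_def by (simp add: cplx_re_vec)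

text \<open>A real orthogonal basis of the complexification of \<open>W\<close>: one time-like vector, all others space-like.\<close>

definition basis :: "complex \<Rightarrow> 'j option option option option \<Rightarrow> complex ^ 'a option" where
  "basis z i = (case i of None \<Rightarrow> \<psi> z + N z | Some None \<Rightarrow> N z - \<psi> z | Some (Some None) \<Rightarrow> P z + Pb z
     | Some (Some (Some None)) \<Rightarrow> \<i> *s (P z - Pb z) | Some (Some (Some (Some j))) \<Rightarrow> \<xi> j z)"

lemma basis_simps: "basis z None = \<psi> z + N z" "basis z (Some None) = N z - \<psi> z" "basis z (Some (Some None)) = P z + Pb z"
  "basis z (Some (Some (Some None))) = \<i> *s (P z - Pb z)" "basis z (Some (Some (Some (Some j)))) = \<xi> j z"
  unfolding basis_def by simp_all

lemma index_cases:
  fixes i :: "'j option option option option"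
  obtains "i = None" | "i = Some None" | "i = Some (Some None)" | "i = Some (Some (Some None))"
  | j where "i = Some (Some (Some (Some j)))"
  by (metis option.exhaust)

lemma basis_real: assumes z: "z \<in> \<Omega>" shows "vcnj (basis z i) = basis z i"
  by (cases i rule: index_cases) (simp_all add: basis_simps real vcnj_N vcnj_P vcnj_Pb xi_real z vec_eq_iff)

lemma basis_Pi: assumes z: "z \<in> \<Omega>" shows "PrW z (basis z i) = basis z i"
proof -
  have d: "PrW z (X - X') = PrW z X - PrW z X'" for X X'
    using PiW_lin(1)[of UNIV \<xi> z "X - X'" X'] by (simp add: algebra_simps)
  show ?thesis
    by (cases i rule: index_cases) (simp_all add: basis_simps PiW_lin d Pi_frame z)
qed

lemma basis_orth: assumes z: "z \<in> \<Omega>" shows "i \<noteq> j \<Longrightarrow> lorentz (basis z i) (basis z j) = 0"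
  by (cases i rule: index_cases; cases j rule: index_cases; simp add: basis_simps ip z perp_frame[OF xi_perp] xi_ip)

lemma basis_norm: assumes z: "z \<in> \<Omega>" shows "lorentz (basis z i) (basis z i) = (case i of None \<Rightarrow> -2 | Some None \<Rightarrow> 2 | _ \<Rightarrow> 1)"
  by (cases i rule: index_cases; simp add: basis_simps ip z xi_ip)

lemma dim_W: assumes z: "z \<in> \<Omega>" shows "dim (W z) = CARD('j) + 4"
proof -
  define e where "e i = re_vec (basis z i)" for i
  have ce: "cplx (e i) = basis z i" for i unfolding e_def by (rule cplx_re_vec[OF basis_real[OF z]])
  have le: "of_real (lorentz (e i) (e j)) = lorentz (basis z i) (basis z j)" for i j unfolding ce[symmetric] by simp
  have "dim (span (range e)) = CARD('j option option option option)"
  proof (rule lorentz_orthogonal_independent)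
    show "lorentz (e i) (e j) = 0" if "i \<noteq> j" for i j using le[of i j] basis_orth[OF z that] by simp
    show "lorentz (e i) (e i) \<noteq> 0" for i using le[of i i] basis_norm[OF z, of i] by (auto split: option.splits)
  qed
  moreover have "span (range e) = W z"
  proof
    show "span (range e) \<subseteq> W z"
      by (rule span_minimal[OF _ W_subspace]) (auto simp: e_def intro!: re_in_W basis_real basis_Pi z)
    show "W z \<subseteq> span (range e)"
    proof
      fix x assume x: "x \<in> W z"
      let ?X = "cplx x"
      define q where "q i = lorentz x (e i)" for i
      have q: "lorentz ?X (basis z i) = of_real (q i)" for i unfolding q_def ce[symmetric] by simp
      note qs = q[of None] q[of "Some None"] q[of "Some (Some None)"] q[of "Some (Some (Some None))"] q[of "Some (Some (Some (Some _)))"]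
      have "?X = PrW z ?X" using x unfolding W_def by simp
      also have "\<dots> = (- (1/2) * lorentz ?X (basis z None)) *s basis z None + ((1/2) * lorentz ?X (basis z (Some None))) *s basis z (Some None)
         + lorentz ?X (basis z (Some (Some None))) *s basis z (Some (Some None)) + lorentz ?X (basis z (Some (Some (Some None)))) *s basis z (Some (Some (Some None)))
         + (\<Sum>j\<in>UNIV. lorentz ?X (basis z (Some (Some (Some (Some j))))) *s basis z (Some (Some (Some (Some j)))))"
        unfolding PiW_def basis_simps by (simp add: vec_eq_iff algebra_simps)
      also have "\<dots> = cplx ((- (1/2) * q None) *\<^sub>R e None + ((1/2) * q (Some None)) *\<^sub>R e (Some None) + q (Some (Some None)) *\<^sub>R e (Some (Some None))
         + q (Some (Some (Some None))) *\<^sub>R e (Some (Some (Some None))) + (\<Sum>j\<in>UNIV. q (Some (Some (Some (Some j)))) *\<^sub>R e (Some (Some (Some (Some j))))))"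
      proof -
        have s: "cplx (\<Sum>j\<in>UNIV. f j) = (\<Sum>j\<in>UNIV. cplx (f j))" for f :: "'j \<Rightarrow> real ^ 'a option"
          using linear_sum[OF bounded_linear.linear[OF bounded_linear_cplx]] by blast
        show ?thesis by (simp add: q s ce)
      qed
      finally have "x = (- (1/2) * q None) *\<^sub>R e None + ((1/2) * q (Some None)) *\<^sub>R e (Some None) + q (Some (Some None)) *\<^sub>R e (Some (Some None))
         + q (Some (Some (Some None))) *\<^sub>R e (Some (Some (Some None))) + (\<Sum>j\<in>UNIV. q (Some (Some (Some (Some j)))) *\<^sub>R e (Some (Some (Some (Some j)))))"
        by (rule cplx_simps(6)[THEN iffD1])
      then show "x \<in> span (range e)"
        by (elim ssubst) (intro span_add span_scale span_sum span_base, auto)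
    qed
  qed
  ultimately show ?thesis by simp
qed

lemma psi_in_W: "z \<in> \<Omega> \<Longrightarrow> p \<in> \<Omega> \<Longrightarrow> re_vec (\<psi> z) \<in> W p"
  using W_const[of z p] re_in_W[OF real Pi_frame(1)] by blast

lemma xi_in_W: "z \<in> \<Omega> \<Longrightarrow> p \<in> \<Omega> \<Longrightarrow> re_vec (\<xi> j z) \<in> W p"
  using W_const[of z p] re_in_W[OF xi_real Pi_frame(5)] by blast

text \<open>The lift takes values in the fixed subspace \<open>W\<close>, which contains the time-like vector \<open>\<psi> + N\<close>.\<close>

theorem surface_in_round_sphere:
  fixes F :: "complex \<Rightarrow> real ^ 'a"
  assumes p: "p \<in> \<Omega>" and card: "CARD('j) + 2 = m"
    and F: "\<And>z. z \<in> \<Omega> \<Longrightarrow> F z \<in> sphere 0 1" "\<And>z. z \<in> \<Omega> \<Longrightarrow> \<exists>a. null_vec (F z) = a *\<^sub>R re_vec (\<psi> z)"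
  obtains S where "round_sphere m S" "lorentz_span S = W p" "F ` \<Omega> \<subseteq> S"
proof -
  define t where "t = re_vec (basis p None)"
  have t: "t \<in> W p" unfolding t_def by (intro re_in_W basis_real basis_Pi p)
  have "of_real (lorentz t t) = lorentz (basis p None) (basis p None)"
    unfolding t_def lorentz_cplx[symmetric] cplx_re_vec[OF basis_real[OF p]] by simp
  then have "complex_of_real (lorentz t t) = of_real (-2)" using basis_norm[OF p, of None] by simp
  then have t2: "lorentz t t < 0" unfolding of_real_eq_iff by simp
  have d: "dim (W p) = m + 2" using dim_W[OF p] card by simp
  note S = round_sphere_of_subspace[OF W_subspace d t t2]
  have "F ` \<Omega> \<subseteq> {x \<in> sphere 0 1. null_vec x \<in> W p}"
  proof
    fix x assume "x \<in> F ` \<Omega>"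
    then obtain z where z: "z \<in> \<Omega>" "x = F z" by blast
    obtain a where "null_vec x = a *\<^sub>R re_vec (\<psi> z)" using F(2) z by blast
    then show "x \<in> {x \<in> sphere 0 1. null_vec x \<in> W p}" using F(1) psi_in_W[OF z(1) p] W_subspace z by (simp add: subspace_scale)
  qed
  then show ?thesis using that S by blast
qed

end

section \<open>Minimal surfaces in three-dimensional space forms\<close>

locale hypersurface_lift = framed_lift \<Omega> \<psi> \<xi> K for \<Omega> and \<psi> :: "complex \<Rightarrow> complex ^ 'n::finite option"
  and \<xi> :: "1 \<Rightarrow> complex \<Rightarrow> complex ^ 'n option" and K
begin

text \<open>If \<open>v\<close> is orthogonal to the normal field, vectors of \<open>W\<close> orthogonal to a rescaled
  lift \<open>G\<close>, its differential and \<open>v\<close> are multiples of the normal field, whose product with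
  \<open>G\<^bsub>z zbar\<^esub>\<close> vanishes.\<close>

lemma orthogonal_laplacian:
  assumes z: "z \<in> \<Omega>" and a: "smooth_on \<Omega> a" "a z \<noteq> 0" and v: "lorentz (\<xi> 1 z) v = 0" "lorentz (\<psi> z) v \<noteq> 0"
    and Y: "PrW z Y' = Y'" "lorentz Y' v = 0" "lorentz Y' (\<psi> z) = 0"
      "lorentz Y' (wirt (\<lambda>z. a z *s \<psi> z) z) = 0" "lorentz Y' (wirtbar (\<lambda>z. a z *s \<psi> z) z) = 0"
  shows "lorentz Y' (wirtbar (wirt (\<lambda>z. a z *s \<psi> z)) z) = 0"
proof -
  have G: "has_wirt (\<lambda>z. a z *s \<psi> z) (wirtc a w *s \<psi> w + a w *s P w) (wirtbarc a w *s \<psi> w + a w *s Pb w) w" if "w \<in> \<Omega>" for w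
    by (intro wirt_intros smooth_has_wirtc[OF a(1)] has_wirt_psi that)
  have 1: "lorentz Y' (P z) = 0" "lorentz Y' (Pb z) = 0" using Y(3,4,5) a(2) unfolding has_wirtD(1,2)[OF G[OF z]] by simp_all
  define s t where "s = - lorentz Y' (N z)" and "t = lorentz Y' (\<xi> 1 z)"
  have Ye: "Y' = s *s \<psi> z + t *s \<xi> 1 z"
    using Y(1) unfolding PiW_def s_def t_def by (simp add: Y(3) 1 sum_1 vec_eq_iff)
  have "s = 0" using Y(2) v unfolding Ye by simp
  then have Ye: "Y' = t *s \<xi> 1 z" using Ye by simp
  have "has_wirt (\<lambda>w. wirtc a w *s \<psi> w + a w *s P w) (wirtc (wirtc a) z *s \<psi> z + wirtc a z *s P z + (wirtc a z *s P z + a z *s Z z))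
     (wirtbarc (wirtc a) z *s \<psi> z + wirtc a z *s Pb z + (wirtbarc a z *s P z + a z *s Y z)) z"
    by (intro wirt_intros smooth_has_wirtc[OF a(1)] smooth_has_wirtc[OF smooth_on_wirtc[OF open_dom a(1)]] has_wirt_psi has_wirt_P z)
  then have "has_wirt (wirt (\<lambda>z. a z *s \<psi> z)) (wirtc (wirtc a) z *s \<psi> z + wirtc a z *s P z + (wirtc a z *s P z + a z *s Z z))
     (wirtbarc (wirtc a) z *s \<psi> z + wirtc a z *s Pb z + (wirtbarc a z *s P z + a z *s Y z)) z"
    by (rule has_wirt_cong_open[OF _ open_dom z]) (simp add: has_wirtD(1)[OF G])
  then have "wirtbar (wirt (\<lambda>z. a z *s \<psi> z)) z = wirtbarc (wirtc a) z *s \<psi> z + wirtc a z *s Pb z + (wirtbarc a z *s P z + a z *s Y z)"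
    by (rule has_wirtD)
  then show ?thesis unfolding Ye Y_eq using perp_frame[OF xi_perp[OF z]] by simp
qed

end

section \<open>The ordinary differential equations\<close>

lemma wirtc_along_curve:
  assumes "has_wirtc f a b (\<gamma> s)" "(\<gamma> has_vector_derivative d) (at s within T)"
  shows "((\<lambda>s. f (\<gamma> s)) has_vector_derivative (d * a + cnj d * b)) (at s within T)"
proof -
  have "((\<lambda>s. f (\<gamma> s)) has_derivative (\<lambda>x. (x *\<^sub>R d) * a + cnj (x *\<^sub>R d) * b)) (at s within T)"
    by (rule has_derivative_compose[where g = f and f = \<gamma>, OF assms(2)[unfolded has_vector_derivative_def] assms(1)[unfolded has_wirtc_def]])
  then show ?thesis unfolding has_vector_derivative_def by (simp add: algebra_simps)
qed

lemma Re_mult_of_real: "Re (w * of_real x) = Re w * x" by simp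

lemma real_wirtc_along_curve:
  fixes g :: "complex \<Rightarrow> real"
  assumes "has_wirtc (\<lambda>z. of_real (g z)) a (cnj a) (\<gamma> s)" "(\<gamma> has_vector_derivative d) (at s within T)"
  shows "((\<lambda>s. g (\<gamma> s)) has_real_derivative (2 * Re (d * a))) (at s within T)"
proof -
  have "((\<lambda>s. Re (of_real (g (\<gamma> s)))) has_vector_derivative Re (d * a + cnj d * cnj a)) (at s within T)"
    by (rule bounded_linear.has_vector_derivative[OF bounded_linear_Re wirtc_along_curve[OF assms]])
  then show ?thesis unfolding has_real_derivative_iff_has_vector_derivative by (simp add: algebra_simps)
qed

lemma const_along_curve:
  fixes g :: "complex \<Rightarrow> real" and \<gamma> :: "real \<Rightarrow> complex"
  assumes "\<And>s. s \<in> {0..1} \<Longrightarrow> \<gamma> s \<in> \<Omega>" "\<And>z. z \<in> \<Omega> \<Longrightarrow> has_wirtc (\<lambda>z. of_real (g z)) (a z) (cnj (a z)) z"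
    "\<And>s. s \<in> {0..1} \<Longrightarrow> (\<gamma> has_vector_derivative d s) (at s within {0..1})" "\<And>s. s \<in> {0..1} \<Longrightarrow> Re (d s * a (\<gamma> s)) = 0"
  shows "g (\<gamma> 0) = g (\<gamma> 1)"
proof -
  have "((\<lambda>s. g (\<gamma> s)) has_real_derivative 0) (at s within {0..1})" if "s \<in> {0..1}" for s
    using real_wirtc_along_curve[where g = g and \<gamma> = \<gamma>, OF assms(2)[OF assms(1)[OF that]] assms(3)[OF that]] assms(4)[OF that] by simp
  then obtain c where "\<And>s. s \<in> {0..1} \<Longrightarrow> g (\<gamma> s) = c"
    using has_field_derivative_zero_constant[of "{0..1}" "\<lambda>s. g (\<gamma> s)"] by auto
  then show ?thesis by simp
qed

lemma has_vector_derivative_vec_lambda: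
  fixes k :: "'j::finite \<Rightarrow> real \<Rightarrow> real"
  assumes "\<And>j. (k j has_real_derivative k' j) (at s)"
  shows "((\<lambda>s. \<chi> j. k j s) has_vector_derivative (\<chi> j. k' j)) (at s)"
proof -
  have e: "(\<chi> j. f j) = (\<Sum>j\<in>UNIV. f j *\<^sub>R axis j 1)" for f :: "'j \<Rightarrow> real"
    by (simp add: vec_eq_iff axis_def if_distrib cong: if_cong)
  show ?thesis unfolding e
    by (intro has_vector_derivative_sum has_vector_derivative_scaleR[OF _ has_vector_derivative_const, simplified] assms)
qed

text \<open>A real vector function \<open>K\<close> with \<open>K\<^bsub>zz\<^esub> = -(c/2) K\<close> whose differential is real after
  multiplication by \<open>h\<close>, which makes it constant along the levels
  of the real function with gradient \<open>h\<close>. The equation for \<open>c\<close> determines the potential of the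
  resulting ordinary differential equation by \<open>\<langle>K, K\<rangle>\<close>, up to a constant.\<close>

locale hopf_ode =
  fixes p :: complex and r :: real and K :: "2 \<Rightarrow> complex \<Rightarrow> real" and Kz :: "2 \<Rightarrow> complex \<Rightarrow> complex" and y :: "2 \<Rightarrow> complex \<Rightarrow> real"
    and c c' :: "complex \<Rightarrow> complex" and h :: "complex \<Rightarrow> complex" and \<Omega>
  assumes dom: "\<Omega> = ball p r" and r: "r > 0"
    and dK: "z \<in> \<Omega> \<Longrightarrow> has_wirtc (\<lambda>z. of_real (K j z)) (Kz j z) (cnj (Kz j z)) z"
    and ddK: "z \<in> \<Omega> \<Longrightarrow> has_wirtc (Kz j) (- (c z / 2) * of_real (K j z)) (of_real (y j z)) z"
    and dc: "z \<in> \<Omega> \<Longrightarrow> has_wirtc c (c' z) (8 * (\<Sum>j\<in>UNIV. of_real (K j z) * Kz j z)) z"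
    and hK: "z \<in> \<Omega> \<Longrightarrow> h z * Kz j z = cnj (h z) * cnj (Kz j z)"
    and Knz: "z \<in> \<Omega> \<Longrightarrow> \<exists>j. K j z \<noteq> 0"
begin

definition "S z = (\<Sum>j\<in>UNIV. complex_of_real (K j z) * Kz j z)"

lemma hS: assumes z: "z \<in> \<Omega>" shows "h z * S z = cnj (h z) * cnj (S z)"
proof -
  have "h z * S z = (\<Sum>j\<in>UNIV. of_real (K j z) * (h z * Kz j z))" unfolding S_def by (simp add: sum_distrib_left mult_ac)
  also have "\<dots> = (\<Sum>j\<in>UNIV. of_real (K j z) * (cnj (h z) * cnj (Kz j z)))" by (simp add: hK[OF z])
  also have "\<dots> = cnj (h z) * cnj (S z)" unfolding S_def by (simp add: sum_distrib_left mult_ac cnj_sum)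
  finally show ?thesis .
qed

lemma dU: assumes z: "z \<in> \<Omega>" shows "has_wirtc (\<lambda>z. of_real (\<Sum>j\<in>UNIV. K j z * K j z)) (2 * S z) (cnj (2 * S z)) z"
proof -
  have "has_wirtc (\<lambda>z. \<Sum>j\<in>UNIV. of_real (K j z) * of_real (K j z)) (\<Sum>j\<in>UNIV. Kz j z * of_real (K j z) + of_real (K j z) * Kz j z)
     (\<Sum>j\<in>UNIV. cnj (Kz j z) * of_real (K j z) + of_real (K j z) * cnj (Kz j z)) z"
    by (intro wirt_intros dK z)
  moreover have "(\<Sum>j\<in>UNIV. Kz j z * of_real (K j z) + of_real (K j z) * Kz j z) = 2 * S z"
    "(\<Sum>j\<in>UNIV. cnj (Kz j z) * of_real (K j z) + of_real (K j z) * cnj (Kz j z)) = cnj (2 * S z)"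
    unfolding S_def by (simp_all add: cnj_sum sum_distrib_left mult.commute)
  ultimately show ?thesis by simp
qed

end

locale hopf_elastica = hopf_ode where h = "\<lambda>z. \<eta>" for \<eta> +
  assumes eta: "\<eta> \<noteq> 0"
begin

text \<open>The direction \<open>e\<close> is orthogonal to the levels of \<open>t = 2 Re (cnj \<eta> z)\<close>, and \<open>t\<close> increases at unit rate along it.\<close>

definition "e = \<eta> / (2 * (cmod \<eta>)\<^sup>2)"
definition "a z = c z / (2 * (cnj \<eta>)\<^sup>2)"
definition "tt z = Re (cnj \<eta> * z + cnj (cnj \<eta>) * cnj z)"
definition "zs s = p + of_real (s - tt p) * e"

lemma n2: "\<eta> * cnj \<eta> = of_real ((cmod \<eta>)\<^sup>2)" unfolding complex_norm_square ..

lemma e_alt: "e = 1 / (2 * cnj \<eta>)" unfolding e_def using eta n2 by (simp add: field_simps complex_norm_square)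

text \<open>\<open>\<eta> K\<^sub>z\<close> is real, hence its two derivatives are conjugate to each other; this relates \<open>c\<close> to the real
  number \<open>K\<^bsub>z zbar\<^esub>\<close> and shows that \<open>a\<close> is real.\<close>

lemma g_wirt: assumes z: "z \<in> \<Omega>"
  shows "has_wirtc (\<lambda>z. of_real (Re (\<eta> * Kz j z))) (\<eta> * (- (c z / 2) * of_real (K j z))) (cnj (\<eta> * (- (c z / 2) * of_real (K j z)))) z"
    "- (a z * of_real (K j z)) = of_real (y j z / (cmod \<eta>)\<^sup>2)"
proof -
  have 1: "has_wirtc (\<lambda>z. \<eta> * Kz j z) (0 * Kz j z + \<eta> * (- (c z / 2) * of_real (K j z))) (0 * Kz j z + \<eta> * of_real (y j z)) z"
    by (intro wirt_intros ddK z)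
  have e: "\<eta> * Kz j w = of_real (Re (\<eta> * Kz j w))" if "w \<in> \<Omega>" for w
  proof -
    have "cnj (\<eta> * Kz j w) = \<eta> * Kz j w" using hK[OF that, of j] by simp
    then show ?thesis by (metis Reals_cnj_iff of_real_Re)
  qed
  have o: "open \<Omega>" using dom by simp
  have 2: "has_wirtc (\<lambda>z. of_real (Re (\<eta> * Kz j z))) (\<eta> * (- (c z / 2) * of_real (K j z))) (\<eta> * of_real (y j z)) z"
    using has_wirtc_cong_open[OF 1 o z e] by simp
  have "has_wirtc (\<lambda>z. of_real (Re (\<eta> * Kz j z))) (cnj (\<eta> * of_real (y j z))) (cnj (\<eta> * (- (c z / 2) * of_real (K j z)))) z"
    using has_wirtc_cnj[OF 2] by simp
  note u = has_wirtc_unique[OF 2 this]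
  show "has_wirtc (\<lambda>z. of_real (Re (\<eta> * Kz j z))) (\<eta> * (- (c z / 2) * of_real (K j z))) (cnj (\<eta> * (- (c z / 2) * of_real (K j z)))) z"
    using 2 u(2) by simp
  have "\<eta> * (- (c z / 2) * of_real (K j z)) = cnj \<eta> * of_real (y j z)" using u(1) by simp
  then have "- (c z / 2) * of_real (K j z) = cnj \<eta> * of_real (y j z) / \<eta>" using eta by (simp add: field_simps)
  moreover have "- (a z * of_real (K j z)) = (- (c z / 2) * of_real (K j z)) / (cnj \<eta>)\<^sup>2" unfolding a_def by simp
  ultimately have "- (a z * of_real (K j z)) = (cnj \<eta> * of_real (y j z) / \<eta>) / (cnj \<eta>)\<^sup>2" by (simp only:)
  also have "\<dots> = of_real (y j z) / (\<eta> * cnj \<eta>)" using eta by (simp add: field_simps power2_eq_square)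
  finally show "- (a z * of_real (K j z)) = of_real (y j z / (cmod \<eta>)\<^sup>2)" unfolding n2 by simp
qed

lemma a_real: assumes z: "z \<in> \<Omega>" shows "cnj (a z) = a z"
proof -
  obtain j where j: "K j z \<noteq> 0" using Knz[OF z] by blast
  have "a z * of_real (K j z) = of_real (- (y j z / (cmod \<eta>)\<^sup>2))" using g_wirt(2)[OF z, of j] by (metis minus_minus of_real_minus)
  then have "cnj (a z * of_real (K j z)) = a z * of_real (K j z)" by simp
  then show ?thesis using j by simp
qed

text \<open>\<open>a - 2 \<langle>K, K\<rangle> / |\<eta>|\<^sup>2\<close> is real and holomorphic, hence constant.\<close>

lemma a_eq: obtains \<gamma> where "\<And>z. z \<in> \<Omega> \<Longrightarrow> a z = of_real (2 / (cmod \<eta>)\<^sup>2 * ((\<Sum>j\<in>UNIV. K j z * K j z) + \<gamma>))"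
proof -
  define f where "f z = a z - of_real (2 / (cmod \<eta>)\<^sup>2) * of_real (\<Sum>j\<in>UNIV. K j z * K j z)" for z
  have o: "open \<Omega>" using dom by simp
  have fr: "cnj (f z) = f z" if "z \<in> \<Omega>" for z using a_real[OF that] unfolding f_def by simp
  have "has_wirtc f 0 0 z" if z: "z \<in> \<Omega>" for z
  proof -
    have "has_wirtc (\<lambda>z. c z * (1 / (2 * (cnj \<eta>)\<^sup>2)) - of_real (2 / (cmod \<eta>)\<^sup>2) * of_real (\<Sum>j\<in>UNIV. K j z * K j z))
      (c' z * (1 / (2 * (cnj \<eta>)\<^sup>2)) + c z * 0 - (0 * of_real (\<Sum>j\<in>UNIV. K j z * K j z) + of_real (2 / (cmod \<eta>)\<^sup>2) * (2 * S z)))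
      (8 * S z * (1 / (2 * (cnj \<eta>)\<^sup>2)) + c z * 0 - (0 * of_real (\<Sum>j\<in>UNIV. K j z * K j z) + of_real (2 / (cmod \<eta>)\<^sup>2) * cnj (2 * S z))) z"
      using dc[OF z] unfolding S_def[symmetric] by (intro wirt_intros dU z)
    moreover have "(\<lambda>z. c z * (1 / (2 * (cnj \<eta>)\<^sup>2)) - of_real (2 / (cmod \<eta>)\<^sup>2) * of_real (\<Sum>j\<in>UNIV. K j z * K j z)) = f"
      unfolding f_def a_def by auto
    moreover have "8 * S z * (1 / (2 * (cnj \<eta>)\<^sup>2)) - of_real (2 / (cmod \<eta>)\<^sup>2) * cnj (2 * S z) = 0"
    proof -
      have "cnj (S z) = \<eta> * S z / cnj \<eta>" using hS[OF z] eta by (simp add: field_simps)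
      moreover have "of_real (2 / (cmod \<eta>)\<^sup>2) = 2 / (\<eta> * cnj \<eta>)" unfolding n2 by simp
      ultimately show ?thesis using eta by (simp add: field_simps power2_eq_square)
    qed
    ultimately obtain f' where f': "has_wirtc f f' 0 z" by simp
    have "has_wirtc f (cnj 0) (cnj f') z" by (rule has_wirtc_cong_open[OF has_wirtc_cnj[OF f'] o z fr])
    from has_wirtc_unique(1)[OF f' this] show ?thesis using f' by simp
  qed
  then have "(f has_field_derivative 0) (at z within \<Omega>)" if "z \<in> \<Omega>" for z
    using that has_wirtc_field_iff has_field_derivative_at_within by blast
  then obtain k where k: "\<And>z. z \<in> \<Omega> \<Longrightarrow> f z = k" using has_field_derivative_zero_constant[of \<Omega> f] dom by auto
  have "p \<in> \<Omega>" using dom r by simp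
  then have "k = of_real (Re k)" using fr[of p] k[of p] by (simp add: complex_eq_iff)
  then have "a z = of_real (2 / (cmod \<eta>)\<^sup>2 * ((\<Sum>j\<in>UNIV. K j z * K j z) + Re k * (cmod \<eta>)\<^sup>2 / 2))" if "z \<in> \<Omega>" for z
    using k[OF that] eta unfolding f_def by (simp add: algebra_simps)
  then show ?thesis using that by blast
qed

lemma tt_alt: "tt w = 2 * Re (cnj \<eta> * w)" unfolding tt_def by simp

lemma tt_zs: "tt (zs s) = s"
proof -
  have "cnj \<eta> * zs s = cnj \<eta> * p + of_real ((s - tt p) / 2)" unfolding zs_def e_alt using eta by (simp add: field_simps)
  then have "Re (cnj \<eta> * zs s) = Re (cnj \<eta> * p) + (s - tt p) / 2" by (simp only: plus_complex.sel Re_complex_of_real)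
  then have "tt (zs s) = tt p + (s - tt p)" unfolding tt_alt[of "zs s"] tt_alt[of p] by argo
  then show ?thesis by simp
qed

text \<open>\<open>zs (tt z)\<close> is the foot of the perpendicular from \<open>z\<close> to the diameter in direction \<open>e\<close>, so the segment from
  \<open>z\<close> to it is contained in the disc and in a level of \<open>tt\<close>.\<close>

lemma foot: assumes z: "z \<in> \<Omega>"
  shows "zs (tt z) \<in> \<Omega>" "K j z = K j (zs (tt z))"
proof -
  define w where "w = z - zs (tt z)"
  have w: "Re (cnj \<eta> * w) = 0"
  proof -
    have "tt z = tt (zs (tt z))" by (simp add: tt_zs)
    then show ?thesis unfolding w_def tt_def by (simp add: algebra_simps)
  qed
  have "cmod (z - p) \<ge> cmod (zs (tt z) - p)"
  proof -
    define d where "d = zs (tt z) - p"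
    have "d = of_real (tt z - tt p) * e" unfolding d_def zs_def by simp
    then have "cnj w * d = cnj (cnj \<eta> * w) * of_real ((tt z - tt p) / (2 * (cmod \<eta>)\<^sup>2))" unfolding e_def by simp
    then have "Re (cnj w * d) = Re (cnj (cnj \<eta> * w)) * ((tt z - tt p) / (2 * (cmod \<eta>)\<^sup>2))"
      by (simp only: Re_mult_of_real)
    then have "Re (cnj w * d) = (tt z - tt p) / (2 * (cmod \<eta>)\<^sup>2) * Re (cnj \<eta> * w)" by simp
    then have 0: "Re w * Re d + Im w * Im d = 0" using w by simp
    have "(cmod (w + d))\<^sup>2 = (cmod w)\<^sup>2 + (cmod d)\<^sup>2 + 2 * (Re w * Re d + Im w * Im d)"
      unfolding cmod_power2 by (simp add: power2_eq_square algebra_simps)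
    then have "(cmod d)\<^sup>2 \<le> (cmod (w + d))\<^sup>2" using 0 by simp
    then have "cmod d \<le> cmod (w + d)" by (rule power2_le_imp_le) simp
    then show ?thesis unfolding d_def w_def by simp
  qed
  then show f: "zs (tt z) \<in> \<Omega>" using z unfolding dom by (simp add: dist_norm norm_minus_commute)
  have "K j (zs (tt z) + of_real 0 * w) = K j (zs (tt z) + of_real 1 * w)"
  proof (rule const_along_curve[where \<gamma> = "\<lambda>s. zs (tt z) + of_real s * w" and \<Omega> = \<Omega> and a = "Kz j" and d = "\<lambda>s. w"])
    fix s :: real assume s: "s \<in> {0..1}"
    have "zs (tt z) + of_real s * w = (1 - s) *\<^sub>R zs (tt z) + s *\<^sub>R z" unfolding w_def by (simp add: scaleR_conv_of_real algebra_simps)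
    then show m: "zs (tt z) + of_real s * w \<in> \<Omega>" using f z s convexD[OF convex_ball[of p r], of "zs (tt z)" z "1 - s" s] unfolding dom by simp
    show "((\<lambda>s. zs (tt z) + of_real s * w) has_vector_derivative w) (at s within {0..1})"
      by (auto intro!: derivative_eq_intros simp: has_vector_derivative_def scaleR_conv_of_real)
    define k where "k = Kz j (zs (tt z) + of_real s * w)"
    have "cnj (\<eta> * k) = \<eta> * k" using hK[OF m, of j] unfolding k_def by simp
    then obtain q where q: "\<eta> * k = of_real q" by (metis Reals_cnj_iff of_real_Re)
    have "w * k = (cnj \<eta> * w) * of_real (q / (cmod \<eta>)\<^sup>2)"
    proof -
      have "k = of_real q / \<eta>" using q eta by (simp add: field_simps)
      also have "\<dots> = cnj \<eta> * of_real q / (\<eta> * cnj \<eta>)" using eta by simp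
      finally show ?thesis unfolding n2 by simp
    qed
    then have "Re (w * k) = Re (cnj \<eta> * w) * (q / (cmod \<eta>)\<^sup>2)" by (simp only: Re_mult_of_real)
    then show "Re (w * Kz j (zs (tt z) + of_real s * w)) = 0" using w unfolding k_def by simp
  qed (rule dK)
  then show "K j z = K j (zs (tt z))" unfolding w_def by simp
qed

theorem elastica: "elastica_hopf \<Omega> (\<lambda>z. \<chi> j. K j z)"
proof -
  obtain \<gamma> where \<gamma>: "\<And>z. z \<in> \<Omega> \<Longrightarrow> a z = of_real (2 / (cmod \<eta>)\<^sup>2 * ((\<Sum>j\<in>UNIV. K j z * K j z) + \<gamma>))" using a_eq by blast
  define k k' k'' where "k s = (\<chi> j. K j (zs s))" and "k' s = (\<chi> j. Re (\<eta> * Kz j (zs s)) / (cmod \<eta>)\<^sup>2)"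
    and "k'' s = - (Re (a (zs s)) *\<^sub>R (\<chi> j. K j (zs s)))" for s
  have dz: "(zs has_vector_derivative e) (at s)" for s
    unfolding zs_def[abs_def] has_vector_derivative_def
    by (auto intro!: derivative_eq_intros simp: scaleR_conv_of_real)
  show ?thesis unfolding elastica_hopf_def Let_def
  proof (intro exI conjI ballI)
    show "cnj \<eta> \<noteq> 0" using eta by simp
    fix z assume z: "z \<in> \<Omega>"
    define s where "s = Re (cnj \<eta> * z + cnj (cnj \<eta>) * cnj z)"
    have s: "s = tt z" unfolding s_def tt_def ..
    have zo: "zs s \<in> \<Omega>" unfolding s by (rule foot(1)[OF z])
    show "(\<chi> j. K j z) = k s" unfolding k_def s using foot(2)[OF z] by (simp add: vec_eq_iff)
    show "(k has_vector_derivative k' s) (at s)" unfolding k_def[abs_def] k'_def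
    proof (rule has_vector_derivative_vec_lambda)
      fix j
      have "2 * Re (e * Kz j (zs s)) = Re (\<eta> * Kz j (zs s)) / (cmod \<eta>)\<^sup>2"
      proof -
        have "e * Kz j (zs s) = (\<eta> * Kz j (zs s)) * of_real (1 / (2 * (cmod \<eta>)\<^sup>2))" unfolding e_def by simp
        then have "Re (e * Kz j (zs s)) = Re (\<eta> * Kz j (zs s)) * (1 / (2 * (cmod \<eta>)\<^sup>2))" by (simp only: Re_mult_of_real)
        then show ?thesis by (simp del: times_complex.sel)
      qed
      then show "((\<lambda>s. K j (zs s)) has_real_derivative Re (\<eta> * Kz j (zs s)) / (cmod \<eta>)\<^sup>2) (at s)"
        using real_wirtc_along_curve[where g = "K j" and \<gamma> = zs, OF dK[OF zo] dz] by simp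
    qed
    have e2: "(\<chi> j. - (Re (a (zs s)) * K j (zs s))) = k'' s" unfolding k''_def by (simp add: vec_eq_iff)
    have "((\<lambda>s. \<chi> j. Re (\<eta> * Kz j (zs s)) / (cmod \<eta>)\<^sup>2) has_vector_derivative (\<chi> j. - (Re (a (zs s)) * K j (zs s)))) (at s)"
    proof (rule has_vector_derivative_vec_lambda)
      fix j
      have "2 * Re (e * (\<eta> * (- (c (zs s) / 2) * of_real (K j (zs s))))) / (cmod \<eta>)\<^sup>2 = - (Re (a (zs s)) * K j (zs s))"
      proof -
        have "e * (\<eta> * (- (c (zs s) / 2) * of_real (K j (zs s)))) = - (a (zs s) * of_real (K j (zs s) * (cmod \<eta>)\<^sup>2 / 2))"
          unfolding e_alt a_def of_real_mult of_real_divide n2[symmetric] using eta by (simp add: field_simps power2_eq_square)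
        then have E: "Re (e * (\<eta> * (- (c (zs s) / 2) * of_real (K j (zs s))))) = - (Re (a (zs s)) * (K j (zs s) * (cmod \<eta>)\<^sup>2 / 2))"
          by (simp only: uminus_complex.sel Re_mult_of_real)
        show ?thesis unfolding E using eta by simp
      qed
      then show "((\<lambda>s. Re (\<eta> * Kz j (zs s)) / (cmod \<eta>)\<^sup>2) has_real_derivative - (Re (a (zs s)) * K j (zs s))) (at s)"
        using DERIV_cdivide[OF real_wirtc_along_curve[where g = "\<lambda>z. Re (\<eta> * Kz j z)" and \<gamma> = zs, OF g_wirt(1)[OF zo, of j] dz[of s]], of "(cmod \<eta>)\<^sup>2"] by simp
    qed
    then show "(k' has_vector_derivative k'' s) (at s)" unfolding k'_def[abs_def] e2 .
    have "Re (a (zs s)) = 2 / (cmod \<eta>)\<^sup>2 * ((\<Sum>j\<in>UNIV. K j (zs s) * K j (zs s)) + \<gamma>)" unfolding \<gamma>[OF zo] by simp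
    then show "k'' s + (2 / (cmod (cnj \<eta>))\<^sup>2 * (k s \<bullet> k s + \<gamma>)) *\<^sub>R k s = 0"
      unfolding k''_def k_def by (simp add: inner_vec_def)
  qed
qed

end

locale hopf_radial = hopf_ode where h = "\<lambda>z. of_real \<alpha> * z" for \<alpha> :: real +
  assumes alpha: "\<alpha> \<noteq> 0"
begin

lemma zK: "z \<in> \<Omega> \<Longrightarrow> z * Kz j z = cnj z * cnj (Kz j z)"
  using hK[of z j] alpha by simp

lemma zS: "z \<in> \<Omega> \<Longrightarrow> cnj (z * S z) = z * S z"
  using hS[of z] alpha by simp

text \<open>The coefficient \<open>\<rho>\<close> of the equation. As in the case of elastica, reality of \<open>z K\<^sub>z\<close> makes it real.\<close>

definition "a z = c z * z\<^sup>2 / 2"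

lemma g_wirt: assumes z: "z \<in> \<Omega>"
  shows "has_wirtc (\<lambda>z. of_real (Re (z * Kz j z))) (Kz j z + z * (- (c z / 2) * of_real (K j z))) (cnj (Kz j z + z * (- (c z / 2) * of_real (K j z)))) z"
    "z * Kz j z - a z * of_real (K j z) = of_real ((cmod z)\<^sup>2 * y j z)"
proof -
  have 1: "has_wirtc (\<lambda>z. z * Kz j z) (1 * Kz j z + z * (- (c z / 2) * of_real (K j z))) (0 * Kz j z + z * of_real (y j z)) z"
    by (intro wirt_intros ddK z has_wirtc_field DERIV_ident)
  have e: "w * Kz j w = of_real (Re (w * Kz j w))" if "w \<in> \<Omega>" for w
  proof -
    have "cnj (w * Kz j w) = w * Kz j w" using zK[OF that, of j] by simp
    then show ?thesis by (metis Reals_cnj_iff of_real_Re)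
  qed
  have o: "open \<Omega>" using dom by simp
  have 2: "has_wirtc (\<lambda>z. of_real (Re (z * Kz j z))) (Kz j z + z * (- (c z / 2) * of_real (K j z))) (z * of_real (y j z)) z"
    using has_wirtc_cong_open[OF 1 o z e] by simp
  have "has_wirtc (\<lambda>z. of_real (Re (z * Kz j z))) (cnj (z * of_real (y j z))) (cnj (Kz j z + z * (- (c z / 2) * of_real (K j z)))) z"
    using has_wirtc_cnj[OF 2] by simp
  note u = has_wirtc_unique[OF 2 this]
  show "has_wirtc (\<lambda>z. of_real (Re (z * Kz j z))) (Kz j z + z * (- (c z / 2) * of_real (K j z))) (cnj (Kz j z + z * (- (c z / 2) * of_real (K j z)))) z"
    using 2 u(2) by simp
  have "z * (Kz j z + z * (- (c z / 2) * of_real (K j z))) = (z * cnj z) * of_real (y j z)" using u(1) by simp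
  then show "z * Kz j z - a z * of_real (K j z) = of_real ((cmod z)\<^sup>2 * y j z)"
    unfolding a_def complex_norm_square[symmetric] by (simp add: algebra_simps power2_eq_square)
qed

lemma a_real: assumes z: "z \<in> \<Omega>" shows "cnj (a z) = a z"
proof -
  obtain j where j: "K j z \<noteq> 0" using Knz[OF z] by blast
  have "cnj (z * Kz j z) = z * Kz j z" using zK[OF z, of j] by simp
  moreover have "a z * of_real (K j z) = z * Kz j z - of_real ((cmod z)\<^sup>2 * y j z)" using g_wirt(2)[OF z, of j] by (simp add: algebra_simps)
  ultimately have "cnj (a z * of_real (K j z)) = a z * of_real (K j z)" by simp
  then show ?thesis using j by simp
qed

text \<open>Its derivative by \<open>zbar\<close> is known from \<open>c\<^bsub>zbar\<^esub>\<close>, and, as it is real, so is the other one.\<close>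

lemma a_wirt: assumes z: "z \<in> \<Omega>" shows "has_wirtc (\<lambda>z. of_real (Re (a z))) (cnj (4 * S z * z\<^sup>2)) (4 * S z * z\<^sup>2) z"
proof -
  have o: "open \<Omega>" using dom by simp
  define q where "q = c' z * (z * z * (1/2)) + c z * ((1 * z + z * 1) * (1/2) + z * z * 0)"
  have b: "8 * S z * (z * z * (1/2)) + c z * ((0 * z + z * 0) * (1/2) + z * z * 0) = 4 * S z * z\<^sup>2"
    by (simp add: power2_eq_square algebra_simps)
  have "has_wirtc (\<lambda>z. c z * (z * z * (1/2))) q (8 * S z * (z * z * (1/2)) + c z * ((0 * z + z * 0) * (1/2) + z * z * 0)) z"
    unfolding q_def using dc[OF z] unfolding S_def[symmetric] by (intro wirt_intros has_wirtc_field DERIV_ident)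
  then have "has_wirtc (\<lambda>z. c z * (z * z * (1/2))) q (4 * S z * z\<^sup>2) z" unfolding b .
  moreover have "c w * (w * w * (1/2)) = of_real (Re (a w))" if "w \<in> \<Omega>" for w
  proof -
    have "a w = of_real (Re (a w))" using a_real[OF that] by (simp add: complex_eq_iff)
    then show ?thesis unfolding a_def by (simp add: power2_eq_square)
  qed
  ultimately have 1: "has_wirtc (\<lambda>z. of_real (Re (a z))) q (4 * S z * z\<^sup>2) z" by (rule has_wirtc_cong_open[OF _ o z])
  have "has_wirtc (\<lambda>z. of_real (Re (a z))) (cnj (4 * S z * z\<^sup>2)) (cnj q) z" using has_wirtc_cnj[OF 1] by simp
  from has_wirtc_unique(1)[OF 1 this] show ?thesis using 1 by simp
qed

text \<open>The functions of \<open>s\<close> are read off along the ray through the centre \<open>p\<close> of the disc; the arc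
  from \<open>z\<close> to the ray stays in the disc since it approaches \<open>p\<close>. If \<open>p = 0\<close>, any ray serves.\<close>

definition "e = (if p = 0 then 1 else sgn p)"
definition "zs s = of_real (exp (s / 2)) * e"

lemma e: "cmod e = 1" "p = of_real (cmod p) * e"
  unfolding e_def by (auto simp: sgn_eq norm_divide)

lemma foot: assumes z: "z \<in> \<Omega>" "z \<noteq> 0"
  shows "zs (2 * ln (cmod z)) = of_real (cmod z) * e" "zs (2 * ln (cmod z)) \<in> \<Omega>" "K j z = K j (zs (2 * ln (cmod z)))"
proof -
  show f: "zs (2 * ln (cmod z)) = of_real (cmod z) * e" unfolding zs_def using z by simp
  define \<theta> where "\<theta> = Arg (z / e)"
  have enz: "e \<noteq> 0" using e(1) by auto
  have th: "z = of_real (cmod z) * e * exp (\<i> * of_real \<theta>)" "\<bar>\<theta>\<bar> \<le> pi"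
  proof -
    have "z / e = of_real (cmod (z / e)) * exp (\<i> * of_real \<theta>)" unfolding \<theta>_def using Arg_eq[of "z / e"] z enz by simp
    then show "z = of_real (cmod z) * e * exp (\<i> * of_real \<theta>)" using enz e(1) by (simp add: norm_divide field_simps)
    show "\<bar>\<theta>\<bar> \<le> pi" unfolding \<theta>_def using Arg_le_pi[of "z / e"] mpi_less_Arg[of "z / e"] by linarith
  qed
  define \<gamma> where "\<gamma> s = of_real (cmod z) * e * exp (\<i> * of_real (s * \<theta>))" for s :: real
  have dist: "(cmod (\<gamma> s - p))\<^sup>2 = (cmod z)\<^sup>2 + (cmod p)\<^sup>2 - 2 * (cmod z * cmod p) * cos (s * \<theta>)" for s
  proof -
    have "\<gamma> s - p = e * (of_real (cmod z) * exp (\<i> * of_real (s * \<theta>)) - of_real (cmod p))" unfolding \<gamma>_def by (subst e(2)) (simp add: algebra_simps)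
    then have "cmod (\<gamma> s - p) = cmod (of_real (cmod z) * exp (\<i> * of_real (s * \<theta>)) - of_real (cmod p))" using e(1) by (simp add: norm_mult)
    then have "(cmod (\<gamma> s - p))\<^sup>2 = (cmod (of_real (cmod z) * exp (\<i> * of_real (s * \<theta>)) - of_real (cmod p)))\<^sup>2" by simp
    also have "\<dots> = (cmod z * cos (s * \<theta>) - cmod p)\<^sup>2 + (cmod z * sin (s * \<theta>))\<^sup>2"
      unfolding cmod_power2 by (simp add: Re_exp Im_exp)
    also have "\<dots> = (cmod z)\<^sup>2 * ((sin (s * \<theta>))\<^sup>2 + (cos (s * \<theta>))\<^sup>2) + (cmod p)\<^sup>2 - 2 * (cmod z * cmod p) * cos (s * \<theta>)"
      by (simp only: power2_eq_square algebra_simps)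
    finally show ?thesis by simp
  qed
  have in': "\<gamma> s \<in> \<Omega>" if s: "s \<in> {0..1}" for s
  proof -
    have "cos (1 * \<theta>) \<le> cos (s * \<theta>)"
    proof -
      have "cos \<bar>\<theta>\<bar> \<le> cos \<bar>s * \<theta>\<bar>"
        using s th(2) by (intro cos_monotone_0_pi_le) (auto simp: abs_mult intro: mult_left_le_one_le)
      then show ?thesis by simp
    qed
    then have "(cmod (\<gamma> s - p))\<^sup>2 \<le> (cmod (\<gamma> 1 - p))\<^sup>2" unfolding dist by (simp add: mult_left_mono)
    then have "cmod (\<gamma> s - p) \<le> cmod (\<gamma> 1 - p)" by (rule power2_le_imp_le) simp
    moreover have "\<gamma> 1 = z" unfolding \<gamma>_def using th(1) by simp
    ultimately show ?thesis using z unfolding dom by (simp add: dist_norm norm_minus_commute)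
  qed
  have g0: "\<gamma> 0 = of_real (cmod z) * e" "\<gamma> 1 = z" unfolding \<gamma>_def using th(1) by simp_all
  show "zs (2 * ln (cmod z)) \<in> \<Omega>" unfolding f using in'[of 0] g0 by simp
  have "K j (\<gamma> 0) = K j (\<gamma> 1)"
  proof (rule const_along_curve[where \<gamma> = \<gamma> and \<Omega> = \<Omega> and a = "Kz j" and d = "\<lambda>s. \<i> * of_real \<theta> * \<gamma> s"])
    fix s :: real assume s: "s \<in> {0..1}"
    show "\<gamma> s \<in> \<Omega>" by (rule in'[OF s])
    have "((\<lambda>w. of_real (cmod z) * e * exp (\<i> * (w * of_real \<theta>))) has_field_derivative \<i> * of_real \<theta> * \<gamma> s) (at (of_real s))"
      unfolding \<gamma>_def by (auto intro!: derivative_eq_intros)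
    from wirtc_along_curve[where \<gamma> = of_real and d = 1 and T = "{0..1}", OF has_wirtc_field[OF this]]
    show "(\<gamma> has_vector_derivative \<i> * of_real \<theta> * \<gamma> s) (at s within {0..1})"
      unfolding \<gamma>_def[abs_def]
      by (simp add: has_vector_derivative_def scaleR_conv_of_real bounded_linear_imp_has_derivative[OF bounded_linear_of_real])
    have "cnj (\<gamma> s * Kz j (\<gamma> s)) = \<gamma> s * Kz j (\<gamma> s)" using zK[OF in'[OF s], of j] by simp
    then obtain q where q: "\<gamma> s * Kz j (\<gamma> s) = of_real q" by (metis Reals_cnj_iff Reals_cases)
    have E: "\<i> * of_real \<theta> * \<gamma> s * Kz j (\<gamma> s) = \<i> * of_real (\<theta> * q)" using q by (simp add: mult.assoc)
    show "Re (\<i> * of_real \<theta> * \<gamma> s * Kz j (\<gamma> s)) = 0" unfolding E by simp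
  qed (rule dK)
  then show "K j z = K j (zs (2 * ln (cmod z)))" unfolding f g0 by simp
qed

theorem radial: "radial_painleve_hopf \<Omega> (\<lambda>z. \<chi> j. K j z)"
proof -
  define k k' k'' \<rho> where "k s = (\<chi> j. K j (zs s))" and "k' s = (\<chi> j. Re (zs s * Kz j (zs s)))"
    and "k'' s = (\<chi> j. Re (zs s * Kz j (zs s)) - Re (a (zs s)) * K j (zs s))" and "\<rho> s = Re (a (zs s))" for s
  have dz: "(zs has_vector_derivative zs s / 2) (at s)" for s
    unfolding zs_def[abs_def] has_vector_derivative_def
    by (auto intro!: derivative_eq_intros simp: scaleR_conv_of_real)
  show ?thesis unfolding radial_painleve_hopf_def Let_def
  proof (intro exI conjI ballI)
    fix z assume "z \<in> \<Omega> - {0}"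
    then have z: "z \<in> \<Omega>" "z \<noteq> 0" by auto
    define s where "s = 2 * ln (cmod z)"
    have zo: "zs s \<in> \<Omega>" unfolding s_def by (rule foot(2)[OF z])
    have cz: "cmod (zs s) = cmod z" unfolding s_def foot(1)[OF z] using e(1) by (simp add: norm_mult)
    show "(\<chi> j. K j z) = k s" unfolding k_def s_def using foot(3)[OF z] by (simp add: vec_eq_iff)
    show "(k has_vector_derivative k' s) (at s)" unfolding k_def[abs_def] k'_def
    proof (rule has_vector_derivative_vec_lambda)
      fix j
      have "2 * Re (zs s / 2 * Kz j (zs s)) = Re (zs s * Kz j (zs s))" by (simp add: field_simps)
      then show "((\<lambda>s. K j (zs s)) has_real_derivative Re (zs s * Kz j (zs s))) (at s)"
        using real_wirtc_along_curve[where g = "K j" and \<gamma> = zs, OF dK[OF zo, of j] dz[of s]] by (simp only:)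
    qed
    show "(k' has_vector_derivative k'' s) (at s)" unfolding k'_def[abs_def] k''_def
    proof (rule has_vector_derivative_vec_lambda)
      fix j
      have "zs s / 2 * (Kz j (zs s) + zs s * (- (c (zs s) / 2) * of_real (K j (zs s)))) = (zs s * Kz j (zs s) - a (zs s) * of_real (K j (zs s))) / 2"
        unfolding a_def by (simp add: field_simps power2_eq_square)
      then have "2 * Re (zs s / 2 * (Kz j (zs s) + zs s * (- (c (zs s) / 2) * of_real (K j (zs s))))) = Re (zs s * Kz j (zs s)) - Re (a (zs s)) * K j (zs s)"
        by simp
      then show "((\<lambda>s. Re (zs s * Kz j (zs s))) has_real_derivative Re (zs s * Kz j (zs s)) - Re (a (zs s)) * K j (zs s)) (at s)"
        using real_wirtc_along_curve[where g = "\<lambda>z. Re (z * Kz j z)" and \<gamma> = zs, OF g_wirt(1)[OF zo, of j] dz[of s]] by (simp only:)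
    qed
    show "k'' s - k' s + \<rho> s *\<^sub>R k s = 0" unfolding k''_def k'_def \<rho>_def k_def by (simp add: vec_eq_iff)
    show "(\<rho> has_real_derivative 2 * Re (zs s / 2 * cnj (4 * S (zs s) * (zs s)\<^sup>2))) (at s)"
      unfolding \<rho>_def[abs_def]
      by (rule real_wirtc_along_curve[where g = "\<lambda>z. Re (a z)" and \<gamma> = zs, OF _ dz]) (use a_wirt[OF zo] in simp)
    show "((\<lambda>v. k v \<bullet> k v) has_real_derivative 2 * Re (zs s / 2 * (2 * S (zs s)))) (at s)"
      unfolding k_def inner_vec_def
      using real_wirtc_along_curve[where g = "\<lambda>z. \<Sum>j\<in>UNIV. K j z * K j z" and \<gamma> = zs, OF dU[OF zo] dz] by simp
    have "zs s / 2 * cnj (4 * S (zs s) * (zs s)\<^sup>2) = 2 * (zs s * cnj (zs s)) * cnj (zs s * S (zs s))" by (simp add: power2_eq_square)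
    also have "\<dots> = of_real (2 * (cmod z)\<^sup>2) * (zs s * S (zs s))" unfolding zS[OF zo] complex_norm_square[symmetric] cz by simp
    finally have "Re (zs s / 2 * cnj (4 * S (zs s) * (zs s)\<^sup>2)) = 2 * (cmod z)\<^sup>2 * Re (zs s * S (zs s))" by (metis Re_mult_of_real mult.commute)
    moreover have "Re (zs s / 2 * (2 * S (zs s))) = Re (zs s * S (zs s))" by simp
    ultimately show "2 * Re (zs s / 2 * cnj (4 * S (zs s) * (zs s)\<^sup>2)) = 2 * (2 * Re (zs s / 2 * (2 * S (zs s)))) * (cmod z)\<^sup>2" by simp
  qed
qed

end

section \<open>The alternatives for a single lift\<close>

lemma real_const_vector:
  fixes v :: "complex \<Rightarrow> complex ^ 'm"
  assumes "open \<Omega>" "convex \<Omega>" "p \<in> \<Omega>" and r: "\<And>z. z \<in> \<Omega> \<Longrightarrow> vcnj (v z) = v z" and d: "\<And>z. z \<in> \<Omega> \<Longrightarrow> \<exists>b. has_wirt v 0 b z"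
  shows "\<And>z. z \<in> \<Omega> \<Longrightarrow> v z = v p"
proof -
  have "has_wirt v 0 0 z" if z: "z \<in> \<Omega>" for z
  proof -
    obtain b where b: "has_wirt v 0 b z" using d[OF z] by blast
    have "has_wirt v (vcnj b) (vcnj 0) z" by (rule has_wirt_cong_open[OF has_wirt_vcnj[OF b] assms(1) z r])
    from has_wirt_unique(2)[OF b this] show ?thesis using b by simp
  qed
  then have "(v has_derivative (\<lambda>v. 0)) (at z within \<Omega>)" if "z \<in> \<Omega>" for z
    using that unfolding has_wirt_def by (auto intro: has_derivative_at_withinI)
  then obtain k where "\<And>z. z \<in> \<Omega> \<Longrightarrow> v z = k" using has_derivative_zero_constant[OF assms(2), of v] by blast
  then show "\<And>z. z \<in> \<Omega> \<Longrightarrow> v z = v p" using assms(3) by simp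
qed

context lightcone_lift
begin

text \<open>The data from which a minimal surface in a 3-dimensional space form is obtained: a parallel unit
  normal field \<open>\<xi> 1\<close> carrying the Hopf differential, and a vector \<open>v\<close> of the resulting
  5-dimensional space that is orthogonal to it. The surface in the space form of \<open>v\<close> is the lift scaled
  to have product \<open>-1\<close> with \<open>v\<close>.\<close>

definition minimal_frame :: "real ^ 'n option \<Rightarrow> (1 \<Rightarrow> complex \<Rightarrow> complex ^ 'n option) \<Rightarrow> (1 \<Rightarrow> complex \<Rightarrow> real) \<Rightarrow> bool" where
  "minimal_frame v \<xi> K \<longleftrightarrow> parallel_hopf_frame \<xi> K \<and>
    (\<forall>z\<in>\<Omega>. lorentz (\<xi> 1 z) (cplx v) = 0 \<and> PiW UNIV \<xi> z (cplx v) = cplx v)"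

text \<open>If \<open>\<kappa>\<close> vanishes, the projection to \<open>V\<close> itself is constant and the surface lies in a round 2-sphere.
  Any unit vector \<open>y\<close> orthogonal to \<open>V\<close> is then a parallel normal field; it exists because the
  Lorentz space has dimension at least five. The time-like vector \<open>\<psi> + N\<close> at one point serves as \<open>v\<close>, since no
  null vector is orthogonal to it.\<close>

theorem umbilic_minimal_frame:
  assumes conv: "convex \<Omega>" and p: "p \<in> \<Omega>" and k0: "\<And>z. z \<in> \<Omega> \<Longrightarrow> kap z = 0" and card: "CARD('n) \<ge> 4"
  obtains v \<xi> K where "minimal_frame v \<xi> K" "\<And>z. z \<in> \<Omega> \<Longrightarrow> lorentz (\<psi> z) (cplx v) \<noteq> 0"
proof -
  have dk0: "dk z = 0" if z: "z \<in> \<Omega>" for z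
  proof -
    have "has_wirt kap 0 0 z" by (rule has_wirt_cong_open[OF has_wirt_const[of 0] open_dom z]) (simp add: k0)
    then have "wirtbar kap z = 0" by (rule has_wirtD)
    then show ?thesis unfolding dk_def pr_def by simp
  qed
  \<comment> \<open>The product with \<open>v\<close> is the Euclidean product with \<open>J v\<close>, so that Euclidean orthogonality supplies \<open>x\<close>.\<close>
  define J where "J v = (\<chi> i. case i of None \<Rightarrow> - (v $ None) | Some k \<Rightarrow> v $ Some k)" for v :: "real ^ 'n option"
  have J: "lorentz x v = x \<bullet> J v" for x v
    unfolding lorentz_def J_def inner_vec_def UNIV_option_conv by (simp add: sum.reindex)
  define B where "B = {J (re_vec (\<psi> p)), J (re_vec (P p + Pb p)), J (re_vec (\<i> *s (P p - Pb p))), J (re_vec (N p))}"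
  have "card B \<le> 4" unfolding B_def by (simp add: card_insert_if)
  then have "dim (span B) \<le> 4" using dim_le_card[of "span B" B] unfolding B_def by auto
  moreover have "DIM(real ^ 'n option) \<ge> 5" using card by simp
  ultimately have "dim (span B) < DIM(real ^ 'n option)" by linarith
  then have "span B \<noteq> UNIV" by (metis dim_UNIV less_irrefl)
  then obtain x where x: "x \<noteq> 0" "\<And>y. y \<in> span B \<Longrightarrow> orthogonal x y"
    using orthogonal_to_subspace_exists[of "span B"] \<open>dim (span B) < DIM(real ^ 'n option)\<close> by (metis span_span)
  have c: "lorentz (cplx x) V = 0" if "vcnj V = V" "J (re_vec V) \<in> B" for V
  proof -
    have "lorentz x (re_vec V) = 0" using x(2)[OF span_base[OF that(2)]] unfolding J orthogonal_def .
    then have "lorentz (cplx x) (cplx (re_vec V)) = 0" by simp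
    then show ?thesis using cplx_re_vec[OF that(1)] by simp
  qed
  have r: "vcnj (P p + Pb p) = P p + Pb p" "vcnj (\<i> *s (P p - Pb p)) = \<i> *s (P p - Pb p)"
    by (simp_all add: vcnj_P vcnj_Pb p vec_eq_iff)
  have 1: "lorentz (cplx x) (\<psi> p) = 0" "lorentz (cplx x) (N p) = 0" "lorentz (cplx x) (P p + Pb p) = 0" "lorentz (cplx x) (\<i> *s (P p - Pb p)) = 0"
    by (rule c[OF real[OF p]], simp add: B_def, rule c[OF vcnj_N[OF p]], simp add: B_def,
        rule c[OF r(1)], simp only: B_def insertI1 insertI2, rule c[OF r(2)], simp only: B_def insertI1 insertI2)
  have px: "perp p (cplx x)" unfolding perp_def using 1 by (simp add: add_eq_0_iff)
  have cx: "cplx x \<noteq> 0" using x(1) cplx_simps(3,6) by metis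
  then obtain q where q: "q \<ge> 0" "lorentz (cplx x) (cplx x) = of_real q" "lorentz (cplx x) (cplx x) \<noteq> 0"
    using perp_real_pos[OF p px] by auto
  define y where "y = of_real (1 / sqrt q) *s cplx x"
  have py: "perp p y" using px unfolding y_def perp_def by simp
  have ry: "vcnj y = y" unfolding y_def by simp
  have "q > 0" using q by (metis less_eq_real_def of_real_0)
  then have yy: "lorentz y y = 1" unfolding y_def using q(2) by (simp add: of_real_mult[symmetric] del: of_real_mult)
  have Pc: "PiW {} (\<lambda>j::1. \<lambda>z. y) z X = PiW {} (\<lambda>j::1. \<lambda>z. y) p X" if "z \<in> \<Omega>" for z X
    by (rule PiW_const[OF _ _ _ _ conv that p]) (auto simp: k0 dk0)
  have perpy: "perp z y" if z: "z \<in> \<Omega>" for z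
  proof -
    have "PiW {} (\<lambda>j::1. \<lambda>z. y) p y = 0" unfolding PiW_def by (simp add: perp_frame[OF py])
    then have "PiW {} (\<lambda>j::1. \<lambda>z. y) z y = 0" by (simp only: Pc[OF z])
    then have "pr z y = y" unfolding pr_def PiW_def by (simp add: vec_eq_iff algebra_simps)
    then show ?thesis using pr_perp[OF z, of y] by simp
  qed
  have sy: "sect (\<lambda>z. y)" unfolding sect_def using perpy by (simp add: smooth_on_const)
  have s0: "sect (\<lambda>z. 0)" unfolding sect_def perp_def by (simp add: smooth_on_const)
  have D: "hasD (\<lambda>z. y) (\<lambda>z. 0) (\<lambda>z. 0)" unfolding hasD_def using sy s0 by (simp add: k0 dk0 has_wirt_const)
  have fr: "parallel_hopf_frame (\<lambda>j::1. \<lambda>z. y) (\<lambda>j z. 0)"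
    unfolding parallel_hopf_frame_def using D ry yy by (simp add: smooth_on_const k0)
  define v where "v = re_vec (\<psi> p + N p)"
  have cv: "cplx v = \<psi> p + N p" unfolding v_def by (rule cplx_re_vec) (simp add: real vcnj_N p)
  have fl: "framed_lift \<Omega> \<psi> (\<lambda>j::1. \<lambda>z. y) (\<lambda>j z. 0)"
    by unfold_locales (use fr conv in auto)
  have "PiW UNIV (\<lambda>j::1. \<lambda>z. y) p (\<psi> p + N p) = \<psi> p + N p"
    by (simp only: PiW_lin(1) framed_lift.Pi_frame(1,4)[OF fl p])
  then have "PiW UNIV (\<lambda>j::1. \<lambda>z. y) z (\<psi> p + N p) = \<psi> p + N p" if "z \<in> \<Omega>" for z
    by (simp only: framed_lift.Pi_const[OF fl that p])
  then have "minimal_frame v (\<lambda>j::1. \<lambda>z. y) (\<lambda>j z. 0)"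
    unfolding minimal_frame_def cv using fr perp_frame[OF py] by auto
  moreover have "lorentz (\<psi> z) (cplx v) \<noteq> 0" if z: "z \<in> \<Omega>" for z
  proof
    assume 0: "lorentz (\<psi> z) (cplx v) = 0"
    have cz: "cplx (re_vec (\<psi> z)) = \<psi> z" by (rule cplx_re_vec[OF real[OF z]])
    have "complex_of_real (lorentz v v) = of_real (-2)" unfolding lorentz_cplx[symmetric] cv by (simp add: ip p)
    then have "lorentz v v < 0" unfolding of_real_eq_iff by simp
    moreover have "complex_of_real (lorentz (re_vec (\<psi> z)) v) = of_real 0" unfolding lorentz_cplx[symmetric] cz using 0 by simp
    then have "lorentz (re_vec (\<psi> z)) v = 0" unfolding of_real_eq_iff .
    moreover have "re_vec (\<psi> z) \<noteq> 0"
    proof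
      assume "re_vec (\<psi> z) = 0"
      then have "\<psi> z = 0" using cz by simp
      then show False using ipN(1)[OF z] by simp
    qed
    ultimately have "lorentz (re_vec (\<psi> z)) (re_vec (\<psi> z)) > 0" by (rule lorentz_pos_orthogonal_timelike)
    moreover have "complex_of_real (lorentz (re_vec (\<psi> z)) (re_vec (\<psi> z))) = of_real 0" unfolding lorentz_cplx[symmetric] cz using ip1(1)[OF z] by simp
    then have "lorentz (re_vec (\<psi> z)) (re_vec (\<psi> z)) = 0" unfolding of_real_eq_iff .
    ultimately show False by simp
  qed
  ultimately show ?thesis by (rule that)
qed

end

context isothermic_willmore
begin

text \<open>A vector \<open>v\<close> orthogonal to the normal field with \<open>-\<langle>v, \<psi>\<rangle> = |\<kappa>|\<close> is determined by
  this equation and its derivatives, provided that it is constant; this prescribes the coefficients \<open>q\<close>,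
  \<open>l\<close>, \<open>d\<close>, \<open>x\<close> below, which are the components of \<open>\<kappa>\<close> and of its derivatives along the normal. That \<open>v\<close> is
  indeed constant is the Euler-Lagrange equation together with the equation for \<open>D\<^sub>z X\<close>.\<close>

theorem hypersurface_minimal_frame:
  assumes conv: "convex \<Omega>" and p: "p \<in> \<Omega>" and mu0: "\<And>z. z \<in> \<Omega> \<Longrightarrow> mu z = 0"
  obtains v \<xi> K where "minimal_frame v \<xi> K" "\<And>z. z \<in> \<Omega> \<Longrightarrow> lorentz (\<psi> z) (cplx v) \<noteq> 0"
proof -
  define n where "n z = inverse (of_real (rt z)) *s kap z" for z
  have fr: "parallel_hopf_frame (\<lambda>j::1. n) (\<lambda>j. rt)" unfolding n_def[abs_def] by (rule parallel_frame_1[OF mu0])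
  interpret F: framed_lift \<Omega> \<psi> "\<lambda>j::1. n" "\<lambda>j. rt" by unfold_locales (use fr conv in auto)
  have D: "hasD n (\<lambda>z. 0) (\<lambda>z. 0)" and nn: "z \<in> \<Omega> \<Longrightarrow> lorentz (n z) (n z) = 1" and pn: "z \<in> \<Omega> \<Longrightarrow> perp z (n z)"
    and rn: "z \<in> \<Omega> \<Longrightarrow> vcnj (n z) = n z" for z
    using F.xi_D F.xi_ip[of z 1 1] F.xi_perp F.xi_real by auto
  define q l d x where "q z = lorentz (kap z) (n z)" and "l z = lorentz (L z) (n z)" and "d z = lorentz (dk z) (n z)" and "x z = lorentz (X z) (n z)" for z
  have kn: "kap z = of_real (rt z) *s n z" if "z \<in> \<Omega>" for z unfolding n_def using unit_kap(3)[OF that] by simp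
  have qr: "q z = of_real (rt z)" if "z \<in> \<Omega>" for z unfolding q_def kn[OF that] using nn[OF that] by simp
  have mult: "V = lorentz V (n z) *s n z" if "V = k *s n z" "z \<in> \<Omega>" for V k z using that(1) nn[OF that(2)] by simp
  have Ln: "L z = l z *s n z" if z: "z \<in> \<Omega>" for z
    unfolding l_def by (rule mult[of _ "f0 z * of_real (rt z)", OF _ z]) (simp add: L_mu mu0 z kn[OF z] vector_smult_assoc)
  have dn: "dk z = d z *s n z" if z: "z \<in> \<Omega>" for z
  proof -
    have "Mb z = 0" using vcnj_mu[OF z] mu0[OF z] by simp
    then show ?thesis unfolding d_def by (intro mult[of _ "cnj (f0 z) * of_real (rt z)", OF _ z]) (simp add: dk_Mb z kn[OF z] vector_smult_assoc)
  qed
  have kq: "kap z = q z *s n z" if "z \<in> \<Omega>" for z using kn[OF that] qr[OF that] by simp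
  have uq: "u z = q z * q z" "uz z = 2 * (q z * l z)" "mm z = q z * q z" if z: "z \<in> \<Omega>" for z
  proof -
    have "mm z = lorentz (kap z) (kap z)" using mm_eq[OF z] by (simp add: kap_real z)
    then show "u z = q z * q z" "uz z = 2 * (q z * l z)" "mm z = q z * q z"
      using nn[OF z] unfolding u_def uz_def kq[OF z] Ln[OF z] by simp_all
  qed
  have dq: "has_wirtc q (l z) (d z) z" and dl: "has_wirtc l (- (cc z / 2) * q z) (x z) z" and dd: "has_wirtc d (x z) (- (cnj (cc z) / 2) * q z) z"
    and dx: "has_wirtc x (- 2 * uz z * q z - cc z / 2 * d z) (- 2 * cnj (uz z) * q z - cnj (cc z) / 2 * l z) z" if z: "z \<in> \<Omega>" for z
    using hasD_wirtc[OF hasD_kap_L D z] hasD_wirtc[OF hasD_L D z] hasD_wirtc[OF hasD_dk D z] hasD_wirtc[OF hasD_X D z]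
    unfolding q_def[abs_def] l_def[abs_def] d_def[abs_def] x_def[abs_def] by (simp_all add: algebra_simps)
  have rc: "cnj (q z) = q z" "cnj (l z) = d z" "cnj (d z) = l z" "cnj (x z) = x z" if z: "z \<in> \<Omega>" for z
    using lorentz_vcnj[of "kap z" "n z"] lorentz_vcnj[of "L z" "n z"] lorentz_vcnj[of "dk z" "n z"] lorentz_vcnj[of "X z" "n z"]
    unfolding q_def l_def d_def x_def by (simp_all add: kap_real z rn vcnj_L X_real L_def)
  define v where "v z = q z *s N z - (2 * l z) *s Pb z - (2 * d z) *s P z + (2 * (q z * (q z * q z)) + 2 * x z) *s \<psi> z" for z
  have vr: "vcnj (v z) = v z" if z: "z \<in> \<Omega>" for z
    unfolding v_def by (simp add: rc z real vcnj_N vcnj_P vcnj_Pb vec_eq_iff)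
  have ex: "\<exists>b. has_wirt v 0 b z" if z: "z \<in> \<Omega>" for z
  proof -
    have two: "has_wirtc (\<lambda>z. 2 * f z) (2 * a) (2 * b) z" if "has_wirtc f a b z" for f a b
      using has_wirtc_mult[OF has_wirtc_const[of 2] that] by simp
    define A where "A = (l z *s N z + q z *s (2 *s dk z - (2 * mm z) *s P z - cc z *s Pb z)) - ((2 * (- (cc z / 2) * q z)) *s Pb z + (2 * l z) *s Y z)
       - ((2 * x z) *s P z + (2 * d z) *s Z z) + ((2 * (l z * (q z * q z) + q z * (l z * q z + q z * l z)) + 2 * (- 2 * uz z * q z - cc z / 2 * d z)) *s \<psi> z
        + (2 * (q z * (q z * q z)) + 2 * x z) *s P z)"
    have "\<exists>b. has_wirt v A b z" unfolding v_def[abs_def] A_def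
      by (rule exI, rule has_wirt_add[OF has_wirt_diff[OF has_wirt_diff[OF has_wirt_scale[OF dq[OF z] has_wirt_N(1)[OF z]]
            has_wirt_scale[OF two[OF dl[OF z]] has_wirt_Pb[OF z]]] has_wirt_scale[OF two[OF dd[OF z]] has_wirt_P[OF z]]]
          has_wirt_scale[OF has_wirtc_add[OF two[OF has_wirtc_mult[OF dq[OF z] has_wirtc_mult[OF dq[OF z] dq[OF z]]]] two[OF dx[OF z]]] has_wirt_psi[OF z]]])
    moreover have "A = 0" unfolding A_def Z_eq Y_eq uq[OF z] kq[OF z] dn[OF z] by (simp add: vec_eq_iff algebra_simps)
    ultimately show ?thesis by simp
  qed
  have vc: "v z = v p" if "z \<in> \<Omega>" for z by (rule real_const_vector[OF open_dom conv p vr ex that])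
  define v0 where "v0 = re_vec (v p)"
  have cv: "cplx v0 = v z" if "z \<in> \<Omega>" for z unfolding v0_def using cplx_re_vec[OF vr[OF p]] vc[OF that] by simp
  have "minimal_frame v0 (\<lambda>j::1. n) (\<lambda>j. rt)"
    unfolding minimal_frame_def
  proof (intro conjI ballI fr)
    fix z assume z: "z \<in> \<Omega>"
    show "lorentz (n z) (cplx v0) = 0" unfolding cv[OF z] v_def by (simp add: perp_frame[OF pn[OF z]])
    have dif: "F.PrW z (V - V') = F.PrW z V - F.PrW z V'" for V V'
      using PiW_lin(1)[of UNIV "\<lambda>j::1. n" z "V - V'" V'] by (simp add: algebra_simps)
    show "PiW UNIV (\<lambda>j::1. n) z (cplx v0) = cplx v0"
      unfolding cv[OF z] v_def by (simp only: PiW_lin(1,2) dif F.Pi_frame[OF z])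
  qed
  moreover have "lorentz (\<psi> z) (cplx v0) \<noteq> 0" if z: "z \<in> \<Omega>" for z
    unfolding cv[OF z] v_def using qr[OF z] rt_pos[OF z] by (simp add: ip z)
  ultimately show ?thesis by (rule that)
qed

end

context affine_sqrt
begin

text \<open>In components with respect to a parallel frame covariant derivatives become ordinary ones, and the
  equations for \<open>D\<^sub>z L\<close>, \<open>D\<^bsub>zbar\<^esub> L\<close>, \<open>c\<^bsub>zbar\<^esub>\<close> and the reality of \<open>hh L\<close> are the hypotheses of the reduction to an
  ordinary differential equation.\<close>

theorem ode_frame:
  assumes ball: "\<Omega> = ball p r" "r > 0"
  obtains \<xi> :: "2 \<Rightarrow> complex \<Rightarrow> complex ^ 'a option" and K where "parallel_hopf_frame \<xi> K"
    "\<alpha> = 0 \<Longrightarrow> elastica_hopf \<Omega> (\<lambda>z. \<chi> j. K j z)" "\<alpha> \<noteq> 0 \<Longrightarrow> \<eta> = 0 \<Longrightarrow> radial_painleve_hopf \<Omega> (\<lambda>z. \<chi> j. K j z)"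
proof -
  obtain \<xi> :: "2 \<Rightarrow> complex \<Rightarrow> complex ^ 'a option" and K where fr: "parallel_hopf_frame \<xi> K" using parallel_frame_2[OF ball(1)] .
  interpret F: framed_lift \<Omega> \<psi> \<xi> K by unfold_locales (use fr ball in auto)
  have LK: "L z = (\<Sum>j\<in>UNIV. F.Kz j z *s \<xi> j z)" if z: "z \<in> \<Omega>" for z
    by (rule hasD_unique(1)[OF hasD_kap_L F.hasD_combination[OF F.Kc_smooth F.has_wirtc_Kc] _ z]) (simp_all add: F.kap_K F.Kc_def)
  define y where "y j z = Re (lorentz (X z) (\<xi> j z))" for j z
  have yX: "lorentz (X z) (\<xi> j z) = of_real (y j z)" if z: "z \<in> \<Omega>" for j z
  proof -
    have "cnj (lorentz (X z) (\<xi> j z)) = lorentz (X z) (\<xi> j z)" using lorentz_vcnj[of "X z" "\<xi> j z"] by (simp add: X_real z F.xi_real)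
    then show ?thesis unfolding y_def by (simp add: complex_eq_iff)
  qed
  have kc: "lorentz (kap z) (\<xi> j z) = of_real (K j z)" if z: "z \<in> \<Omega>" for j z
    unfolding F.kap_K[OF z] by (rule F.coeff[OF z])
  have Lc: "lorentz (L z) (\<xi> j z) = F.Kz j z" if z: "z \<in> \<Omega>" for j z unfolding LK[OF z] by (rule F.coeff[OF z])
  have 1: "has_wirtc (\<lambda>z. of_real (K j z)) (F.Kz j z) (cnj (F.Kz j z)) z" if "z \<in> \<Omega>" for j z
    using F.has_wirtc_Kc[OF that, of j] unfolding F.Kc_def[abs_def] .
  have 2: "has_wirtc (F.Kz j) (- (cc z / 2) * of_real (K j z)) (of_real (y j z)) z" if z: "z \<in> \<Omega>" for j z
  proof -
    have "has_wirtc (\<lambda>z. lorentz (L z) (\<xi> j z)) (- (cc z / 2) * of_real (K j z)) (of_real (y j z)) z"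
      using hasD_wirtc[OF hasD_L F.xi_D z, of j] by (simp add: kc z yX)
    then show ?thesis by (rule has_wirtc_cong_open[OF _ open_dom z Lc])
  qed
  have 3: "has_wirtc cc (wirtc cc z) (8 * (\<Sum>j\<in>UNIV. of_real (K j z) * F.Kz j z)) z" if z: "z \<in> \<Omega>" for z
  proof -
    have "lorentz (kap z) (L z) = (\<Sum>j\<in>UNIV. of_real (K j z) * F.Kz j z)"
      unfolding lorentz_commute[of "kap z"] LK[OF z] lorentz_sum by (simp add: lorentz_commute[of "\<xi> _ z"] kc z mult.commute)
    then have "4 * uz z = 8 * (\<Sum>j\<in>UNIV. of_real (K j z) * F.Kz j z)" unfolding uz_def by simp
    then show ?thesis using has_wirtc_c[OF z] by simp
  qed
  have 4: "hh z * F.Kz j z = cnj (hh z) * cnj (F.Kz j z)" if z: "z \<in> \<Omega>" for j z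
  proof -
    have "lorentz (dk z) (\<xi> j z) = cnj (F.Kz j z)" unfolding F.dk_K[OF z] by (rule F.coeff[OF z])
    then show ?thesis using arg_cong[OF sqrt_Q_real(3)[OF z hh_Q[OF z]], of "\<lambda>v. lorentz v (\<xi> j z)"] by (simp add: Lc z)
  qed
  have 5: "\<exists>j. K j z \<noteq> 0" if z: "z \<in> \<Omega>" for z
  proof (rule ccontr)
    assume "\<not> (\<exists>j. K j z \<noteq> 0)"
    then have "kap z = 0" unfolding F.kap_K[OF z] by simp
    then show False using kap_nz[OF z] by simp
  qed
  show ?thesis
  proof (rule that[OF fr])
    assume a: "\<alpha> = 0"
    interpret E: hopf_elastica where p = p and r = r and K = K and Kz = "F.Kz" and y = y and c = cc and c' = "wirtc cc" and \<Omega> = \<Omega> and \<eta> = \<eta>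
      by unfold_locales (use ball 1 2 3 5 4[unfolded hh_def] a aff_nz in auto)
    show "elastica_hopf \<Omega> (\<lambda>z. \<chi> j. K j z)" by (rule E.elastica)
  next
    assume a: "\<alpha> \<noteq> 0" and e: "\<eta> = 0"
    interpret R: hopf_radial where p = p and r = r and K = K and Kz = "F.Kz" and y = y and c = cc and c' = "wirtc cc" and \<Omega> = \<Omega> and \<alpha> = \<alpha>
      by unfold_locales (use ball 1 2 3 5 4[unfolded hh_def] a e in auto)
    show "radial_painleve_hopf \<Omega> (\<lambda>z. \<chi> j. K j z)" by (rule R.radial)
  qed
qed

end

lemma (in lightcone_lift) hopf_components_of_frame:
  fixes \<xi> :: "2 \<Rightarrow> complex \<Rightarrow> complex ^ 'n option"
  assumes fr: "parallel_hopf_frame \<xi> K" and conv: "convex \<Omega>" and p: "p \<in> \<Omega>"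
    and W: "lorentz_span S = framed_lift.W \<psi> \<xi> p"
  shows "hopf_components (lorentz_span S) \<Omega> \<psi> (\<lambda>z. \<chi> j. K j z)"
proof -
  interpret F: framed_lift \<Omega> \<psi> \<xi> K by unfold_locales (use fr conv in auto)
  have cx: "cplx (re_vec (\<xi> j z)) = \<xi> j z" if "z \<in> \<Omega>" for j z by (rule cplx_re_vec[OF F.xi_real[OF that]])
  show ?thesis unfolding hopf_components_def parallel_normal_frame_def
  proof (intro exI[of _ "\<lambda>j z. re_vec (\<xi> j z)"] conjI allI ballI)
    show "smooth_on \<Omega> (\<lambda>z. re_vec (\<xi> j z))" for j by (intro smooth_intros open_dom F.xi_smooth)
  next
    fix z j assume z: "z \<in> \<Omega>"
    show "re_vec (\<xi> j z) \<in> lorentz_span S" unfolding W by (rule F.xi_in_W[OF z p])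
    show "cplx (re_vec (\<xi> j z)) \<in> bundleVperp \<psi> z" unfolding cx[OF z] bundleVperp_iff[OF z] by (rule F.xi_perp[OF z])
  next
    fix z i j assume z: "z \<in> \<Omega>"
    have "complex_of_real (lorentz (re_vec (\<xi> i z)) (re_vec (\<xi> j z))) = of_real (if i = j then 1 else 0)"
      unfolding lorentz_cplx[symmetric] cx[OF z] F.xi_ip[OF z] by simp
    then show "lorentz (re_vec (\<xi> i z)) (re_vec (\<xi> j z)) = (if i = j then 1 else 0)" unfolding of_real_eq_iff .
  next
    fix z j v assume z: "z \<in> \<Omega>"
    obtain A B where AB: "has_wirt (\<xi> j) A B z" "pr z A = 0" "pr z B = 0" using hasD_at[OF F.xi_D z] by metis
    have "smooth_on \<Omega> (\<lambda>z. re_vec (\<xi> j z))" by (intro smooth_intros open_dom F.xi_smooth)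
    from bounded_linear.has_derivative[OF bounded_linear_cplx smooth_on_has_derivative(2)[OF this z]]
    have "((\<lambda>z. cplx (re_vec (\<xi> j z))) has_derivative (\<lambda>v. cplx (dder (\<lambda>z. re_vec (\<xi> j z)) v z))) (at z)" .
    then have "(\<xi> j has_derivative (\<lambda>v. cplx (dder (\<lambda>z. re_vec (\<xi> j z)) v z))) (at z)"
      by (rule has_derivative_transform_within_open[OF _ open_dom z]) (rule cx)
    then have "cplx (dder (\<lambda>z. re_vec (\<xi> j z)) v z) = v *s A + cnj v *s B"
      using has_derivative_unique[OF _ AB(1)[unfolded has_wirt_def]] by (metis (mono_tags))
    then show "perp_proj \<psi> z (cplx (dder (\<lambda>z. re_vec (\<xi> j z)) v z)) = 0"
      unfolding perp_proj_eq[OF z] by (simp add: AB)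
  next
    fix z assume z: "z \<in> \<Omega>"
    show "hopf \<psi> z = cplx (\<Sum>j\<in>UNIV. ((\<chi> j. K j z) $ j) *\<^sub>R re_vec (\<xi> j z))"
      unfolding hopf_eq[OF z] F.kap_K[OF z] by (simp add: sum_2 cx z)
  qed
qed

section \<open>Coordinates on a Riemann surface\<close>

lemma normalized_lift_lightcone:
  fixes F :: "complex \<Rightarrow> real ^ 'n::finite"
  assumes S: "open S" and \<psi>: "normalized_lift S F \<psi>"
  shows "lightcone_lift S (cplx \<circ> \<psi>)"
proof
  have sm: "smooth_on S \<psi>" and n: "z \<in> S \<Longrightarrow> lorentz (\<psi> z) (\<psi> z) = 0" and c: "z \<in> S \<Longrightarrow> lorentz (dder \<psi> v z) (dder \<psi> v z) = (cmod v)\<^sup>2" for z v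
    using \<psi> unfolding normalized_lift_def forward_light_cone_def light_cone_def by auto
  show "open S" by (rule S)
  show "smooth_on S (cplx \<circ> \<psi>)" unfolding o_def by (intro smooth_intros S sm)
  fix z assume z: "z \<in> S"
  show "vcnj ((cplx \<circ> \<psi>) z) = (cplx \<circ> \<psi>) z" "lorentz ((cplx \<circ> \<psi>) z) ((cplx \<circ> \<psi>) z) = 0" using n[OF z] by simp_all
  have d: "dder (cplx \<circ> \<psi>) v z = cplx (dder \<psi> v z)" for v
    using frechet_derivative_at[OF bounded_linear.has_derivative[OF bounded_linear_cplx smooth_on_has_derivative(2)[OF sm z]], THEN fun_cong[where x = v]]
    unfolding dder_def o_def by simp
  have add: "dder \<psi> (1 + \<i>) z = dder \<psi> 1 z + dder \<psi> \<i> z"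
    using differentiable_imp_dder(2)[OF smooth_on_has_derivative(1)[OF sm z], of "1 + \<i>"] by simp
  have 1: "lorentz (dder \<psi> 1 z) (dder \<psi> 1 z) = 1" "lorentz (dder \<psi> \<i> z) (dder \<psi> \<i> z) = 1" using c[OF z] by simp_all
  have "(cmod (1 + \<i>))\<^sup>2 = 2" by (simp add: cmod_power2)
  then have 2: "lorentz (dder \<psi> 1 z) (dder \<psi> \<i> z) = 0"
    using c[OF z, of "1 + \<i>"] 1 unfolding add by (simp add: lorentz_commute[of "dder \<psi> \<i> z" "dder \<psi> 1 z"])
  show "lorentz (wirt (cplx \<circ> \<psi>) z) (wirt (cplx \<circ> \<psi>) z) = 0" "lorentz (wirt (cplx \<circ> \<psi>) z) (wirtbar (cplx \<circ> \<psi>) z) = 1 / 2"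
    unfolding wirt_def wirtbar_def d using 1 2 by (simp_all add: lorentz_commute[of "dder \<psi> \<i> z" "dder \<psi> 1 z"])
qed

lemma complex_chart_props:
  assumes "complex_chart X U \<phi>"
  shows "openin X U" "open (\<phi> ` U)" "inj_on \<phi> U" "U \<subseteq> topspace X"
    "\<And>V. V \<subseteq> U \<Longrightarrow> openin X V \<Longrightarrow> open (\<phi> ` V)"
    "\<And>B. open B \<Longrightarrow> openin X {x \<in> U. \<phi> x \<in> B}"
proof -
  have h: "homeomorphic_map (subtopology X U) (top_of_set (\<phi> ` U)) \<phi>" and o: "openin X U" "open (\<phi> ` U)"
    using assms unfolding complex_chart_def by auto
  show "openin X U" "open (\<phi> ` U)" by (rule o)+
  show t: "U \<subseteq> topspace X" using o(1) openin_subset by blast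
  have ts: "topspace (subtopology X U) = U" using t by auto
  show "inj_on \<phi> U" using homeomorphic_imp_injective_map[OF h] ts by simp
  show "open (\<phi> ` V)" if V: "V \<subseteq> U" "openin X V" for V
  proof -
    have "openin (subtopology X U) V" using V openin_subset_topspace_eq o(1) openin_open_subtopology by blast
    then have "openin (top_of_set (\<phi> ` U)) (\<phi> ` V)" using homeomorphic_map_openness[OF h, of V] V(1) unfolding ts by blast
    then show ?thesis using openin_open_eq[OF o(2)] by blast
  qed
  show "openin X {x \<in> U. \<phi> x \<in> B}" if B: "open B" for B
  proof -
    have "openin (top_of_set (\<phi> ` U)) (\<phi> ` U \<inter> B)" using B by (simp add: openin_open_Int)
    then have "openin (subtopology X U) {x \<in> topspace (subtopology X U). \<phi> x \<in> \<phi> ` U \<inter> B}"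
      by (rule openin_continuous_map_preimage[OF homeomorphic_imp_continuous_map[OF h]])
    moreover have "{x \<in> topspace (subtopology X U). \<phi> x \<in> \<phi> ` U \<inter> B} = {x \<in> U. \<phi> x \<in> B}" unfolding ts by auto
    ultimately show ?thesis using openin_open_subtopology[OF o(1)] by auto
  qed
qed

lemma complex_chart_restrict_shift:
  assumes c: "complex_chart X U \<phi>" and V: "V \<subseteq> U" "openin X V"
  shows "complex_chart X V (\<lambda>x. \<phi> x - a)"
proof -
  note p = complex_chart_props[OF c]
  have h: "homeomorphic_map (subtopology X U) (top_of_set (\<phi> ` U)) \<phi>" using c unfolding complex_chart_def by auto
  have VX: "V \<subseteq> topspace X" using V p by auto
  have "homeomorphic_map (subtopology (subtopology X U) V) (subtopology (top_of_set (\<phi> ` U)) (\<phi> ` V)) \<phi>"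
    by (rule homeomorphic_map_subtopologies[OF h]) (use V VX in auto)
  moreover have "subtopology (subtopology X U) V = subtopology X V" "subtopology (top_of_set (\<phi> ` U)) (\<phi> ` V) = top_of_set (\<phi> ` V)"
    using V(1) by (auto simp: subtopology_subtopology inf.absorb2 image_mono)
  ultimately have h1: "homeomorphic_map (subtopology X V) (top_of_set (\<phi> ` V)) \<phi>" by simp
  have im: "(\<lambda>x. \<phi> x - a) ` V = (\<lambda>w. w - a) ` \<phi> ` V" by auto
  have "homeomorphic_maps (top_of_set (\<phi> ` V)) (top_of_set ((\<lambda>x. \<phi> x - a) ` V)) (\<lambda>w. w - a) (\<lambda>w. w + a)"
    unfolding homeomorphic_maps_def by (auto intro!: continuous_intros)
  then have "homeomorphic_map (top_of_set (\<phi> ` V)) (top_of_set ((\<lambda>x. \<phi> x - a) ` V)) (\<lambda>w. w - a)"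
    using homeomorphic_map_maps by blast
  from homeomorphic_map_compose[OF h1 this] have "homeomorphic_map (subtopology X V) (top_of_set ((\<lambda>x. \<phi> x - a) ` V)) (\<lambda>x. \<phi> x - a)"
    by (simp add: o_def)
  moreover have "open ((\<lambda>x. \<phi> x - a) ` V)" unfolding im using open_translation_subtract[OF p(5)[OF V]] by simp
  ultimately show ?thesis using V unfolding complex_chart_def by blast
qed

lemma inv_into_restrict_shift:
  fixes \<phi> :: "'a \<Rightarrow> complex"
  assumes "inj_on \<phi> U" "V \<subseteq> U" "w \<in> (\<lambda>x. \<phi> x - a) ` V"
  shows "inv_into V (\<lambda>x. \<phi> x - a) w = inv_into U \<phi> (w + a)" "w + a \<in> \<phi> ` V"
proof -
  obtain x where x: "x \<in> V" "w = \<phi> x - a" using assms(3) by blast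
  have "inj_on (\<lambda>x. \<phi> x - a) V" using inj_on_subset[OF assms(1,2)] by (simp add: inj_on_def)
  then have "inv_into V (\<lambda>x. \<phi> x - a) w = x" unfolding x(2) by (rule inv_into_f_f[OF _ x(1)])
  moreover have "inv_into U \<phi> (w + a) = x" unfolding x(2) using inv_into_f_f[OF assms(1), of x] x assms(2) by auto
  ultimately show "inv_into V (\<lambda>x. \<phi> x - a) w = inv_into U \<phi> (w + a)" by simp
  show "w + a \<in> \<phi> ` V" using x by simp
qed

lemma holo_coord_restrict_shift:
  assumes c: "holo_coord X \<A> U \<phi>" and V: "V \<subseteq> U" "openin X V"
  shows "holo_coord X \<A> V (\<lambda>x. \<phi> x - a)"
  unfolding holo_coord_def
proof (intro conjI ballI, goal_cases)
  case 1 then show ?case using complex_chart_restrict_shift[OF _ V] c unfolding holo_coord_def by blast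
next
  case (2 P)
  obtain W \<theta> where P: "P = (W, \<theta>)" by fastforce
  have hc: "holo_compatible U \<phi> W \<theta>" using c 2 unfolding holo_coord_def P by blast
  have inj: "inj_on \<phi> U" using c complex_chart_props(3) unfolding holo_coord_def by blast
  let ?p = "\<lambda>x. \<phi> x - a"
  have "(\<lambda>w. (\<theta> \<circ> inv_into U \<phi>) (w + a)) holomorphic_on ?p ` (V \<inter> W)"
  proof (rule holomorphic_on_compose_gen[of "\<lambda>w. w + a" _ "\<theta> \<circ> inv_into U \<phi>" "\<phi> ` (U \<inter> W)", unfolded o_def[of _ "\<lambda>w. w + a"]])
    show "(\<lambda>w. w + a) holomorphic_on ?p ` (V \<inter> W)" by (intro holomorphic_intros)
    show "\<theta> \<circ> inv_into U \<phi> holomorphic_on \<phi> ` (U \<inter> W)" using hc unfolding holo_compatible_def by blast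
  qed (use V in auto)
  then have "(\<theta> \<circ> inv_into V ?p) holomorphic_on ?p ` (V \<inter> W)"
    by (rule holomorphic_transform) (auto simp: inv_into_restrict_shift(1)[OF inj V(1)])
  moreover have "(\<lambda>w. (\<phi> \<circ> inv_into W \<theta>) w - a) holomorphic_on \<theta> ` (V \<inter> W)"
  proof (intro holomorphic_on_diff holomorphic_on_const)
    have "(\<phi> \<circ> inv_into W \<theta>) holomorphic_on \<theta> ` (U \<inter> W)" using hc unfolding holo_compatible_def by blast
    then show "(\<phi> \<circ> inv_into W \<theta>) holomorphic_on \<theta> ` (V \<inter> W)" by (rule holomorphic_on_subset) (use V in auto)
  qed
  ultimately show ?case unfolding P holo_compatible_def by (auto simp: o_def)
qed

text \<open>Coordinates are only required to be compatible with the atlas; near each point the transition factors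
  through a chart of the atlas.\<close>

lemma holo_coord_transition:
  assumes X: "riemann_surface X \<A>" and c: "holo_coord X \<A> U \<phi>" "holo_coord X \<A> U' \<phi>'"
  shows "(\<phi> \<circ> inv_into U' \<phi>') holomorphic_on \<phi>' ` (U \<inter> U')"
proof -
  have cc: "complex_chart X U \<phi>" "complex_chart X U' \<phi>'" using c unfolding holo_coord_def by auto
  note p = complex_chart_props[OF cc(1)] and p' = complex_chart_props[OF cc(2)]
  have "(\<phi> \<circ> inv_into U' \<phi>') field_differentiable (at w)" if w: "w \<in> \<phi>' ` (U \<inter> U')" for w
  proof -
    obtain q where q: "q \<in> U" "q \<in> U'" "w = \<phi>' q" using w by blast
    have "q \<in> topspace X" using q p by auto
    then obtain V \<theta> where V: "(V, \<theta>) \<in> \<A>" "q \<in> V" using X unfolding riemann_surface_def by blast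
    have cV: "complex_chart X V \<theta>" using X V unfolding riemann_surface_def by blast
    note pV = complex_chart_props[OF cV]
    have hc: "holo_compatible U \<phi> V \<theta>" "holo_compatible U' \<phi>' V \<theta>" using c V unfolding holo_coord_def by blast+
    let ?O = "\<phi>' ` (U \<inter> U' \<inter> V)"
    have o: "open ?O" by (rule p'(5)) (use p p' pV in auto)
    have "((\<phi> \<circ> inv_into V \<theta>) \<circ> (\<theta> \<circ> inv_into U' \<phi>')) holomorphic_on ?O"
    proof (rule holomorphic_on_compose_gen[where t = "\<theta> ` (U \<inter> V)"])
      show "(\<theta> \<circ> inv_into U' \<phi>') holomorphic_on ?O"
        using hc(2) unfolding holo_compatible_def by (auto elim: holomorphic_on_subset)
      show "(\<phi> \<circ> inv_into V \<theta>) holomorphic_on \<theta> ` (U \<inter> V)" using hc(1) unfolding holo_compatible_def by blast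
      show "(\<theta> \<circ> inv_into U' \<phi>') ` ?O \<subseteq> \<theta> ` (U \<inter> V)" using inv_into_f_f[OF p'(3)] by auto
    qed
    then have "(\<phi> \<circ> inv_into U' \<phi>') holomorphic_on ?O"
      by (rule holomorphic_transform) (auto simp: inv_into_f_f[OF p'(3)] inv_into_f_f[OF pV(3)])
    then show ?thesis using o q V(2) by (auto simp: holomorphic_on_open field_differentiable_def)
  qed
  then show ?thesis unfolding holomorphic_on_def using field_differentiable_at_within by blast
qed

section \<open>Lifts of a surface in different coordinates\<close>

lemma dder_shift: "dder (\<lambda>z. F (z + a)) v z = dder F v (z + a)"
proof -
  have "((\<lambda>z. F (z + a)) has_derivative D) (at z) \<longleftrightarrow> (F has_derivative D) (at (z + a))" for D
  proof
    assume "(F has_derivative D) (at (z + a))"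
    from has_derivative_compose[where f = "\<lambda>z. z + a" and g = F and f' = "\<lambda>x. x", OF _ this]
    show "((\<lambda>z. F (z + a)) has_derivative D) (at z)" by (simp add: has_derivative_add_const[OF has_derivative_ident, simplified])
  next
    assume A: "((\<lambda>z. F (z + a)) has_derivative D) (at z)"
    have "((\<lambda>w. F (w - a + a)) has_derivative D) (at (z + a))"
      by (rule has_derivative_compose[where f = "\<lambda>w. w - a" and g = "\<lambda>z. F (z + a)" and f' = "\<lambda>x. x"])
         (use A in \<open>auto intro!: derivative_eq_intros\<close>)
    then show "(F has_derivative D) (at (z + a))" by simp
  qed
  then show ?thesis unfolding dder_def frechet_derivative_def by simp
qed

lemma dder_shift_on:
  assumes "open S" "z \<in> S" "\<And>w. w \<in> S \<Longrightarrow> G w = F (w + a)" "G differentiable (at z)"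
  shows "dder G v z = dder F v (z + a)"
proof -
  have "dder G v z = dder (\<lambda>z. F (z + a)) v z"
    unfolding dder_def by (subst frechet_derivative_transform_within_open[OF assms(4,1,2,3)]) auto
  then show ?thesis by (simp add: dder_shift)
qed

lemma wirt_shift_on:
  assumes "open S" "smooth_on S G" "\<And>w. w \<in> S \<Longrightarrow> G w = F (w + a)" "z \<in> S"
  shows "wirt G z = wirt F (z + a)" "wirtbar G z = wirtbar F (z + a)"
  unfolding wirt_def wirtbar_def
  using dder_shift_on[OF assms(1,4,3) smooth_on_has_derivative(1)[OF assms(2,4)]] by simp_all

lemma surf_lift_lightcone:
  fixes f :: "'a \<Rightarrow> real ^ 'n::finite"
  assumes ci: "conformal_immersion X \<A> f" and c: "holo_coord X \<A> U \<phi>"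
  obtains \<psi> where "surf_lift f U \<phi> = cplx \<circ> \<psi>" "normalized_lift (\<phi> ` U) (f \<circ> inv_into U \<phi>) \<psi>" "lightcone_lift (\<phi> ` U) (surf_lift f U \<phi>)"
    "conformal_immersion_on (\<phi> ` U) (f \<circ> inv_into U \<phi>)" "(f \<circ> inv_into U \<phi>) ` \<phi> ` U \<subseteq> sphere 0 1"
proof -
  have cc: "complex_chart X U \<phi>" using c unfolding holo_coord_def by auto
  note p = complex_chart_props[OF cc]
  have 1: "conformal_immersion_on (\<phi> ` U) (f \<circ> inv_into U \<phi>)" using ci c unfolding conformal_immersion_def by blast
  have 2: "(f \<circ> inv_into U \<phi>) ` \<phi> ` U \<subseteq> sphere 0 1"
    using ci p(4) inv_into_into[of _ \<phi> U] unfolding conformal_immersion_def by fastforce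
  obtain \<psi> where \<psi>: "nlift (\<phi> ` U) (f \<circ> inv_into U \<phi>) = cplx \<circ> \<psi>" "normalized_lift (\<phi> ` U) (f \<circ> inv_into U \<phi>) \<psi>"
    using nlift_normalized[OF p(2) 1 2] .
  then show ?thesis using that[OF _ \<psi>(2) _ 1 2] normalized_lift_lightcone[OF p(2) \<psi>(2)] unfolding surf_lift_def by simp
qed

text \<open>The formula for the normalized lift commutes with translation of the coordinate and with restriction.\<close>

lemma surf_lift_shift:
  fixes f :: "'a \<Rightarrow> real ^ 'n::finite"
  assumes ci: "conformal_immersion X \<A> f" and c: "holo_coord X \<A> U \<phi>" and V: "V \<subseteq> U" "openin X V"
    and z: "z \<in> (\<lambda>x. \<phi> x - a) ` V"
  shows "surf_lift f V (\<lambda>x. \<phi> x - a) z = surf_lift f U \<phi> (z + a)"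
proof -
  let ?p = "\<lambda>x. \<phi> x - a"
  have cV: "holo_coord X \<A> V ?p" by (rule holo_coord_restrict_shift[OF c V])
  have cc: "complex_chart X U \<phi>" "complex_chart X V ?p" using c cV unfolding holo_coord_def by auto
  note p = complex_chart_props[OF cc(1)] and pV = complex_chart_props[OF cc(2)]
  obtain \<psi> where \<psi>: "surf_lift f U \<phi> = cplx \<circ> \<psi>" "normalized_lift (\<phi> ` U) (f \<circ> inv_into U \<phi>) \<psi>"
    "conformal_immersion_on (\<phi> ` U) (f \<circ> inv_into U \<phi>)" "(f \<circ> inv_into U \<phi>) ` \<phi> ` U \<subseteq> sphere 0 1"
    using surf_lift_lightcone[OF ci c] by metis
  obtain \<psi>' where \<psi>': "surf_lift f V ?p = cplx \<circ> \<psi>'" "normalized_lift (?p ` V) (f \<circ> inv_into V ?p) \<psi>'"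
    "conformal_immersion_on (?p ` V) (f \<circ> inv_into V ?p)" "(f \<circ> inv_into V ?p) ` ?p ` V \<subseteq> sphere 0 1"
    using surf_lift_lightcone[OF ci cV] by metis
  have za: "z + a \<in> \<phi> ` U" using inv_into_restrict_shift(2)[OF p(3) V(1) z] V(1) by blast
  have F: "(f \<circ> inv_into V ?p) w = (f \<circ> inv_into U \<phi>) (w + a)" if "w \<in> ?p ` V" for w
    using inv_into_restrict_shift(1)[OF p(3) V(1) that] by simp
  have "dder (f \<circ> inv_into V ?p) 1 z = dder (f \<circ> inv_into U \<phi>) 1 (z + a)"
    by (rule dder_shift_on[where G = "f \<circ> inv_into V ?p" and F = "f \<circ> inv_into U \<phi>" and a = a, OF pV(2) z F]) (use \<psi>'(3) smooth_on_has_derivative(1)[OF _ z] in \<open>auto simp: conformal_immersion_on_def\<close>)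
  then have "\<psi>' z = \<psi> (z + a)"
    unfolding normalized_lift_eq[OF p(2) \<psi>(3,4,2) za] normalized_lift_eq[OF pV(2) \<psi>'(3,4,2) z] F[OF z] by simp
  then show ?thesis unfolding \<psi> \<psi>' by simp
qed

lemma lift_shift:
  fixes \<psi>0 \<psi>1 :: "complex \<Rightarrow> complex ^ 'n::finite option"
  assumes l: "lightcone_lift \<Omega>0 \<psi>0" "lightcone_lift \<Omega>1 \<psi>1"
    and e: "\<And>z. z \<in> \<Omega>1 \<Longrightarrow> z + a \<in> \<Omega>0" "\<And>z. z \<in> \<Omega>1 \<Longrightarrow> \<psi>1 z = \<psi>0 (z + a)" and z: "z \<in> \<Omega>1"
  shows "lightcone_lift.kap \<psi>1 z = lightcone_lift.kap \<psi>0 (z + a)" "lightcone_lift.dk \<psi>1 z = lightcone_lift.dk \<psi>0 (z + a)"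
proof -
  note o = lightcone_lift.open_dom[OF l(2)] and s = lightcone_lift.smooth[OF l(2)] and sf = lightcone_lift.smooth_fields[OF l(2)]
  have 1: "wirt \<psi>1 w = wirt \<psi>0 (w + a)" "wirtbar \<psi>1 w = wirtbar \<psi>0 (w + a)" if "w \<in> \<Omega>1" for w
    using wirt_shift_on[OF o s e(2) that] by auto
  have 2: "wirt (wirt \<psi>1) w = wirt (wirt \<psi>0) (w + a)" "wirtbar (wirt \<psi>1) w = wirtbar (wirt \<psi>0) (w + a)" if "w \<in> \<Omega>1" for w
    using wirt_shift_on[OF o sf(1) 1(1) that] by auto
  have c: "lightcone_lift.cc \<psi>1 w = lightcone_lift.cc \<psi>0 (w + a)" if "w \<in> \<Omega>1" for w
    unfolding lightcone_lift.cc_def[OF l(1)] lightcone_lift.cc_def[OF l(2)] 2[OF that] ..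
  have k: "lightcone_lift.kap \<psi>1 w = lightcone_lift.kap \<psi>0 (w + a)" if "w \<in> \<Omega>1" for w
    unfolding lightcone_lift.kap_def[OF l(1)] lightcone_lift.kap_def[OF l(2)] 2[OF that] c[OF that] e(2)[OF that] ..
  show "lightcone_lift.kap \<psi>1 z = lightcone_lift.kap \<psi>0 (z + a)" by (rule k[OF z])
  have N: "lightcone_lift.N \<psi>1 z = lightcone_lift.N \<psi>0 (z + a)"
    unfolding lightcone_lift.N_def[OF l(1)] lightcone_lift.N_def[OF l(2)] lightcone_lift.mm_def[OF l(1)] lightcone_lift.mm_def[OF l(2)] 2[OF z] e(2)[OF z] ..
  have "wirtbar (lightcone_lift.kap \<psi>1) z = wirtbar (lightcone_lift.kap \<psi>0) (z + a)"
    using wirt_shift_on(2)[OF o sf(8) k z] .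
  then show "lightcone_lift.dk \<psi>1 z = lightcone_lift.dk \<psi>0 (z + a)"
    unfolding lightcone_lift.dk_def[OF l(1)] lightcone_lift.dk_def[OF l(2)] lightcone_lift.pr_def[OF l(1)] lightcone_lift.pr_def[OF l(2)]
    by (simp add: N 1[OF z] e(2)[OF z])
qed

text \<open>Umbilics do not depend on the coordinate: they are the points where the second derivative of a
  lift lies in the span of the lift and its first derivative, a condition that survives rescaling of
  the lift and holomorphic changes of the coordinate.\<close>

lemma hopf_zero_change_of_coordinate:
  fixes \<psi> \<psi>' :: "complex \<Rightarrow> complex ^ 'n::finite option"
  assumes l: "lightcone_lift \<Omega> \<psi>" "lightcone_lift \<Omega>' \<psi>'" and O: "open O'" "O' \<subseteq> \<Omega>" and T: "T holomorphic_on O'" "T ` O' \<subseteq> \<Omega>'"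
    and par: "\<And>z. z \<in> O' \<Longrightarrow> \<psi>' (T z) $ None *s \<psi> z = \<psi> z $ None *s \<psi>' (T z)"
    and nz: "\<And>z. z \<in> O' \<Longrightarrow> \<psi> z $ None \<noteq> 0" "\<And>z. z \<in> O' \<Longrightarrow> \<psi>' (T z) $ None \<noteq> 0"
    and z: "z \<in> O'" and k: "lightcone_lift.kap \<psi>' (T z) = 0"
  shows "lightcone_lift.kap \<psi> z = 0"
proof -
  interpret A: lightcone_lift \<Omega> \<psi> by (rule l)
  interpret B: lightcone_lift \<Omega>' \<psi>' by (rule l)
  have zO: "z \<in> \<Omega>" and Tz: "T z \<in> \<Omega>'" using z O T by auto
  have dT: "(T has_field_derivative deriv T w) (at w)" if "w \<in> O'" for w by (rule holomorphic_derivI[OF T(1) O(1) that])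
  obtain T2 where ddT: "(deriv T has_field_derivative T2) (at z)"
    using holomorphic_derivI[OF holomorphic_deriv[OF T(1) O(1)] O(1) z] by blast
  have B1: "has_wirt (\<lambda>z. \<psi>' (T z)) (deriv T w *s B.P (T w)) (cnj (deriv T w) *s B.Pb (T w)) w" if "w \<in> O'" for w
    by (rule has_wirt_holo[OF dT[OF that] B.has_wirt_psi]) (use T that in auto)
  have B2: "has_wirt (\<lambda>z. B.P (T z)) (deriv T z *s B.Z (T z)) (cnj (deriv T z) *s B.Y (T z)) z"
    by (rule has_wirt_holo[OF dT[OF z] B.has_wirt_P[OF Tz]])
  define b where "b z = \<psi> z $ None" for z
  define a where "a z = \<psi>' (T z) $ None" for z
  have comp: "has_wirtc (\<lambda>z. F z $ None) (x $ None) (y $ None) w" if "has_wirt F x y w" for F :: "complex \<Rightarrow> complex ^ 'n option" and x y w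
    using that unfolding has_wirt_iff by blast
  have b1: "has_wirtc b (A.P w $ None) (A.Pb w $ None) w" if "w \<in> \<Omega>" for w unfolding b_def by (rule comp[OF A.has_wirt_psi[OF that]])
  have b2: "has_wirtc (\<lambda>z. A.P z $ None) (A.Z z $ None) (A.Y z $ None) z" by (rule comp[OF A.has_wirt_P[OF zO]])
  have a1: "has_wirtc a (deriv T w * B.P (T w) $ None) (cnj (deriv T w) * B.Pb (T w) $ None) w" if "w \<in> O'" for w
    using comp[OF B1[OF that]] unfolding a_def by simp
  have first: "(deriv T w * B.P (T w) $ None) *s \<psi> w + a w *s A.P w = A.P w $ None *s \<psi>' (T w) + b w *s (deriv T w *s B.P (T w))" if w: "w \<in> O'" for w
  proof -
    have wO: "w \<in> \<Omega>" using w O by blast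
    note 1 = has_wirt_scale[OF a1[OF w] A.has_wirt_psi[OF wO]]
    note 2 = has_wirt_scale[OF b1[OF wO] B1[OF w]]
    have "a v *s \<psi> v = b v *s \<psi>' (T v)" if "v \<in> O'" for v using par[OF that] unfolding a_def b_def .
    from has_wirt_unique(1)[OF has_wirt_cong_open[OF 1 O(1) w this] 2] show ?thesis .
  qed
  have a2: "has_wirtc (\<lambda>w. deriv T w * B.P (T w) $ None) (T2 * B.P (T z) $ None + deriv T z * (deriv T z *s B.Z (T z)) $ None)
      (0 * B.P (T z) $ None + deriv T z * (cnj (deriv T z) *s B.Y (T z)) $ None) z"
    by (rule has_wirtc_mult[OF has_wirtc_field[OF ddT] comp[OF B2]])
  have c2: "has_wirt (\<lambda>w. deriv T w *s B.P (T w)) (T2 *s B.P (T z) + deriv T z *s (deriv T z *s B.Z (T z)))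
      (0 *s B.P (T z) + deriv T z *s (cnj (deriv T z) *s B.Y (T z))) z"
    by (rule has_wirt_scale[OF has_wirtc_field[OF ddT] B2])
  note 1 = has_wirt_add[OF has_wirt_scale[OF a2 A.has_wirt_psi[OF zO]] has_wirt_scale[OF a1[OF z] A.has_wirt_P[OF zO]]]
  note 2 = has_wirt_add[OF has_wirt_scale[OF b2 B1[OF z]] has_wirt_scale[OF b1[OF zO] c2]]
  note second = has_wirt_unique(1)[OF has_wirt_cong_open[OF 1 O(1) z first] 2]
  have az: "a z \<noteq> 0" "b z \<noteq> 0" unfolding a_def b_def using nz z by auto
  \<comment> \<open>\<open>\<psi>'\<close> is \<open>\<rho> \<psi>\<close>, where the scale is written with time components since these are known to be nonzero and smooth.\<close>
  define \<rho> where "\<rho> = a z / b z"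
  have p0: "\<psi>' (T z) = \<rho> *s \<psi> z"
  proof -
    have "b z * \<psi>' (T z) $ i = a z * \<psi> z $ i" for i using arg_cong[OF par[OF z], of "\<lambda>v. v $ i"] unfolding a_def b_def by simp
    then show ?thesis unfolding \<rho>_def using az by (simp add: vec_eq_iff field_simps)
  qed
  have p1: "\<exists>s. deriv T z *s B.P (T z) = s *s \<psi> z + \<rho> *s A.P z"
  proof -
    define s where "s = (deriv T z * B.P (T z) $ None - A.P z $ None * \<rho>) / b z"
    have sb: "b z * s = deriv T z * B.P (T z) $ None - A.P z $ None * \<rho>" "b z * \<rho> = a z" unfolding s_def \<rho>_def using az by simp_all
    have "b z * (deriv T z * B.P (T z) $ i) = b z * (s * \<psi> z $ i + \<rho> * A.P z $ i)" for i
      using arg_cong[OF first[OF z], of "\<lambda>v. v $ i"] unfolding p0 distrib_left mult.assoc[symmetric] sb by (simp add: algebra_simps)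
    then have "deriv T z * B.P (T z) $ i = s * \<psi> z $ i + \<rho> * A.P z $ i" for i using az by simp
    then have "deriv T z *s B.P (T z) = s *s \<psi> z + \<rho> *s A.P z" unfolding vec_eq_iff by simp
    then show ?thesis by blast
  qed
  then obtain s where s: "deriv T z *s B.P (T z) = s *s \<psi> z + \<rho> *s A.P z" by blast
  have r0: "\<rho> \<noteq> 0" unfolding \<rho>_def using az by simp
  have T0: "deriv T z \<noteq> 0"
  proof
    assume "deriv T z = 0"
    then have "lorentz (s *s \<psi> z + \<rho> *s A.P z) (A.Pb z) = 0" unfolding s[symmetric] by simp
    then show False using r0 by (simp add: A.ip zO)
  qed
  have s': "B.P (T z) = (s / deriv T z) *s \<psi> z + (\<rho> / deriv T z) *s A.P z"
  proof -
    have "deriv T z * B.P (T z) $ i = s * \<psi> z $ i + \<rho> * A.P z $ i" for i using arg_cong[OF s, of "\<lambda>v. v $ i"] by simp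
    then show ?thesis using T0 by (simp add: vec_eq_iff field_simps)
  qed
  have Zz: "B.Z (T z) = (- (B.cc (T z) / 2) * \<rho>) *s \<psi> z" unfolding B.Z_eq k p0 by (simp add: vec_eq_iff)
  define m where "m = s / deriv T z"
  define n where "n = \<rho> / deriv T z"
  have Pe: "B.P (T z) = m *s \<psi> z + n *s A.P z" unfolding m_def n_def by (rule s')
  have "\<exists>x y. a z *s A.Z z = x *s \<psi> z + y *s A.P z"
  proof -
    have "a z *s A.Z z = (A.Z z $ None) *s (\<rho> *s \<psi> z) + (A.P z $ None) *s (deriv T z *s (m *s \<psi> z + n *s A.P z))
      + ((A.P z $ None) *s (deriv T z *s (m *s \<psi> z + n *s A.P z)) + b z *s (T2 *s (m *s \<psi> z + n *s A.P z) + deriv T z *s (deriv T z *s ((- (B.cc (T z) / 2) * \<rho>) *s \<psi> z))))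
      - ((T2 * B.P (T z) $ None + deriv T z * (deriv T z *s B.Z (T z)) $ None) *s \<psi> z + (deriv T z * B.P (T z) $ None) *s A.P z + (deriv T z * B.P (T z) $ None) *s A.P z)"
      (is "_ = ?R")
    proof -
      have "(T2 * B.P (T z) $ None + deriv T z * (deriv T z *s B.Z (T z)) $ None) *s \<psi> z + (deriv T z * B.P (T z) $ None) *s A.P z + ((deriv T z * B.P (T z) $ None) *s A.P z + a z *s A.Z z)
        = (A.Z z $ None) *s (\<rho> *s \<psi> z) + (A.P z $ None) *s (deriv T z *s (m *s \<psi> z + n *s A.P z))
      + ((A.P z $ None) *s (deriv T z *s (m *s \<psi> z + n *s A.P z)) + b z *s (T2 *s (m *s \<psi> z + n *s A.P z) + deriv T z *s (deriv T z *s ((- (B.cc (T z) / 2) * \<rho>) *s \<psi> z))))"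
        using second unfolding p0 Pe[symmetric] Zz[symmetric] .
      then show ?thesis by (simp add: algebra_simps)
    qed
    moreover have "\<exists>x y. ?R = x *s \<psi> z + y *s A.P z"
    proof (intro exI)
      show "?R = ((A.Z z $ None) * \<rho> + 2 * (A.P z $ None * deriv T z * m) + b z * (T2 * m + deriv T z * deriv T z * (- (B.cc (T z) / 2) * \<rho>)) - (T2 * B.P (T z) $ None + deriv T z * (deriv T z *s B.Z (T z)) $ None)) *s \<psi> z
        + (2 * (A.P z $ None * deriv T z * n) + b z * T2 * n - 2 * (deriv T z * B.P (T z) $ None)) *s A.P z"
        by (simp add: vec_eq_iff algebra_simps)
    qed
    ultimately show ?thesis by simp
  qed
  then obtain x y where xy: "a z *s A.Z z = x *s \<psi> z + y *s A.P z" by blast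
  have "lorentz (a z *s A.Z z) (A.Pb z) = 0" by (simp add: A.ip zO)
  then have "y = 0" unfolding xy by (simp add: A.ip zO)
  then have "a z * A.Z z $ i = x * \<psi> z $ i" for i using arg_cong[OF xy, of "\<lambda>v. v $ i"] by simp
  then have "A.Z z = (x / a z) *s \<psi> z" using az by (simp add: vec_eq_iff field_simps)
  moreover define k where "k = x / a z + A.cc z / 2"
  ultimately have ke: "A.kap z = k *s \<psi> z" unfolding A.kap_def by simp
  have "lorentz (A.kap z) (A.N z) = 0" by (rule A.perp_frame(7)[OF A.kap_perp[OF zO]])
  then have "k = 0" unfolding ke by (simp add: A.ip zO)
  then show ?thesis unfolding ke by simp
qed

section \<open>Minimal surfaces in every coordinate\<close>

lemma lorentz_re_vec: "lorentz y (re_vec X) = Re (lorentz (cplx y) X)"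
  unfolding lorentz_def re_vec_def cplx_def by simp

text \<open>The Laplacian of a surface changes by the factor \<open>|T'|\<^sup>2\<close> under a holomorphic change \<open>T\<close> of the
  coordinate, so vanishing mean curvature in one coordinate gives it in all.\<close>

lemma zero_mean_curvature_in_all_coordinates:
  fixes G :: "complex \<Rightarrow> complex ^ 'n::finite option"
  assumes X: "riemann_surface X \<A>" and c: "holo_coord X \<A> U \<phi>" "holo_coord X \<A> U' \<phi>'" and U: "U' \<subseteq> U"
    and G: "smooth_on (\<phi> ` U) G" "\<And>z. z \<in> \<phi> ` U \<Longrightarrow> vcnj (G z) = G z"
    and H: "\<And>z y. z \<in> \<phi> ` U \<Longrightarrow> y \<in> W \<Longrightarrow> lorentz (cplx y) (G z) = 0 \<Longrightarrow> lorentz (cplx y) (cplx v) = 0 \<Longrightarrow>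
       lorentz (cplx y) (wirt G z) = 0 \<Longrightarrow> lorentz (cplx y) (wirtbar G z) = 0 \<Longrightarrow> lorentz (cplx y) (wirtbar (wirt G) z) = 0"
  shows "zero_mean_curvature W v (\<phi>' ` U') ((\<lambda>x. re_vec (G (\<phi> x))) \<circ> inv_into U' \<phi>')"
proof -
  have cc: "complex_chart X U \<phi>" "complex_chart X U' \<phi>'" using c unfolding holo_coord_def by auto
  note p = complex_chart_props[OF cc(1)] and p' = complex_chart_props[OF cc(2)]
  define T where "T = \<phi> \<circ> inv_into U' \<phi>'"
  define R where "R = \<phi>' \<circ> inv_into U \<phi>"
  have UU: "U \<inter> U' = U'" "U' \<inter> U = U'" using U by auto
  have holT: "T holomorphic_on \<phi>' ` U'" unfolding T_def using holo_coord_transition[OF X c] UU by simp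
  have holR: "R holomorphic_on \<phi> ` U'" unfolding R_def using holo_coord_transition[OF X c(2,1)] UU by simp
  let ?D = "\<phi>' ` U'"
  have oD: "open ?D" by (rule p'(2))
  have oR: "open (\<phi> ` U')" by (rule p(5)[OF U p'(1)])
  have TR: "T w \<in> \<phi> ` U'" "R (T w) = w" if w: "w \<in> ?D" for w
  proof -
    obtain q where q: "q \<in> U'" "w = \<phi>' q" using w by blast
    have "inv_into U' \<phi>' w = q" unfolding q(2) by (rule inv_into_f_f[OF p'(3) q(1)])
    then have t: "T w = \<phi> q" unfolding T_def by simp
    then show "T w \<in> \<phi> ` U'" using q by simp
    have "inv_into U \<phi> (\<phi> q) = q" using inv_into_f_f[OF p(3)] q(1) U by blast
    then show "R (T w) = w" using t q(2) unfolding R_def by simp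
  qed
  have TU: "T w \<in> \<phi> ` U" if "w \<in> ?D" for w using TR(1)[OF that] U by auto
  have dT: "(T has_field_derivative deriv T w) (at w)" if "w \<in> ?D" for w by (rule holomorphic_derivI[OF holT oD that])
  have T0: "deriv T w \<noteq> 0" if w: "w \<in> ?D" for w
  proof -
    have "(R has_field_derivative deriv R (T w)) (at (T w))" by (rule holomorphic_derivI[OF holR oR TR(1)[OF w]])
    from DERIV_chain2[OF this dT[OF w]] have "((\<lambda>w. R (T w)) has_field_derivative deriv R (T w) * deriv T w) (at w)" .
    then have "((\<lambda>w. w) has_field_derivative deriv R (T w) * deriv T w) (at w)"
      by (rule has_field_derivative_transform_within_open[OF _ oD w]) (rule TR(2))
    from DERIV_unique[OF this DERIV_ident] show ?thesis by auto
  qed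
  define G' where "G' w = re_vec (G (T w))" for w
  have G'e: "(\<lambda>x. re_vec (G (\<phi> x))) \<circ> inv_into U' \<phi>' = G'" unfolding G'_def T_def by auto
  define A B where "A w = deriv T w *s wirt G (T w)" and "B w = cnj (deriv T w) *s wirtbar G (T w)" for w
  have GT: "has_wirt (\<lambda>w. G (T w)) (A w) (B w) w" if "w \<in> ?D" for w
    unfolding A_def B_def by (rule has_wirt_holo[OF dT[OF that] smooth_has_wirt[OF G(1) TU[OF that]]])
  have sG: "smooth_on (\<phi> ` U) (wirt G)" "smooth_on (\<phi> ` U) (wirtbar G)" by (intro smooth_on_wirt smooth_on_wirtbar p(2) G(1))+
  have re: "dder (\<lambda>w. re_vec (F w)) v w = re_vec (v *s a + cnj v *s b)" if "has_wirt F a b w" for F :: "complex \<Rightarrow> complex ^ 'n option" and a b v w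
    using frechet_derivative_at[OF bounded_linear.has_derivative[OF bounded_linear_re_vec that[unfolded has_wirt_def]], THEN fun_cong[where x = v]]
    unfolding dder_def by simp
  have first: "dder G' v w = re_vec (v *s A w + cnj v *s B w)" if "w \<in> ?D" for v w
    unfolding G'_def[abs_def] by (rule re[OF GT[OF that]])
  have second: "\<exists>A1 B2. \<forall>v. dder (dder G' v) v w = re_vec ((v * v) *s A1 + (cnj v * cnj v) *s B2 + (2 * (v * cnj v) * (deriv T w * cnj (deriv T w))) *s wirtbar (wirt G) (T w))"
    if w: "w \<in> ?D" for w
  proof -
    obtain T2 where ddT: "(deriv T has_field_derivative T2) (at w)"
      using holomorphic_derivI[OF holomorphic_deriv[OF holT oD] oD w] by blast
    let ?Y = "wirtbar (wirt G) (T w)"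
    have a: "has_wirt A (T2 *s wirt G (T w) + deriv T w *s (deriv T w *s wirt (wirt G) (T w))) (0 *s wirt G (T w) + deriv T w *s (cnj (deriv T w) *s ?Y)) w"
      unfolding A_def[abs_def] by (intro has_wirt_scale has_wirtc_field ddT has_wirt_holo dT smooth_has_wirt[OF sG(1)] TU w)
    have "has_wirt B (cnj 0 *s wirtbar G (T w) + cnj (deriv T w) *s (deriv T w *s wirt (wirtbar G) (T w))) (cnj T2 *s wirtbar G (T w) + cnj (deriv T w) *s (cnj (deriv T w) *s wirtbar (wirtbar G) (T w))) w"
      unfolding B_def[abs_def] by (intro has_wirt_scale has_wirtc_cnj has_wirtc_field ddT has_wirt_holo dT smooth_has_wirt[OF sG(2)] TU w)
    then have b: "has_wirt B (cnj 0 *s wirtbar G (T w) + cnj (deriv T w) *s (deriv T w *s ?Y)) (cnj T2 *s wirtbar G (T w) + cnj (deriv T w) *s (cnj (deriv T w) *s wirtbar (wirtbar G) (T w))) w"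
      unfolding wirt_wirtbar_commute[OF p(2) G(1) TU[OF w]] .
    define A1 B2 where "A1 = T2 *s wirt G (T w) + deriv T w *s (deriv T w *s wirt (wirt G) (T w))"
      and "B2 = cnj T2 *s wirtbar G (T w) + cnj (deriv T w) *s (cnj (deriv T w) *s wirtbar (wirtbar G) (T w))"
    have "dder (dder G' v) v w = re_vec ((v * v) *s A1 + (cnj v * cnj v) *s B2 + (2 * (v * cnj v) * (deriv T w * cnj (deriv T w))) *s ?Y)" for v
    proof -
      have h: "has_wirt (\<lambda>w. v *s A w + cnj v *s B w) (0 *s A w + v *s A1 + (0 *s B w + cnj v *s (cnj 0 *s wirtbar G (T w) + cnj (deriv T w) *s (deriv T w *s ?Y))))
         (0 *s A w + v *s (0 *s wirt G (T w) + deriv T w *s (cnj (deriv T w) *s ?Y)) + (0 *s B w + cnj v *s B2)) w"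
        unfolding A1_def B2_def by (intro has_wirt_add has_wirt_scale has_wirtc_const a b)
      have "dder (dder G' v) v w = dder (\<lambda>w. re_vec (v *s A w + cnj v *s B w)) v w"
      proof -
        have "(\<lambda>w. re_vec (v *s A w + cnj v *s B w)) differentiable (at w)"
          using bounded_linear.has_derivative[OF bounded_linear_re_vec h[unfolded has_wirt_def]] unfolding differentiable_def by blast
        from frechet_derivative_transform_within_open[OF this oD w, of "dder G' v"] show ?thesis
          unfolding dder_def[of "dder G' v"] dder_def[of "\<lambda>w. re_vec (v *s A w + cnj v *s B w)"] by (simp add: first)
      qed
      also have "\<dots> = re_vec ((v * v) *s A1 + (cnj v * cnj v) *s B2 + (2 * (v * cnj v) * (deriv T w * cnj (deriv T w))) *s ?Y)"
        unfolding re[OF h] by (rule arg_cong[of _ _ re_vec]) (simp add: vec_eq_iff algebra_simps)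
      finally show ?thesis .
    qed
    then show ?thesis by blast
  qed
  show ?thesis unfolding zero_mean_curvature_def G'e
  proof (intro ballI impI)
    fix w y assume w: "w \<in> ?D" and y: "y \<in> W" and yy: "lorentz y (G' w) = 0 \<and> lorentz y v = 0 \<and> (\<forall>v. lorentz y (dder G' v w) = 0)"
    let ?z = "T w"
    have zU: "?z \<in> \<phi> ` U" by (rule TU[OF w])
    have "cplx (G' w) = G ?z" unfolding G'_def by (rule cplx_re_vec[OF G(2)[OF zU]])
    then have 1: "lorentz (cplx y) (G ?z) = 0" using yy by (metis lorentz_cplx of_real_0)
    have 2: "lorentz (cplx y) (cplx v) = 0" using yy by simp
    have Bz: "wirtbar G ?z = vcnj (wirt G ?z)"
      using has_wirt_unique(2)[OF smooth_has_wirt[OF G(1) zU] has_wirt_cong_open[OF has_wirt_vcnj[OF smooth_has_wirt[OF G(1) zU]] p(2) zU G(2)]] .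
    define s where "s = lorentz (cplx y) (wirt G ?z)"
    have sb: "lorentz (cplx y) (wirtbar G ?z) = cnj s" unfolding Bz s_def using lorentz_vcnj[of "cplx y" "wirt G ?z"] by simp
    have "Re (v * deriv T w * s) = 0" for v
    proof -
      have "0 = lorentz y (dder G' v w)" using yy by simp
      also have "\<dots> = Re (v * (deriv T w * s) + cnj v * (cnj (deriv T w) * cnj s))"
        unfolding first[OF w] lorentz_re_vec A_def B_def by (simp only: lorentz_simps sb s_def[symmetric])
      also have "cnj v * (cnj (deriv T w) * cnj s) = cnj (v * (deriv T w * s))" by simp
      finally show ?thesis by (simp add: algebra_simps)
    qed
    \<comment> \<open>The direction \<open>v\<close> is chosen so that the product is \<open>|T' s|\<^sup>2\<close>.\<close>
    then have "Re (cnj (deriv T w * s) * deriv T w * s) = 0" by blast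
    then have "Re (of_real ((cmod (deriv T w * s))\<^sup>2)) = 0" unfolding complex_norm_square by (simp only: mult.assoc mult.commute[of "cnj _"])
    then have "s = 0" using T0[OF w] by simp
    then have "lorentz (cplx y) (wirtbar (wirt G) ?z) = 0"
      using H[OF zU y 1 2] s_def sb by simp
    moreover obtain A1 B2 where s2: "\<And>v. dder (dder G' v) v w = re_vec ((v * v) *s A1 + (cnj v * cnj v) *s B2 + (2 * (v * cnj v) * (deriv T w * cnj (deriv T w))) *s wirtbar (wirt G) ?z)"
      using second[OF w] by blast
    ultimately show "lorentz y (dder (dder G' 1) 1 w + dder (dder G' \<i>) \<i> w) = 0"
      unfolding s2 by (simp add: lorentz_re_vec)
  qed
qed

lemma surf_lift_null_vec:
  fixes f :: "'a \<Rightarrow> real ^ 'n::finite"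
  assumes ci: "conformal_immersion X \<A> f" and c: "holo_coord X \<A> U \<phi>" and z: "z \<in> \<phi> ` U"
  shows "\<exists>k\<noteq>0. re_vec (surf_lift f U \<phi> z) = k *\<^sub>R null_vec (f (inv_into U \<phi> z))"
    "\<exists>k. null_vec (f (inv_into U \<phi> z)) = k *\<^sub>R re_vec (surf_lift f U \<phi> z)"
    "re_vec (surf_lift f U \<phi> z) \<noteq> 0" "surf_lift f U \<phi> z $ None \<noteq> 0"
    "surf_lift f U \<phi> z = surf_lift f U \<phi> z $ None *s cplx (null_vec (f (inv_into U \<phi> z)))"
proof -
  obtain \<psi> where \<psi>: "surf_lift f U \<phi> = cplx \<circ> \<psi>" "normalized_lift (\<phi> ` U) (f \<circ> inv_into U \<phi>) \<psi>"
    using surf_lift_lightcone[OF ci c] by metis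
  have m: "\<psi> z \<in> forward_light_cone" "\<psi> z \<in> span {null_vec (f (inv_into U \<phi> z))}"
    using \<psi>(2) z unfolding normalized_lift_def by auto
  obtain k where k: "\<psi> z = k *\<^sub>R null_vec (f (inv_into U \<phi> z))" using m(2) by (auto simp: span_singleton)
  have k0: "k = \<psi> z $ None" using k by simp
  then have kp: "k > 0" using m(1) unfolding forward_light_cone_def by simp
  have r: "re_vec (surf_lift f U \<phi> z) = \<psi> z" unfolding \<psi>(1) by simp
  show "\<exists>k\<noteq>0. re_vec (surf_lift f U \<phi> z) = k *\<^sub>R null_vec (f (inv_into U \<phi> z))" using r k kp by (intro exI[of _ k]) simp
  show "\<exists>k. null_vec (f (inv_into U \<phi> z)) = k *\<^sub>R re_vec (surf_lift f U \<phi> z)" using r k kp by (intro exI[of _ "1/k"]) simp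
  show "re_vec (surf_lift f U \<phi> z) \<noteq> 0" unfolding r using m(1) unfolding forward_light_cone_def light_cone_def by simp
  have s: "surf_lift f U \<phi> z = of_real k *s cplx (null_vec (f (inv_into U \<phi> z)))" unfolding \<psi>(1) using k by simp
  have sn: "surf_lift f U \<phi> z $ None = of_real k" unfolding s by (simp add: cplx_def)
  show "surf_lift f U \<phi> z $ None \<noteq> 0" unfolding sn using kp by simp
  show "surf_lift f U \<phi> z = surf_lift f U \<phi> z $ None *s cplx (null_vec (f (inv_into U \<phi> z)))" unfolding sn by (rule s)
qed

lemma minimal_in_3space_of_frame:
  fixes f :: "'a \<Rightarrow> real ^ 'n::finite"
  assumes X: "riemann_surface X \<A>" and ci: "conformal_immersion X \<A> f" and c: "holo_coord X \<A> U \<phi>"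
    and conv: "convex (\<phi> ` U)" and p: "p \<in> \<phi> ` U"
    and fr: "lightcone_lift.minimal_frame (\<phi> ` U) (surf_lift f U \<phi>) v \<xi> K"
    and nz: "\<And>z. z \<in> \<phi> ` U \<Longrightarrow> lorentz (surf_lift f U \<phi> z) (cplx v) \<noteq> 0"
  shows "minimal_in_3space X \<A> f U"
proof -
  define \<psi> where "\<psi> = surf_lift f U \<phi>"
  have cc: "complex_chart X U \<phi>" using c unfolding holo_coord_def by auto
  note pc = complex_chart_props[OF cc]
  have ll: "lightcone_lift (\<phi> ` U) \<psi>" and F: "(f \<circ> inv_into U \<phi>) ` \<phi> ` U \<subseteq> sphere 0 1"
    unfolding \<psi>_def using surf_lift_lightcone[OF ci c] by metis+
  interpret A: lightcone_lift "\<phi> ` U" \<psi> by (rule ll)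
  have mf: "A.parallel_hopf_frame \<xi> K" "\<And>z. z \<in> \<phi> ` U \<Longrightarrow> lorentz (\<xi> 1 z) (cplx v) = 0" "\<And>z. z \<in> \<phi> ` U \<Longrightarrow> A.PiW UNIV \<xi> z (cplx v) = cplx v"
    using fr unfolding \<psi>_def[symmetric] A.minimal_frame_def by auto
  interpret H: hypersurface_lift "\<phi> ` U" \<psi> \<xi> K by unfold_locales (use mf(1) conv in auto)
  have sph: "f (inv_into U \<phi> z) \<in> sphere 0 1" if "z \<in> \<phi> ` U" for z using subsetD[OF F imageI[OF that]] by simp
  obtain S where S: "round_sphere 3 S" "lorentz_span S = H.W p" "(\<lambda>z. f (inv_into U \<phi> z)) ` \<phi> ` U \<subseteq> S"
    by (rule H.surface_in_round_sphere[OF p _ sph, of 3]) (use surf_lift_null_vec(2)[OF ci c] in \<open>auto simp: \<psi>_def\<close>)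
  have inv: "inv_into U \<phi> (\<phi> x) = x" if "x \<in> U" for x by (rule inv_into_f_f[OF pc(3) that])
  have fS: "f ` U \<subseteq> S"
  proof
    fix y assume "y \<in> f ` U"
    then obtain x where x: "x \<in> U" "y = f x" by blast
    then have "y = (\<lambda>z. f (inv_into U \<phi> z)) (\<phi> x)" using inv by simp
    then show "y \<in> S" using S(3) x(1) by blast
  qed
  have vW: "v \<in> lorentz_span S" unfolding S(2) H.W_def using mf(3)[OF p] by simp
  have v0: "v \<noteq> 0" using nz[OF p] by auto
  define a where "a z = - inverse (lorentz (\<psi> z) (cplx v))" for z
  have sa: "smooth_on (\<phi> ` U) a" unfolding a_def[abs_def]
    by (intro smooth_on_minus smooth_on_inverse smooth_on_lorentz smooth_on_const A.open_dom A.smooth) (use nz in \<open>auto simp: \<psi>_def\<close>)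
  have ar: "cnj (a z) = a z" if "z \<in> \<phi> ` U" for z
    using lorentz_vcnj[of "\<psi> z" "cplx v"] unfolding a_def by (simp add: A.real that)
  have a0: "a z \<noteq> 0" if "z \<in> \<phi> ` U" for z using nz[OF that] unfolding a_def \<psi>_def by simp
  define G where "G z = a z *s \<psi> z" for z
  have sG: "smooth_on (\<phi> ` U) G" unfolding G_def[abs_def] by (intro smooth_on_vec_scale A.open_dom sa A.smooth)
  have rG: "vcnj (G z) = G z" if "z \<in> \<phi> ` U" for z unfolding G_def by (simp add: A.real ar that)
  define g where "g x = re_vec (G (\<phi> x))" for x
  have cg: "cplx (g x) = G (\<phi> x)" if "x \<in> U" for x unfolding g_def by (rule cplx_re_vec[OF rG]) (use that in auto)
  have gsp: "g x \<in> space_form v" "g x \<in> span {null_vec (f x)}" if x: "x \<in> U" for x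
  proof -
    have z: "\<phi> x \<in> \<phi> ` U" using x by simp
    have ae: "a (\<phi> x) = of_real (Re (a (\<phi> x)))" using ar[OF z] by (simp add: complex_eq_iff)
    have "cplx (g x) = cplx (Re (a (\<phi> x)) *\<^sub>R re_vec (\<psi> (\<phi> x)))"
      unfolding cg[OF x] G_def using ae by (simp add: cplx_re_vec[OF A.real[OF z]])
    from arg_cong[OF this, of re_vec] have ge: "g x = Re (a (\<phi> x)) *\<^sub>R re_vec (\<psi> (\<phi> x))" by (simp only: re_vec_cplx)
    have ra: "Re (a (\<phi> x)) \<noteq> 0" using a0[OF z] ae by auto
    obtain k where k: "re_vec (\<psi> (\<phi> x)) = k *\<^sub>R null_vec (f x)" using surf_lift_null_vec(1)[OF ci c z] unfolding \<psi>_def inv[OF x] by blast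
    show "g x \<in> span {null_vec (f x)}" unfolding ge k by (intro span_scale span_base) simp
    have "g x \<noteq> 0" unfolding ge using ra surf_lift_null_vec(3)[OF ci c z] unfolding \<psi>_def by simp
    moreover have "complex_of_real (lorentz (g x) (g x)) = of_real 0" unfolding lorentz_cplx[symmetric] cg[OF x] G_def by (simp add: A.null z)
    then have "lorentz (g x) (g x) = 0" unfolding of_real_eq_iff .
    moreover have "complex_of_real (lorentz (g x) v) = of_real (-1)" unfolding lorentz_cplx[symmetric] cg[OF x] G_def a_def using nz[OF z] by (simp add: \<psi>_def)
    then have "lorentz (g x) v = -1" unfolding of_real_eq_iff .
    ultimately show "g x \<in> space_form v" unfolding space_form_def light_cone_def by simp
  qed
  have zm: "zero_mean_curvature (lorentz_span S) v (\<phi>' ` U') (g \<circ> inv_into U' \<phi>')" if c': "holo_coord X \<A> U' \<phi>'" "U' \<subseteq> U" for U' \<phi>'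
    unfolding g_def[abs_def]
  proof (rule zero_mean_curvature_in_all_coordinates[OF X c c' sG rG])
    fix z y assume z: "z \<in> \<phi> ` U" and y: "y \<in> lorentz_span S" and y1: "lorentz (cplx y) (G z) = 0" and y2: "lorentz (cplx y) (cplx v) = 0"
      and y3: "lorentz (cplx y) (wirt G z) = 0" "lorentz (cplx y) (wirtbar G z) = 0"
    have "y \<in> H.W z" using y H.W_const[OF p z] unfolding S(2) by simp
    then have yP: "H.PrW z (cplx y) = cplx y" unfolding H.W_def by simp
    have "lorentz (cplx y) (\<psi> z) = 0" using y1 a0[OF z] unfolding G_def by simp
    then show "lorentz (cplx y) (wirtbar (wirt G) z) = 0"
      unfolding G_def[abs_def]
      by (intro H.orthogonal_laplacian[OF z sa a0[OF z] mf(2)[OF z] _ yP y2])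
         (use nz[OF z] y3 in \<open>auto simp: \<psi>_def G_def[abs_def]\<close>)
  qed
  show ?thesis unfolding minimal_in_3space_def
    using S(1) fS vW v0 gsp zm by blast
qed

section \<open>The local classification\<close>

lemma coordinate_disc:
  assumes c: "holo_coord X \<A> U \<phi>" and p: "p \<in> U" and I: "open I" "\<phi> p \<in> I"
  obtains r U0 where "r > 0" "U0 \<subseteq> U" "openin X U0" "p \<in> U0" "\<phi> ` U0 = ball (\<phi> p) r" "ball (\<phi> p) r \<subseteq> I"
proof -
  have cc: "complex_chart X U \<phi>" using c unfolding holo_coord_def by auto
  note pc = complex_chart_props[OF cc]
  have "open (\<phi> ` U \<inter> I)" "\<phi> p \<in> \<phi> ` U \<inter> I" using pc(2) I p by auto
  then obtain r where r: "r > 0" "ball (\<phi> p) r \<subseteq> \<phi> ` U \<inter> I" using open_contains_ball by blast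
  define U0 where "U0 = {x \<in> U. \<phi> x \<in> ball (\<phi> p) r}"
  have "\<phi> ` U0 = ball (\<phi> p) r" unfolding U0_def using r(2) by auto
  moreover have "openin X U0" unfolding U0_def by (rule pc(6)) simp
  moreover have "p \<in> U0" unfolding U0_def using p r(1) by simp
  ultimately show ?thesis using that[of r U0] r unfolding U0_def by auto
qed

text \<open>The defining equation, stated with the connection of the bundle, is the one for the explicit
  projection.\<close>

lemma isothermic_willmore_lift:
  fixes f :: "'a \<Rightarrow> real ^ 'n::finite"
  assumes ci: "conformal_immersion X \<A> f" and w: "willmore X \<A> f" and c: "holo_coord X \<A> U \<phi>"
    and real: "\<And>z. z \<in> \<phi> ` U \<Longrightarrow> vcnj (lightcone_lift.kap (surf_lift f U \<phi>) z) = lightcone_lift.kap (surf_lift f U \<phi>) z"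
    and nz: "\<And>z. z \<in> \<phi> ` U \<Longrightarrow> lightcone_lift.kap (surf_lift f U \<phi>) z \<noteq> 0"
  shows "isothermic_willmore (\<phi> ` U) (surf_lift f U \<phi>)"
proof -
  let ?\<psi> = "surf_lift f U \<phi>"
  have ll: "lightcone_lift (\<phi> ` U) ?\<psi>" using surf_lift_lightcone[OF ci c] by metis
  interpret A: lightcone_lift "\<phi> ` U" ?\<psi> by (rule ll)
  have hk: "hopf ?\<psi> z = A.kap z" if "z \<in> \<phi> ` U" for z by (rule A.hopf_eq[OF that])
  have D1: "Dzbar ?\<psi> (hopf ?\<psi>) z = A.dk z" if z: "z \<in> \<phi> ` U" for z
  proof -
    have "has_wirt (hopf ?\<psi>) (wirt A.kap z) (wirtbar A.kap z) z"
      by (rule has_wirt_cong_open[OF A.has_wirt_kap[OF z] A.open_dom z]) (simp add: hk)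
    then have "wirtbar (hopf ?\<psi>) z = wirtbar A.kap z" by (rule has_wirtD)
    then show ?thesis unfolding Dzbar_def A.perp_proj_eq[OF z] A.dk_def by simp
  qed
  have D2: "Dzbar ?\<psi> (Dzbar ?\<psi> (hopf ?\<psi>)) z = A.pr z (wirtbar A.dk z)" if z: "z \<in> \<phi> ` U" for z
  proof -
    have "has_wirt (Dzbar ?\<psi> (hopf ?\<psi>)) (wirt A.dk z) (wirtbar A.dk z) z"
      by (rule has_wirt_cong_open[OF smooth_has_wirt[OF A.smooth_dk z] A.open_dom z]) (simp add: D1)
    then have "wirtbar (Dzbar ?\<psi> (hopf ?\<psi>)) z = wirtbar A.dk z" by (rule has_wirtD)
    then show ?thesis unfolding Dzbar_def[of ?\<psi> "Dzbar ?\<psi> (hopf ?\<psi>)"] A.perp_proj_eq[OF z] by simp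
  qed
  show ?thesis
  proof unfold_locales
    fix z assume z: "z \<in> \<phi> ` U"
    show "vcnj (A.kap z) = A.kap z" by (rule real[OF z])
    show "A.kap z \<noteq> 0" by (rule nz[OF z])
    have "Dzbar ?\<psi> (Dzbar ?\<psi> (hopf ?\<psi>)) z + (cnj (schwarzian ?\<psi> z) / 2) *s hopf ?\<psi> z = 0"
      using w c z unfolding willmore_def Let_def by blast
    then have "A.pr z (wirtbar A.dk z) + (cnj (A.cc z) / 2) *s A.kap z = 0"
      unfolding D2[OF z] hk[OF z] A.schwarzian_eq[OF z] .
    then show "A.pr z (wirtbar A.dk z) = (- (cnj (A.cc z) / 2)) *s A.kap z" by (simp add: add_eq_0_iff2 vec.scale_minus_left)
  qed
qed

lemma ode_in_4space_of_frame:
  fixes f :: "'a \<Rightarrow> real ^ 'n::finite" and \<xi> :: "2 \<Rightarrow> complex \<Rightarrow> complex ^ 'n option"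
  assumes ci: "conformal_immersion X \<A> f" and c: "holo_coord X \<A> U \<phi>" and conv: "convex (\<phi> ` U)" and p: "p \<in> \<phi> ` U"
    and fr: "lightcone_lift.parallel_hopf_frame (\<phi> ` U) (surf_lift f U \<phi>) \<xi> K"
    and ode: "elastica_hopf (\<phi> ` U) (\<lambda>z. \<chi> j. K j z) \<or> radial_painleve_hopf (\<phi> ` U) (\<lambda>z. \<chi> j. K j z)"
  shows "ode_in_4space X \<A> f U"
proof -
  define \<psi> where "\<psi> = surf_lift f U \<phi>"
  have cc: "complex_chart X U \<phi>" using c unfolding holo_coord_def by auto
  note pc = complex_chart_props[OF cc]
  have ll: "lightcone_lift (\<phi> ` U) \<psi>" and F: "(f \<circ> inv_into U \<phi>) ` \<phi> ` U \<subseteq> sphere 0 1"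
    unfolding \<psi>_def using surf_lift_lightcone[OF ci c] by metis+
  interpret A: lightcone_lift "\<phi> ` U" \<psi> by (rule ll)
  have fr': "A.parallel_hopf_frame \<xi> K" using fr unfolding \<psi>_def .
  interpret H: framed_lift "\<phi> ` U" \<psi> \<xi> K by unfold_locales (use fr' conv in auto)
  have sph: "f (inv_into U \<phi> z) \<in> sphere 0 1" if "z \<in> \<phi> ` U" for z using subsetD[OF F imageI[OF that]] by simp
  obtain S where S: "round_sphere 4 S" "lorentz_span S = H.W p" "(\<lambda>z. f (inv_into U \<phi> z)) ` \<phi> ` U \<subseteq> S"
    by (rule H.surface_in_round_sphere[OF p _ sph, of 4]) (use surf_lift_null_vec(2)[OF ci c] in \<open>auto simp: \<psi>_def\<close>)
  have "f ` U \<subseteq> S"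
  proof
    fix y assume "y \<in> f ` U"
    then obtain x where x: "x \<in> U" "y = f x" by blast
    then have "y = (\<lambda>z. f (inv_into U \<phi> z)) (\<phi> x)" using inv_into_f_f[OF pc(3)] by simp
    then show "y \<in> S" using S(3) x(1) by blast
  qed
  moreover have "hopf_components (lorentz_span S) (\<phi> ` U) (surf_lift f U \<phi>) (\<lambda>z. \<chi> j. K j z)"
    using A.hopf_components_of_frame[OF fr' conv p S(2)] unfolding \<psi>_def .
  ultimately show ?thesis unfolding ode_in_4space_def using S(1) c ode by blast
qed

text \<open>The disc is taken in the translated coordinate in which the zero of \<open>\<alpha> z + \<eta>\<close> is the origin, as
  radial symmetry requires; the origin need not lie in it. The translation \<open>a\<close> is known only after \<open>\<alpha>\<close> and \<open>\<eta>\<close>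
  have been found in the original coordinate.\<close>

lemma local_alternatives_nonumbilic:
  fixes f :: "'a \<Rightarrow> real ^ 'n::finite"
  assumes X: "riemann_surface X \<A>" and ci: "conformal_immersion X \<A> f" and w: "willmore X \<A> f"
    and c: "holo_coord X \<A> U \<phi>" and p: "p \<in> U"
    and real: "\<And>z. z \<in> \<phi> ` U \<Longrightarrow> hopf (surf_lift f U \<phi>) z = vcnj (hopf (surf_lift f U \<phi>) z)"
    and nz: "hopf (surf_lift f U \<phi>) (\<phi> p) \<noteq> 0"
  shows "\<exists>U. openin X U \<and> p \<in> U \<and> (minimal_in_3space X \<A> f U \<or> ode_in_4space X \<A> f U)"
proof -
  let ?\<psi> = "surf_lift f U \<phi>"
  have ll: "lightcone_lift (\<phi> ` U) ?\<psi>" using surf_lift_lightcone[OF ci c] by metis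
  interpret A: lightcone_lift "\<phi> ` U" ?\<psi> by (rule ll)
  have "open (\<phi> ` U \<inter> A.kap -` (- {0}))"
    by (rule continuous_open_preimage[OF smooth_on_imp_continuous_on[OF A.smooth_fields(8)] A.open_dom]) (simp add: open_Compl)
  moreover have "\<phi> p \<in> \<phi> ` U \<inter> A.kap -` (- {0})" using nz A.hopf_eq[of "\<phi> p"] p by simp
  ultimately obtain r U0 where r: "r > 0" "U0 \<subseteq> U" "openin X U0" "p \<in> U0" "\<phi> ` U0 = ball (\<phi> p) r" "ball (\<phi> p) r \<subseteq> \<phi> ` U \<inter> A.kap -` (- {0})"
    using coordinate_disc[OF c p] by metis
  have chart: "holo_coord X \<A> U0 (\<lambda>x. \<phi> x - a)" for a by (rule holo_coord_restrict_shift[OF c r(2,3)])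
  have im: "(\<lambda>x. \<phi> x - a) ` U0 = ball (\<phi> p - a) r" for a
  proof -
    have "(\<lambda>x. \<phi> x - a) ` U0 = (\<lambda>w. w - a) ` \<phi> ` U0" by auto
    also have "\<dots> = ball (\<phi> p - a) r" unfolding r(5) using ball_translation_subtract[of "\<phi> p" a r] by simp
    finally show ?thesis .
  qed
  have ll1: "lightcone_lift (ball (\<phi> p - a) r) (surf_lift f U0 (\<lambda>x. \<phi> x - a))" for a
    using surf_lift_lightcone[OF ci chart[of a]] unfolding im by metis
  have sh: "z + a \<in> ball (\<phi> p) r" "surf_lift f U0 (\<lambda>x. \<phi> x - a) z = ?\<psi> (z + a)" if "z \<in> ball (\<phi> p - a) r" for a z
    using that surf_lift_shift[OF ci c r(2,3), of z a] unfolding im by (auto simp: dist_norm algebra_simps)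
  have zU: "w \<in> \<phi> ` U" "A.kap w \<noteq> 0" if "w \<in> ball (\<phi> p) r" for w using r(6) that by auto
  have kd: "lightcone_lift.kap (surf_lift f U0 (\<lambda>x. \<phi> x - a)) z = A.kap (z + a)" "lightcone_lift.dk (surf_lift f U0 (\<lambda>x. \<phi> x - a)) z = A.dk (z + a)"
    if z: "z \<in> ball (\<phi> p - a) r" for a z
    by (rule lift_shift[OF ll ll1 _ _ z], rule zU(1), erule sh, erule sh)+
  have iw: "isothermic_willmore (ball (\<phi> p - a) r) (surf_lift f U0 (\<lambda>x. \<phi> x - a))" for a
  proof -
    have "isothermic_willmore ((\<lambda>x. \<phi> x - a) ` U0) (surf_lift f U0 (\<lambda>x. \<phi> x - a))"
      by (rule isothermic_willmore_lift[OF ci w chart]; unfold im kd)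
         (use sh(1) zU real A.hopf_eq in \<open>metis\<close>)+
    then show ?thesis unfolding im .
  qed
  have conv: "convex ((\<lambda>x. \<phi> x - a) ` U0)" and mem: "\<phi> p - a \<in> (\<lambda>x. \<phi> x - a) ` U0" for a unfolding im using r(1) by auto
  \<comment> \<open>Translation by \<open>0\<close> treats the original coordinate on the smaller domain like the translated ones.\<close>
  interpret B: isothermic_willmore "ball (\<phi> p - 0) r" "surf_lift f U0 (\<lambda>x. \<phi> x - 0)" by (rule iw)
  consider (zero) "\<And>z. z \<in> ball (\<phi> p - 0) r \<Longrightarrow> B.mu z = 0"
    | (affine) \<alpha> \<eta> where "\<alpha> \<noteq> 0 \<or> \<eta> \<noteq> 0" "\<And>z. z \<in> ball (\<phi> p - 0) r \<Longrightarrow> (of_real \<alpha> * z + \<eta>)\<^sup>2 = B.Q z"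
    using B.Q_zero_or_affine_square[OF connected_ball] by metis
  then have "minimal_in_3space X \<A> f U0 \<or> ode_in_4space X \<A> f U0"
  proof cases
    case zero
    obtain v \<xi> K where "B.minimal_frame v \<xi> K" "\<And>z. z \<in> ball (\<phi> p - 0) r \<Longrightarrow> lorentz (surf_lift f U0 (\<lambda>x. \<phi> x - 0) z) (cplx v) \<noteq> 0"
      using B.hypersurface_minimal_frame[OF convex_ball _ zero, of "\<phi> p - 0"] r(1) by auto
    then have "minimal_in_3space X \<A> f U0"
      by (intro minimal_in_3space_of_frame[OF X ci chart[of 0] conv mem]) (unfold im, auto)
    then show ?thesis ..
  next
    case (affine \<alpha> \<eta>)
    define a where "a = (if \<alpha> = 0 then 0 else - \<eta> / of_real \<alpha>)"
    define \<eta>' where "\<eta>' = (if \<alpha> = 0 then \<eta> else 0)"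
    interpret C: isothermic_willmore "ball (\<phi> p - a) r" "surf_lift f U0 (\<lambda>x. \<phi> x - a)" by (rule iw)
    have QQ: "C.Q z = B.Q (z + a)" if z: "z \<in> ball (\<phi> p - a) r" for z
    proof -
      have z0: "z + a \<in> ball (\<phi> p - 0) r" using sh(1)[OF z] by simp
      have "C.kap z = B.kap (z + a)" "C.dk z = B.dk (z + a)" using kd[OF z] kd[OF z0] by simp_all
      then show ?thesis unfolding C.Q_def B.Q_def C.u_def B.u_def C.cnj_uz[OF z] B.cnj_uz[OF z0] by simp
    qed
    have aq: "of_real \<alpha> * z + \<eta>' = of_real \<alpha> * (z + a) + \<eta>" for z unfolding a_def \<eta>'_def by (simp add: algebra_simps)
    interpret D: affine_sqrt "ball (\<phi> p - a) r" "surf_lift f U0 (\<lambda>x. \<phi> x - a)" \<alpha> \<eta>'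
    proof unfold_locales
      show "\<alpha> \<noteq> 0 \<or> \<eta>' \<noteq> 0" using affine(1) unfolding \<eta>'_def by auto
      fix z assume z: "z \<in> ball (\<phi> p - a) r"
      show "(of_real \<alpha> * z + \<eta>')\<^sup>2 = C.Q z" unfolding QQ[OF z] aq using affine(2)[of "z + a"] sh(1)[OF z] by simp
    qed
    obtain \<xi> K where K: "C.parallel_hopf_frame \<xi> K" "\<alpha> = 0 \<Longrightarrow> elastica_hopf (ball (\<phi> p - a) r) (\<lambda>z. \<chi> j. K j z)"
      "\<alpha> \<noteq> 0 \<Longrightarrow> \<eta>' = 0 \<Longrightarrow> radial_painleve_hopf (ball (\<phi> p - a) r) (\<lambda>z. \<chi> j. K j z)"
      using D.ode_frame[OF refl r(1)] by metis
    have "ode_in_4space X \<A> f U0"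
      by (rule ode_in_4space_of_frame[OF ci chart[of a] conv mem]; unfold im) (use K in \<open>auto simp: \<eta>'_def\<close>)
    then show ?thesis ..
  qed
  then show ?thesis using r(3,4) by blast
qed

text \<open>Umbilicity at a point is witnessed in some coordinate, which may change from point to point; it is
  transported to a single coordinate first.\<close>

lemma local_alternatives_umbilic:
  fixes f :: "'a \<Rightarrow> real ^ 'n::finite"
  assumes X: "riemann_surface X \<A>" and card: "CARD('n) \<ge> 4" and ci: "conformal_immersion X \<A> f"
    and I: "openin X I" "p \<in> I" "\<And>q. q \<in> I \<Longrightarrow> umbilic X \<A> f q"
  shows "\<exists>U. openin X U \<and> p \<in> U \<and> minimal_in_3space X \<A> f U"
proof -
  have "p \<in> topspace X" using I openin_subset by blast
  then obtain U \<phi> where U: "(U, \<phi>) \<in> \<A>" "p \<in> U" using X unfolding riemann_surface_def by blast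
  have c: "holo_coord X \<A> U \<phi>" using X U unfolding riemann_surface_def holo_coord_def by blast
  have cc: "complex_chart X U \<phi>" using c unfolding holo_coord_def by auto
  note pc = complex_chart_props[OF cc]
  have "open (\<phi> ` (U \<inter> I))" by (rule pc(5)) (use pc(1) I(1) in auto)
  moreover have "\<phi> p \<in> \<phi> ` (U \<inter> I)" using U(2) I(2) by blast
  ultimately obtain r U0 where r: "r > 0" "U0 \<subseteq> U" "openin X U0" "p \<in> U0" "\<phi> ` U0 = ball (\<phi> p) r" "ball (\<phi> p) r \<subseteq> \<phi> ` (U \<inter> I)"
    using coordinate_disc[OF c U(2)] by metis
  have c0: "holo_coord X \<A> U0 \<phi>" using holo_coord_restrict_shift[OF c r(2,3), of 0] by simp
  have cc0: "complex_chart X U0 \<phi>" using c0 unfolding holo_coord_def by auto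
  note pc0 = complex_chart_props[OF cc0]
  let ?\<psi> = "surf_lift f U0 \<phi>"
  have ll: "lightcone_lift (\<phi> ` U0) ?\<psi>" using surf_lift_lightcone[OF ci c0] by metis
  interpret A: lightcone_lift "\<phi> ` U0" ?\<psi> by (rule ll)
  have k0: "A.kap z = 0" if z: "z \<in> \<phi> ` U0" for z
  proof -
    obtain q where q: "q \<in> U0" "z = \<phi> q" using z by blast
    have "z \<in> \<phi> ` (U \<inter> I)" by (rule subsetD[OF r(6) z[unfolded r(5)]])
    then obtain q' where q': "q' \<in> U" "q' \<in> I" "\<phi> q = \<phi> q'" unfolding q(2) by (elim imageE IntE)
    have "q = q'" by (rule inj_onD[OF pc(3) q'(3)]) (use q(1) q'(1) r(2) in auto)
    then have "q \<in> I" using q'(2) by simp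
    then obtain U' \<phi>' where u: "holo_coord X \<A> U' \<phi>'" "q \<in> U'" "hopf (surf_lift f U' \<phi>') (\<phi>' q) = 0"
      using I(3) unfolding umbilic_def by blast
    have cc': "complex_chart X U' \<phi>'" using u(1) unfolding holo_coord_def by auto
    note pc' = complex_chart_props[OF cc']
    have ll': "lightcone_lift (\<phi>' ` U') (surf_lift f U' \<phi>')" using surf_lift_lightcone[OF ci u(1)] by metis
    let ?T = "\<phi>' \<circ> inv_into U0 \<phi>"
    let ?O = "\<phi> ` (U' \<inter> U0)"
    have inv: "inv_into U0 \<phi> (\<phi> x) = x" if "x \<in> U0" for x by (rule inv_into_f_f[OF pc0(3) that])
    have inv': "inv_into U' \<phi>' (\<phi>' x) = x" if "x \<in> U'" for x by (rule inv_into_f_f[OF pc'(3) that])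
    show ?thesis
    proof (rule hopf_zero_change_of_coordinate[OF ll ll'])
      show "open ?O" by (rule pc0(5)) (use pc0(1) pc'(1) in auto)
      show "?O \<subseteq> \<phi> ` U0" by auto
      show "?T holomorphic_on ?O" by (rule holo_coord_transition[OF X u(1) c0])
      show "?T ` ?O \<subseteq> \<phi>' ` U'" using inv by auto
      show "z \<in> ?O" using q u(2) by blast
      have "lightcone_lift.kap (surf_lift f U' \<phi>') (\<phi>' q) = 0"
        using lightcone_lift.hopf_eq[OF ll', of "\<phi>' q"] u(2,3) by simp
      then show "lightcone_lift.kap (surf_lift f U' \<phi>') (?T z) = 0" using q inv by simp
      fix w assume "w \<in> ?O"
      then obtain x where x: "x \<in> U'" "x \<in> U0" "w = \<phi> x" by blast
      have w0: "w \<in> \<phi> ` U0" and Tw: "?T w \<in> \<phi>' ` U'" using x inv by auto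
      show "?\<psi> w $ None \<noteq> 0" by (rule surf_lift_null_vec(4)[OF ci c0 w0])
      show "surf_lift f U' \<phi>' (?T w) $ None \<noteq> 0" by (rule surf_lift_null_vec(4)[OF ci u(1) Tw])
      have e: "f (inv_into U0 \<phi> w) = f x" "f (inv_into U' \<phi>' (?T w)) = f x" using x inv inv' by simp_all
      show "surf_lift f U' \<phi>' (?T w) $ None *s ?\<psi> w = ?\<psi> w $ None *s surf_lift f U' \<phi>' (?T w)"
        using surf_lift_null_vec(5)[OF ci c0 w0] surf_lift_null_vec(5)[OF ci u(1) Tw] unfolding e
        by (metis (no_types, lifting) mult.commute vector_smult_assoc)
    qed
  qed
  have conv: "convex (\<phi> ` U0)" and mem: "\<phi> p \<in> \<phi> ` U0" unfolding r(5) using r(1) by auto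
  obtain v \<xi> K where "A.minimal_frame v \<xi> K" "\<And>z. z \<in> \<phi> ` U0 \<Longrightarrow> lorentz (?\<psi> z) (cplx v) \<noteq> 0"
    using A.umbilic_minimal_frame[OF conv mem k0 card] by metis
  then have "minimal_in_3space X \<A> f U0"
    by (intro minimal_in_3space_of_frame[OF X ci c0 conv mem])
  then show ?thesis using r(3,4) by blast
qed

theorem theorem3p4:
  fixes X :: "'a topology"
    and \<A> :: "('a set \<times> ('a \<Rightarrow> complex)) set"
    and f :: "'a \<Rightarrow> real ^ 'n::finite"
    and n :: nat
  assumes "riemann_surface X \<A>"
    and "n \<ge> 3" and "CARD('n) = n + 1"
    and "conformal_immersion X \<A> f"
    and "isothermic X \<A> f"
    and "willmore X \<A> f"
  shows "\<forall>p \<in> topspace X - X frontier_of {q \<in> topspace X. umbilic X \<A> f q}.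
           \<exists>U. openin X U \<and> p \<in> U \<and>
             (minimal_in_3space X \<A> f U \<or> ode_in_4space X \<A> f U)"
proof
  fix p assume p: "p \<in> topspace X - X frontier_of {q \<in> topspace X. umbilic X \<A> f q}"
  let ?M = "{q \<in> topspace X. umbilic X \<A> f q}"
  show "\<exists>U. openin X U \<and> p \<in> U \<and> (minimal_in_3space X \<A> f U \<or> ode_in_4space X \<A> f U)"
  proof (cases "umbilic X \<A> f p")
    case False
    then obtain U \<phi> where U: "holo_coord X \<A> U \<phi>" "p \<in> U" "\<forall>z\<in>\<phi> ` U. hopf (surf_lift f U \<phi>) z = vcnj (hopf (surf_lift f U \<phi>) z)"
      using assms(5) p unfolding isothermic_def by blast
    have nz: "hopf (surf_lift f U \<phi>) (\<phi> p) \<noteq> 0" using False U(1,2) unfolding umbilic_def by blast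
    show ?thesis by (rule local_alternatives_nonumbilic[OF assms(1,4,6) U(1,2) bspec[OF U(3)] nz])
  next
    case True
    have "p \<in> ?M" using True p by blast
    then have "p \<in> X closure_of ?M" using closure_of_subset[of ?M X] by blast
    then have "p \<in> X interior_of ?M" using p unfolding frontier_of_def by blast
    moreover have "umbilic X \<A> f q" if "q \<in> X interior_of ?M" for q using interior_of_subset[of X ?M] that by blast
    ultimately show ?thesis
      using local_alternatives_umbilic[OF assms(1) _ assms(4) openin_interior_of, of p ?M] assms(2,3) by auto
  qed
qed

end
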